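(* Let $d\ge2$ and let $Z,Z_1,Z_2,\ldots$ be i.i.d. random vectors in $\mathbb{R}^d$ with $\mathbb{E}(\|Z\|^2)<\infty$, mean $\mu:=\mathbb{E}Z\neq\mathbf{0}$ and covariance $\Sigma:=\mathbb{E}((Z-\mu)(Z-\mu)^\top)$. Let $S_n=\sum_{i=1}^nZ_i$, $G_0:=\mathbf{0}$, $G_n:=\frac1n\sum_{i=1}^nS_i$ for $n\ge1$, and $\mathcal{G}_n:=\operatorname{hull}\{G_0,\ldots,G_n\}$. Then \[\limsup_{n\to\infty}\frac{V_d(\mathcal{G}_n)}{\sqrt{2^{d-1}n^{d+1}(\log\log n)^{d-1}}}=\tilde\lambda_d\cdot\frac{\|\mu\|}{2}\cdot\sqrt{\det\Sigma_{\mu^\perp}}\quad\text{a.s.},\] where $\tilde\lambda_d:=\sup_{f\in U_{d-1}}V_d(H(\mathfrak{g}_f))$.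
   Context: $V_d$ is $d$-dimensional volume. $\Sigma_{\mu^\perp}$ is the $(d-1)\times(d-1)$ matrix obtained by writing $\Sigma$ in an orthonormal basis containing $\mu/\|\mu\|$ and deleting the row and column of $\mu/\|\mu\|$. $U_{d-1}$ is the set of $f:[0,1]\to\mathbb{R}^{d-1}$ with $f(0)=\mathbf{0}$, absolutely continuous components, $\int_0^1\|f'(s)\|^2ds\le1$. For continuous $f$ with $f(0)=\mathbf 0$, $\mathfrak{g}_f(0):=\mathbf{0}$ and $\mathfrak{g}_f(t):=\frac1t\int_0^tf(s)\,ds$ for $0<t\le1$. For $g:[0,1]\to\mathbb{R}^{d-1}$, $H(g):=\operatorname{hull}\{(t,g(t)):0\le t\le1\}\subset\mathbb{R}^d$. *)

theory Defs
  imports "HOL-Probability.Probability"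
begin

definition abs_cont_on :: "real set \<Rightarrow> (real \<Rightarrow> real) \<Rightarrow> bool" where
  "abs_cont_on S f \<longleftrightarrow>
     (\<forall>e>0. \<exists>d>0. \<forall>(n::nat) (a::nat \<Rightarrow> real) (b::nat \<Rightarrow> real).
        (\<forall>k<n. a k \<le> b k \<and> {a k..b k} \<subseteq> S) \<and>
        (\<forall>k<n. \<forall>l<n. k \<noteq> l \<longrightarrow> {a k<..<b k} \<inter> {a l<..<b l} = {}) \<and>
        (\<Sum>k<n. b k - a k) < d
        \<longrightarrow> (\<Sum>k<n. \<bar>f (b k) - f (a k)\<bar>) < e)"

definition U_set :: "(real \<Rightarrow> real ^ 'm) set" where
  "U_set = {f. f 0 = 0 \<and> (\<forall>j. abs_cont_on {0..1} (\<lambda>s. f s $ j)) \<and>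
     (\<exists>h. (AE s in lborel. s \<in> {0<..<1} \<longrightarrow> (f has_vector_derivative h s) (at s)) \<and>
          (\<integral>\<^sup>+ s. ennreal (indicator {0..1} s * (norm (h s))\<^sup>2) \<partial>lborel) \<le> 1)}"

definition gmean :: "(real \<Rightarrow> real ^ 'm) \<Rightarrow> real \<Rightarrow> real ^ 'm" where
  "gmean f t = (if t = 0 then 0 else (1 / t) *\<^sub>R integral {0..t} f)"

definition Hhull :: "(real \<Rightarrow> real ^ 'm) \<Rightarrow> (real \<times> (real ^ 'm)) set" where
  "Hhull g = convex hull {(t, g t) | t. t \<in> {0..1}}"

definition lambda_tilde :: "('m::finite) itself \<Rightarrow> ereal" where
  "lambda_tilde _ = (SUP f \<in> (U_set :: (real \<Rightarrow> real ^ 'm) set). ereal (measure lborel (Hhull (gmean f))))"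

text \<open>Sigma_{mu perp}: Sigma written in an orthonormal basis (b_j) of mu-perp
  (the basis of R^d containing mu/|mu| with that vector deleted).
  The determinant does not depend on the choice of basis.\<close>
definition perp_cov :: "real ^ 'n ^ 'n \<Rightarrow> real ^ 'n \<Rightarrow> real ^ 'm ^ 'm" where
  "perp_cov Sig mu =
    (let B = (SOME B :: 'm \<Rightarrow> real ^ 'n.
               (\<forall>i j. B i \<bullet> B j = (if i = j then 1 else 0)) \<and> (\<forall>i. B i \<bullet> mu = 0))
     in \<chi> i j. B i \<bullet> (Sig *v B j))"

end

theory Submission
  imports Defs
begin

text \<open>Write \<open>L n\<close> for \<open>sqrt (2 n ln (ln n))\<close>. A linear change of coordinates turns the components of \<open>Z\<close>
  orthogonal to \<open>\<mu>\<close> into a centred walk with identity covariance (if \<open>\<Sigma>\<close> is degenerate on the orthogonal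
  complement of \<open>\<mu>\<close>, all hulls lie in a hyperplane). By Strassen's law this walk, run up to time \<open>n\<close> and divided by \<open>L n\<close>, has
  as limit points exactly the paths of energy at most 1. Taking means is continuous on paths, the coordinate along \<open>\<mu>\<close>
  is asymptotically deterministic, and the volume of a convex hull is Lipschitz under small perturbations
  of the generating points, so the limsup of the volumes is the supremum over the limit set.

  Strassen's law is obtained as follows. Truncation, Bernstein bounds and exponential tilting give the law
  of the iterated logarithm for every fixed linear combination of the increments over \<open>N\<close> equal blocks:
  its limsup over \<open>L n\<close> is the dual norm. Finitely many combinations control the energy of the whole
  vector of increments from above, and, since the unit ball is strictly convex, a combination can be nearly extremal only
  when the vector is close to the extremal direction. A uniform modulus of continuity, from
  Ottaviani's inequality, passes from block increments to whole paths.\<close>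

section \<open>Exponential moments and maximal inequalities\<close>

text \<open>The shape is dictated by having only second moments: everything probabilistic is proved
  for real sums of bounded independent variables, and vectors are recovered by duality. For the
  block increments x, divided by the scale, and a target d of unit energy, N |x - d|^2 = N |x|^2 + N
  |d|^2 - 2 N (d \<bullet> x). The energy bound controls the first term for all large times, and the
  scalar lower bound brings the last one close to -2 infinitely often. A single scalar lower tail
  thus replaces a joint lower tail for all blocks. The constant |mu| / 2 comes from averaging the
  drift: \<open>G k\<close> has expectation (k + 1) / 2 times \<open>mu\<close>, so the hull has
  length of order n |mu| / 2 along \<open>mu\<close> and width of order L n in each of the d - 1
  other directions; the normalisation is n times the (d - 1)-st power of L n. The root of the
  determinant is the volume factor of the map that undoes the change of coordinates to identity
  covariance.\<close>

lemma exp_quadratic_bounds: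
  fixes y \<eta> :: real
  assumes "\<bar>y\<bar> \<le> \<eta>" "\<eta> \<le> 1"
  shows "exp y \<le> 1 + y + (1 + \<eta>) * y\<^sup>2 / 2" "1 + y + (1 - \<eta>) * y\<^sup>2 / 2 \<le> exp y"
proof -
  obtain t where t: "\<bar>t\<bar> \<le> \<bar>y\<bar>" "exp y = (\<Sum>m<3. y ^ m / fact m) + exp t / fact 3 * y ^ 3"
    using Maclaurin_exp_le[of y 3] by blast
  have e: "exp y = 1 + y + y\<^sup>2 / 2 + exp t / 6 * y ^ 3"
    using t(2) by (simp add: numeral_eq_Suc power2_eq_square)
  have "exp t \<le> exp 1" using t(1) assms by simp
  then have "exp t \<le> 3" using exp_le by linarith
  \<comment> \<open>The cubic remainder is at most |y|^3 / 2, hence at most \<eta> y^2 / 2: it is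
    absorbed as a relative error \<eta> of the quadratic coefficient.\<close>
  then have "\<bar>exp t / 6 * y ^ 3\<bar> \<le> 3 / 6 * \<bar>y\<bar> ^ 3"
    by (simp add: abs_mult power_abs mult_right_mono mult.commute)
  also have "\<bar>y\<bar> ^ 3 = \<bar>y\<bar> * y\<^sup>2" by (simp add: power3_eq_cube power2_eq_square)
  also have "3 / 6 * (\<bar>y\<bar> * y\<^sup>2) \<le> 3 / 6 * (\<eta> * y\<^sup>2)"
    using assms by (intro mult_left_mono mult_right_mono) auto
  finally have "\<bar>exp t / 6 * y ^ 3\<bar> \<le> \<eta> * y\<^sup>2 / 2" by simp
  then show "exp y \<le> 1 + y + (1 + \<eta>) * y\<^sup>2 / 2" "1 + y + (1 - \<eta>) * y\<^sup>2 / 2 \<le> exp y"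
    unfolding e abs_le_iff by (auto simp: algebra_simps add_divide_distrib diff_divide_distrib)
qed

context prob_space begin

lemma integrable_bounded_fun:
  fixes f :: "'a \<Rightarrow> 'b::{banach, second_countable_topology}"
  assumes "f \<in> borel_measurable M" "\<And>\<omega>. norm (f \<omega>) \<le> B"
  shows "integrable M f"
  using assms by (intro integrable_const_bound[of _ B]) auto

text \<open>Integrating the quadratic bounds removes the linear term because the mean is 0. The
  lower bound loses 2 \<eta> instead of \<eta>: turning 1 + z back into an exponential costs a
  factor 1 - z in the exponent.\<close>

lemma mgf_bounds:
  fixes X :: "'a \<Rightarrow> real"
  assumes X[measurable]: "X \<in> borel_measurable M" and b: "\<And>\<omega>. \<bar>X \<omega>\<bar> \<le> b" and EX: "expectation X = 0"
    and s: "0 \<le> s" "s * b \<le> \<eta>" "\<eta> \<le> 1"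
  shows "expectation (\<lambda>\<omega>. exp (s * X \<omega>)) \<le> exp ((1 + \<eta>) * s\<^sup>2 * expectation (\<lambda>\<omega>. (X \<omega>)\<^sup>2) / 2)"
    "exp ((1 - 2 * \<eta>) * s\<^sup>2 * expectation (\<lambda>\<omega>. (X \<omega>)\<^sup>2) / 2) \<le> expectation (\<lambda>\<omega>. exp (s * X \<omega>))"
proof -
  have b0: "0 \<le> b" using b[of undefined] by linarith
  have sX: "\<bar>s * X \<omega>\<bar> \<le> \<eta>" for \<omega>
    using mult_left_mono[OF b s(1), of \<omega>] s by (simp add: abs_mult)
  have \<eta>0: "0 \<le> \<eta>" using sX[of undefined] by linarith
  have iX: "integrable M X" by (rule integrable_bounded_fun[of _ b]) (auto simp: b)
  have X2b: "(X \<omega>)\<^sup>2 \<le> b\<^sup>2" for \<omega> using b[of \<omega>] b0 by (metis abs_le_square_iff abs_of_nonneg)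
  have iX2: "integrable M (\<lambda>\<omega>. (X \<omega>)\<^sup>2)"
    by (rule integrable_bounded_fun[of _ "b\<^sup>2"]) (auto simp: X2b)
  have iE: "integrable M (\<lambda>\<omega>. exp (s * X \<omega>))"
    using sX by (intro integrable_bounded_fun[of _ "exp \<eta>"]) (auto simp: abs_le_iff)
  let ?v = "expectation (\<lambda>\<omega>. (X \<omega>)\<^sup>2)"
  have eq: "expectation (\<lambda>\<omega>. 1 + s * X \<omega> + c * (s * X \<omega>)\<^sup>2 / 2) = 1 + c * s\<^sup>2 * ?v / 2"
    "integrable M (\<lambda>\<omega>. 1 + s * X \<omega> + c * (s * X \<omega>)\<^sup>2 / 2)" for c
    using iX iX2 EX by (auto simp: power_mult_distrib prob_space)
  have "expectation (\<lambda>\<omega>. exp (s * X \<omega>)) \<le> expectation (\<lambda>\<omega>. 1 + s * X \<omega> + (1 + \<eta>) * (s * X \<omega>)\<^sup>2 / 2)"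
    by (intro integral_mono iE eq exp_quadratic_bounds sX s)
  also have "\<dots> \<le> exp ((1 + \<eta>) * s\<^sup>2 * ?v / 2)" unfolding eq by (rule exp_ge_add_one_self)
  finally show "expectation (\<lambda>\<omega>. exp (s * X \<omega>)) \<le> exp ((1 + \<eta>) * s\<^sup>2 * ?v / 2)" .
  define z where "z = (1 - \<eta>) * s\<^sup>2 * ?v / 2"
  have v0: "0 \<le> ?v" by simp
  have "s\<^sup>2 * ?v = expectation (\<lambda>\<omega>. (s * X \<omega>)\<^sup>2)" by (simp add: power_mult_distrib)
  also have "\<dots> \<le> expectation (\<lambda>_. \<eta>\<^sup>2)"
  proof (rule integral_mono)
    show "integrable M (\<lambda>\<omega>. (s * X \<omega>)\<^sup>2)" using iX2 by (simp add: power_mult_distrib)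
    show "(s * X \<omega>)\<^sup>2 \<le> \<eta>\<^sup>2" for \<omega>
      using sX[of \<omega>] \<eta>0 by (metis abs_le_square_iff abs_of_nonneg)
  qed simp
  also have "\<dots> = \<eta>\<^sup>2" by (simp add: prob_space)
  finally have sv: "s\<^sup>2 * ?v \<le> \<eta>\<^sup>2" .
  have svn: "0 \<le> s\<^sup>2 * ?v" by simp
  have \<eta>2: "\<eta>\<^sup>2 \<le> \<eta>" using \<eta>0 s(3) by (simp add: power2_eq_square mult_left_le_one_le)
  have z0: "0 \<le> z" unfolding z_def using s(3) by simp
  have "z = (1 - \<eta>) * (s\<^sup>2 * ?v) / 2" unfolding z_def by (simp add: algebra_simps)
  also have "\<dots> \<le> 1 * (s\<^sup>2 * ?v) / 2" using svn s(3) \<eta>0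
    by (intro divide_right_mono mult_right_mono) auto
  finally have z1: "z \<le> \<eta> / 2" using sv \<eta>2 by linarith
  have "(1 - 2 * \<eta>) * s\<^sup>2 * ?v / 2 = (1 - 2 * \<eta>) * (s\<^sup>2 * ?v) / 2" by (simp add: algebra_simps)
  \<comment> \<open>The second factor is reserved for the bound ln (1 + z) \<ge> z (1 - z), where z
    is at most \<eta> / 2.\<close>
  also have "\<dots> \<le> ((1 - \<eta>) * (1 - \<eta> / 2)) * (s\<^sup>2 * ?v) / 2"
    using svn \<eta>0 by (intro divide_right_mono mult_right_mono) (auto simp: algebra_simps)
  also have "\<dots> = z * (1 - \<eta> / 2)" by (simp add: z_def field_simps)
  also have "\<dots> \<le> z * (1 - z)" using z0 z1 by (intro mult_left_mono) auto
  also have "\<dots> = z - z\<^sup>2" by (simp add: power2_eq_square algebra_simps)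
  also have "\<dots> \<le> ln (1 + z)" using z0 z1 s(3) by (intro ln_one_plus_pos_lower_bound) auto
  finally have "exp ((1 - 2 * \<eta>) * s\<^sup>2 * ?v / 2) \<le> 1 + z"
    using z0 by (metis exp_ln add_nonneg_pos exp_le_cancel_iff zero_less_one add.commute)
  also have "\<dots> = expectation (\<lambda>\<omega>. 1 + s * X \<omega> + (1 - \<eta>) * (s * X \<omega>)\<^sup>2 / 2)" unfolding eq z_def ..
  also have "\<dots> \<le> expectation (\<lambda>\<omega>. exp (s * X \<omega>))"
    by (intro integral_mono iE eq exp_quadratic_bounds sX s)
  finally show "exp ((1 - 2 * \<eta>) * s\<^sup>2 * ?v / 2) \<le> expectation (\<lambda>\<omega>. exp (s * X \<omega>))" .
qed

lemma mgf_sum_bounds: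
  fixes X :: "'i \<Rightarrow> 'a \<Rightarrow> real"
  assumes I: "finite I" and ind: "indep_vars (\<lambda>_. borel) X I"
    and b: "\<And>i \<omega>. i \<in> I \<Longrightarrow> \<bar>X i \<omega>\<bar> \<le> b" and EX: "\<And>i. i \<in> I \<Longrightarrow> expectation (X i) = 0"
    and s: "0 \<le> s" "s * b \<le> \<eta>" "\<eta> \<le> 1"
  defines "V \<equiv> (\<Sum>i\<in>I. expectation (\<lambda>\<omega>. (X i \<omega>)\<^sup>2))"
  shows "integrable M (\<lambda>\<omega>. exp (s * (\<Sum>i\<in>I. X i \<omega>)))"
    "expectation (\<lambda>\<omega>. exp (s * (\<Sum>i\<in>I. X i \<omega>))) \<le> exp ((1 + \<eta>) * s\<^sup>2 * V / 2)"
    "exp ((1 - 2 * \<eta>) * s\<^sup>2 * V / 2) \<le> expectation (\<lambda>\<omega>. exp (s * (\<Sum>i\<in>I. X i \<omega>)))"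
proof -
  have m: "X i \<in> borel_measurable M" if "i \<in> I" for i using ind that by (simp add: indep_vars_def)
  have sX: "s * X i \<omega> \<le> \<eta>" if "i \<in> I" for i \<omega>
    using mult_left_mono[OF b s(1), of i \<omega>] s that
    by (smt (verit) mult_left_mono)
  have "indep_vars (\<lambda>_. borel) (\<lambda>i \<omega>. exp (s * X i \<omega>)) I"
    using ind by (rule indep_vars_compose2) simp
  moreover have int: "integrable M (\<lambda>\<omega>. exp (s * X i \<omega>))" if "i \<in> I" for i
    using sX that m[OF that] by (intro integrable_bounded_fun[of _ "exp \<eta>"]) auto
  ultimately have E: "expectation (\<lambda>\<omega>. \<Prod>i\<in>I. exp (s * X i \<omega>)) = (\<Prod>i\<in>I. expectation (\<lambda>\<omega>. exp (s * X i \<omega>)))"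
    "integrable M (\<lambda>\<omega>. \<Prod>i\<in>I. exp (s * X i \<omega>))"
    using I by (auto intro: indep_vars_lebesgue_integral indep_vars_integrable)
  have eq: "(\<Prod>i\<in>I. exp (s * X i \<omega>)) = exp (s * (\<Sum>i\<in>I. X i \<omega>))" for \<omega>
    by (simp add: exp_sum I sum_distrib_left)
  show "integrable M (\<lambda>\<omega>. exp (s * (\<Sum>i\<in>I. X i \<omega>)))" using E(2) unfolding eq .
  have "(\<Prod>i\<in>I. expectation (\<lambda>\<omega>. exp (s * X i \<omega>))) \<le> (\<Prod>i\<in>I. exp ((1 + \<eta>) * s\<^sup>2 * expectation (\<lambda>\<omega>. (X i \<omega>)\<^sup>2) / 2))"
    by (intro prod_mono conjI mgf_bounds[OF m b EX s] integral_nonneg) auto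
  also have "\<dots> = exp ((1 + \<eta>) * s\<^sup>2 * V / 2)"
    by (simp add: exp_sum[symmetric] I V_def sum_distrib_left sum_divide_distrib)
  finally show "expectation (\<lambda>\<omega>. exp (s * (\<Sum>i\<in>I. X i \<omega>))) \<le> exp ((1 + \<eta>) * s\<^sup>2 * V / 2)"
    unfolding E(1)[unfolded eq] .
  have "exp ((1 - 2 * \<eta>) * s\<^sup>2 * V / 2) = (\<Prod>i\<in>I. exp ((1 - 2 * \<eta>) * s\<^sup>2 * expectation (\<lambda>\<omega>. (X i \<omega>)\<^sup>2) / 2))"
    by (simp add: exp_sum[symmetric] I V_def sum_distrib_left sum_divide_distrib)
  also have "\<dots> \<le> (\<Prod>i\<in>I. expectation (\<lambda>\<omega>. exp (s * X i \<omega>)))"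
    by (intro prod_mono conjI mgf_bounds[OF m b EX s]) auto
  finally show "exp ((1 - 2 * \<eta>) * s\<^sup>2 * V / 2) \<le> expectation (\<lambda>\<omega>. exp (s * (\<Sum>i\<in>I. X i \<omega>)))"
    unfolding E(1)[unfolded eq] .
qed

lemma chernoff_bound:
  fixes T :: "'a \<Rightarrow> real"
  assumes i: "integrable M (\<lambda>\<omega>. exp (s * T \<omega>))" and T[measurable]: "T \<in> borel_measurable M" and s: "0 \<le> s"
  shows "prob {\<omega> \<in> space M. x \<le> T \<omega>} \<le> exp (- s * x) * expectation (\<lambda>\<omega>. exp (s * T \<omega>))"
proof -
  have "prob {\<omega> \<in> space M. x \<le> T \<omega>} = expectation (indicator {\<omega> \<in> space M. x \<le> T \<omega>})"
    by (auto intro!: arg_cong[where f=prob])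
  also have "\<dots> \<le> expectation (\<lambda>\<omega>. exp (- s * x) * exp (s * T \<omega>))"
  proof (rule integral_mono)
    show "integrable M (\<lambda>\<omega>. exp (- s * x) * exp (s * T \<omega>))" using i by (rule integrable_mult_right)
    show "indicator {\<omega> \<in> space M. x \<le> T \<omega>} \<omega> \<le> exp (- s * x) * exp (s * T \<omega>)" for \<omega>
      using mult_left_mono[of x "T \<omega>" s] s by (auto simp: indicator_def exp_add[symmetric])
  qed (auto simp: less_top[symmetric])
  finally show ?thesis by (simp only: Bochner_Integration.integral_mult_right_zero)
qed

text \<open>The parameter \<open>s\<close> is left free: the modulus of continuity uses it crudely
  with \<open>\<eta> = 1\<close>, the sharp upper bound for weighted blocks with small
  \<open>\<eta>\<close>.\<close>

lemma sum_tail_upper: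
  fixes X :: "'i \<Rightarrow> 'a \<Rightarrow> real"
  assumes I: "finite I" and ind: "indep_vars (\<lambda>_. borel) X I"
    and b: "\<And>i \<omega>. i \<in> I \<Longrightarrow> \<bar>X i \<omega>\<bar> \<le> b" and EX: "\<And>i. i \<in> I \<Longrightarrow> expectation (X i) = 0"
    and W: "(\<Sum>i\<in>I. expectation (\<lambda>\<omega>. (X i \<omega>)\<^sup>2)) \<le> W"
    and s: "0 \<le> s" "s * b \<le> \<eta>" "\<eta> \<le> 1" "0 \<le> \<eta>"
  shows "prob {\<omega> \<in> space M. x \<le> (\<Sum>i\<in>I. X i \<omega>)} \<le> exp (- s * x + (1 + \<eta>) * s\<^sup>2 * W / 2)"
proof -
  note m = mgf_sum_bounds[OF I ind b EX s(1-3)]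
  have [measurable]: "X i \<in> borel_measurable M" if "i \<in> I" for i using ind that by (simp add: indep_vars_def)
  have "prob {\<omega> \<in> space M. x \<le> (\<Sum>i\<in>I. X i \<omega>)} \<le> exp (- s * x) * expectation (\<lambda>\<omega>. exp (s * (\<Sum>i\<in>I. X i \<omega>)))"
    by (intro chernoff_bound m s) auto
  also have "\<dots> \<le> exp (- s * x) * exp ((1 + \<eta>) * s\<^sup>2 * (\<Sum>i\<in>I. expectation (\<lambda>\<omega>. (X i \<omega>)\<^sup>2)) / 2)"
    by (intro mult_left_mono m) auto
  also have "\<dots> \<le> exp (- s * x) * exp ((1 + \<eta>) * s\<^sup>2 * W / 2)"
    using W s by (intro mult_left_mono) (auto intro!: divide_right_mono mult_left_mono)
  finally show ?thesis unfolding exp_add .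
qed

lemma sum_tail_two_sided:
  fixes X :: "'i \<Rightarrow> 'a \<Rightarrow> real"
  assumes I: "finite I" and ind: "indep_vars (\<lambda>_. borel) X I"
    and b: "\<And>i \<omega>. i \<in> I \<Longrightarrow> \<bar>X i \<omega>\<bar> \<le> b" and EX: "\<And>i. i \<in> I \<Longrightarrow> expectation (X i) = 0"
    and W: "(\<Sum>i\<in>I. expectation (\<lambda>\<omega>. (X i \<omega>)\<^sup>2)) \<le> W" "0 < W"
    and x: "0 \<le> x" "x * b \<le> 2 * W"
  shows "prob {\<omega> \<in> space M. x < \<bar>\<Sum>i\<in>I. X i \<omega>\<bar>} \<le> 2 * exp (- x\<^sup>2 / (4 * W))"
proof -
  have [measurable]: "X i \<in> borel_measurable M" if "i \<in> I" for i using ind that by (simp add: indep_vars_def)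
  \<comment> \<open>With \<open>\<eta> = 1\<close> the choice \<open>s = x / (2 * W)\<close> yields
    half of the Gaussian exponent, which is enough where constants do not matter; the assumption on
    \<open>x * b\<close> says exactly that s b is at most 1.\<close>
  have s: "0 \<le> x / (2 * W)" "x / (2 * W) * b \<le> 1" "(1::real) \<le> 1" "0 \<le> (1::real)"
    using x W(2) by (auto simp: field_simps)
  have ex: "- (x / (2 * W)) * x + (1 + 1) * (x / (2 * W))\<^sup>2 * W / 2 = - x\<^sup>2 / (4 * W)"
    using W(2) by (simp add: field_simps power2_eq_square)
  have ind': "indep_vars (\<lambda>_. borel) (\<lambda>i \<omega>. - X i \<omega>) I"
    using ind by (rule indep_vars_compose2) simp
  have "prob {\<omega> \<in> space M. x < \<bar>\<Sum>i\<in>I. X i \<omega>\<bar>}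
     \<le> prob ({\<omega> \<in> space M. x \<le> (\<Sum>i\<in>I. X i \<omega>)} \<union> {\<omega> \<in> space M. x \<le> (\<Sum>i\<in>I. - X i \<omega>)})"
    by (intro finite_measure_mono) (auto simp: sum_negf)
  also have "\<dots> \<le> prob {\<omega> \<in> space M. x \<le> (\<Sum>i\<in>I. X i \<omega>)} + prob {\<omega> \<in> space M. x \<le> (\<Sum>i\<in>I. - X i \<omega>)}"
    by (intro measure_Un_le) auto
  also have "\<dots> \<le> exp (- x\<^sup>2 / (4 * W)) + exp (- x\<^sup>2 / (4 * W))"
    unfolding ex[symmetric]
    using b EX W(1) by (intro add_mono sum_tail_upper[OF I ind _ _ _ s] sum_tail_upper[OF I ind' _ _ _ s]) auto
  finally show ?thesis by simp
qed

text \<open>Lower tail by exponential tilting: under the density proportional to \<open>exp (\<theta> T)\<close> the variable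
  \<open>T\<close> concentrates near \<open>\<theta> V\<close>, because the moment generating function at \<open>(1 \<plusminus> \<epsilon>) \<theta>\<close> is too small
  to allow mass outside \<open>(1 \<plusminus> \<epsilon>) \<theta> V\<close>.\<close>

lemma tilting_lower_tail:
  fixes T :: "'a \<Rightarrow> real"
  assumes T[measurable]: "T \<in> borel_measurable M"
    and i: "\<And>s. 0 \<le> s \<Longrightarrow> s \<le> 2 * \<theta> \<Longrightarrow> integrable M (\<lambda>\<omega>. exp (s * T \<omega>))"
    and up: "\<And>s. 0 \<le> s \<Longrightarrow> s \<le> 2 * \<theta> \<Longrightarrow> expectation (\<lambda>\<omega>. exp (s * T \<omega>)) \<le> exp ((1 + \<eta>) * s\<^sup>2 * V / 2)"
    and lo: "\<And>s. 0 \<le> s \<Longrightarrow> s \<le> 2 * \<theta> \<Longrightarrow> exp ((1 - \<eta>) * s\<^sup>2 * V / 2) \<le> expectation (\<lambda>\<omega>. exp (s * T \<omega>))"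
    and \<theta>: "0 \<le> \<theta>" and V: "0 \<le> V" and \<epsilon>: "0 < \<epsilon>" "\<epsilon> \<le> 1/2" and \<eta>: "0 \<le> \<eta>" "\<eta> \<le> \<epsilon>\<^sup>2 / 10"
    and a: "a = \<theta>\<^sup>2 * V / 2" "4 \<le> a * \<epsilon>\<^sup>2"
  shows "exp (- a * (1 + 2 * \<epsilon> + \<eta>)) / 2 \<le> prob {\<omega> \<in> space M. (1 - \<epsilon>) * (\<theta> * V) \<le> T \<omega>}"
proof -
  define m where "m = \<theta> * V"
  define d where "d = \<epsilon> * \<theta>"
  let ?p = "prob {\<omega> \<in> space M. (1 - \<epsilon>) * m \<le> T \<omega>}"
  have d: "0 \<le> d" "d \<le> \<theta>" unfolding d_def using \<epsilon> \<theta> by (auto intro: mult_left_le_one_le)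
  \<comment> \<open>Chebyshev's argument under the tilted law: above the window exp (d (t - (1 +
    \<epsilon>) m)) is at least 1, below it exp (d ((1 - \<epsilon>) m - t)) is, and inside it the
    weight is at most its value at the upper end.\<close>
  have pw: "exp (\<theta> * t) \<le> exp (\<theta> * (1 + \<epsilon>) * m) * indicator {(1 - \<epsilon>) * m..} t
      + exp (- d * (1 + \<epsilon>) * m) * exp ((\<theta> + d) * t) + exp (d * (1 - \<epsilon>) * m) * exp ((\<theta> - d) * t)" for t
  proof -
    consider "t < (1 - \<epsilon>) * m" | "(1 - \<epsilon>) * m \<le> t" "t \<le> (1 + \<epsilon>) * m" | "(1 + \<epsilon>) * m < t" by linarith
    then show ?thesis
    proof cases
      case 1
      then have "d * t \<le> d * ((1 - \<epsilon>) * m)" using d by (intro mult_left_mono) auto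
      then have "exp (\<theta> * t) \<le> exp (d * (1 - \<epsilon>) * m) * exp ((\<theta> - d) * t)"
        unfolding exp_add[symmetric] by (simp add: algebra_simps)
      then show ?thesis by (simp add: indicator_def add_increasing)
    next
      case 2
      then have "\<theta> * t \<le> \<theta> * ((1 + \<epsilon>) * m)" using \<theta> by (intro mult_left_mono) auto
      then have "exp (\<theta> * t) \<le> exp (\<theta> * (1 + \<epsilon>) * m)" by (simp add: mult.assoc)
      then show ?thesis using 2 by (simp add: add_increasing2)
    next
      case 3
      then have "d * ((1 + \<epsilon>) * m) \<le> d * t" using d by (intro mult_left_mono) auto
      then have "exp (\<theta> * t) \<le> exp (- d * (1 + \<epsilon>) * m) * exp ((\<theta> + d) * t)"
        unfolding exp_add[symmetric] by (simp add: algebra_simps)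
      then show ?thesis by (smt (verit) exp_ge_zero indicator_pos_le mult_nonneg_nonneg)
    qed
  qed
  have ii: "integrable M (\<lambda>\<omega>. exp (\<theta> * T \<omega>))" "integrable M (\<lambda>\<omega>. exp ((\<theta> + d) * T \<omega>))"
    "integrable M (\<lambda>\<omega>. exp ((\<theta> - d) * T \<omega>))"
    using d \<theta> by (auto intro!: i)
  have ind: "integrable M (\<lambda>\<omega>. indicator {(1 - \<epsilon>) * m..} (T \<omega>) :: real)"
    by (rule integrable_bounded_fun[of _ 1]) (auto simp: indicator_def)
  have ind2: "expectation (\<lambda>\<omega>. indicator {(1 - \<epsilon>) * m..} (T \<omega>)) = ?p"
  proof -
    have "expectation (\<lambda>\<omega>. indicator {(1 - \<epsilon>) * m..} (T \<omega>) :: real) = expectation (indicator {\<omega> \<in> space M. (1 - \<epsilon>) * m \<le> T \<omega>})"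
      by (intro Bochner_Integration.integral_cong) (auto simp: indicator_def)
    also have "\<dots> = ?p" by (auto intro!: arg_cong[where f=prob])
    finally show ?thesis .
  qed
  have "exp (a * (1 - \<eta>)) = exp ((1 - \<eta>) * \<theta>\<^sup>2 * V / 2)" by (simp add: a algebra_simps)
  also have "\<dots> \<le> expectation (\<lambda>\<omega>. exp (\<theta> * T \<omega>))" using \<theta> by (intro lo) auto
  also have "\<dots> \<le> expectation (\<lambda>\<omega>. exp (\<theta> * (1 + \<epsilon>) * m) * indicator {(1 - \<epsilon>) * m..} (T \<omega>)
      + exp (- d * (1 + \<epsilon>) * m) * exp ((\<theta> + d) * T \<omega>) + exp (d * (1 - \<epsilon>) * m) * exp ((\<theta> - d) * T \<omega>))"
    using ii ind by (intro integral_mono pw) auto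
  also have "\<dots> = exp (\<theta> * (1 + \<epsilon>) * m) * ?p + exp (- d * (1 + \<epsilon>) * m) * expectation (\<lambda>\<omega>. exp ((\<theta> + d) * T \<omega>))
      + exp (d * (1 - \<epsilon>) * m) * expectation (\<lambda>\<omega>. exp ((\<theta> - d) * T \<omega>))"
    using ii ind ind2 by simp
  also have "\<dots> \<le> exp (\<theta> * (1 + \<epsilon>) * m) * ?p + exp (- d * (1 + \<epsilon>) * m) * exp ((1 + \<eta>) * (\<theta> + d)\<^sup>2 * V / 2)
      + exp (d * (1 - \<epsilon>) * m) * exp ((1 + \<eta>) * (\<theta> - d)\<^sup>2 * V / 2)"
    using d \<theta> by (intro add_mono mult_left_mono up) auto
  also have "exp (\<theta> * (1 + \<epsilon>) * m) = exp (a * (2 + 2 * \<epsilon>))"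
    by (simp add: a m_def power2_eq_square algebra_simps)
  also have "exp (- d * (1 + \<epsilon>) * m) * exp ((1 + \<eta>) * (\<theta> + d)\<^sup>2 * V / 2) = exp (a * (1 - \<epsilon>\<^sup>2 + \<eta> * (1 + \<epsilon>)\<^sup>2))"
    unfolding exp_add[symmetric] by (rule arg_cong[where f=exp]) (simp add: a m_def d_def power2_eq_square field_simps)
  also have "exp (d * (1 - \<epsilon>) * m) * exp ((1 + \<eta>) * (\<theta> - d)\<^sup>2 * V / 2) = exp (a * (1 - \<epsilon>\<^sup>2 + \<eta> * (1 - \<epsilon>)\<^sup>2))"
    unfolding exp_add[symmetric] by (rule arg_cong[where f=exp]) (simp add: a m_def d_def power2_eq_square field_simps)
  finally have main: "exp (a * (1 - \<eta>)) \<le> exp (a * (2 + 2 * \<epsilon>)) * ?p + exp (a * (1 - \<epsilon>\<^sup>2 + \<eta> * (1 + \<epsilon>)\<^sup>2)) + exp (a * (1 - \<epsilon>\<^sup>2 + \<eta> * (1 - \<epsilon>)\<^sup>2))" .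
  have a0: "0 \<le> a" using V by (simp add: a)
  have e4: "exp (-2) \<le> (1/4::real)"
  proof -
    have "(2::real) \<le> exp 1" using exp_ge_add_one_self[of 1] by simp
    then have "2 * 2 \<le> exp 1 * exp (1::real)" by (intro mult_mono) auto
    then show ?thesis by (simp add: exp_add[symmetric] exp_minus field_simps)
  qed
  \<comment> \<open>Since \<eta> is at most \<epsilon>^2 / 10, both outer exponents lie at least a
    \<epsilon>^2 / 2 \<ge> 2 below a (1 - \<eta>), and exp (-2) \<le> 1/4. Each outer part takes at
    most a quarter, so the window keeps half of the mass.\<close>
  have small: "exp (a * (1 - \<epsilon>\<^sup>2 + \<eta> * c)) \<le> exp (a * (1 - \<eta>)) / 4" if "c \<le> (3/2)\<^sup>2" "0 \<le> c" for c
  proof -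
    have "\<eta> * c \<le> \<epsilon>\<^sup>2 / 10 * (3/2)\<^sup>2" using \<eta> that by (intro mult_mono) auto
    then have "1 - \<epsilon>\<^sup>2 + \<eta> * c \<le> 1 - \<eta> - \<epsilon>\<^sup>2 / 2" using \<eta> by (simp add: power2_eq_square)
    then have "a * (1 - \<epsilon>\<^sup>2 + \<eta> * c) \<le> a * (1 - \<eta> - \<epsilon>\<^sup>2 / 2)" using a0 by (rule mult_left_mono)
    also have "\<dots> \<le> a * (1 - \<eta>) + (-2)" using a(2) by (simp add: algebra_simps)
    finally have "exp (a * (1 - \<epsilon>\<^sup>2 + \<eta> * c)) \<le> exp (a * (1 - \<eta>)) * exp (-2)"
      unfolding exp_add[symmetric] by (subst exp_le_cancel_iff)
    also have "\<dots> \<le> exp (a * (1 - \<eta>)) * (1/4)" by (intro mult_left_mono e4) auto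
    finally show ?thesis by simp
  qed
  have c: "(1 + \<epsilon>)\<^sup>2 \<le> (3/2)\<^sup>2" "(1 - \<epsilon>)\<^sup>2 \<le> (3/2)\<^sup>2" using \<epsilon> by (auto intro!: power_mono)
  have "exp (a * (1 - \<eta>)) / 2 \<le> exp (a * (2 + 2 * \<epsilon>)) * ?p"
    using main small[OF c(1)] small[OF c(2)] by simp
  then have "exp (- (a * (2 + 2 * \<epsilon>))) * (exp (a * (1 - \<eta>)) / 2) \<le> exp (- (a * (2 + 2 * \<epsilon>))) * (exp (a * (2 + 2 * \<epsilon>)) * ?p)"
    by (intro mult_left_mono) auto
  also have "\<dots> = ?p" by (simp add: mult.assoc[symmetric] exp_add[symmetric])
  finally show ?thesis unfolding m_def times_divide_eq_right exp_add[symmetric] by (simp add: algebra_simps)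
qed

text \<open>Split at the first time t at which the partial sum exceeds 2 x. The remaining sum is
  independent of that event and stays within x with probability at least 1/2, in which case the full
  sum still exceeds x.\<close>

lemma ottaviani:
  fixes X :: "nat \<Rightarrow> 'a \<Rightarrow> real"
  assumes ind: "indep_vars (\<lambda>_. borel) X {..<w}"
    and half: "\<And>t. t \<le> w \<Longrightarrow> prob {\<omega> \<in> space M. x < \<bar>\<Sum>i\<in>{t..<w}. X i \<omega>\<bar>} \<le> 1/2"
  shows "prob {\<omega> \<in> space M. \<exists>t\<le>w. 2 * x < \<bar>\<Sum>i<t. X i \<omega>\<bar>} \<le> 2 * prob {\<omega> \<in> space M. x < \<bar>\<Sum>i<w. X i \<omega>\<bar>}"
proof -
  have [measurable]: "X i \<in> borel_measurable M" if "i < w" for i using ind that by (simp add: indep_vars_def)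
  have mS: "(\<lambda>\<omega>. \<Sum>i\<in>J. X i \<omega>) \<in> borel_measurable M" if "J \<subseteq> {..<w}" for J
    using that by (intro borel_measurable_sum) auto
  have [measurable]: "(\<lambda>\<omega>. \<Sum>i<r. X i \<omega>) \<in> borel_measurable M" if "r \<le> w" for r
    using that by (intro mS) auto
  define A where "A t = {\<omega> \<in> space M. 2 * x < \<bar>\<Sum>i<t. X i \<omega>\<bar> \<and> (\<forall>r<t. \<bar>\<Sum>i<r. X i \<omega>\<bar> \<le> 2 * x)}" for t
  define B where "B t = {\<omega> \<in> space M. \<bar>\<Sum>i\<in>{t..<w}. X i \<omega>\<bar> \<le> x}" for t
  have mA[measurable]: "A t \<in> events" if "t \<le> w" for t
  proof -
    have "A t = {\<omega> \<in> space M. 2 * x < \<bar>\<Sum>i<t. X i \<omega>\<bar>} \<inter> {\<omega> \<in> space M. \<forall>r\<in>{..<t}. \<bar>\<Sum>i<r. X i \<omega>\<bar> \<le> 2 * x}"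
      unfolding A_def by blast
    moreover have "{\<omega> \<in> space M. \<forall>r\<in>{..<t}. \<bar>\<Sum>i<r. X i \<omega>\<bar> \<le> 2 * x} \<in> events"
      using that by (intro sets.sets_Collect_finite_All) (auto intro!: mS borel_measurable_le borel_measurable_abs)
    moreover have "{\<omega> \<in> space M. 2 * x < \<bar>\<Sum>i<t. X i \<omega>\<bar>} \<in> events" using that by measurable
    ultimately show ?thesis by (simp only: sets.Int)
  qed
  have mB[measurable]: "B t \<in> events" for t
  proof -
    have [measurable]: "(\<lambda>\<omega>. \<Sum>i\<in>{t..<w}. X i \<omega>) \<in> borel_measurable M" by (intro mS) auto
    show ?thesis unfolding B_def by measurable
  qed
  have pB: "1/2 \<le> prob (B t)" if "t \<le> w" for t
  proof -
    have "B t = space M - {\<omega> \<in> space M. x < \<bar>\<Sum>i\<in>{t..<w}. X i \<omega>\<bar>}"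
      unfolding B_def set_eq_iff Diff_iff mem_Collect_eq by (meson not_less)
    moreover have "{\<omega> \<in> space M. x < \<bar>\<Sum>i\<in>{t..<w}. X i \<omega>\<bar>} \<in> events"
      by (intro borel_measurable_less borel_measurable_abs mS) auto
    ultimately show ?thesis using half[OF that] by (simp add: prob_compl)
  qed
  have AB: "prob (A t \<inter> B t) = prob (A t) * prob (B t)" if t: "t \<le> w" for t
  proof -
    \<comment> \<open>\<open>A t\<close> depends only on the variables below t and
      \<open>B t\<close> only on the later ones, so both are written as preimages under the two
      restriction maps.\<close>
    have iv: "indep_var (PiM {..<t} (\<lambda>_. borel)) (\<lambda>\<omega>. restrict (\<lambda>i. X i \<omega>) {..<t})
        (PiM {t..<w} (\<lambda>_. borel)) (\<lambda>\<omega>. restrict (\<lambda>i. X i \<omega>) {t..<w})"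
      using t by (intro indep_var_restrict[OF ind]) auto
    let ?P = "PiM {..<t} (\<lambda>_. borel :: real measure)" and ?Q = "PiM {t..<w} (\<lambda>_. borel :: real measure)"
    define A' where "A' = {f \<in> space ?P. 2 * x < \<bar>\<Sum>i<t. f i\<bar> \<and> (\<forall>r\<in>{..<t}. \<bar>\<Sum>i<r. f i\<bar> \<le> 2 * x)}"
    define B' where "B' = {f \<in> space ?Q. \<bar>\<Sum>i\<in>{t..<w}. f i\<bar> \<le> x}"
    have m1: "(\<lambda>f. \<Sum>i<r. f i) \<in> borel_measurable ?P" if "r \<le> t" for r
      using that by (intro borel_measurable_sum measurable_component_singleton) auto
    have A'm: "A' \<in> sets ?P" unfolding A'_def
      by (intro sets.sets_Collect_conj sets.sets_Collect_finite_All borel_measurable_less borel_measurable_le borel_measurable_abs m1) auto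
    have B'm: "B' \<in> sets ?Q" unfolding B'_def
      by (intro borel_measurable_le borel_measurable_abs borel_measurable_sum measurable_component_singleton) auto
    have r: "(\<Sum>i\<in>J. restrict f K i) = (\<Sum>i\<in>J. f i)" if "J \<subseteq> K" for J K and f :: "nat \<Rightarrow> real"
      using that by (intro sum.cong) auto
    have sp: "restrict f K \<in> space (PiM K (\<lambda>_. borel :: real measure))" for f K by (auto simp: space_PiM)
    have rr: "(\<Sum>i<r. restrict f {..<t} i) = (\<Sum>i<r. f i)" if "r \<in> {..<t}" for r and f :: "nat \<Rightarrow> real"
      using that by (intro r) auto
    have eA: "(\<lambda>\<omega>. restrict (\<lambda>i. X i \<omega>) {..<t}) -` A' \<inter> space M = A t"
    proof (rule set_eqI)
      fix \<omega>
      let ?f = "\<lambda>i. X i \<omega>"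
      have "(\<forall>r\<in>{..<t}. \<bar>\<Sum>i<r. restrict ?f {..<t} i\<bar> \<le> 2 * x) = (\<forall>r\<in>{..<t}. \<bar>\<Sum>i<r. ?f i\<bar> \<le> 2 * x)"
        by (intro ball_cong refl) (simp only: rr)
      moreover have "\<dots> = (\<forall>r<t. \<bar>\<Sum>i<r. ?f i\<bar> \<le> 2 * x)" by blast
      ultimately show "\<omega> \<in> (\<lambda>\<omega>. restrict (\<lambda>i. X i \<omega>) {..<t}) -` A' \<inter> space M \<longleftrightarrow> \<omega> \<in> A t"
        unfolding A'_def A_def vimage_eq Int_iff mem_Collect_eq r[OF order_refl]
        using sp[of ?f "{..<t}"] by blast
    qed
    have eB: "(\<lambda>\<omega>. restrict (\<lambda>i. X i \<omega>) {t..<w}) -` B' \<inter> space M = B t"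
      unfolding B'_def B_def set_eq_iff vimage_eq Int_iff mem_Collect_eq r[OF order_refl]
      using sp by blast
    have eAB: "(\<lambda>\<omega>. (restrict (\<lambda>i. X i \<omega>) {..<t}, restrict (\<lambda>i. X i \<omega>) {t..<w})) -` (A' \<times> B') \<inter> space M = A t \<inter> B t"
      using eA eB by auto
    show ?thesis using indep_varD[OF iv A'm B'm] unfolding eA eB eAB .
  qed
  have sub: "A t \<inter> B t \<subseteq> {\<omega> \<in> space M. x < \<bar>\<Sum>i<w. X i \<omega>\<bar>}" if "t \<le> w" for t
  proof
    fix \<omega> assume "\<omega> \<in> A t \<inter> B t"
    then have h: "\<omega> \<in> space M" "2 * x < \<bar>\<Sum>i<t. X i \<omega>\<bar>" "\<bar>\<Sum>i\<in>{t..<w}. X i \<omega>\<bar> \<le> x"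
      unfolding A_def B_def by blast+
    have "(\<Sum>i<w. X i \<omega>) = (\<Sum>i<t. X i \<omega>) + (\<Sum>i\<in>{t..<w}. X i \<omega>)"
      using that by (simp add: lessThan_atLeast0 sum.atLeastLessThan_concat)
    then have "x < \<bar>\<Sum>i<w. X i \<omega>\<bar>" using h(2,3) by linarith
    then show "\<omega> \<in> {\<omega> \<in> space M. x < \<bar>\<Sum>i<w. X i \<omega>\<bar>}" using h(1) by blast
  qed
  have disj: "disjoint_family_on A {..w}"
  proof (unfold disjoint_family_on_def, intro ballI impI)
    have "A s \<inter> A t = {}" if "s < t" for s t using that unfolding A_def disjoint_iff mem_Collect_eq by (meson not_less)
    then show "A s \<inter> A t = {}" if "s \<noteq> t" for s t using that by (metis Int_commute linorder_neqE_nat)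
  qed
  have eq: "{\<omega> \<in> space M. \<exists>t\<le>w. 2 * x < \<bar>\<Sum>i<t. X i \<omega>\<bar>} = (\<Union>t\<le>w. A t)"
  proof (intro equalityI subsetI)
    fix \<omega> assume "\<omega> \<in> {\<omega> \<in> space M. \<exists>t\<le>w. 2 * x < \<bar>\<Sum>i<t. X i \<omega>\<bar>}"
    then have "\<omega> \<in> space M" and ex: "\<exists>t. t \<le> w \<and> 2 * x < \<bar>\<Sum>i<t. X i \<omega>\<bar>" by auto
    let ?t = "LEAST t. t \<le> w \<and> 2 * x < \<bar>\<Sum>i<t. X i \<omega>\<bar>"
    have "?t \<le> w \<and> 2 * x < \<bar>\<Sum>i<?t. X i \<omega>\<bar>" by (rule LeastI_ex[OF ex])
    moreover have "\<bar>\<Sum>i<r. X i \<omega>\<bar> \<le> 2 * x" if "r < ?t" for r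
      using not_less_Least[OF that] that calculation by linarith
    ultimately have "\<omega> \<in> A ?t" unfolding A_def using \<open>\<omega> \<in> space M\<close> by blast
    then show "\<omega> \<in> (\<Union>t\<le>w. A t)" using \<open>?t \<le> w \<and> _\<close> by blast
  qed (auto simp: A_def)
  have "prob (\<Union>t\<le>w. A t) = (\<Sum>t\<le>w. prob (A t))"
    by (intro finite_measure_finite_Union disj) auto
  also have "\<dots> \<le> (\<Sum>t\<le>w. 2 * prob (A t \<inter> B t))"
  proof (rule sum_mono)
    fix t assume "t \<in> {..w}"
    then have "prob (A t) * (1/2) \<le> prob (A t) * prob (B t)" using pB by (intro mult_left_mono) auto
    then show "prob (A t) \<le> 2 * prob (A t \<inter> B t)" using AB \<open>t \<in> {..w}\<close> by simp
  qed
  also have "\<dots> = 2 * prob (\<Union>t\<le>w. A t \<inter> B t)"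
  proof -
    have "disjoint_family_on (\<lambda>t. A t \<inter> B t) {..w}" using disj unfolding disjoint_family_on_def by blast
    then have "prob (\<Union>t\<le>w. A t \<inter> B t) = (\<Sum>t\<le>w. prob (A t \<inter> B t))"
      by (intro finite_measure_finite_Union) auto
    then show ?thesis by (simp add: sum_distrib_left)
  qed
  also have "\<dots> \<le> 2 * prob {\<omega> \<in> space M. x < \<bar>\<Sum>i<w. X i \<omega>\<bar>}"
    using sub by (intro mult_left_mono finite_measure_mono) auto
  finally show ?thesis unfolding eq .
qed

section \<open>Borel-Cantelli lemmas\<close>

lemma borel_cantelli_AE_eventually:
  assumes A: "\<And>n. {\<omega> \<in> space M. \<not> Q n \<omega>} \<in> events" and p: "\<And>n. n \<ge> n0 \<Longrightarrow> prob {\<omega> \<in> space M. \<not> Q n \<omega>} \<le> f n" and f: "summable f"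
  shows "AE \<omega> in M. eventually (\<lambda>n. Q n \<omega>) sequentially"
proof -
  have "summable (\<lambda>n. prob {\<omega> \<in> space M. \<not> Q n \<omega>})"
    using p by (intro summable_comparison_test'[OF f, of n0]) simp
  then have "AE \<omega> in M. eventually (\<lambda>n. \<omega> \<in> space M - {\<omega> \<in> space M. \<not> Q n \<omega>}) sequentially"
    using A by (intro borel_cantelli_AE1) (auto simp: less_top[symmetric])
  then show ?thesis by eventually_elim (auto elim: eventually_mono)
qed

text \<open>By independence, the probability that no event occurs from m on is at most exp of minus
  every partial sum of p beyond m. Were it positive, its logarithm would bound all these partial
  sums. The form with a lower bound p for the probabilities fits the output of exponential
  tilting.\<close>

lemma borel_cantelli_second:
  fixes R :: "nat \<Rightarrow> 'a \<Rightarrow> real"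
  assumes ind: "indep_vars (\<lambda>_. borel) R UNIV"
    and p: "\<And>k. k \<ge> k0 \<Longrightarrow> p k \<le> prob {\<omega> \<in> space M. c k \<le> R k \<omega>}" and p0: "\<And>k. 0 \<le> p k" and div: "\<not> summable p"
  shows "AE \<omega> in M. frequently (\<lambda>k. c k \<le> R k \<omega>) sequentially"
proof -
  have [measurable]: "R k \<in> borel_measurable M" for k using ind by (simp add: indep_vars_def)
  define F where "F m = {\<omega> \<in> space M. \<forall>k\<ge>m. \<not> c k \<le> R k \<omega>}" for m
  have mF[measurable]: "F m \<in> events" for m unfolding F_def by measurable
  have "prob (F m) = 0" if m: "m \<ge> k0" for m
  proof -
    have bd: "prob (F m) \<le> exp (- (\<Sum>k\<in>{m..<m+j}. p k))" if j: "0 < j" for j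
    proof -
      have "prob (F m) \<le> prob (\<Inter>k\<in>{m..<m+j}. R k -` {..<c k} \<inter> space M)"
        using j by (intro finite_measure_mono) (auto simp: F_def)
      also have "\<dots> = (\<Prod>k\<in>{m..<m+j}. prob (R k -` {..<c k} \<inter> space M))"
        using j by (intro indep_varsD[OF ind]) auto
      also have "\<dots> \<le> (\<Prod>k\<in>{m..<m+j}. exp (- p k))"
      proof (intro prod_mono conjI)
        fix k assume k: "k \<in> {m..<m+j}"
        have "R k -` {..<c k} \<inter> space M = space M - {\<omega> \<in> space M. c k \<le> R k \<omega>}" by auto
        then have "prob (R k -` {..<c k} \<inter> space M) = 1 - prob {\<omega> \<in> space M. c k \<le> R k \<omega>}"
          by (simp add: prob_compl)
        also have "\<dots> \<le> 1 - p k" using p[of k] k m by auto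
        also have "\<dots> \<le> exp (- p k)" using exp_ge_add_one_self[of "- p k"] by simp
        finally show "prob (R k -` {..<c k} \<inter> space M) \<le> exp (- p k)" .
      qed auto
      also have "\<dots> = exp (- (\<Sum>k\<in>{m..<m+j}. p k))" by (simp add: exp_sum[symmetric] sum_negf)
      finally show ?thesis .
    qed
    show ?thesis
    proof (rule ccontr)
      assume "prob (F m) \<noteq> 0"
      then have pos: "0 < prob (F m)" by (simp add: zero_less_measure_iff)
      have "summable p"
      proof (rule summableI_nonneg_bounded[where x = "(\<Sum>k<m. p k) + (- ln (prob (F m)))"])
        fix n
        show "(\<Sum>k<n. p k) \<le> (\<Sum>k<m. p k) + (- ln (prob (F m)))"
        proof (cases "n \<le> m")
          case True
          then have "(\<Sum>k<n. p k) \<le> (\<Sum>k<m. p k)" using p0 by (intro sum_mono2) auto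
          moreover have "ln (prob (F m)) \<le> 0" using pos prob_le_1 by simp
          ultimately show ?thesis by linarith
        next
          case False
          then obtain j where j: "n = m + j" "0 < j" by (metis less_imp_add_positive not_le)
          have "ln (prob (F m)) \<le> - (\<Sum>k\<in>{m..<m+j}. p k)"
            using bd[OF j(2)] pos by (metis ln_exp ln_le_cancel_iff exp_gt_zero)
          moreover have "(\<Sum>k<n. p k) = (\<Sum>k<m. p k) + (\<Sum>k\<in>{m..<m+j}. p k)"
            unfolding j by (simp add: lessThan_atLeast0 sum.atLeastLessThan_concat)
          ultimately show ?thesis by linarith
        qed
      qed (rule p0)
      then show False using div by simp
    qed
  qed
  then have "AE \<omega> in M. \<omega> \<notin> F m" if "m \<ge> k0" for m
    using that by (intro AE_not_in) (simp add: null_sets_def emeasure_eq_measure)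
  then have "AE \<omega> in M. \<forall>m. m \<ge> k0 \<longrightarrow> \<omega> \<notin> F m" by (intro AE_all_countable[THEN iffD2] allI) (auto simp: AE_impI)
  then show ?thesis
  proof (rule AE_mp, intro AE_I2 impI, unfold frequently_def eventually_sequentially, intro notI, elim exE)
    fix \<omega> N assume s: "\<omega> \<in> space M" "\<forall>m\<ge>k0. \<omega> \<notin> F m" and N: "\<forall>n\<ge>N. \<not> c n \<le> R n \<omega>"
    then have "\<omega> \<notin> F (max k0 N)" by (meson max.cobounded1)
    then obtain k where "k \<ge> max k0 N" "c k \<le> R k \<omega>" unfolding F_def using s by blast
    then show False using N by (meson max.bounded_iff)
  qed
qed

end

section \<open>Truncated random walks\<close>

definition lil_scale :: "nat \<Rightarrow> real" where
  "lil_scale n = sqrt (2 * real n * ln (ln (real n)))"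

text \<open>On the dyadic block \<open>2 ^ (k - 1) \<le> n < 2 ^ k\<close> the scale \<open>lil_scale n\<close> is comparable to \<open>dy_scale k\<close>. Steps are
  truncated at a multiple of \<open>dy_level k\<close>: this keeps the exponential parameter \<open>dy_scale k / 2 ^ k\<close> times a step
  bounded, and the excess over these levels is still summable for square integrable steps.\<close>

definition dy_log :: "nat \<Rightarrow> real" where "dy_log k = ln (real k + 2)"
definition dy_level :: "nat \<Rightarrow> real" where "dy_level k = sqrt (2 ^ k / dy_log k)"
definition dy_scale :: "nat \<Rightarrow> real" where "dy_scale k = sqrt (2 ^ k * dy_log k)"

lemma dy_log_ge: "1/2 \<le> dy_log k"
proof -
  have "2/3 \<le> ln (2::real)" by (rule ln2_ge_two_thirds)
  also have "ln 2 \<le> dy_log k" unfolding dy_log_def by simp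
  finally show ?thesis by simp
qed

lemma dy_log_pos: "0 < dy_log k" using dy_log_ge[of k] by simp

lemma dy_level_pos: "0 < dy_level k" and dy_scale_pos: "0 < dy_scale k"
  by (simp_all add: dy_level_def dy_scale_def dy_log_pos)

lemma dy_scale_mult_level: "dy_scale k * dy_level k = 2 ^ k"
  unfolding dy_scale_def dy_level_def real_sqrt_mult[symmetric]
  using dy_log_pos[of k] by (simp add: power2_eq_square[symmetric])

lemma dy_scale_sq: "(dy_scale k)\<^sup>2 = 2 ^ k * dy_log k"
  unfolding dy_scale_def using dy_log_pos[of k] by simp

text \<open>For x = k + 2 \<ge> 2, the inequality (x + 1)^5 \<le> x^8 limits the growth of the
  logarithm to a factor 8/5. Hence the square of the level grows at least by 2 (5/8) = 5/4, which
  exceeds (11/10)^2.\<close>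

lemma dy_level_Suc: "11/10 * dy_level k \<le> dy_level (Suc k)"
proof -
  define x where "x = real k + 2"
  have x: "2 \<le> x" by (simp add: x_def)
  have "(x + 1) ^ 5 \<le> (x * (3/2)) ^ 5" using x by (intro power_mono) auto
  also have "\<dots> = x ^ 5 * (3/2) ^ 5" by (rule power_mult_distrib)
  also have "\<dots> \<le> x ^ 5 * 2 ^ 3" using x by (intro mult_left_mono) (auto simp: numeral_eq_Suc)
  also have "\<dots> \<le> x ^ 5 * x ^ 3" using x by (intro mult_left_mono power_mono) auto
  finally have "(x + 1) ^ 5 \<le> x ^ 8" by (simp add: power_add[symmetric])
  then have "ln ((x + 1) ^ 5) \<le> ln (x ^ 8)" using x by (subst ln_le_cancel_iff) auto
  then have "5 * ln (x + 1) \<le> 8 * ln x" using x by (simp add: ln_realpow)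
  then have l: "5 * dy_log (Suc k) \<le> 8 * dy_log k" by (simp add: dy_log_def x_def algebra_simps)
  have "(11/10)\<^sup>2 * (2 ^ k / dy_log k) \<le> 2 ^ Suc k / dy_log (Suc k)"
  proof -
    have "(11/10)\<^sup>2 * dy_log (Suc k) \<le> 2 * dy_log k" using l dy_log_pos[of k] dy_log_pos[of "Suc k"]
      by (simp add: power2_eq_square)
    then have "2 ^ k * ((11/10)\<^sup>2 * dy_log (Suc k)) \<le> 2 ^ k * (2 * dy_log k)" by (rule mult_left_mono) simp
    then show ?thesis using dy_log_pos[of k] dy_log_pos[of "Suc k"] by (simp add: field_simps)
  qed
  then have "sqrt ((11/10)\<^sup>2 * (2 ^ k / dy_log k)) \<le> dy_level (Suc k)"
    unfolding dy_level_def by (rule real_sqrt_le_mono)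
  then show ?thesis unfolding real_sqrt_mult dy_level_def by simp
qed

lemma dy_level_ge: "(11/10) ^ k \<le> dy_level k"
proof (induction k)
  case 0
  have "ln (2::real) \<le> 1" using ln_le_minus_one[of 2] by simp
  then show ?case by (simp add: dy_level_def dy_log_def)
next
  case (Suc k)
  then show ?case using dy_level_Suc[of k] by simp
qed

lemma dy_level_at_top: "filterlim dy_level at_top sequentially"
proof -
  have "filterlim (\<lambda>k. (11/10::real) ^ k) at_top sequentially"
    unfolding filterlim_at_top_gt[of _ _ 0]
  proof (intro allI impI)
    fix Z :: real
    obtain n where n: "Z < (11/10) ^ n" using real_arch_pow[of "11/10" Z] by auto
    show "eventually (\<lambda>k. Z \<le> (11/10) ^ k) sequentially"
    proof (rule eventually_sequentiallyI[of n])
      fix k assume "n \<le> k"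
      then have "(11/10::real) ^ n \<le> (11/10) ^ k" by (intro power_increasing) auto
      then show "Z \<le> (11/10) ^ k" using n by linarith
    qed
  qed
  then show ?thesis by (rule filterlim_at_top_mono) (simp add: dy_level_ge)
qed

text \<open>In a geometrically growing sequence the last term dominates the sum. Applied to
  truncation levels below a multiple of |y| this gives a multiple of |y|, which is how
  \<open>summable_level_excess\<close> produces a second moment.\<close>

lemma geometric_growth_sum_less:
  fixes u :: "nat \<Rightarrow> real"
  assumes pos: "\<And>k. 0 < u k" and gr: "\<And>k. r * u k \<le> u (Suc k)" and r: "1 < r" and y: "0 \<le> y"
  shows "(\<Sum>k\<in>{k. k < K \<and> u k < y}. u k) \<le> r / (r - 1) * y"
proof -
  have S: "(\<Sum>k<n. u k) \<le> u n / (r - 1)" for n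
  proof (induction n)
    case 0
    then show ?case using pos[of 0] r by simp
  next
    case (Suc n)
    have "(\<Sum>k<Suc n. u k) \<le> u n / (r - 1) + u n" using Suc by simp
    also have "\<dots> = r * u n / (r - 1)" using r by (simp add: field_simps)
    also have "\<dots> \<le> u (Suc n) / (r - 1)" using gr r by (intro divide_right_mono) auto
    finally show ?case .
  qed
  let ?A = "{k. k < K \<and> u k < y}"
  show ?thesis
  proof (cases "?A = {}")
    case True
    then show ?thesis using r y by (simp only:) simp
  next
    case False
    have fin: "finite ?A" by simp
    define j where "j = Max ?A"
    have j: "j \<in> ?A" unfolding j_def using fin False by (rule Max_in)
    have "?A \<subseteq> {..<Suc j}" unfolding j_def using Max_ge[OF fin] by (auto simp: less_Suc_eq_le)
    then have "(\<Sum>k\<in>?A. u k) \<le> (\<Sum>k<Suc j. u k)" using pos by (intro sum_mono2) (auto intro: less_imp_le)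
    also have "\<dots> \<le> u j / (r - 1) + u j" using S[of j] by simp
    also have "\<dots> = r / (r - 1) * u j" using r by (simp add: field_simps)
    also have "\<dots> \<le> r / (r - 1) * y" using j r by (intro mult_left_mono) auto
    finally show ?thesis .
  qed
qed

text \<open>On block k both ln ln n against ln (k + 2) and n against \<open>2 ^ k\<close> are
  determined up to a factor 2, so the two scales differ by at most a factor 2 either way.\<close>

lemma dyadic_bounds:
  assumes k: "9 \<le> k" and n: "2 ^ (k - 1) \<le> n" "n < 2 ^ k"
  shows "dy_log k / 2 \<le> ln (ln (real n))" "ln (ln (real n)) \<le> dy_log k"
    "dy_scale k \<le> 2 * lil_scale n" "lil_scale n \<le> 2 * dy_scale k"
proof -
  have n0: "0 < n" using n(1) by (metis gr0I not_le zero_less_numeral zero_less_power)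
  have rn: "2 ^ (k - 1) \<le> real n" "real n \<le> 2 ^ k"
    using n by (metis of_nat_le_iff of_nat_numeral of_nat_power, metis less_imp_le of_nat_le_iff of_nat_numeral of_nat_power)
  have rn1: "2 ^ k \<le> 2 * real n"
    using rn(1) k by (cases k) auto
  have "real (k - 1) * ln 2 = ln (2 ^ (k - 1))" by (simp add: ln_realpow)
  also have "\<dots> \<le> ln (real n)" using rn n0 by simp
  finally have l1: "real (k - 1) * ln 2 \<le> ln (real n)" .
  have "real (k - 1) * (1/2) \<le> real (k - 1) * ln 2" using ln2_ge_two_thirds by (intro mult_left_mono) auto
  then have "real (k - 1) * (1/2) \<le> ln (real n)" using l1 by (rule order_trans)
  then have l2: "(real k - 1) / 2 \<le> ln (real n)" using k by (simp add: of_nat_diff)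
  have "ln (real n) \<le> ln (2 ^ k)" using rn n0 by simp
  also have "\<dots> = real k * ln 2" by (simp add: ln_realpow)
  also have "\<dots> \<le> real k * 1" using ln_le_minus_one[of 2] by (intro mult_left_mono) auto
  finally have l3: "ln (real n) \<le> real k" by simp
  have lp: "0 < ln (real n)" using l2 k by simp
  show up: "ln (ln (real n)) \<le> dy_log k"
    unfolding dy_log_def using l3 lp by (subst ln_le_cancel_iff) auto
  \<comment> \<open>Squaring ln n only doubles ln ln n; \<open>9 \<le> k\<close> ensures that the
    square exceeds k + 2.\<close>
  have "real k + 2 \<le> ((real k - 1) / 2)\<^sup>2"
  proof -
    have "0 \<le> (real k - 9) * (real k + 3)" using k by (intro mult_nonneg_nonneg) auto
    then show ?thesis by (simp add: power2_eq_square field_simps)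
  qed
  also have "\<dots> \<le> (ln (real n))\<^sup>2" using l2 k by (intro power_mono) auto
  finally have "ln (real k + 2) \<le> ln ((ln (real n))\<^sup>2)" by (subst ln_le_cancel_iff) (use lp in auto)
  then show lo: "dy_log k / 2 \<le> ln (ln (real n))"
    unfolding dy_log_def using lp by (simp add: ln_realpow)
  have "dy_scale k = sqrt (2 ^ k * dy_log k)" by (simp add: dy_scale_def)
  also have "\<dots> \<le> sqrt (4 * (2 * real n * ln (ln (real n))))"
  proof (rule real_sqrt_le_mono)
    have "2 ^ k * dy_log k \<le> (2 * real n) * (2 * ln (ln (real n)))"
      using rn1 lo dy_log_pos[of k] by (intro mult_mono) auto
    also have "\<dots> \<le> 4 * (2 * real n * ln (ln (real n)))" using lo dy_log_pos[of k] by simp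
    finally show "2 ^ k * dy_log k \<le> 4 * (2 * real n * ln (ln (real n)))" .
  qed
  also have "\<dots> = 2 * lil_scale n" unfolding lil_scale_def by (subst real_sqrt_mult) simp
  finally show "dy_scale k \<le> 2 * lil_scale n" .
  have "lil_scale n \<le> sqrt (4 * (2 ^ k * dy_log k))"
    unfolding lil_scale_def
  proof (rule real_sqrt_le_mono)
    have "2 * real n * ln (ln (real n)) \<le> 2 * 2 ^ k * dy_log k"
      using rn up lo dy_log_pos[of k] by (intro mult_mono) auto
    also have "\<dots> \<le> 4 * (2 ^ k * dy_log k)" using dy_log_pos[of k] by simp
    finally show "2 * real n * ln (ln (real n)) \<le> 4 * (2 ^ k * dy_log k)" .
  qed
  also have "\<dots> = 2 * dy_scale k" unfolding dy_scale_def by (subst real_sqrt_mult) simp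
  finally show "lil_scale n \<le> 2 * dy_scale k" .
qed

definition dy_index :: "nat \<Rightarrow> nat" where "dy_index n = (LEAST k. n < 2 ^ k)"

text \<open>The block index of n tends to infinity with n, so what holds for all large blocks may be
  used at the block of every large n.\<close>

lemma eventually_dy_index:
  assumes "eventually Q sequentially"
  shows "eventually (\<lambda>n. Q (dy_index n) \<and> 9 \<le> dy_index n \<and> 2 ^ (dy_index n - 1) \<le> n \<and> n < 2 ^ dy_index n) sequentially"
proof -
  obtain K where K: "\<And>k. k \<ge> K \<Longrightarrow> Q k" using assms unfolding eventually_sequentially by blast
  show ?thesis
  proof (rule eventually_sequentiallyI[of "2 ^ (K + 9)"])
    fix n :: nat assume n: "2 ^ (K + 9) \<le> n"
    let ?k = "dy_index n"
    have ex: "n < 2 ^ n" by (rule less_exp)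
    have k1: "n < 2 ^ ?k" unfolding dy_index_def by (rule LeastI[of _ n]) (rule ex)
    have "2 ^ (K + 9) < (2::nat) ^ ?k" using n k1 by (rule le_less_trans)
    then have k2: "K + 9 < ?k" by (rule power_less_imp_less_exp[rotated]) simp
    have "\<not> n < 2 ^ (?k - 1)" using not_less_Least[of "?k - 1" "\<lambda>k. n < 2 ^ k"] k2 unfolding dy_index_def by auto
    then show "Q ?k \<and> 9 \<le> ?k \<and> 2 ^ (?k - 1) \<le> n \<and> n < 2 ^ ?k" using k1 k2 K[of ?k] by auto
  qed
qed

lemma lnln_ge_0: "3 \<le> n \<Longrightarrow> 0 < ln (ln (real n))"
proof -
  assume "3 \<le> n"
  have "exp 1 < (3::real)" using e_less_272 by simp
  also have "3 \<le> real n" using \<open>3 \<le> n\<close> by simp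
  finally have "1 < ln (real n)" by (metis exp_gt_zero ln_exp ln_less_cancel_iff less_trans)
  then show ?thesis by simp
qed

lemma lil_scale_pos: "3 \<le> n \<Longrightarrow> 0 < lil_scale n"
  unfolding lil_scale_def using lnln_ge_0[of n] by simp

lemma lil_scale_mono: "3 \<le> n \<Longrightarrow> n \<le> m \<Longrightarrow> lil_scale n \<le> lil_scale m"
proof -
  assume a: "3 \<le> n" "n \<le> m"
  have "1 < real n" "real n \<le> real m" using a by auto
  then have "ln (ln (real n)) \<le> ln (ln (real m))" by (subst ln_le_cancel_iff) auto
  then show ?thesis unfolding lil_scale_def using a lnln_ge_0[of n]
    by (intro real_sqrt_le_mono mult_mono) auto
qed

text \<open>Large values become 0 instead of being projected to the ball: the discarded part
  \<open>y - trunc c y\<close> is then either 0 or y itself, and its expected norm is a tail of the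
  first moment.\<close>

definition trunc :: "real \<Rightarrow> 'v::real_normed_vector \<Rightarrow> 'v" where
  "trunc c y = (if norm y \<le> c then y else 0)"

lemma norm_trunc_le: "0 \<le> c \<Longrightarrow> norm (trunc c y) \<le> c" by (simp add: trunc_def)
lemma norm_trunc_le': "norm (trunc c y) \<le> norm y" by (simp add: trunc_def)

lemma trunc_measurable[measurable]: "trunc c \<in> borel_measurable (borel :: 'v::{real_normed_vector, second_countable_topology} measure)"
  unfolding trunc_def by measurable

section \<open>Centred square-integrable sequences and their truncations\<close>

locale iid_seq = prob_space M for M :: "'a measure" +
  fixes Y :: "nat \<Rightarrow> 'a \<Rightarrow> 'v::euclidean_space"
  assumes rvY[measurable]: "\<And>i. Y i \<in> borel_measurable M"
    and indepY: "indep_vars (\<lambda>_. borel) Y UNIV"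
    and identY: "\<And>i. distr M borel (Y i) = distr M borel (Y 0)"
    and sqY: "integrable M (\<lambda>\<omega>. (norm (Y 0 \<omega>))\<^sup>2)"
    and meanY: "expectation (Y 0) = 0"
begin

definition walk :: "nat \<Rightarrow> 'a \<Rightarrow> 'v" where "walk l \<omega> = (\<Sum>i<l. Y i \<omega>)"
text \<open>Truncation destroys the mean 0; this is the resulting bias, subtracted again in
  \<open>tvar\<close>.\<close>

definition tmean :: "real \<Rightarrow> 'v" where "tmean c = expectation (\<lambda>\<omega>. trunc c (Y 0 \<omega>))"
definition tvar :: "real \<Rightarrow> nat \<Rightarrow> 'a \<Rightarrow> 'v" where "tvar c i \<omega> = trunc c (Y i \<omega>) - tmean c"
definition twalk :: "real \<Rightarrow> nat \<Rightarrow> 'a \<Rightarrow> 'v" where "twalk c l \<omega> = (\<Sum>i<l. tvar c i \<omega>)"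
definition excess :: "real \<Rightarrow> real" where "excess c = expectation (\<lambda>\<omega>. norm (Y 0 \<omega> - trunc c (Y 0 \<omega>)))"

lemma walk_measurable[measurable]: "walk l \<in> borel_measurable M"
  unfolding walk_def by measurable
lemma tvar_measurable[measurable]: "tvar c i \<in> borel_measurable M"
  unfolding tvar_def by measurable
lemma twalk_measurable[measurable]: "twalk c l \<in> borel_measurable M"
  unfolding twalk_def by measurable

lemma expectation_ident:
  fixes f :: "'v \<Rightarrow> 'b::{banach, second_countable_topology}"
  assumes [measurable]: "f \<in> borel_measurable borel"
  shows "expectation (\<lambda>\<omega>. f (Y i \<omega>)) = expectation (\<lambda>\<omega>. f (Y 0 \<omega>))"
proof -
  have "expectation (\<lambda>\<omega>. f (Y i \<omega>)) = integral\<^sup>L (distr M borel (Y i)) f" by (subst integral_distr) auto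
  also have "\<dots> = expectation (\<lambda>\<omega>. f (Y 0 \<omega>))" unfolding identY[of i] by (subst integral_distr) auto
  finally show ?thesis .
qed

lemma integrable_ident:
  fixes f :: "'v \<Rightarrow> 'b::{banach, second_countable_topology}"
  assumes [measurable]: "f \<in> borel_measurable borel" and i: "integrable M (\<lambda>\<omega>. f (Y 0 \<omega>))"
  shows "integrable M (\<lambda>\<omega>. f (Y i \<omega>))"
proof -
  have "integrable (distr M borel (Y i)) f" unfolding identY[of i] using i by (subst integrable_distr_eq) auto
  then show ?thesis by (subst (asm) integrable_distr_eq) auto
qed

lemma integrable_norm_Y: "integrable M (\<lambda>\<omega>. norm (Y 0 \<omega>))"
proof (rule Bochner_Integration.integrable_bound[OF Bochner_Integration.integrable_add[OF sqY integrable_const[of 1]]])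
  show "AE \<omega> in M. norm (norm (Y 0 \<omega>)) \<le> norm ((norm (Y 0 \<omega>))\<^sup>2 + 1)"
  proof (rule AE_I2)
    fix \<omega>
    have "0 \<le> (norm (Y 0 \<omega>) - 1)\<^sup>2" by simp
    then have "2 * norm (Y 0 \<omega>) \<le> (norm (Y 0 \<omega>))\<^sup>2 + 1" by (simp add: power2_eq_square algebra_simps)
    then have "norm (Y 0 \<omega>) \<le> (norm (Y 0 \<omega>))\<^sup>2 + 1" using norm_ge_zero[of "Y 0 \<omega>"] by linarith
    then show "norm (norm (Y 0 \<omega>)) \<le> norm ((norm (Y 0 \<omega>))\<^sup>2 + 1)" by simp
  qed
qed auto

lemma integrable_Y: "integrable M (Y 0)"
  using integrable_norm_Y by (subst integrable_norm_iff[symmetric]) auto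

lemma norm_excess_le: "norm (y - trunc c y) \<le> norm y" by (simp add: trunc_def)

lemma integrable_excess: "integrable M (\<lambda>\<omega>. norm (Y i \<omega> - trunc c (Y i \<omega>)))"
proof (rule integrable_ident[where f = "\<lambda>y. norm (y - trunc c y)"])
  show "integrable M (\<lambda>\<omega>. norm (Y 0 \<omega> - trunc c (Y 0 \<omega>)))"
    by (rule Bochner_Integration.integrable_bound[OF integrable_norm_Y]) (auto simp: norm_excess_le)
qed measurable

lemma excess_nonneg: "0 \<le> excess c" unfolding excess_def by simp

lemma integrable_trunc: "0 \<le> c \<Longrightarrow> integrable M (\<lambda>\<omega>. trunc c (Y i \<omega>))"
  by (rule integrable_bounded_fun[of _ c]) (auto simp: norm_trunc_le)

text \<open>Since the full mean is 0, the bias is minus the mean of the discarded part. Truncation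
  and recentring are thus controlled by the same quantity.\<close>

lemma norm_tmean_le_excess: "0 \<le> c \<Longrightarrow> norm (tmean c) \<le> excess c"
proof -
  assume c: "0 \<le> c"
  have "tmean c = - expectation (\<lambda>\<omega>. Y 0 \<omega> - trunc c (Y 0 \<omega>))"
    unfolding tmean_def using integrable_trunc[OF c] integrable_Y meanY by simp
  also have "norm \<dots> \<le> excess c" unfolding excess_def by simp
  finally show ?thesis .
qed

lemma norm_tmean_le: "0 \<le> c \<Longrightarrow> norm (tmean c) \<le> c"
proof -
  assume c: "0 \<le> c"
  have "norm (tmean c) \<le> expectation (\<lambda>\<omega>. norm (trunc c (Y 0 \<omega>)))"
    unfolding tmean_def by (rule integral_norm_bound)
  also have "\<dots> \<le> expectation (\<lambda>_. c)"
    using integrable_norm[OF integrable_trunc[OF c]] c by (intro integral_mono) (auto simp: norm_trunc_le)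
  finally show ?thesis by (simp add: prob_space)
qed

lemma norm_tvar_le: "0 \<le> c \<Longrightarrow> norm (tvar c i \<omega>) \<le> 2 * c"
  unfolding tvar_def using norm_triangle_ineq4[of "trunc c (Y i \<omega>)" "tmean c"] norm_trunc_le[of c "Y i \<omega>"] norm_tmean_le
  by fastforce

lemma expectation_tvar: "0 \<le> c \<Longrightarrow> expectation (tvar c i) = 0"
proof -
  assume c: "0 \<le> c"
  have "expectation (tvar c i) = expectation (\<lambda>\<omega>. trunc c (Y i \<omega>)) - tmean c"
    unfolding tvar_def using integrable_trunc[OF c] by (simp add: prob_space)
  then show ?thesis unfolding tmean_def using expectation_ident[of "trunc c" i] by simp
qed

lemma integrable_tvar: "0 \<le> c \<Longrightarrow> integrable M (tvar c i)"
  by (rule integrable_bounded_fun[of _ "2*c"]) (auto simp: norm_tvar_le)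

lemma indep_tvar: "indep_vars (\<lambda>_. borel) (tvar c) UNIV"
proof -
  have "indep_vars (\<lambda>_. borel) (\<lambda>i \<omega>. trunc c (Y i \<omega>) - tmean c) UNIV"
    using indepY by (rule indep_vars_compose2) measurable
  then show ?thesis unfolding tvar_def[abs_def] .
qed

lemma abs_inner_tvar_le: "0 \<le> c \<Longrightarrow> \<bar>v \<bullet> tvar c i \<omega>\<bar> \<le> norm v * (2 * c)"
  using Cauchy_Schwarz_ineq2[of v "tvar c i \<omega>"] norm_tvar_le[of c i \<omega>] norm_ge_zero[of v]
  by (meson mult_left_mono order_trans)

lemma expectation_inner_tvar: "0 \<le> c \<Longrightarrow> expectation (\<lambda>\<omega>. v \<bullet> tvar c i \<omega>) = 0"
  using integrable_tvar expectation_tvar by (simp add: integral_inner_right)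

lemma tvar_second_moment:
  assumes c: "0 \<le> c"
  shows "expectation (\<lambda>\<omega>. (v \<bullet> tvar c i \<omega>)\<^sup>2) = expectation (\<lambda>\<omega>. (v \<bullet> trunc c (Y 0 \<omega>))\<^sup>2) - (v \<bullet> tmean c)\<^sup>2"
proof -
  have "expectation (\<lambda>\<omega>. (v \<bullet> tvar c i \<omega>)\<^sup>2) = expectation (\<lambda>\<omega>. (v \<bullet> tvar c 0 \<omega>)\<^sup>2)"
    unfolding tvar_def by (rule expectation_ident[where f = "\<lambda>y. (v \<bullet> (trunc c y - tmean c))\<^sup>2"]) measurable
  also have "\<dots> = expectation (\<lambda>\<omega>. (v \<bullet> trunc c (Y 0 \<omega>))\<^sup>2 - 2 * (v \<bullet> tmean c) * (v \<bullet> trunc c (Y 0 \<omega>)) + (v \<bullet> tmean c)\<^sup>2)"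
    unfolding tvar_def by (intro Bochner_Integration.integral_cong refl) (simp add: inner_diff_right power2_eq_square algebra_simps)
  also have "\<dots> = expectation (\<lambda>\<omega>. (v \<bullet> trunc c (Y 0 \<omega>))\<^sup>2) - 2 * (v \<bullet> tmean c) * expectation (\<lambda>\<omega>. v \<bullet> trunc c (Y 0 \<omega>)) + (v \<bullet> tmean c)\<^sup>2"
  proof -
    have b: "\<bar>v \<bullet> trunc c (Y 0 \<omega>)\<bar> \<le> norm v * c" for \<omega>
      using Cauchy_Schwarz_ineq2[of v "trunc c (Y 0 \<omega>)"] norm_trunc_le[OF c, of "Y 0 \<omega>"] by (meson mult_left_mono norm_ge_zero order_trans)
    have "(v \<bullet> trunc c (Y 0 \<omega>))\<^sup>2 \<le> (norm v * c)\<^sup>2" for \<omega>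
      using b[of \<omega>] c by (intro abs_le_square_iff[THEN iffD1]) auto
    then have "integrable M (\<lambda>\<omega>. (v \<bullet> trunc c (Y 0 \<omega>))\<^sup>2)"
      by (intro integrable_bounded_fun[of _ "(norm v * c)\<^sup>2"]) auto
    moreover have "integrable M (\<lambda>\<omega>. v \<bullet> trunc c (Y 0 \<omega>))" using integrable_trunc[OF c] by auto
    ultimately show ?thesis by (simp add: prob_space)
  qed
  also have "expectation (\<lambda>\<omega>. v \<bullet> trunc c (Y 0 \<omega>)) = v \<bullet> tmean c"
    unfolding tmean_def using integrable_trunc[OF c] by (simp add: integral_inner_right)
  finally show ?thesis by (simp only: power2_eq_square)
qed

lemma integrable_inner_sq: "integrable M (\<lambda>\<omega>. (v \<bullet> Y 0 \<omega>)\<^sup>2)"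
proof (rule Bochner_Integration.integrable_bound[OF integrable_mult_right[OF sqY, of "(norm v)\<^sup>2"]])
  show "AE \<omega> in M. norm ((v \<bullet> Y 0 \<omega>)\<^sup>2) \<le> norm ((norm v)\<^sup>2 * (norm (Y 0 \<omega>))\<^sup>2)"
    using Cauchy_Schwarz_ineq2[of v] by (intro AE_I2) (simp add: power_mult_distrib[symmetric] abs_le_square_iff[symmetric] abs_mult)
qed measurable

lemma tvar_second_moment_le:
  assumes c: "0 \<le> c"
  shows "expectation (\<lambda>\<omega>. (v \<bullet> tvar c i \<omega>)\<^sup>2) \<le> expectation (\<lambda>\<omega>. (v \<bullet> Y 0 \<omega>)\<^sup>2)"
proof -
  have "expectation (\<lambda>\<omega>. (v \<bullet> trunc c (Y 0 \<omega>))\<^sup>2) \<le> expectation (\<lambda>\<omega>. (v \<bullet> Y 0 \<omega>)\<^sup>2)"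
  proof (rule integral_mono)
    show "integrable M (\<lambda>\<omega>. (v \<bullet> trunc c (Y 0 \<omega>))\<^sup>2)"
      by (rule Bochner_Integration.integrable_bound[OF integrable_inner_sq[of v]]) (auto simp: trunc_def)
  qed (auto simp: integrable_inner_sq trunc_def)
  then show ?thesis unfolding tvar_second_moment[OF c] using zero_le_power2[of "v \<bullet> tmean c"] by linarith
qed

text \<open>The sharp lower tail needs truncated variances close to the full one. Dominated
  convergence gives this, the bias tending to the mean 0.\<close>

lemma tvar_second_moment_tendsto:
  assumes c: "filterlim c at_top sequentially" and c0: "\<And>k. 0 \<le> c k"
  shows "(\<lambda>k. expectation (\<lambda>\<omega>. (v \<bullet> tvar (c k) i \<omega>)\<^sup>2)) \<longlonglongrightarrow> expectation (\<lambda>\<omega>. (v \<bullet> Y 0 \<omega>)\<^sup>2)"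
proof -
  have ev: "eventually (\<lambda>k. trunc (c k) (Y 0 \<omega>) = Y 0 \<omega>) sequentially" for \<omega>
    using filterlim_at_top[THEN iffD1, OF c, rule_format, of "norm (Y 0 \<omega>)"] by eventually_elim (simp add: trunc_def)
  have 1: "(\<lambda>k. expectation (\<lambda>\<omega>. (v \<bullet> trunc (c k) (Y 0 \<omega>))\<^sup>2)) \<longlonglongrightarrow> expectation (\<lambda>\<omega>. (v \<bullet> Y 0 \<omega>)\<^sup>2)"
  proof (rule integral_dominated_convergence[where w = "\<lambda>\<omega>. (v \<bullet> Y 0 \<omega>)\<^sup>2"])
    show "AE \<omega> in M. (\<lambda>k. (v \<bullet> trunc (c k) (Y 0 \<omega>))\<^sup>2) \<longlonglongrightarrow> (v \<bullet> Y 0 \<omega>)\<^sup>2"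
    proof (rule AE_I2)
      fix \<omega>
      show "(\<lambda>k. (v \<bullet> trunc (c k) (Y 0 \<omega>))\<^sup>2) \<longlonglongrightarrow> (v \<bullet> Y 0 \<omega>)\<^sup>2"
        by (rule tendsto_eventually, rule eventually_mono[OF ev[of \<omega>]]) simp
    qed
  qed (auto simp: integrable_inner_sq trunc_def)
  have 2: "(\<lambda>k. tmean (c k)) \<longlonglongrightarrow> expectation (Y 0)"
    unfolding tmean_def
  proof (rule integral_dominated_convergence[where w = "\<lambda>\<omega>. norm (Y 0 \<omega>)"])
    show "AE \<omega> in M. (\<lambda>k. trunc (c k) (Y 0 \<omega>)) \<longlonglongrightarrow> Y 0 \<omega>"
      using ev by (intro AE_I2 tendsto_eventually)
  qed (auto simp: integrable_norm_Y norm_trunc_le')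
  have "(\<lambda>k. expectation (\<lambda>\<omega>. (v \<bullet> trunc (c k) (Y 0 \<omega>))\<^sup>2) - (v \<bullet> tmean (c k))\<^sup>2) \<longlonglongrightarrow> expectation (\<lambda>\<omega>. (v \<bullet> Y 0 \<omega>)\<^sup>2) - (v \<bullet> expectation (Y 0))\<^sup>2"
    by (intro tendsto_intros 1 2)
  then show ?thesis using c0 by (simp add: tvar_second_moment meanY)
qed

text \<open>This is where the finite second moment pays off. After exchanging sum and expectation, a
  fixed value y is discarded only at levels below |y| / \<tau>, and these add up to at most 11 |y| /
  \<tau>; the constant is (11/10) / (11/10 - 1).\<close>

lemma summable_level_excess:
  assumes \<tau>: "0 < \<tau>"
  shows "summable (\<lambda>k. dy_level k * excess (\<tau> * dy_level k))"
proof (rule summableI_nonneg_bounded[where x = "11 / \<tau> * expectation (\<lambda>\<omega>. (norm (Y 0 \<omega>))\<^sup>2)"])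
  fix K
  have pw: "(\<Sum>k<K. dy_level k * norm (y - trunc (\<tau> * dy_level k) y)) \<le> 11 / \<tau> * (norm y)\<^sup>2" for y :: 'v
  proof -
    let ?A = "{k. k < K \<and> dy_level k < norm y / \<tau>}"
    have "(\<Sum>k<K. dy_level k * norm (y - trunc (\<tau> * dy_level k) y)) = (\<Sum>k\<in>?A. dy_level k * norm (y - trunc (\<tau> * dy_level k) y))"
      using \<tau> by (intro sum.mono_neutral_right) (auto simp: trunc_def field_simps)
    also have "\<dots> \<le> (\<Sum>k\<in>?A. dy_level k * norm y)"
      by (intro sum_mono mult_left_mono norm_excess_le less_imp_le dy_level_pos)
    also have "\<dots> = (\<Sum>k\<in>?A. dy_level k) * norm y" by (simp add: sum_distrib_right)
    also have "\<dots> \<le> ((11/10) / (11/10 - 1) * (norm y / \<tau>)) * norm y"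
      using \<tau> by (intro mult_right_mono geometric_growth_sum_less dy_level_pos dy_level_Suc) auto
    also have "\<dots> = 11 / \<tau> * (norm y)\<^sup>2" by (simp add: power2_eq_square)
    finally show ?thesis .
  qed
  have "(\<Sum>k<K. dy_level k * excess (\<tau> * dy_level k)) = expectation (\<lambda>\<omega>. \<Sum>k<K. dy_level k * norm (Y 0 \<omega> - trunc (\<tau> * dy_level k) (Y 0 \<omega>)))"
    unfolding excess_def using integrable_excess[of 0] by simp
  also have "\<dots> \<le> expectation (\<lambda>\<omega>. 11 / \<tau> * (norm (Y 0 \<omega>))\<^sup>2)"
    using integrable_excess[of 0] sqY by (intro integral_mono pw) auto
  finally show "(\<Sum>k<K. dy_level k * excess (\<tau> * dy_level k)) \<le> 11 / \<tau> * expectation (\<lambda>\<omega>. (norm (Y 0 \<omega>))\<^sup>2)" by simp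
qed (simp add: excess_nonneg dy_level_pos less_imp_le)

text \<open>Markov's inequality and Borel-Cantelli: by \<open>dy_scale_mult_level\<close>, the
  expected discarded mass among \<open>2 ^ k\<close> steps, divided by \<open>dy_scale k\<close>, is
  the summable quantity of \<open>summable_level_excess\<close>. Adding norms instead of vectors
  makes the bound uniform in l.\<close>

lemma truncation_remainder:
  assumes \<tau>: "0 < \<tau>" and \<delta>: "0 < \<delta>"
  shows "AE \<omega> in M. eventually (\<lambda>k. \<forall>l\<le>2^k. norm (walk l \<omega> - twalk (\<tau> * dy_level k) l \<omega>) \<le> \<delta> * dy_scale k) sequentially"
proof -
  define R where "R k \<omega> = (\<Sum>i<2^k. norm (Y i \<omega> - trunc (\<tau> * dy_level k) (Y i \<omega>)))" for k \<omega>
  have [measurable]: "R k \<in> borel_measurable M" for k unfolding R_def by measurable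
  have iR: "integrable M (R k)" for k unfolding R_def using integrable_excess by auto
  have ER: "expectation (R k) = 2 ^ k * excess (\<tau> * dy_level k)" for k
  proof -
    have e: "expectation (\<lambda>\<omega>. norm (Y i \<omega> - trunc c (Y i \<omega>))) = excess c" for i c
      unfolding excess_def by (rule expectation_ident[where f = "\<lambda>y. norm (y - trunc c y)"]) measurable
    show ?thesis unfolding R_def using integrable_excess
      by (subst Bochner_Integration.integral_sum) (auto simp: e)
  qed
  have pos: "0 < \<tau> * dy_level k" for k using \<tau> dy_level_pos by simp
  have ds: "0 < \<delta> / 2 * dy_scale k" for k using \<delta> dy_scale_pos[of k] by simp
  have sm: "summable (\<lambda>k. 2 / \<delta> * (dy_level k * excess (\<tau> * dy_level k)))"
    by (intro summable_mult summable_level_excess \<tau>)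
  have scale: "2 ^ k * excess (\<tau> * dy_level k) = dy_scale k * (dy_level k * excess (\<tau> * dy_level k))" for k
    by (simp add: dy_scale_mult_level[symmetric])
  have 1: "AE \<omega> in M. eventually (\<lambda>k. R k \<omega> \<le> \<delta> / 2 * dy_scale k) sequentially"
  proof (rule borel_cantelli_AE_eventually[OF _ _ sm])
    fix k
    show "{\<omega> \<in> space M. \<not> R k \<omega> \<le> \<delta> / 2 * dy_scale k} \<in> events" by measurable
    have "prob {\<omega> \<in> space M. \<not> R k \<omega> \<le> \<delta> / 2 * dy_scale k} \<le> prob {\<omega> \<in> space M. \<delta> / 2 * dy_scale k \<le> R k \<omega>}"
      by (intro finite_measure_mono) auto
    also have "\<dots> \<le> expectation (R k) / (\<delta> / 2 * dy_scale k)"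
      using ds[of k] by (intro integral_Markov_inequality_measure[OF iR, where A = "{}"]) (auto simp: R_def sum_nonneg)
    also have "\<dots> = 2 / \<delta> * (dy_level k * excess (\<tau> * dy_level k))"
      unfolding ER scale using dy_scale_pos[of k] \<delta> by (simp add: field_simps)
    finally show "prob {\<omega> \<in> space M. \<not> R k \<omega> \<le> \<delta> / 2 * dy_scale k} \<le> 2 / \<delta> * (dy_level k * excess (\<tau> * dy_level k))" .
  qed
  have "(\<lambda>k. 2 / \<delta> * (dy_level k * excess (\<tau> * dy_level k))) \<longlonglongrightarrow> 0" by (rule summable_LIMSEQ_zero[OF sm])
  then have 2: "eventually (\<lambda>k. 2 / \<delta> * (dy_level k * excess (\<tau> * dy_level k)) < 1) sequentially"
    by (rule order_tendstoD) simp
  show ?thesis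
  proof (rule AE_mp[OF 1], intro AE_I2 impI)
    fix \<omega> assume "eventually (\<lambda>k. R k \<omega> \<le> \<delta> / 2 * dy_scale k) sequentially"
    then show "eventually (\<lambda>k. \<forall>l\<le>2^k. norm (walk l \<omega> - twalk (\<tau> * dy_level k) l \<omega>) \<le> \<delta> * dy_scale k) sequentially"
      using 2
    proof (eventually_elim, intro allI impI)
      fix k l :: nat assume R: "R k \<omega> \<le> \<delta> / 2 * dy_scale k" and k: "2 / \<delta> * (dy_level k * excess (\<tau> * dy_level k)) < 1" and l: "l \<le> 2 ^ k"
      let ?c = "\<tau> * dy_level k"
      have c: "0 \<le> ?c" using pos[of k] by simp
      have "walk l \<omega> - twalk ?c l \<omega> = (\<Sum>i<l. Y i \<omega> - trunc ?c (Y i \<omega>) + tmean ?c)"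
        unfolding walk_def twalk_def tvar_def sum_subtractf[symmetric] by (intro sum.cong) auto
      also have "norm \<dots> \<le> (\<Sum>i<l. norm (Y i \<omega> - trunc ?c (Y i \<omega>)) + excess ?c)"
        by (intro sum_norm_le norm_triangle_le add_mono order_refl norm_tmean_le_excess c)
      also have "\<dots> \<le> (\<Sum>i<2^k. norm (Y i \<omega> - trunc ?c (Y i \<omega>)) + excess ?c)"
        using l by (intro sum_mono2) (auto intro!: add_nonneg_nonneg excess_nonneg)
      also have "\<dots> = R k \<omega> + 2 ^ k * excess ?c" by (simp add: R_def sum.distrib)
      \<comment> \<open>The second half of the tolerance pays for the bias. This part is
        deterministic: the terms of the convergent series tend to 0.\<close>
      also have "2 ^ k * excess ?c \<le> \<delta> / 2 * dy_scale k"
      proof -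
        have "dy_level k * excess ?c \<le> \<delta> / 2" using k \<delta> by (simp add: field_simps)
        then show ?thesis unfolding scale using dy_scale_pos[of k] by (simp add: mult.commute[of "dy_scale k"] mult_right_mono)
      qed
      finally show "norm (walk l \<omega> - twalk ?c l \<omega>) \<le> \<delta> * dy_scale k" using R by simp
    qed
  qed
qed

end

section \<open>Modulus of continuity of the walk\<close>

lemma (in prob_space) indep_vars_shift:
  fixes X :: "nat \<Rightarrow> 'a \<Rightarrow> 'b::topological_space"
  assumes "indep_vars (\<lambda>_. borel) X UNIV"
  shows "indep_vars (\<lambda>_. borel) (\<lambda>i. X (s + i)) I"
proof -
  have "indep_vars (\<lambda>j. PiM {s + j} (\<lambda>_. borel)) (\<lambda>j \<omega>. restrict (\<lambda>i. X i \<omega>) {s + j}) I"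
    by (rule indep_vars_restrict[OF assms]) (auto simp: disjoint_family_on_def)
  then have "indep_vars (\<lambda>_. borel) (\<lambda>j \<omega>. (restrict (\<lambda>i. X i \<omega>) {s + j}) (s + j)) I"
    by (rule indep_vars_compose2[where Y = "\<lambda>j f. f (s + j)"]) (auto intro!: measurable_component_singleton)
  then show ?thesis by simp
qed

context iid_seq
begin

text \<open>The added 1 keeps \<open>sd\<close> positive when the steps vanish.\<close>

definition sd :: real where "sd = sqrt (expectation (\<lambda>\<omega>. (norm (Y 0 \<omega>))\<^sup>2) + 1)"
text \<open>Three cell oscillations of size \<open>8 * real DIM('v) * sd\<close>, two truncation
  remainders of size 1, and a factor 2 for passing from \<open>dy_scale\<close> to
  \<open>lil_scale\<close>.\<close>

definition mod_const :: real where "mod_const = 2 * (24 * real DIM('v) * sd + 2)"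

lemma sd_sq: "sd\<^sup>2 = expectation (\<lambda>\<omega>. (norm (Y 0 \<omega>))\<^sup>2) + 1" and sd_pos: "0 < sd"
proof -
  have "0 \<le> expectation (\<lambda>\<omega>. (norm (Y 0 \<omega>))\<^sup>2)" by simp
  then have "0 < expectation (\<lambda>\<omega>. (norm (Y 0 \<omega>))\<^sup>2) + 1" by linarith
  then show "sd\<^sup>2 = expectation (\<lambda>\<omega>. (norm (Y 0 \<omega>))\<^sup>2) + 1" "0 < sd" unfolding sd_def by simp_all
qed

lemma mod_const_pos: "0 < mod_const"
  unfolding mod_const_def using sd_pos by (simp add: add_nonneg_pos)

lemma inner_basis_second_moment:
  assumes "b \<in> Basis" "0 \<le> c"
  shows "expectation (\<lambda>\<omega>. (b \<bullet> tvar c i \<omega>)\<^sup>2) \<le> sd\<^sup>2"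
proof -
  have "expectation (\<lambda>\<omega>. (b \<bullet> tvar c i \<omega>)\<^sup>2) \<le> expectation (\<lambda>\<omega>. (b \<bullet> Y 0 \<omega>)\<^sup>2)"
    by (rule tvar_second_moment_le) fact
  also have "\<dots> \<le> expectation (\<lambda>\<omega>. (norm (Y 0 \<omega>))\<^sup>2)"
  proof (rule integral_mono[OF integrable_inner_sq sqY])
    fix \<omega>
    have "\<bar>b \<bullet> Y 0 \<omega>\<bar> \<le> norm (Y 0 \<omega>)" using Basis_le_norm[OF assms(1), of "Y 0 \<omega>"] by (simp add: inner_commute)
    then show "(b \<bullet> Y 0 \<omega>)\<^sup>2 \<le> (norm (Y 0 \<omega>))\<^sup>2" by (intro abs_le_square_iff[THEN iffD1]) simp
  qed
  finally show ?thesis unfolding sd_sq by simp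
qed

text \<open>The constants in \<open>c\<close> and \<open>x\<close> are matched:
  \<open>x * (2 * c)\<close> equals 2 W, the limit allowed by \<open>sum_tail_two_sided\<close>, and
  x^2 / (4 W) equals 2 \<open>dy_log k\<close>, so the tail is of order 1 / (k + 2)^2 and summable
  over dyadic blocks.\<close>

lemma cell_tail:
  assumes N: "1 \<le> N" and b: "b \<in> Basis" and J: "finite J" "real (card J) \<le> 2 * 2 ^ k / real N"
  defines "c \<equiv> sd / (2 * sqrt (real N)) * dy_level k" and "x \<equiv> 4 * sd * dy_scale k / sqrt (real N)"
  shows "prob {\<omega> \<in> space M. x < \<bar>\<Sum>i\<in>J. b \<bullet> tvar c i \<omega>\<bar>} \<le> 2 / (real k + 2)\<^sup>2"
proof -
  have N0: "0 < real N" using N by simp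
  have c0: "0 \<le> c" unfolding c_def using sd_pos dy_level_pos[of k] by simp
  define W where "W = 2 * 2 ^ k / real N * sd\<^sup>2"
  have W: "0 < W" unfolding W_def using N0 sd_pos by simp
  have "prob {\<omega> \<in> space M. x < \<bar>\<Sum>i\<in>J. b \<bullet> tvar c i \<omega>\<bar>} \<le> 2 * exp (- x\<^sup>2 / (4 * W))"
  proof (rule sum_tail_two_sided[OF J(1)])
    show "indep_vars (\<lambda>_. borel) (\<lambda>i \<omega>. b \<bullet> tvar c i \<omega>) J"
      by (rule indep_vars_compose2[OF indep_vars_subset[OF indep_tvar]]) auto
    show "\<bar>b \<bullet> tvar c i \<omega>\<bar> \<le> 2 * c" for i \<omega>
      using abs_inner_tvar_le[OF c0, of b i \<omega>] b by simp
    show "expectation (\<lambda>\<omega>. b \<bullet> tvar c i \<omega>) = 0" for i by (rule expectation_inner_tvar[OF c0])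
    have "(\<Sum>i\<in>J. expectation (\<lambda>\<omega>. (b \<bullet> tvar c i \<omega>)\<^sup>2)) \<le> (\<Sum>i\<in>J. sd\<^sup>2)"
      by (intro sum_mono inner_basis_second_moment b c0)
    also have "\<dots> = real (card J) * sd\<^sup>2" by simp
    also have "\<dots> \<le> W" unfolding W_def by (intro mult_right_mono J) simp
    finally show "(\<Sum>i\<in>J. expectation (\<lambda>\<omega>. (b \<bullet> tvar c i \<omega>)\<^sup>2)) \<le> W" .
    show "0 < W" by fact
    show "0 \<le> x" unfolding x_def using sd_pos dy_scale_pos[of k] by simp
    have "x * (2 * c) = 4 * sd\<^sup>2 * (dy_scale k * dy_level k) / (sqrt (real N) * sqrt (real N))"
      unfolding x_def c_def by (simp add: power2_eq_square)
    also have "\<dots> = 2 * W" unfolding W_def dy_scale_mult_level using N0 by simp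
    finally show "x * (2 * c) \<le> 2 * W" by simp
  qed
  also have "- x\<^sup>2 / (4 * W) = - (2 * dy_log k)"
  proof -
    have "x\<^sup>2 = 16 * sd\<^sup>2 * (dy_scale k)\<^sup>2 / real N" unfolding x_def by (simp add: power_divide power_mult_distrib)
    also have "\<dots> = (2 * dy_log k) * (4 * W)" unfolding dy_scale_sq W_def by simp
    finally show ?thesis using W by (simp add: field_simps)
  qed
  also have "exp (- (2 * dy_log k)) = inverse ((exp (dy_log k))\<^sup>2)"
    by (simp add: exp_minus exp_double)
  also have "exp (dy_log k) = real k + 2" unfolding dy_log_def by simp
  finally show ?thesis by (simp add: divide_inverse)
qed

text \<open>Ottaviani's inequality upgrades the bound at the end of a cell to all times in it; its
  hypothesis holds because 2 / (k + 2)^2 is at most 1/2.\<close>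

lemma cell_max_tail:
  assumes N: "1 \<le> N" and b: "b \<in> Basis" and w: "real w \<le> 2 * 2 ^ k / real N"
  defines "c \<equiv> sd / (2 * sqrt (real N)) * dy_level k" and "x \<equiv> 4 * sd * dy_scale k / sqrt (real N)"
  shows "prob {\<omega> \<in> space M. \<exists>t\<le>w. 2 * x < \<bar>\<Sum>i<t. b \<bullet> tvar c (s + i) \<omega>\<bar>} \<le> 4 / (real k + 2)\<^sup>2"
proof -
  have tail: "prob {\<omega> \<in> space M. x < \<bar>\<Sum>i\<in>J. b \<bullet> tvar c (s + i) \<omega>\<bar>} \<le> 2 / (real k + 2)\<^sup>2"
    if "J \<subseteq> {..<w}" for J
  proof -
    have "finite J" using that finite_subset by blast
    have "card J \<le> card {..<w}" using that by (intro card_mono) auto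
    then have "real (card ((+) s ` J)) \<le> 2 * 2 ^ k / real N" using w by (subst card_image) auto
    from cell_tail[OF N b _ this] \<open>finite J\<close>
    show ?thesis unfolding c_def x_def by (simp add: sum.reindex)
  qed
  have "prob {\<omega> \<in> space M. \<exists>t\<le>w. 2 * x < \<bar>\<Sum>i<t. b \<bullet> tvar c (s + i) \<omega>\<bar>}
      \<le> 2 * prob {\<omega> \<in> space M. x < \<bar>\<Sum>i<w. b \<bullet> tvar c (s + i) \<omega>\<bar>}"
  proof (rule ottaviani)
    show "indep_vars (\<lambda>_. borel) (\<lambda>i \<omega>. b \<bullet> tvar c (s + i) \<omega>) {..<w}"
      by (rule indep_vars_compose2[OF indep_vars_shift[OF indep_tvar]]) auto
    fix t
    have "prob {\<omega> \<in> space M. x < \<bar>\<Sum>i\<in>{t..<w}. b \<bullet> tvar c (s + i) \<omega>\<bar>} \<le> 2 / (real k + 2)\<^sup>2"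
      by (rule tail) auto
    also have "\<dots> \<le> 2 / 2\<^sup>2" by (intro divide_left_mono power_mono) auto
    finally show "prob {\<omega> \<in> space M. x < \<bar>\<Sum>i\<in>{t..<w}. b \<bullet> tvar c (s + i) \<omega>\<bar>} \<le> 1/2" by simp
  qed
  also have "\<dots> \<le> 2 * (2 / (real k + 2)\<^sup>2)" by (intro mult_left_mono tail) auto
  finally show ?thesis by simp
qed

lemma twalk_add: "twalk c (s + t) \<omega> = twalk c s \<omega> + (\<Sum>i<t. tvar c (s + i) \<omega>)"
  by (induction t) (simp_all add: twalk_def algebra_simps)

text \<open>The number of cells and of coordinates does not depend on k, so the union bound stays
  summable. The \<open>+ 1\<close> in \<open>w\<close> makes N cells cover all times up to
  \<open>2 ^ k\<close>.\<close>

lemma cells_AE: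
  assumes N: "1 \<le> N"
  defines "c \<equiv> (\<lambda>k. sd / (2 * sqrt (real N)) * dy_level k)" and "w \<equiv> (\<lambda>k. 2 ^ k div N + 1)"
  shows "AE \<omega> in M. eventually (\<lambda>k. \<forall>j\<le>N. \<forall>t\<le>w k. norm (twalk (c k) (j * w k + t) \<omega> - twalk (c k) (j * w k) \<omega>)
      \<le> 8 * real DIM('v) * sd * dy_scale k / sqrt (real N)) sequentially"
proof -
  define x where "x k = 4 * sd * dy_scale k / sqrt (real N)" for k
  define Q where "Q k \<omega> \<longleftrightarrow> (\<forall>j\<in>{..N}. \<forall>b\<in>Basis. \<not> (\<exists>t\<le>w k. 2 * x k < \<bar>\<Sum>i<t. b \<bullet> tvar (c k) (j * w k + i) \<omega>\<bar>))" for k \<omega>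
  let ?E = "\<lambda>k j b. {\<omega> \<in> space M. \<exists>t\<le>w k. 2 * x k < \<bar>\<Sum>i<t. b \<bullet> tvar (c k) (j * w k + i) \<omega>\<bar>}"
  have mE: "?E k j b \<in> events" for k j b by measurable
  have eq: "{\<omega> \<in> space M. \<not> Q k \<omega>} = (\<Union>j\<in>{..N}. \<Union>b\<in>Basis. ?E k j b)" for k
    unfolding Q_def by blast
  have sm: "summable (\<lambda>k. real (N + 1) * real DIM('v) * (4 / (real k + 2)\<^sup>2))"
  proof (intro summable_mult)
    have "summable (\<lambda>k. inverse ((real k)\<^sup>2))" using inverse_power_summable[of 2, where 'a=real] by simp
    then have "summable (\<lambda>k. inverse ((real (k + 2))\<^sup>2))" by (subst summable_iff_shift)
    then have "summable (\<lambda>k. 4 * inverse ((real (k + 2))\<^sup>2))" by (rule summable_mult)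
    then show "summable (\<lambda>k. 4 / (real k + 2)\<^sup>2)" by (simp add: divide_inverse add.commute)
  qed
  have AE: "AE \<omega> in M. eventually (\<lambda>k. Q k \<omega>) sequentially"
  proof (rule borel_cantelli_AE_eventually[OF _ _ sm])
    fix k
    show "{\<omega> \<in> space M. \<not> Q k \<omega>} \<in> events"
      unfolding eq by (intro sets.finite_UN mE) auto
    assume k: "k \<ge> N"
    have "N \<le> 2 ^ k" using k less_exp[of k] by linarith
    then have Nk: "real N \<le> 2 ^ k" by (metis of_nat_le_iff of_nat_numeral of_nat_power)
    have w: "real (w k) \<le> 2 * 2 ^ k / real N"
    proof -
      have "real (2 ^ k div N) \<le> 2 ^ k / real N" by (metis of_nat_div_le_of_nat of_nat_numeral of_nat_power)
      moreover have "1 \<le> 2 ^ k / real N" using Nk N by simp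
      ultimately show ?thesis unfolding w_def by simp
    qed
    have "prob {\<omega> \<in> space M. \<not> Q k \<omega>} \<le> (\<Sum>j\<in>{..N}. prob (\<Union>b\<in>Basis. ?E k j b))"
      unfolding eq by (intro finite_measure_subadditive_finite) (auto intro!: sets.finite_UN mE)
    also have "\<dots> \<le> (\<Sum>j\<in>{..N}. \<Sum>b\<in>Basis. prob (?E k j b))"
      by (intro sum_mono finite_measure_subadditive_finite) (auto intro!: mE)
    also have "\<dots> \<le> (\<Sum>j\<in>{..N}. \<Sum>b\<in>(Basis::'v set). 4 / (real k + 2)\<^sup>2)"
      unfolding x_def c_def by (intro sum_mono cell_max_tail N w)
    also have "\<dots> = real (N + 1) * real DIM('v) * (4 / (real k + 2)\<^sup>2)" by simp
    finally show "prob {\<omega> \<in> space M. \<not> Q k \<omega>} \<le> real (N + 1) * real DIM('v) * (4 / (real k + 2)\<^sup>2)" .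
  qed
  show ?thesis
  proof (rule AE_mp[OF AE], intro AE_I2 impI)
    fix \<omega> assume "eventually (\<lambda>k. Q k \<omega>) sequentially"
    then show "eventually (\<lambda>k. \<forall>j\<le>N. \<forall>t\<le>w k. norm (twalk (c k) (j * w k + t) \<omega> - twalk (c k) (j * w k) \<omega>)
      \<le> 8 * real DIM('v) * sd * dy_scale k / sqrt (real N)) sequentially"
    proof (eventually_elim, intro allI impI)
      fix k j t assume Q: "Q k \<omega>" and j: "j \<le> N" and t: "t \<le> w k"
      have "norm (twalk (c k) (j * w k + t) \<omega> - twalk (c k) (j * w k) \<omega>) = norm (\<Sum>i<t. tvar (c k) (j * w k + i) \<omega>)"
        unfolding twalk_add by simp
      also have "\<dots> \<le> (\<Sum>b\<in>Basis. \<bar>(\<Sum>i<t. tvar (c k) (j * w k + i) \<omega>) \<bullet> b\<bar>)" by (rule norm_le_l1)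
      also have "\<dots> \<le> (\<Sum>b\<in>(Basis::'v set). 2 * x k)"
      proof (rule sum_mono)
        fix b :: 'v assume "b \<in> Basis"
        then have "\<bar>\<Sum>i<t. b \<bullet> tvar (c k) (j * w k + i) \<omega>\<bar> \<le> 2 * x k"
          using Q j t unfolding Q_def by (meson atMost_iff not_less)
        then show "\<bar>(\<Sum>i<t. tvar (c k) (j * w k + i) \<omega>) \<bullet> b\<bar> \<le> 2 * x k"
          by (simp add: inner_sum_right inner_commute[of _ b])
      qed
      also have "\<dots> = 8 * real DIM('v) * sd * dy_scale k / sqrt (real N)" by (simp add: x_def)
      finally show "norm (twalk (c k) (j * w k + t) \<omega> - twalk (c k) (j * w k) \<omega>) \<le> 8 * real DIM('v) * sd * dy_scale k / sqrt (real N)" .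
    qed
  qed
qed

text \<open>An increment over at most n / N steps is shorter than one cell and meets at most two
  neighbouring cells, so three cell oscillations suffice. The factor 1 / sqrt N lets later choices
  of N absorb everything that happens between grid times; the case N = 1 already bounds the walk by
  a multiple of the scale.\<close>

lemma walk_modulus:
  assumes N: "1 \<le> N"
  shows "AE \<omega> in M. eventually (\<lambda>n. \<forall>l l'. l \<le> l' \<longrightarrow> l' \<le> n \<longrightarrow> N * (l' - l) \<le> n \<longrightarrow>
     norm (walk l' \<omega> - walk l \<omega>) \<le> mod_const * lil_scale n / sqrt (real N)) sequentially"
proof -
  define c where "c k = sd / (2 * sqrt (real N)) * dy_level k" for k
  define w where "w k = (2::nat) ^ k div N + 1" for k
  define y where "y k = 8 * real DIM('v) * sd * dy_scale k / sqrt (real N)" for k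
  have N0: "0 < sqrt (real N)" using N by simp
  have "0 < sd / (2 * sqrt (real N))" using sd_pos N0 by simp
  from truncation_remainder[OF this, of "1 / sqrt (real N)"] N0
  have R: "AE \<omega> in M. eventually (\<lambda>k. \<forall>l\<le>2^k. norm (walk l \<omega> - twalk (c k) l \<omega>) \<le> 1 / sqrt (real N) * dy_scale k) sequentially"
    unfolding c_def by simp
  show ?thesis
    using cells_AE[OF N] R
  proof eventually_elim
    fix \<omega>
    assume "eventually (\<lambda>k. \<forall>j\<le>N. \<forall>t\<le>2 ^ k div N + 1. norm (twalk (sd / (2 * sqrt (real N)) * dy_level k) (j * (2 ^ k div N + 1) + t) \<omega> - twalk (sd / (2 * sqrt (real N)) * dy_level k) (j * (2 ^ k div N + 1)) \<omega>)
      \<le> 8 * real DIM('v) * sd * dy_scale k / sqrt (real N)) sequentially"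
      and "eventually (\<lambda>k. \<forall>l\<le>2^k. norm (walk l \<omega> - twalk (c k) l \<omega>) \<le> 1 / sqrt (real N) * dy_scale k) sequentially"
    then have ev: "eventually (\<lambda>k. (\<forall>j\<le>N. \<forall>t\<le>w k. norm (twalk (c k) (j * w k + t) \<omega> - twalk (c k) (j * w k) \<omega>) \<le> y k) \<and>
      (\<forall>l\<le>2^k. norm (walk l \<omega> - twalk (c k) l \<omega>) \<le> 1 / sqrt (real N) * dy_scale k)) sequentially"
      unfolding c_def[symmetric] w_def[symmetric] y_def[symmetric] by (rule eventually_conj)
    from eventually_dy_index[OF this]
    show "eventually (\<lambda>n. \<forall>l l'. l \<le> l' \<longrightarrow> l' \<le> n \<longrightarrow> N * (l' - l) \<le> n \<longrightarrow>
     norm (walk l' \<omega> - walk l \<omega>) \<le> mod_const * lil_scale n / sqrt (real N)) sequentially"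
    proof (eventually_elim, elim conjE, intro allI impI)
      fix n l l' :: nat
      define k where "k = dy_index n"
      assume "9 \<le> dy_index n" "2 ^ (dy_index n - 1) \<le> n" "n < 2 ^ dy_index n" and l: "l \<le> l'" "l' \<le> n" "N * (l' - l) \<le> n"
        and "\<forall>j\<le>N. \<forall>t\<le>w (dy_index n). norm (twalk (c (dy_index n)) (j * w (dy_index n) + t) \<omega> - twalk (c (dy_index n)) (j * w (dy_index n)) \<omega>) \<le> y (dy_index n)"
        and "\<forall>l\<le>2^dy_index n. norm (walk l \<omega> - twalk (c (dy_index n)) l \<omega>) \<le> 1 / sqrt (real N) * dy_scale (dy_index n)"
      then have k: "9 \<le> k" and n: "2 ^ (k - 1) \<le> n" "n < 2 ^ k"
        and C: "\<forall>j\<le>N. \<forall>t\<le>w k. norm (twalk (c k) (j * w k + t) \<omega> - twalk (c k) (j * w k) \<omega>) \<le> y k"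
        and R: "\<forall>l\<le>2^k. norm (walk l \<omega> - twalk (c k) l \<omega>) \<le> 1 / sqrt (real N) * dy_scale k"
        unfolding k_def by blast+
      have w0: "0 < w k" by (simp add: w_def)
      define j where "j = l div w k"
      define t where "t = l mod w k"
      have lj: "l = j * w k + t" "t < w k" unfolding j_def t_def using w0 by auto
      have "2 ^ k < N * w k" using dividend_less_times_div[of N "2 ^ k"] N by (simp add: w_def algebra_simps)
      then have "j * w k < N * w k" using lj l n by linarith
      then have j: "j < N" by simp
      have "l' - l \<le> 2 ^ k div N"
      proof -
        have "l' - l = N * (l' - l) div N" using N by simp
        also have "\<dots> \<le> 2 ^ k div N" using l n by (intro div_le_mono) linarith
        finally show ?thesis .
      qed
      then have d: "l' - l < w k" by (simp add: w_def)
      have cell: "norm (twalk (c k) (i * w k + s) \<omega> - twalk (c k) (i * w k) \<omega>) \<le> y k" if "i \<le> N" "s \<le> w k" for i s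
        using C that by blast
      have y0: "0 \<le> y k" unfolding y_def using sd_pos dy_scale_pos[of k] by simp
      have tw: "norm (twalk (c k) l' \<omega> - twalk (c k) l \<omega>) \<le> 3 * y k"
      proof (cases "l' \<le> j * w k + w k")
        case True
        then obtain s where s: "l' = j * w k + s" "s \<le> w k" using l lj by (metis add_le_cancel_left le_add1 le_iff_add order_trans)
        have "twalk (c k) l' \<omega> - twalk (c k) l \<omega> = (twalk (c k) l' \<omega> - twalk (c k) (j * w k) \<omega>) - (twalk (c k) l \<omega> - twalk (c k) (j * w k) \<omega>)"
          by simp
        also have "norm \<dots> \<le> y k + y k"
          by (rule norm_triangle_le_diff) (use cell[of j s] cell[of j t] s lj j in \<open>simp add: add_mono\<close>)
        finally show ?thesis using y0 by simp
      next
        case False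
        then obtain s where s: "l' = (j + 1) * w k + s" by (metis add.commute less_imp_le_nat le_iff_add mult_Suc Suc_eq_plus1 not_le)
        have s2: "s \<le> w k" using s d lj l by (simp add: algebra_simps)
        have jw: "(j + 1) * w k = j * w k + w k" by simp
        have "twalk (c k) l' \<omega> - twalk (c k) l \<omega> = (twalk (c k) l' \<omega> - twalk (c k) ((j + 1) * w k) \<omega>)
           + ((twalk (c k) (j * w k + w k) \<omega> - twalk (c k) (j * w k) \<omega>) - (twalk (c k) l \<omega> - twalk (c k) (j * w k) \<omega>))"
          unfolding jw by simp
        also have "norm \<dots> \<le> y k + (y k + y k)"
        proof (intro norm_triangle_mono)
          show "norm (twalk (c k) l' \<omega> - twalk (c k) ((j + 1) * w k) \<omega>) \<le> y k"
            unfolding s by (rule cell) (use j s2 in auto)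
          show "norm ((twalk (c k) (j * w k + w k) \<omega> - twalk (c k) (j * w k) \<omega>) - (twalk (c k) l \<omega> - twalk (c k) (j * w k) \<omega>)) \<le> y k + y k"
            by (rule norm_triangle_le_diff) (use cell[of j "w k"] cell[of j t] lj j in \<open>simp add: add_mono\<close>)
        qed
        finally show ?thesis by simp
      qed
      have "walk l' \<omega> - walk l \<omega> = (twalk (c k) l' \<omega> - twalk (c k) l \<omega>) + ((walk l' \<omega> - twalk (c k) l' \<omega>) - (walk l \<omega> - twalk (c k) l \<omega>))"
        by simp
      also have "norm \<dots> \<le> 3 * y k + (1 / sqrt (real N) * dy_scale k + 1 / sqrt (real N) * dy_scale k)"
      proof (intro norm_triangle_mono tw)
        show "norm ((walk l' \<omega> - twalk (c k) l' \<omega>) - (walk l \<omega> - twalk (c k) l \<omega>)) \<le> 1 / sqrt (real N) * dy_scale k + 1 / sqrt (real N) * dy_scale k"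
          by (rule norm_triangle_le_diff, intro add_mono R[rule_format]) (use l n in auto)
      qed
      also have "\<dots> = (24 * real DIM('v) * sd + 2) / sqrt (real N) * dy_scale k" by (simp add: y_def algebra_simps add_divide_distrib)
      also have "\<dots> \<le> (24 * real DIM('v) * sd + 2) / sqrt (real N) * (2 * lil_scale n)"
        using sd_pos by (intro mult_left_mono dyadic_bounds[OF k n]) auto
      also have "\<dots> = mod_const * lil_scale n / sqrt (real N)" by (simp add: mod_const_def)
      finally show "norm (walk l' \<omega> - walk l \<omega>) \<le> mod_const * lil_scale n / sqrt (real N)" .
    qed
  qed
qed

end

section \<open>The law of the iterated logarithm for weighted blocks\<close>

lemma lil_scale_sq: "3 \<le> n \<Longrightarrow> (lil_scale n)\<^sup>2 = 2 * real n * ln (ln (real n))"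
  unfolding lil_scale_def using lnln_ge_0[of n] by simp

lemma exp_lnln: "3 \<le> n \<Longrightarrow> exp (- (r * ln (ln (real n)))) = ln (real n) powr (- r)"
proof -
  assume n: "3 \<le> n"
  have "0 < ln (real n)" using n by simp
  then show ?thesis by (simp add: powr_def)
qed

lemma filterlim_mult_nat: "1 \<le> (N::nat) \<Longrightarrow> filterlim g at_top sequentially \<Longrightarrow> filterlim (\<lambda>k. N * g k) at_top sequentially"
  by (rule filterlim_at_top_mono[where f = g]) (auto intro!: always_eventually)

locale white_seq = iid_seq +
  assumes white: "\<And>v. expectation (\<lambda>\<omega>. (v \<bullet> Y 0 \<omega>)\<^sup>2) = (norm v)\<^sup>2"
begin

text \<open>A linear functional of the vector of increments over N blocks of q steps. With identity
  covariance its variance over n = N q steps is n times the mean of |th j|^2. The square root of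
  this mean, called \<sigma> below, is the norm dual to the root of the energy, that is of N times
  the sum of |x j|^2.\<close>

definition bsum :: "nat \<Rightarrow> (nat \<Rightarrow> 'b) \<Rightarrow> nat \<Rightarrow> 'a \<Rightarrow> real" where
  "bsum N th q \<omega> = (\<Sum>j<N. th j \<bullet> (walk ((j + 1) * q) \<omega> - walk (j * q) \<omega>))"
definition tbsum :: "real \<Rightarrow> nat \<Rightarrow> (nat \<Rightarrow> 'b) \<Rightarrow> nat \<Rightarrow> 'a \<Rightarrow> real" where
  "tbsum c N th q \<omega> = (\<Sum>j<N. th j \<bullet> (twalk c ((j + 1) * q) \<omega> - twalk c (j * q) \<omega>))"

text \<open>Regrouping exposes a single sum of independent terms, to which the tail bounds
  apply.\<close>

lemma tbsum_eq: "0 < q \<Longrightarrow> tbsum c N th q \<omega> = (\<Sum>i<N * q. th (i div q) \<bullet> tvar c i \<omega>)"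
proof -
  assume q: "0 < q"
  have "tbsum c N th q \<omega> = (\<Sum>j<N. \<Sum>i\<in>{j * q..<j * q + q}. th (i div q) \<bullet> tvar c i \<omega>)"
    unfolding tbsum_def
  proof (rule sum.cong[OF refl])
    fix j
    have "twalk c ((j + 1) * q) \<omega> - twalk c (j * q) \<omega> = (\<Sum>i\<in>{j * q..<j * q + q}. tvar c i \<omega>)"
      unfolding twalk_def lessThan_atLeast0
      by (subst sum_diff_nat_ivl) (auto simp: algebra_simps)
    then have "th j \<bullet> (twalk c ((j + 1) * q) \<omega> - twalk c (j * q) \<omega>) = (\<Sum>i\<in>{j * q..<j * q + q}. th j \<bullet> tvar c i \<omega>)"
      by (simp add: inner_sum_right)
    also have "\<dots> = (\<Sum>i\<in>{j * q..<j * q + q}. th (i div q) \<bullet> tvar c i \<omega>)"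
    proof (rule sum.cong[OF refl])
      fix i assume "i \<in> {j * q..<j * q + q}"
      then have "i div q = j" using q by (intro div_nat_eqI) (auto simp: algebra_simps)
      then show "th j \<bullet> tvar c i \<omega> = th (i div q) \<bullet> tvar c i \<omega>" by simp
    qed
    finally show "th j \<bullet> (twalk c ((j + 1) * q) \<omega> - twalk c (j * q) \<omega>) = (\<Sum>i\<in>{j * q..<j * q + q}. th (i div q) \<bullet> tvar c i \<omega>)" .
  qed
  also have "\<dots> = (\<Sum>i<N * q. th (i div q) \<bullet> tvar c i \<omega>)" by (rule sum.nat_group)
  finally show ?thesis .
qed

lemma sum_div_group: "0 < q \<Longrightarrow> (\<Sum>i<N * q. f (i div q)) = real q * (\<Sum>j<N. f j :: real)"
proof -
  assume q: "0 < q"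
  have "(\<Sum>i<N * q. f (i div q)) = (\<Sum>j<N. \<Sum>i\<in>{j * q..<j * q + q}. f (i div q))"
    by (rule sum.nat_group[symmetric])
  also have "\<dots> = (\<Sum>j<N. \<Sum>i\<in>{j * q..<j * q + q}. f j)"
  proof (intro sum.cong refl)
    fix j i assume "i \<in> {j * q..<j * q + q}"
    then have "i div q = j" using q by (intro div_nat_eqI) (auto simp: algebra_simps)
    then show "f (i div q) = f j" by simp
  qed
  also have "\<dots> = real q * (\<Sum>j<N. f j)" by (simp add: sum_distrib_left)
  finally show ?thesis .
qed

text \<open>Each block increment is a difference of two positions, each with a remainder of 2
  \<delta> times the scale; this gives the factor 4. The bound for single positions is kept because
  \<open>bsum_lower\<close> splits off an initial stretch of the walk.\<close>

lemma bsum_remainder: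
  assumes \<tau>: "0 < \<tau>" and \<delta>: "0 < \<delta>" and N: "1 \<le> N"
  shows "AE \<omega> in M. eventually (\<lambda>n. \<forall>q. n = N * q \<longrightarrow>
     \<bar>bsum N th q \<omega> - tbsum (\<tau> * dy_level (dy_index n)) N th q \<omega>\<bar> \<le> 4 * (\<Sum>j<N. norm (th j)) * \<delta> * lil_scale n \<and>
     (\<forall>l\<le>n. norm (walk l \<omega> - twalk (\<tau> * dy_level (dy_index n)) l \<omega>) \<le> 2 * \<delta> * lil_scale n)) sequentially"
  using truncation_remainder[OF \<tau> \<delta>]
proof eventually_elim
  fix \<omega>
  assume "eventually (\<lambda>k. \<forall>l\<le>2^k. norm (walk l \<omega> - twalk (\<tau> * dy_level k) l \<omega>) \<le> \<delta> * dy_scale k) sequentially"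
  from eventually_dy_index[OF this]
  show "eventually (\<lambda>n. \<forall>q. n = N * q \<longrightarrow>
     \<bar>bsum N th q \<omega> - tbsum (\<tau> * dy_level (dy_index n)) N th q \<omega>\<bar> \<le> 4 * (\<Sum>j<N. norm (th j)) * \<delta> * lil_scale n \<and>
     (\<forall>l\<le>n. norm (walk l \<omega> - twalk (\<tau> * dy_level (dy_index n)) l \<omega>) \<le> 2 * \<delta> * lil_scale n)) sequentially"
  proof (eventually_elim, elim conjE, intro allI impI)
    fix n q
    define k where "k = dy_index n"
    let ?c = "\<tau> * dy_level k"
    assume "\<forall>l\<le>2 ^ dy_index n. norm (walk l \<omega> - twalk (\<tau> * dy_level (dy_index n)) l \<omega>) \<le> \<delta> * dy_scale (dy_index n)"
      and "9 \<le> dy_index n" "2 ^ (dy_index n - 1) \<le> n" "n < 2 ^ dy_index n" and n: "n = N * q"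
    then have R: "\<forall>l\<le>2 ^ k. norm (walk l \<omega> - twalk ?c l \<omega>) \<le> \<delta> * dy_scale k" and k: "9 \<le> k" "2 ^ (k - 1) \<le> n" "n < 2 ^ k"
      unfolding k_def by blast+
    have w: "norm (walk l \<omega> - twalk ?c l \<omega>) \<le> 2 * \<delta> * lil_scale n" if "l \<le> n" for l
    proof -
      have "norm (walk l \<omega> - twalk ?c l \<omega>) \<le> \<delta> * dy_scale k" using that k(3) by (intro R[rule_format]) auto
      also have "\<dots> \<le> \<delta> * (2 * lil_scale n)" using \<delta> by (intro mult_left_mono dyadic_bounds[OF k]) auto
      finally show ?thesis by simp
    qed
    have "\<bar>bsum N th q \<omega> - tbsum ?c N th q \<omega>\<bar>
      = \<bar>\<Sum>j<N. th j \<bullet> ((walk ((j + 1) * q) \<omega> - twalk ?c ((j + 1) * q) \<omega>) - (walk (j * q) \<omega> - twalk ?c (j * q) \<omega>))\<bar>"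
      unfolding bsum_def tbsum_def sum_subtractf[symmetric] by (simp add: inner_diff_right algebra_simps)
    also have "\<dots> \<le> (\<Sum>j<N. norm (th j) * (2 * \<delta> * lil_scale n + 2 * \<delta> * lil_scale n))"
    proof (rule order_trans[OF sum_abs sum_mono])
      fix j assume j: "j \<in> {..<N}"
      have "(j + 1) * q \<le> n" unfolding n by (rule mult_le_mono1) (use j in auto)
      moreover have "j * q \<le> n" unfolding n by (rule mult_le_mono1) (use j in auto)
      ultimately have "norm ((walk ((j + 1) * q) \<omega> - twalk ?c ((j + 1) * q) \<omega>) - (walk (j * q) \<omega> - twalk ?c (j * q) \<omega>)) \<le> 2 * \<delta> * lil_scale n + 2 * \<delta> * lil_scale n"
        by (intro norm_triangle_le_diff add_mono w)
      then show "\<bar>th j \<bullet> ((walk ((j + 1) * q) \<omega> - twalk ?c ((j + 1) * q) \<omega>) - (walk (j * q) \<omega> - twalk ?c (j * q) \<omega>))\<bar> \<le> norm (th j) * (2 * \<delta> * lil_scale n + 2 * \<delta> * lil_scale n)"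
        by (intro order_trans[OF Cauchy_Schwarz_ineq2] mult_left_mono) auto
    qed
    also have "\<dots> = 4 * (\<Sum>j<N. norm (th j)) * \<delta> * lil_scale n" by (simp add: sum_distrib_right[symmetric])
    finally show "\<bar>bsum N th q \<omega> - tbsum (\<tau> * dy_level (dy_index n)) N th q \<omega>\<bar> \<le> 4 * (\<Sum>j<N. norm (th j)) * \<delta> * lil_scale n \<and>
     (\<forall>l\<le>n. norm (walk l \<omega> - twalk (\<tau> * dy_level (dy_index n)) l \<omega>) \<le> 2 * \<delta> * lil_scale n)"
      unfolding k_def[symmetric] using w by blast
  qed
qed

lemma tbsum_tail_upper:
  fixes th :: "nat \<Rightarrow> 'b"
  assumes N: "1 \<le> N" and q: "0 < q" and n: "n = N * q"
    and k: "9 \<le> k" "2 ^ (k - 1) \<le> n" "n < 2 ^ k"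
    and sig: "(\<Sum>j<N. (norm (th j))\<^sup>2) / real N \<le> \<sigma>\<^sup>2" "0 < \<sigma>"
    and \<Theta>: "\<And>j. j < N \<Longrightarrow> norm (th j) \<le> \<Theta>" "0 < \<Theta>"
    and \<eta>: "0 < \<eta>" "\<eta> \<le> 1" and r: "1 + \<eta> \<le> r" and \<tau>: "0 < \<tau>" "8 * \<Theta> * \<tau> \<le> \<eta> * \<sigma>"
  shows "prob {\<omega> \<in> space M. r * \<sigma> * lil_scale n \<le> tbsum (\<tau> * dy_level k) N th q \<omega>} \<le> exp (- (r * ln (ln (real n))))"
proof -
  let ?c = "\<tau> * dy_level k"
  have c0: "0 \<le> ?c" using \<tau> dy_level_pos[of k] by simp
  have n9: "2 ^ 8 \<le> n"
  proof -
    have "(2::nat) ^ 8 \<le> 2 ^ (k - 1)" using k(1) by (intro power_increasing) auto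
    then show ?thesis using k(2) by linarith
  qed
  then have n3: "3 \<le> n" by simp
  have rn: "0 < real n" using n3 by simp
  have LL: "0 < ln (ln (real n))" using lnln_ge_0[OF n3] .
  \<comment> \<open>The optimal parameter for the threshold \<open>\<sigma> * lil_scale n\<close>
    and variance \<sigma>^2 n. The two terms of the exponent become 2 r ln ln n and (1 + \<eta>) ln
    ln n, so \<open>1 + \<eta> \<le> r\<close> leaves at least r ln ln n.\<close>
  define s where "s = lil_scale n / (\<sigma> * real n)"
  have s0: "0 \<le> s" unfolding s_def using lil_scale_pos[OF n3] sig rn by simp
  have kn: "2 ^ k \<le> 2 * real n"
  proof -
    have "(2::real) ^ (k - 1) \<le> real n" using k(2) by (metis of_nat_le_iff of_nat_numeral of_nat_power)
    then show ?thesis using k(1) by (cases k) auto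
  qed
  have "s * (\<Theta> * (2 * ?c)) = lil_scale n * (2 * \<Theta> * \<tau> * dy_level k) / (\<sigma> * real n)" by (simp add: s_def)
  also have "\<dots> \<le> (2 * dy_scale k) * (2 * \<Theta> * \<tau> * dy_level k) / (\<sigma> * real n)"
    using dyadic_bounds(4)[OF k] sig rn \<Theta> \<tau> dy_level_pos[of k] by (intro divide_right_mono mult_right_mono) auto
  also have "\<dots> = 4 * \<Theta> * \<tau> * 2 ^ k / (\<sigma> * real n)" unfolding dy_scale_mult_level[symmetric] by simp
  also have "\<dots> \<le> 4 * \<Theta> * \<tau> * (2 * real n) / (\<sigma> * real n)"
    using kn sig rn \<Theta> \<tau> by (intro divide_right_mono mult_left_mono) auto
  also have "\<dots> = 8 * \<Theta> * \<tau> / \<sigma>" using rn by simp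
  also have "\<dots> \<le> \<eta>" using \<tau> sig by (simp add: field_simps)
  finally have sb: "s * (\<Theta> * (2 * ?c)) \<le> \<eta>" .
  have "prob {\<omega> \<in> space M. r * \<sigma> * lil_scale n \<le> (\<Sum>i<N * q. th (i div q) \<bullet> tvar ?c i \<omega>)}
     \<le> exp (- s * (r * \<sigma> * lil_scale n) + (1 + \<eta>) * s\<^sup>2 * (real n * \<sigma>\<^sup>2) / 2)"
  proof (rule sum_tail_upper[OF _ _ _ _ _ s0 sb])
    show "indep_vars (\<lambda>_. borel) (\<lambda>i \<omega>. th (i div q) \<bullet> tvar ?c i \<omega>) {..<N * q}"
      by (rule indep_vars_compose2[OF indep_vars_subset[OF indep_tvar]]) auto
    show "\<bar>th (i div q) \<bullet> tvar ?c i \<omega>\<bar> \<le> \<Theta> * (2 * ?c)" if "i \<in> {..<N * q}" for i \<omega>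
    proof -
      have "i div q < N" using that q by (auto simp: div_less_iff_less_mult)
      then show ?thesis using abs_inner_tvar_le[OF c0, of "th (i div q)" i \<omega>] \<Theta>(1)[of "i div q"] c0
        by (meson mult_right_mono order_trans mult_nonneg_nonneg zero_le_numeral)
    qed
    show "expectation (\<lambda>\<omega>. th (i div q) \<bullet> tvar ?c i \<omega>) = 0" for i by (rule expectation_inner_tvar[OF c0])
    have "(\<Sum>i<N * q. expectation (\<lambda>\<omega>. (th (i div q) \<bullet> tvar ?c i \<omega>)\<^sup>2)) \<le> (\<Sum>i<N * q. (norm (th (i div q)))\<^sup>2)"
      by (intro sum_mono order_trans[OF tvar_second_moment_le[OF c0]]) (simp add: white)
    also have "\<dots> = real q * (\<Sum>j<N. (norm (th j))\<^sup>2)" by (rule sum_div_group[OF q])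
    also have "\<dots> \<le> real q * (real N * \<sigma>\<^sup>2)" using sig N by (intro mult_left_mono) (auto simp: field_simps)
    finally show "(\<Sum>i<N * q. expectation (\<lambda>\<omega>. (th (i div q) \<bullet> tvar ?c i \<omega>)\<^sup>2)) \<le> real n * \<sigma>\<^sup>2"
      unfolding n by (simp add: mult_ac)
  qed (use \<eta> in auto)
  also have "- s * (r * \<sigma> * lil_scale n) + (1 + \<eta>) * s\<^sup>2 * (real n * \<sigma>\<^sup>2) / 2 = (- 2 * r + (1 + \<eta>)) * ln (ln (real n))"
  proof -
    have "s * (r * \<sigma> * lil_scale n) = r * (lil_scale n)\<^sup>2 / real n" unfolding s_def using sig by (simp add: power2_eq_square)
    moreover have "s\<^sup>2 * (real n * \<sigma>\<^sup>2) = (lil_scale n)\<^sup>2 / real n" unfolding s_def using sig rn by (simp add: power2_eq_square)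
    moreover have "r * (lil_scale n)\<^sup>2 / real n = 2 * r * ln (ln (real n))" "(lil_scale n)\<^sup>2 / real n = 2 * ln (ln (real n))"
      unfolding lil_scale_sq[OF n3] using rn by simp_all
    ultimately have a: "s * (r * \<sigma> * lil_scale n) = 2 * r * ln (ln (real n))" and b: "s\<^sup>2 * (real n * \<sigma>\<^sup>2) = 2 * ln (ln (real n))"
      by metis+
    have "- s * (r * \<sigma> * lil_scale n) + (1 + \<eta>) * s\<^sup>2 * (real n * \<sigma>\<^sup>2) / 2 = - (s * (r * \<sigma> * lil_scale n)) + (1 + \<eta>) * (s\<^sup>2 * (real n * \<sigma>\<^sup>2)) / 2"
      by (simp only: mult_minus_left mult.assoc)
    also have "\<dots> = - (2 * r * ln (ln (real n))) + (1 + \<eta>) * (2 * ln (ln (real n))) / 2" by (simp only: a b)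
    also have "\<dots> = (- 2 * r + (1 + \<eta>)) * ln (ln (real n))" by (simp add: algebra_simps)
    finally show ?thesis .
  qed
  also have "exp \<dots> \<le> exp (- (r * ln (ln (real n))))"
  proof -
    have "(- 2 * r + (1 + \<eta>)) * ln (ln (real n)) \<le> (- r) * ln (ln (real n))" using r LL by (intro mult_right_mono) auto
    then show ?thesis by simp
  qed
  finally show ?thesis unfolding tbsum_eq[OF q] .
qed

lemma floor_power_facts:
  assumes \<rho>: "1 < (\<rho>::real)"
  shows "1 \<le> nat \<lfloor>\<rho> ^ k\<rfloor>" "real (nat \<lfloor>\<rho> ^ k\<rfloor>) \<le> \<rho> ^ k" "\<rho> ^ k / 2 \<le> real (nat \<lfloor>\<rho> ^ k\<rfloor>)" "\<rho> ^ k < real (nat \<lfloor>\<rho> ^ k\<rfloor>) + 1"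
proof -
  have 1: "1 \<le> \<rho> ^ k" using \<rho> by (intro one_le_power) auto
  then have f1: "1 \<le> \<lfloor>\<rho> ^ k\<rfloor>" by simp
  then show a: "1 \<le> nat \<lfloor>\<rho> ^ k\<rfloor>" by linarith
  have e: "real (nat \<lfloor>\<rho> ^ k\<rfloor>) = of_int \<lfloor>\<rho> ^ k\<rfloor>" using f1 by simp
  show "real (nat \<lfloor>\<rho> ^ k\<rfloor>) \<le> \<rho> ^ k" unfolding e by simp
  show b: "\<rho> ^ k < real (nat \<lfloor>\<rho> ^ k\<rfloor>) + 1" unfolding e by linarith
  show "\<rho> ^ k / 2 \<le> real (nat \<lfloor>\<rho> ^ k\<rfloor>)" using a b by linarith
qed

lemma filterlim_floor_power:
  assumes \<rho>: "1 < (\<rho>::real)"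
  shows "filterlim (\<lambda>k. nat \<lfloor>\<rho> ^ k\<rfloor>) at_top sequentially"
  unfolding filterlim_at_top
proof
  fix Z :: nat
  obtain n where n: "real Z < \<rho> ^ n" using real_arch_pow[OF \<rho>] by blast
  show "eventually (\<lambda>k. Z \<le> nat \<lfloor>\<rho> ^ k\<rfloor>) sequentially"
  proof (rule eventually_sequentiallyI[of n])
    fix k assume "n \<le> k"
    then have "\<rho> ^ n \<le> \<rho> ^ k" using \<rho> by (intro power_increasing) auto
    then have "real Z \<le> \<rho> ^ k" using n by linarith
    then show "Z \<le> nat \<lfloor>\<rho> ^ k\<rfloor>" by (simp add: le_nat_floor)
  qed
qed

text \<open>Along block lengths growing like \<rho>^k, ln n grows at least linearly in k, so the
  tail (ln n)^(-r) is summable once r > 1.\<close>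

lemma bsum_upper_geometric:
  fixes th :: "nat \<Rightarrow> 'b"
  assumes N: "1 \<le> N" and \<rho>: "1 < (\<rho>::real)" and \<epsilon>: "0 < \<epsilon>"
  defines "\<sigma> \<equiv> sqrt ((\<Sum>j<N. (norm (th j))\<^sup>2) / real N)"
  shows "AE \<omega> in M. eventually (\<lambda>k. bsum N th (nat \<lfloor>\<rho> ^ k\<rfloor>) \<omega> \<le> (\<sigma> + \<epsilon>) * lil_scale (N * nat \<lfloor>\<rho> ^ k\<rfloor>)) sequentially"
proof -
  define q where "q k = nat \<lfloor>\<rho> ^ k\<rfloor>" for k
  define n where "n k = N * q k" for k
  define \<Theta> where "\<Theta> = (\<Sum>j<N. norm (th j)) + 1"
  have \<Theta>1: "norm (th j) \<le> \<Theta>" if "j < N" for j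
    unfolding \<Theta>_def using that member_le_sum[of j "{..<N}" "\<lambda>j. norm (th j)"] by auto
  have \<Theta>0: "0 < \<Theta>" unfolding \<Theta>_def using sum_nonneg[of "{..<N}" "\<lambda>j. norm (th j)"] by simp
  \<comment> \<open>The shift by \<epsilon> / 4 keeps the variance parameter positive when all
    weights vanish; the gap between \<epsilon> / 4 and \<epsilon> / 2 produces an exponent r > 1,
    and the last \<epsilon> / 2 is left for the truncation remainder.\<close>
  define \<sigma>' where "\<sigma>' = \<sigma> + \<epsilon> / 4"
  have \<sigma>0: "0 \<le> \<sigma>" unfolding \<sigma>_def by (simp add: sum_nonneg)
  have \<sigma>': "0 < \<sigma>'" "(\<Sum>j<N. (norm (th j))\<^sup>2) / real N \<le> \<sigma>'\<^sup>2"
  proof -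
    show "0 < \<sigma>'" unfolding \<sigma>'_def using \<sigma>0 \<epsilon> by simp
    have "(\<Sum>j<N. (norm (th j))\<^sup>2) / real N = \<sigma>\<^sup>2" unfolding \<sigma>_def by (simp add: sum_nonneg)
    also have "\<dots> \<le> \<sigma>'\<^sup>2" using \<sigma>0 \<epsilon> unfolding \<sigma>'_def by (intro power_mono) auto
    finally show "(\<Sum>j<N. (norm (th j))\<^sup>2) / real N \<le> \<sigma>'\<^sup>2" .
  qed
  define \<eta> where "\<eta> = min 1 (\<epsilon> / (4 * \<sigma>'))"
  define r where "r = (\<sigma> + \<epsilon> / 2) / \<sigma>'"
  have \<eta>: "0 < \<eta>" "\<eta> \<le> 1" unfolding \<eta>_def using \<epsilon> \<sigma>' by auto
  have r: "1 + \<eta> \<le> r"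
  proof -
    have "1 + \<eta> \<le> 1 + \<epsilon> / (4 * \<sigma>')" unfolding \<eta>_def by simp
    also have "\<dots> = r" unfolding r_def \<sigma>'_def using \<sigma>'(1)[unfolded \<sigma>'_def] by (simp add: field_simps)
    finally show ?thesis .
  qed
  have r1: "1 < r" using r \<eta> by simp
  define \<tau> where "\<tau> = \<eta> * \<sigma>' / (8 * \<Theta>)"
  have \<tau>: "0 < \<tau>" "8 * \<Theta> * \<tau> \<le> \<eta> * \<sigma>'" unfolding \<tau>_def using \<eta> \<sigma>' \<Theta>0 by auto
  have nlim: "filterlim n at_top sequentially"
    unfolding n_def q_def by (intro filterlim_mult_nat N filterlim_floor_power \<rho>)
  have ev: "eventually (\<lambda>k. 9 \<le> dy_index (n k) \<and> 2 ^ (dy_index (n k) - 1) \<le> n k \<and> n k < 2 ^ dy_index (n k)) sequentially"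
    using nlim eventually_dy_index[of "\<lambda>_. True"] by (auto simp: filterlim_iff)
  have lnn: "eventually (\<lambda>k. real k * ln \<rho> / 2 \<le> ln (real (n k))) sequentially"
  proof -
    have "filterlim (\<lambda>k. real k * (ln \<rho> / 2)) at_top sequentially"
      using \<rho> by (intro filterlim_at_top_mult_tendsto_pos[OF tendsto_const] filterlim_real_sequentially) auto
    then have "eventually (\<lambda>k. ln 2 \<le> real k * (ln \<rho> / 2)) sequentially" by (simp add: filterlim_at_top)
    then show ?thesis
    proof eventually_elim
      fix k assume k: "ln 2 \<le> real k * (ln \<rho> / 2)"
      have pk: "0 < \<rho> ^ k" using \<rho> by simp
      have "\<rho> ^ k / 2 \<le> real (q k)" unfolding q_def by (rule floor_power_facts[OF \<rho>])
      also have "\<dots> \<le> real (n k)" unfolding n_def of_nat_le_iff using N by simp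
      finally have "ln (\<rho> ^ k / 2) \<le> ln (real (n k))" using pk by (subst ln_le_cancel_iff) auto
      then show "real k * ln \<rho> / 2 \<le> ln (real (n k))" using k \<rho> pk by (simp add: ln_div ln_realpow)
    qed
  qed
  obtain k0 where k0: "\<And>k. k \<ge> k0 \<Longrightarrow> 9 \<le> dy_index (n k) \<and> 2 ^ (dy_index (n k) - 1) \<le> n k \<and> n k < 2 ^ dy_index (n k)"
    "\<And>k. k \<ge> k0 \<Longrightarrow> real k * ln \<rho> / 2 \<le> ln (real (n k))" "\<And>k. k \<ge> k0 \<Longrightarrow> 3 \<le> n k" "k0 \<ge> 1"
  proof -
    have "eventually (\<lambda>k. 3 \<le> n k) sequentially" using nlim by (simp add: filterlim_at_top)
    then have "eventually (\<lambda>k. (9 \<le> dy_index (n k) \<and> 2 ^ (dy_index (n k) - 1) \<le> n k \<and> n k < 2 ^ dy_index (n k)) \<and> real k * ln \<rho> / 2 \<le> ln (real (n k)) \<and> 3 \<le> n k \<and> 1 \<le> k) sequentially"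
      using ev lnn eventually_ge_at_top[of 1] by eventually_elim blast
    then obtain k0 where k: "\<forall>k\<ge>k0. (9 \<le> dy_index (n k) \<and> 2 ^ (dy_index (n k) - 1) \<le> n k \<and> n k < 2 ^ dy_index (n k)) \<and> real k * ln \<rho> / 2 \<le> ln (real (n k)) \<and> 3 \<le> n k \<and> 1 \<le> k"
      unfolding eventually_sequentially by blast
    show thesis by (rule that[of k0]) (use k in blast)+
  qed
  have sm: "summable (\<lambda>k. (ln \<rho> / 2) powr (- r) * real k powr (- r))"
    using r1 by (intro summable_mult) (simp add: summable_real_powr_iff)
  have B: "AE \<omega> in M. eventually (\<lambda>k. tbsum (\<tau> * dy_level (dy_index (n k))) N th (q k) \<omega> \<le> (\<sigma> + \<epsilon> / 2) * lil_scale (n k)) sequentially"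
  proof (rule borel_cantelli_AE_eventually[OF _ _ sm])
    fix k
    have [measurable]: "tbsum c N th j \<in> borel_measurable M" for c j unfolding tbsum_def by measurable
    show "{\<omega> \<in> space M. \<not> tbsum (\<tau> * dy_level (dy_index (n k))) N th (q k) \<omega> \<le> (\<sigma> + \<epsilon> / 2) * lil_scale (n k)} \<in> events"
      by measurable
    assume k: "k \<ge> k0"
    have rs: "(\<sigma> + \<epsilon> / 2) = r * \<sigma>'" unfolding r_def using \<sigma>' by simp
    have q0: "0 < q k" unfolding q_def using floor_power_facts(1)[OF \<rho>, of k] by linarith
    have "prob {\<omega> \<in> space M. \<not> tbsum (\<tau> * dy_level (dy_index (n k))) N th (q k) \<omega> \<le> (\<sigma> + \<epsilon> / 2) * lil_scale (n k)}
       \<le> prob {\<omega> \<in> space M. r * \<sigma>' * lil_scale (n k) \<le> tbsum (\<tau> * dy_level (dy_index (n k))) N th (q k) \<omega>}"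
      unfolding rs by (intro finite_measure_mono) auto
    also have "\<dots> \<le> exp (- (r * ln (ln (real (n k)))))"
      using k0(1)[OF k] by (intro tbsum_tail_upper[OF N q0 _ _ _ _ \<sigma>'(2,1) \<Theta>1 \<Theta>0 \<eta> r \<tau>]) (auto simp: n_def)
    also have "\<dots> = ln (real (n k)) powr (- r)" using k0(3)[OF k] by (rule exp_lnln)
    also have "\<dots> \<le> (real k * ln \<rho> / 2) powr (- r)"
      using k0(2)[OF k] k0(4) k \<rho> r1 by (intro powr_mono2') auto
    also have "\<dots> = (ln \<rho> / 2) powr (- r) * real k powr (- r)"
      using \<rho> by (subst powr_mult[symmetric]) (auto simp: mult_ac)
    finally show "prob {\<omega> \<in> space M. \<not> tbsum (\<tau> * dy_level (dy_index (n k))) N th (q k) \<omega> \<le> (\<sigma> + \<epsilon> / 2) * lil_scale (n k)} \<le> (ln \<rho> / 2) powr (- r) * real k powr (- r)" .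
  qed
  have d0: "0 < \<epsilon> / (8 * \<Theta>)" using \<epsilon> \<Theta>0 by simp
  show ?thesis
    using B bsum_remainder[OF \<tau>(1) d0 N, of th]
  proof eventually_elim
    fix \<omega>
    assume b: "eventually (\<lambda>k. tbsum (\<tau> * dy_level (dy_index (n k))) N th (q k) \<omega> \<le> (\<sigma> + \<epsilon> / 2) * lil_scale (n k)) sequentially"
      and "eventually (\<lambda>n. \<forall>q. n = N * q \<longrightarrow>
     \<bar>bsum N th q \<omega> - tbsum (\<tau> * dy_level (dy_index n)) N th q \<omega>\<bar> \<le> 4 * (\<Sum>j<N. norm (th j)) * (\<epsilon> / (8 * \<Theta>)) * lil_scale n \<and>
     (\<forall>l\<le>n. norm (walk l \<omega> - twalk (\<tau> * dy_level (dy_index n)) l \<omega>) \<le> 2 * (\<epsilon> / (8 * \<Theta>)) * lil_scale n)) sequentially"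
    then have "eventually (\<lambda>k. \<forall>q. n k = N * q \<longrightarrow>
     \<bar>bsum N th q \<omega> - tbsum (\<tau> * dy_level (dy_index (n k))) N th q \<omega>\<bar> \<le> 4 * (\<Sum>j<N. norm (th j)) * (\<epsilon> / (8 * \<Theta>)) * lil_scale (n k) \<and>
     (\<forall>l\<le>n k. norm (walk l \<omega> - twalk (\<tau> * dy_level (dy_index (n k))) l \<omega>) \<le> 2 * (\<epsilon> / (8 * \<Theta>)) * lil_scale (n k))) sequentially"
      using nlim unfolding filterlim_iff by blast
    then show "eventually (\<lambda>k. bsum N th (nat \<lfloor>\<rho> ^ k\<rfloor>) \<omega> \<le> (\<sigma> + \<epsilon>) * lil_scale (N * nat \<lfloor>\<rho> ^ k\<rfloor>)) sequentially"
      using b eventually_ge_at_top[of k0]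
    proof eventually_elim
      fix k
      assume "\<forall>q. n k = N * q \<longrightarrow>
     \<bar>bsum N th q \<omega> - tbsum (\<tau> * dy_level (dy_index (n k))) N th q \<omega>\<bar> \<le> 4 * (\<Sum>j<N. norm (th j)) * (\<epsilon> / (8 * \<Theta>)) * lil_scale (n k) \<and>
     (\<forall>l\<le>n k. norm (walk l \<omega> - twalk (\<tau> * dy_level (dy_index (n k))) l \<omega>) \<le> 2 * (\<epsilon> / (8 * \<Theta>)) * lil_scale (n k))"
      then have 1: "\<bar>bsum N th (q k) \<omega> - tbsum (\<tau> * dy_level (dy_index (n k))) N th (q k) \<omega>\<bar> \<le> 4 * (\<Sum>j<N. norm (th j)) * (\<epsilon> / (8 * \<Theta>)) * lil_scale (n k)"
        unfolding n_def by blast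
      assume 2: "tbsum (\<tau> * dy_level (dy_index (n k))) N th (q k) \<omega> \<le> (\<sigma> + \<epsilon> / 2) * lil_scale (n k)" and k: "k0 \<le> k"
      have lp: "0 < lil_scale (n k)" using lil_scale_pos k0(3)[OF k] by simp
      have "4 * (\<Sum>j<N. norm (th j)) * (\<epsilon> / (8 * \<Theta>)) \<le> 4 * \<Theta> * (\<epsilon> / (8 * \<Theta>))"
        using d0 unfolding \<Theta>_def by (intro mult_right_mono) auto
      also have "\<dots> = \<epsilon> / 2" using \<Theta>0 by simp
      finally have "4 * (\<Sum>j<N. norm (th j)) * (\<epsilon> / (8 * \<Theta>)) * lil_scale (n k) \<le> \<epsilon> / 2 * lil_scale (n k)"
        using lp by (intro mult_right_mono) auto
      then have "bsum N th (q k) \<omega> \<le> (\<sigma> + \<epsilon> / 2) * lil_scale (n k) + \<epsilon> / 2 * lil_scale (n k)" using 1 2 by linarith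
      then have "bsum N th (q k) \<omega> \<le> (\<sigma> + \<epsilon>) * lil_scale (n k)" by (simp add: algebra_simps)
      then show "bsum N th (nat \<lfloor>\<rho> ^ k\<rfloor>) \<omega> \<le> (\<sigma> + \<epsilon>) * lil_scale (N * nat \<lfloor>\<rho> ^ k\<rfloor>)" unfolding n_def q_def .
    qed
  qed
qed

text \<open>The modulus of continuity fills the gaps between the geometric block lengths.\<close>

lemma bsum_upper:
  fixes th :: "nat \<Rightarrow> 'b"
  assumes N: "1 \<le> N" and \<epsilon>: "0 < \<epsilon>"
  defines "\<sigma> \<equiv> sqrt ((\<Sum>j<N. (norm (th j))\<^sup>2) / real N)"
  shows "AE \<omega> in M. eventually (\<lambda>q. bsum N th q \<omega> \<le> (\<sigma> + \<epsilon>) * lil_scale (N * q)) sequentially"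
proof -
  define \<Theta> where "\<Theta> = (\<Sum>j<N. norm (th j)) + 1"
  have \<Theta>0: "0 < \<Theta>" unfolding \<Theta>_def using sum_nonneg[of "{..<N}" "\<lambda>j. norm (th j)"] by simp
  have \<sigma>0: "0 \<le> \<sigma>" unfolding \<sigma>_def by (simp add: sum_nonneg)
  obtain K :: nat where K: "4 * \<Theta> * mod_const / \<epsilon> < real K" using reals_Archimedean2 by blast
  define M' where "M' = (K + 1)\<^sup>2"
  have M1: "1 \<le> M'" unfolding M'_def by simp
  have sM: "sqrt (real M') = real K + 1" unfolding M'_def by simp
  have small: "2 * \<Theta> * (mod_const / sqrt (real M')) \<le> \<epsilon> / 2"
  proof -
    have "4 * \<Theta> * mod_const \<le> \<epsilon> * (real K + 1)" using K \<epsilon> by (simp add: field_simps)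
    then show ?thesis unfolding sM by (simp add: field_simps)
  qed
  \<comment> \<open>This ratio keeps a block length q within q / M' of the preceding geometric one:
    half of the distance comes from \<rho> - 1, the other half covers rounding down once q is at
    least 2 M'.\<close>
  define \<rho> where "\<rho> = 1 + 1 / (2 * real M')"
  have \<rho>: "1 < \<rho>" unfolding \<rho>_def using M1 by simp
  define Q where "Q k = nat \<lfloor>\<rho> ^ k\<rfloor>" for k
  have e2: "0 < \<epsilon> / 2" using \<epsilon> by simp
  show ?thesis
    using bsum_upper_geometric[OF N \<rho> e2, of th] walk_modulus[OF M1]
  proof eventually_elim
    fix \<omega>
    assume 1: "eventually (\<lambda>k. bsum N th (nat \<lfloor>\<rho> ^ k\<rfloor>) \<omega> \<le> (sqrt ((\<Sum>j<N. (norm (th j))\<^sup>2) / real N) + \<epsilon> / 2) * lil_scale (N * nat \<lfloor>\<rho> ^ k\<rfloor>)) sequentially"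
      and 2: "eventually (\<lambda>n. \<forall>l l'. l \<le> l' \<longrightarrow> l' \<le> n \<longrightarrow> M' * (l' - l) \<le> n \<longrightarrow>
     norm (walk l' \<omega> - walk l \<omega>) \<le> mod_const * lil_scale n / sqrt (real M')) sequentially"
    obtain k0 where k0: "\<And>k. k \<ge> k0 \<Longrightarrow> bsum N th (Q k) \<omega> \<le> (\<sigma> + \<epsilon> / 2) * lil_scale (N * Q k)"
      using 1 unfolding eventually_sequentially \<sigma>_def Q_def by blast
    obtain k1 where k1: "\<And>k. k \<ge> k1 \<Longrightarrow> 3 \<le> Q k"
      using filterlim_floor_power[OF \<rho>] unfolding filterlim_at_top eventually_sequentially Q_def by blast
    obtain n0 where n0: "\<And>n l l'. n \<ge> n0 \<Longrightarrow> l \<le> l' \<Longrightarrow> l' \<le> n \<Longrightarrow> M' * (l' - l) \<le> n \<Longrightarrow>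
     norm (walk l' \<omega> - walk l \<omega>) \<le> mod_const * lil_scale n / sqrt (real M')"
      using 2 unfolding eventually_sequentially by blast
    show "eventually (\<lambda>q. bsum N th q \<omega> \<le> (\<sigma> + \<epsilon>) * lil_scale (N * q)) sequentially"
    proof (rule eventually_sequentiallyI[of "max (max n0 (2 * M')) (nat \<lceil>\<rho> ^ (k0 + k1 + 1)\<rceil>)"])
      fix q assume "q \<ge> max (max n0 (2 * M')) (nat \<lceil>\<rho> ^ (k0 + k1 + 1)\<rceil>)"
      then have q: "q \<ge> n0" "q \<ge> 2 * M'" "nat \<lceil>\<rho> ^ (k0 + k1 + 1)\<rceil> \<le> q" by auto
      have q3: "\<rho> ^ (k0 + k1 + 1) \<le> real q" using q(3) by linarith
      obtain j where j: "real q < \<rho> ^ j" using real_arch_pow[OF \<rho>] by blast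
      define J where "J = (LEAST j. real q < \<rho> ^ j)"
      have J: "real q < \<rho> ^ J" unfolding J_def using j by (rule LeastI)
      have "\<rho> ^ (k0 + k1 + 1) < \<rho> ^ J" using q3 J by linarith
      then have kJ: "k0 + k1 + 1 < J" by (rule power_less_imp_less_exp[OF \<rho>])
      define k where "k = J - 1"
      have Jk: "J = Suc k" "k0 \<le> k" "k1 \<le> k" using kJ by (auto simp: k_def)
      have "\<not> real q < \<rho> ^ k" using not_less_Least[of k "\<lambda>j. real q < \<rho> ^ j"] Jk unfolding J_def by simp
      then have lo: "\<rho> ^ k \<le> real q" by simp
      have Qq: "Q k \<le> q" using floor_power_facts(2)[OF \<rho>, of k] lo unfolding Q_def by linarith
      have "real q - real (Q k) \<le> (\<rho> - 1) * \<rho> ^ k + 1"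
        using floor_power_facts(4)[OF \<rho>, of k] J unfolding Jk(1) Q_def by (simp add: algebra_simps)
      also have "\<dots> \<le> (\<rho> - 1) * real q + 1" using lo \<rho> by (intro add_mono mult_left_mono) auto
      also have "\<dots> = real q / (2 * real M') + 1" unfolding \<rho>_def by simp
      finally have "real M' * (real q - real (Q k)) \<le> real M' * (real q / (2 * real M') + 1)" by (intro mult_left_mono) auto
      also have "\<dots> = real q / 2 + real M'" using M1 by (simp add: field_simps)
      also have "\<dots> \<le> real q" using q(2) by linarith
      finally have "real (M' * (q - Q k)) \<le> real q" using Qq by (simp add: of_nat_diff)
      then have Mq: "M' * (q - Q k) \<le> q" by linarith
      let ?n = "N * q"
      have qn: "q \<le> ?n" using N by simp
      have n3: "3 \<le> N * Q k" using k1[OF Jk(3)] N by (metis le_trans mult_le_mono1 nat_mult_1)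
      have n33: "N * Q k \<le> ?n" using Qq by simp
      have lp: "0 < lil_scale ?n" using n3 n33 by (intro lil_scale_pos) linarith
      have w: "norm (walk (j * q) \<omega> - walk (j * Q k) \<omega>) \<le> mod_const / sqrt (real M') * lil_scale ?n" if j: "j \<le> N" for j
      proof -
        have "M' * (j * q - j * Q k) = j * (M' * (q - Q k))" by (simp add: diff_mult_distrib2 algebra_simps)
        also have "\<dots> \<le> N * q" using j Mq by (intro mult_le_mono) auto
        finally have "norm (walk (j * q) \<omega> - walk (j * Q k) \<omega>) \<le> mod_const * lil_scale ?n / sqrt (real M')"
          using order_trans[OF q(1) qn] j Qq by (intro n0) (auto intro: mult_le_mono)
        then show ?thesis by simp
      qed
      have "\<bar>bsum N th q \<omega> - bsum N th (Q k) \<omega>\<bar> = \<bar>\<Sum>j<N. th j \<bullet> ((walk ((j + 1) * q) \<omega> - walk ((j + 1) * Q k) \<omega>) - (walk (j * q) \<omega> - walk (j * Q k) \<omega>))\<bar>"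
        unfolding bsum_def sum_subtractf[symmetric] by (simp add: inner_diff_right algebra_simps)
      also have "\<dots> \<le> (\<Sum>j<N. norm (th j) * (2 * (mod_const / sqrt (real M') * lil_scale ?n)))"
      proof (rule order_trans[OF sum_abs sum_mono])
        fix j assume j: "j \<in> {..<N}"
        then have "norm ((walk ((j + 1) * q) \<omega> - walk ((j + 1) * Q k) \<omega>) - (walk (j * q) \<omega> - walk (j * Q k) \<omega>))
            \<le> mod_const / sqrt (real M') * lil_scale ?n + mod_const / sqrt (real M') * lil_scale ?n"
          by (intro norm_triangle_le_diff add_mono w) auto
        then show "\<bar>th j \<bullet> ((walk ((j + 1) * q) \<omega> - walk ((j + 1) * Q k) \<omega>) - (walk (j * q) \<omega> - walk (j * Q k) \<omega>))\<bar> \<le> norm (th j) * (2 * (mod_const / sqrt (real M') * lil_scale ?n))"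
          by (intro order_trans[OF Cauchy_Schwarz_ineq2] mult_left_mono) auto
      qed
      also have "\<dots> = (\<Sum>j<N. norm (th j)) * (2 * (mod_const / sqrt (real M') * lil_scale ?n))" by (rule sum_distrib_right[symmetric])
      also have "\<dots> \<le> \<Theta> * (2 * (mod_const / sqrt (real M') * lil_scale ?n))"
        using lp mod_const_pos unfolding \<Theta>_def by (intro mult_right_mono) auto
      also have "\<dots> = 2 * \<Theta> * (mod_const / sqrt (real M')) * lil_scale ?n" by simp
      also have "\<dots> \<le> \<epsilon> / 2 * lil_scale ?n" using small lp by (intro mult_right_mono) auto
      finally have "bsum N th q \<omega> \<le> bsum N th (Q k) \<omega> + \<epsilon> / 2 * lil_scale ?n" by linarith
      also have "\<dots> \<le> (\<sigma> + \<epsilon> / 2) * lil_scale (N * Q k) + \<epsilon> / 2 * lil_scale ?n" using k0[OF Jk(2)] by simp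
      also have "\<dots> \<le> (\<sigma> + \<epsilon> / 2) * lil_scale ?n + \<epsilon> / 2 * lil_scale ?n"
        using \<sigma>0 \<epsilon> lil_scale_mono[OF n3 n33] by (intro add_right_mono mult_left_mono) auto
      also have "\<dots> = (\<sigma> + \<epsilon>) * lil_scale ?n" by (simp add: algebra_simps)
      finally show "bsum N th q \<omega> \<le> (\<sigma> + \<epsilon>) * lil_scale ?n" .
    qed
  qed
qed

text \<open>(1 - \<epsilon>)^2 (1 + 2 \<epsilon>) = 1 - 3 \<epsilon>^2 + 2 \<epsilon>^3 leaves room
  of order \<epsilon>^2 for \<eta>. The bound 1 is the critical value: it makes the probabilities at
  least 1 / (2 ln n), which is not summable along geometric times.\<close>

lemma tilting_exponent_le:
  fixes \<epsilon> \<eta> :: real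
  assumes "0 < \<epsilon>" "\<epsilon> \<le> 1/2" "\<eta> \<le> \<epsilon>\<^sup>2 / 10" "0 \<le> \<eta>"
  shows "(1 - \<epsilon>)\<^sup>2 * (1 + 2 * \<epsilon> + \<eta>) \<le> 1"
proof -
  have "(1 - \<epsilon>)\<^sup>2 \<le> 1" using assms by (simp add: power_le_one)
  then have "(1 - \<epsilon>)\<^sup>2 * \<eta> \<le> 1 * \<eta>" using assms by (intro mult_right_mono) auto
  moreover have "(1 - \<epsilon>)\<^sup>2 * (1 + 2 * \<epsilon>) = 1 - \<epsilon>\<^sup>2 * (3 - 2 * \<epsilon>)" by (simp add: power2_eq_square algebra_simps)
  moreover have "\<epsilon>\<^sup>2 * 2 \<le> \<epsilon>\<^sup>2 * (3 - 2 * \<epsilon>)" using assms by (intro mult_left_mono) auto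
  moreover have "(1 - \<epsilon>)\<^sup>2 * (1 + 2 * \<epsilon> + \<eta>) = (1 - \<epsilon>)\<^sup>2 * (1 + 2 * \<epsilon>) + (1 - \<epsilon>)\<^sup>2 * \<eta>" by (rule distrib_left)
  ultimately show ?thesis using assms zero_le_power2[of \<epsilon>] by linarith
qed

text \<open>The index set is an arbitrary finite set with enough variance, so that an initial
  stretch of the walk can be left out to gain independence between different times.\<close>

lemma block_tail_lower:
  fixes v :: "nat \<Rightarrow> 'b"
  assumes n3: "3 \<le> n" and k: "9 \<le> k" "2 ^ (k - 1) \<le> n" "n < 2 ^ k"
    and I: "finite I" and \<Theta>: "\<And>i. i \<in> I \<Longrightarrow> norm (v i) \<le> \<Theta>" "0 < \<Theta>"
    and V: "\<sigma>\<^sup>2 * real n \<le> (\<Sum>i\<in>I. expectation (\<lambda>\<omega>. (v i \<bullet> tvar (\<tau> * dy_level k) i \<omega>)\<^sup>2))" "0 < \<sigma>"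
    and \<epsilon>: "0 < \<epsilon>" "\<epsilon> \<le> 1/2" and \<tau>: "0 < \<tau>" "16 * \<Theta> * \<tau> \<le> \<epsilon>\<^sup>2 / 20 * \<sigma>"
    and large: "4 \<le> (1 - \<epsilon>)\<^sup>2 * ln (ln (real n)) * \<epsilon>\<^sup>2"
  shows "1 / (2 * ln (real n)) \<le> prob {\<omega> \<in> space M. (1 - \<epsilon>)\<^sup>2 * \<sigma> * lil_scale n \<le> (\<Sum>i\<in>I. v i \<bullet> tvar (\<tau> * dy_level k) i \<omega>)}"
proof -
  let ?c = "\<tau> * dy_level k"
  define V where "V = (\<Sum>i\<in>I. expectation (\<lambda>\<omega>. (v i \<bullet> tvar ?c i \<omega>)\<^sup>2))"
  define T where "T \<omega> = (\<Sum>i\<in>I. v i \<bullet> tvar ?c i \<omega>)" for \<omega>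
  have c0: "0 \<le> ?c" using \<tau> dy_level_pos[of k] by simp
  have rn: "0 < real n" using n3 by simp
  have LL: "0 < ln (ln (real n))" using lnln_ge_0[OF n3] .
  have V2: "\<sigma>\<^sup>2 * real n \<le> V" unfolding V_def by (rule V(1))
  have V0: "0 < V" using V(2) rn by (intro less_le_trans[OF _ V2]) simp
  \<comment> \<open>Up to 1 - \<epsilon> this is the tilt whose mean \<open>\<theta> * V\<close> is
    sqrt (2 V ln ln n). The exponent \<open>\<theta>\<^sup>2 * V / 2\<close> is then (1 -
    \<epsilon>)^2 ln ln n, which offsets the loss in the tilting bound by
    \<open>tilting_exponent_le\<close>.\<close>
  define \<theta> where "\<theta> = (1 - \<epsilon>) * sqrt (2 * ln (ln (real n)) / V)"
  have \<theta>0: "0 \<le> \<theta>" unfolding \<theta>_def using \<epsilon> LL V0 by simp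
  have lil: "lil_scale n = sqrt (2 * ln (ln (real n)) / real n) * real n"
  proof -
    have "sqrt (2 * ln (ln (real n)) / real n) * real n = sqrt (2 * ln (ln (real n)) / real n) * sqrt ((real n)\<^sup>2)" by simp
    also have "\<dots> = sqrt (2 * ln (ln (real n)) / real n * (real n)\<^sup>2)" by (rule real_sqrt_mult[symmetric])
    also have "\<dots> = lil_scale n" unfolding lil_scale_def using rn by (simp add: power2_eq_square mult_ac)
    finally show ?thesis ..
  qed
  have "\<theta> \<le> 1 * sqrt (2 * ln (ln (real n)) / (\<sigma>\<^sup>2 * real n))"
    unfolding \<theta>_def using \<epsilon> LL V0 V2 V(2) rn by (intro mult_mono real_sqrt_le_mono divide_left_mono) auto
  also have "\<dots> = sqrt (2 * ln (ln (real n)) / real n) / \<sigma>"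
    using V(2) by (simp add: real_sqrt_divide real_sqrt_mult)
  also have "\<dots> = lil_scale n / (\<sigma> * real n)" unfolding lil using rn by simp
  finally have \<theta>le: "\<theta> \<le> lil_scale n / (\<sigma> * real n)" .
  have kn: "2 ^ k \<le> 2 * real n"
  proof -
    have "(2::real) ^ (k - 1) \<le> real n" using k(2) by (metis of_nat_le_iff of_nat_numeral of_nat_power)
    then show ?thesis using k(1) by (cases k) auto
  qed
  have "2 * \<theta> * (\<Theta> * (2 * ?c)) \<le> 2 * (lil_scale n / (\<sigma> * real n)) * (\<Theta> * (2 * ?c))"
    using \<theta>le \<Theta> c0 by (intro mult_right_mono mult_left_mono) auto
  also have "\<dots> = lil_scale n * (4 * \<Theta> * \<tau> * dy_level k) / (\<sigma> * real n)" by simp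
  also have "\<dots> \<le> (2 * dy_scale k) * (4 * \<Theta> * \<tau> * dy_level k) / (\<sigma> * real n)"
    using dyadic_bounds(4)[OF k] V(2) rn \<Theta> \<tau> dy_level_pos[of k] by (intro divide_right_mono mult_right_mono) auto
  also have "\<dots> = 8 * \<Theta> * \<tau> * 2 ^ k / (\<sigma> * real n)" unfolding dy_scale_mult_level[symmetric] by simp
  also have "\<dots> \<le> 8 * \<Theta> * \<tau> * (2 * real n) / (\<sigma> * real n)"
    using kn V(2) rn \<Theta> \<tau> by (intro divide_right_mono mult_left_mono) auto
  also have "\<dots> = 16 * \<Theta> * \<tau> / \<sigma>" using rn by simp
  also have "\<dots> \<le> \<epsilon>\<^sup>2 / 20" using \<tau> V(2) by (simp add: field_simps)
  finally have sb: "2 * \<theta> * (\<Theta> * (2 * ?c)) \<le> \<epsilon>\<^sup>2 / 20" .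
  have e2: "\<epsilon>\<^sup>2 \<le> 1" using \<epsilon> by (simp add: power_le_one)
  have ind: "indep_vars (\<lambda>_. borel) (\<lambda>i \<omega>. v i \<bullet> tvar ?c i \<omega>) I"
    by (rule indep_vars_compose2[OF indep_vars_subset[OF indep_tvar]]) auto
  have bd: "\<bar>v i \<bullet> tvar ?c i \<omega>\<bar> \<le> \<Theta> * (2 * ?c)" if "i \<in> I" for i \<omega>
    using abs_inner_tvar_le[OF c0, of "v i" i \<omega>] \<Theta>(1)[OF that] c0
    by (meson mult_right_mono order_trans mult_nonneg_nonneg zero_le_numeral)
  have E0: "expectation (\<lambda>\<omega>. v i \<bullet> tvar ?c i \<omega>) = 0" if "i \<in> I" for i by (rule expectation_inner_tvar[OF c0])
  have sb': "s * (\<Theta> * (2 * ?c)) \<le> \<epsilon>\<^sup>2 / 20" if "s \<le> 2 * \<theta>" for s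
  proof -
    have "s * (\<Theta> * (2 * ?c)) \<le> 2 * \<theta> * (\<Theta> * (2 * ?c))" using that \<Theta>(2) c0 by (intro mult_right_mono) auto
    then show ?thesis using sb by linarith
  qed
  have e20: "\<epsilon>\<^sup>2 / 20 \<le> 1" using e2 by simp
  have mgf: "integrable M (\<lambda>\<omega>. exp (s * T \<omega>))"
    "expectation (\<lambda>\<omega>. exp (s * T \<omega>)) \<le> exp ((1 + \<epsilon>\<^sup>2 / 20) * s\<^sup>2 * V / 2)"
    "exp ((1 - 2 * (\<epsilon>\<^sup>2 / 20)) * s\<^sup>2 * V / 2) \<le> expectation (\<lambda>\<omega>. exp (s * T \<omega>))"
    if "0 \<le> s" "s \<le> 2 * \<theta>" for s
  proof -
    note mgf = mgf_sum_bounds[OF I ind bd E0 that(1) sb'[OF that(2)] e20, folded V_def T_def]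
    show "integrable M (\<lambda>\<omega>. exp (s * T \<omega>))" by (rule mgf(1))
    show "expectation (\<lambda>\<omega>. exp (s * T \<omega>)) \<le> exp ((1 + \<epsilon>\<^sup>2 / 20) * s\<^sup>2 * V / 2)" by (rule mgf(2))
    show "exp ((1 - 2 * (\<epsilon>\<^sup>2 / 20)) * s\<^sup>2 * V / 2) \<le> expectation (\<lambda>\<omega>. exp (s * T \<omega>))" by (rule mgf(3))
  qed
  have "exp (- ((1 - \<epsilon>)\<^sup>2 * ln (ln (real n))) * (1 + 2 * \<epsilon> + \<epsilon>\<^sup>2 / 10)) / 2 \<le> prob {\<omega> \<in> space M. (1 - \<epsilon>) * (\<theta> * V) \<le> T \<omega>}"
  proof (rule tilting_lower_tail[OF _ mgf(1) _ _ \<theta>0 less_imp_le[OF V0] \<epsilon>])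
    show "T \<in> borel_measurable M" unfolding T_def by measurable
    show "expectation (\<lambda>\<omega>. exp (s * T \<omega>)) \<le> exp ((1 + \<epsilon>\<^sup>2 / 10) * s\<^sup>2 * V / 2)" if s: "0 \<le> s" "s \<le> 2 * \<theta>" for s
    proof -
      have "(1 + \<epsilon>\<^sup>2 / 20) * (s\<^sup>2 * V / 2) \<le> (1 + \<epsilon>\<^sup>2 / 10) * (s\<^sup>2 * V / 2)" using V0 by (intro mult_right_mono) auto
      then have "exp ((1 + \<epsilon>\<^sup>2 / 20) * s\<^sup>2 * V / 2) \<le> exp ((1 + \<epsilon>\<^sup>2 / 10) * s\<^sup>2 * V / 2)" by (simp only: exp_le_cancel_iff times_divide_eq_right mult.assoc)
      then show ?thesis using mgf(2)[OF s] by linarith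
    qed
    show "exp ((1 - \<epsilon>\<^sup>2 / 10) * s\<^sup>2 * V / 2) \<le> expectation (\<lambda>\<omega>. exp (s * T \<omega>))" if s: "0 \<le> s" "s \<le> 2 * \<theta>" for s
      using mgf(3)[OF s] by simp
    show "(1 - \<epsilon>)\<^sup>2 * ln (ln (real n)) = \<theta>\<^sup>2 * V / 2"
      unfolding \<theta>_def using LL V0 by (simp add: power_mult_distrib)
  qed (use large in auto)
  moreover have "1 / (2 * ln (real n)) \<le> exp (- ((1 - \<epsilon>)\<^sup>2 * ln (ln (real n))) * (1 + 2 * \<epsilon> + \<epsilon>\<^sup>2 / 10)) / 2"
  proof -
    have "((1 - \<epsilon>)\<^sup>2 * (1 + 2 * \<epsilon> + \<epsilon>\<^sup>2 / 10)) * ln (ln (real n)) \<le> 1 * ln (ln (real n))"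
      using LL \<epsilon> by (intro mult_right_mono tilting_exponent_le) auto
    then have "- ln (ln (real n)) \<le> - ((1 - \<epsilon>)\<^sup>2 * ln (ln (real n))) * (1 + 2 * \<epsilon> + \<epsilon>\<^sup>2 / 10)"
      by (simp add: mult_ac)
    then have "exp (- ln (ln (real n))) \<le> exp (- ((1 - \<epsilon>)\<^sup>2 * ln (ln (real n))) * (1 + 2 * \<epsilon> + \<epsilon>\<^sup>2 / 10))" by (simp only: exp_le_cancel_iff)
    moreover have "exp (- ln (ln (real n))) = 1 / ln (real n)" using n3 by (simp add: exp_minus inverse_eq_divide)
    ultimately show ?thesis by simp
  qed
  moreover have "prob {\<omega> \<in> space M. (1 - \<epsilon>) * (\<theta> * V) \<le> T \<omega>} \<le> prob {\<omega> \<in> space M. (1 - \<epsilon>)\<^sup>2 * \<sigma> * lil_scale n \<le> T \<omega>}"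
  proof (rule finite_measure_mono)
    have "\<sigma> * lil_scale n = sqrt (2 * ln (ln (real n)) * (\<sigma>\<^sup>2 * real n))"
      unfolding lil_scale_def using V(2) by (simp add: real_sqrt_mult mult_ac)
    also have "\<dots> \<le> sqrt (2 * ln (ln (real n)) * V)" using V2 LL by (intro real_sqrt_le_mono mult_left_mono) auto
    also have "\<dots> = sqrt (2 * ln (ln (real n)) / V * V\<^sup>2)" using V0 by (simp add: power2_eq_square)
    also have "\<dots> = sqrt (2 * ln (ln (real n)) / V) * V" using V0 by (simp only: real_sqrt_mult) simp
    finally have "(1 - \<epsilon>)\<^sup>2 * (\<sigma> * lil_scale n) \<le> (1 - \<epsilon>)\<^sup>2 * (sqrt (2 * ln (ln (real n)) / V) * V)"
      by (intro mult_left_mono) auto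
    also have "\<dots> = (1 - \<epsilon>) * (\<theta> * V)" unfolding \<theta>_def by (simp add: power2_eq_square)
    finally show "{\<omega> \<in> space M. (1 - \<epsilon>) * (\<theta> * V) \<le> T \<omega>} \<subseteq> {\<omega> \<in> space M. (1 - \<epsilon>)\<^sup>2 * \<sigma> * lil_scale n \<le> T \<omega>}"
      by (auto simp: mult.assoc)
    have [measurable]: "T \<in> borel_measurable M" unfolding T_def by measurable
    show "{\<omega> \<in> space M. (1 - \<epsilon>)\<^sup>2 * \<sigma> * lil_scale n \<le> T \<omega>} \<in> events" by measurable
  qed
  ultimately show ?thesis unfolding T_def by linarith
qed

text \<open>Along \<open>n k = N * K ^ (k + 1)\<close> the contributions of the intervals \<open>{n (k - 1)..<n k}\<close> are independent,
  and for large \<open>K\<close> the remaining contribution is negligible by \<open>walk_modulus\<close>.\<close>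

lemma bsum_lower:
  fixes th :: "nat \<Rightarrow> 'b"
  assumes N: "1 \<le> N" and \<epsilon>: "0 < \<epsilon>"
  defines "\<sigma> \<equiv> sqrt ((\<Sum>j<N. (norm (th j))\<^sup>2) / real N)"
  assumes \<sigma>: "0 < \<sigma>"
  shows "AE \<omega> in M. frequently (\<lambda>q. (\<sigma> - \<epsilon>) * lil_scale (N * q) \<le> bsum N th q \<omega>) sequentially"
proof -
  define \<Theta> where "\<Theta> = (\<Sum>j<N. norm (th j)) + 1"
  have \<Theta>1: "norm (th j) \<le> \<Theta>" if "j < N" for j
    unfolding \<Theta>_def using that member_le_sum[of j "{..<N}" "\<lambda>j. norm (th j)"] by auto
  have \<Theta>0: "0 < \<Theta>" unfolding \<Theta>_def using sum_nonneg[of "{..<N}" "\<lambda>j. norm (th j)"] by simp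
  \<comment> \<open>Error budget out of \<open>\<epsilon>0\<close>: half for the loss in (1 - e)^2
    \<sigma>1, an eighth for the early steps, an eighth for truncation.\<close>
  define \<epsilon>0 where "\<epsilon>0 = min \<epsilon> (\<sigma> / 2)"
  have \<epsilon>0: "0 < \<epsilon>0" "\<epsilon>0 \<le> \<epsilon>" "\<epsilon>0 \<le> \<sigma> / 2" unfolding \<epsilon>0_def using \<epsilon> \<sigma> by auto
  define e where "e = \<epsilon>0 / (8 * \<sigma>)"
  define \<sigma>1 where "\<sigma>1 = \<sigma> - \<epsilon>0 / 8"
  have \<sigma>1: "0 < \<sigma>1" "\<sigma>1 < \<sigma>" unfolding \<sigma>1_def using \<epsilon>0 \<sigma> by auto
  have e: "0 < e" "e \<le> 1/2" unfolding e_def using \<epsilon>0 \<sigma> by (auto simp: field_simps)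
  have target: "\<sigma> - \<epsilon>0 / 2 \<le> (1 - e)\<^sup>2 * \<sigma>1"
  proof -
    have "2 * e * \<sigma>1 \<le> 2 * e * \<sigma>" using e \<sigma>1 by (intro mult_left_mono) auto
    also have "\<dots> = \<epsilon>0 / 4" unfolding e_def using \<sigma> by simp
    finally have "2 * e * \<sigma>1 \<le> \<epsilon>0 / 4" .
    moreover have "(1 - 2 * e) * \<sigma>1 = \<sigma>1 - 2 * e * \<sigma>1" by (simp add: algebra_simps)
    ultimately have "\<sigma> - \<epsilon>0 / 2 \<le> (1 - 2 * e) * \<sigma>1" using \<epsilon>0 \<sigma>1_def by linarith
    also have "\<dots> \<le> (1 - e)\<^sup>2 * \<sigma>1" using \<sigma>1 by (intro mult_right_mono) (auto simp: power2_eq_square algebra_simps)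
    finally show ?thesis .
  qed
  have gap: "0 < \<sigma>\<^sup>2 - \<sigma>1\<^sup>2" using \<sigma>1 by (simp add: power_strict_mono)
  obtain K0 :: nat where K0: "(norm (th 0))\<^sup>2 / (\<sigma>\<^sup>2 - \<sigma>1\<^sup>2) < real K0" using reals_Archimedean2 by blast
  obtain K1 :: nat where K1: "8 * \<Theta> * mod_const / \<epsilon>0 < real K1" using reals_Archimedean2 by blast
  \<comment> \<open>\<open>K0\<close> keeps the variance lost with the first \<open>n k / K\<close>
    steps below \<sigma>^2 - \<sigma>1^2, \<open>K1\<close> bounds the contribution of these steps
    by \<open>\<epsilon>0 / 8\<close>, and \<open>N \<le> K\<close> places all of them in the first
    block.\<close>
  define K where "K = K0 + K1\<^sup>2 + N + 2"
  have K: "N \<le> K" "2 \<le> K" "1 \<le> K" unfolding K_def by auto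
  have K0': "(norm (th 0))\<^sup>2 / real K < \<sigma>\<^sup>2 - \<sigma>1\<^sup>2"
  proof -
    have "(norm (th 0))\<^sup>2 < real K0 * (\<sigma>\<^sup>2 - \<sigma>1\<^sup>2)" using K0 gap by (simp add: pos_divide_less_eq)
    also have "\<dots> \<le> real K * (\<sigma>\<^sup>2 - \<sigma>1\<^sup>2)" using gap unfolding K_def by (intro mult_right_mono) auto
    finally show ?thesis using K by (simp add: field_simps)
  qed
  have K1': "\<Theta> * (mod_const / sqrt (real K)) \<le> \<epsilon>0 / 8"
  proof -
    have "real K1 = sqrt ((real K1)\<^sup>2)" by simp
    also have "\<dots> \<le> sqrt (real K)" unfolding K_def by (intro real_sqrt_le_mono) simp
    finally have "8 * \<Theta> * mod_const / \<epsilon>0 < sqrt (real K)" using K1 by linarith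
    then have "8 * \<Theta> * mod_const < sqrt (real K) * \<epsilon>0" using \<epsilon>0 by (simp add: pos_divide_less_eq)
    then show ?thesis using K by (simp add: field_simps)
  qed
  define q where "q k = K ^ (k + 1)" for k
  define n where "n k = N * q k" for k
  define a where "a k = N * K ^ k" for k
  define I where "I k = {a k..<n k}" for k
  define \<tau> where "\<tau> = e\<^sup>2 / 20 * \<sigma>1 / (16 * \<Theta>)"
  have \<tau>: "0 < \<tau>" "16 * \<Theta> * \<tau> \<le> e\<^sup>2 / 20 * \<sigma>1" unfolding \<tau>_def using e \<sigma>1 \<Theta>0 by auto
  define c where "c k = \<tau> * dy_level (dy_index (n k))" for k
  have c0: "0 \<le> c k" for k unfolding c_def using \<tau> dy_level_pos[of "dy_index (n k)"] by simp
  define R where "R k \<omega> = (\<Sum>i\<in>I k. th (i div q k) \<bullet> tvar (c k) i \<omega>)" for k \<omega>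
  have q0: "0 < q k" for k unfolding q_def using K by simp
  have an: "a k \<le> n k" "K * a k = n k" for k unfolding a_def n_def q_def using K by auto
  have aq: "a k \<le> q k" for k unfolding a_def q_def using K by (simp add: mult.commute)
  have qlim: "filterlim q at_top sequentially"
  proof (rule filterlim_at_top_mono[OF filterlim_ident])
    show "eventually (\<lambda>k. k \<le> q k) sequentially"
    proof (rule always_eventually, rule allI)
      fix k
      have "k < 2 ^ k" by (rule less_exp)
      also have "\<dots> \<le> K ^ k" using K by (intro power_mono) auto
      also have "\<dots> \<le> q k" unfolding q_def using K by simp
      finally show "k \<le> q k" by simp
    qed
  qed
  have nlim: "filterlim n at_top sequentially" unfolding n_def by (intro filterlim_mult_nat N qlim)
  have dylim: "filterlim dy_index at_top sequentially"
    unfolding filterlim_at_top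
  proof
    fix Z :: nat
    have "eventually (\<lambda>k. Z \<le> k) sequentially" by (rule eventually_ge_at_top)
    from eventually_dy_index[OF this] show "eventually (\<lambda>k. Z \<le> dy_index k) sequentially" by eventually_elim blast
  qed
  have clim: "filterlim c at_top sequentially"
    unfolding c_def using \<tau>(1)
    by (intro filterlim_tendsto_pos_mult_at_top[OF tendsto_const] filterlim_compose[OF dy_level_at_top filterlim_compose[OF dylim nlim]])
  define v where "v k j = expectation (\<lambda>\<omega>. (th j \<bullet> tvar (c k) 0 \<omega>)\<^sup>2)" for k j
  have v: "expectation (\<lambda>\<omega>. (th j \<bullet> tvar (c k) i \<omega>)\<^sup>2) = v k j" for k j i
    unfolding v_def tvar_second_moment[OF c0] ..
  have Vsum: "(\<Sum>i\<in>I k. v k (i div q k)) = real (n k) * ((\<Sum>j<N. v k j) / real N - v k 0 / real K)" for k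
  proof -
    have "(\<Sum>i<n k. v k (i div q k)) = real (q k) * (\<Sum>j<N. v k j)"
      unfolding n_def by (rule sum_div_group[OF q0])
    moreover have "(\<Sum>i<a k. v k (i div q k)) = real (a k) * v k 0"
    proof -
      have "(\<Sum>i<a k. v k (i div q k)) = (\<Sum>i<a k. v k 0)"
        using aq[of k] by (intro sum.cong refl) auto
      then show ?thesis by simp
    qed
    moreover have "(\<Sum>i<n k. v k (i div q k)) = (\<Sum>i<a k. v k (i div q k)) + (\<Sum>i\<in>I k. v k (i div q k))"
      unfolding I_def lessThan_atLeast0 using an by (simp add: sum.atLeastLessThan_concat)
    ultimately have "(\<Sum>i\<in>I k. v k (i div q k)) = real (q k) * (\<Sum>j<N. v k j) - real (a k) * v k 0" by simp
    moreover have "real (a k) = real (n k) / real K" using K unfolding an(2)[symmetric] by simp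
    moreover have "real (q k) = real (n k) / real N" using N unfolding n_def by simp
    ultimately show ?thesis by (simp add: algebra_simps)
  qed
  have "(\<lambda>k. (\<Sum>j<N. v k j) / real N - v k 0 / real K) \<longlonglongrightarrow> (\<Sum>j<N. (norm (th j))\<^sup>2) / real N - (norm (th 0))\<^sup>2 / real K"
    unfolding v_def white[symmetric] using N K by (intro tendsto_intros tvar_second_moment_tendsto clim c0) auto
  moreover have "\<sigma>1\<^sup>2 < (\<Sum>j<N. (norm (th j))\<^sup>2) / real N - (norm (th 0))\<^sup>2 / real K"
  proof -
    have "(\<Sum>j<N. (norm (th j))\<^sup>2) / real N = \<sigma>\<^sup>2" unfolding \<sigma>_def by (simp add: sum_nonneg)
    then show ?thesis using K0' by simp
  qed
  ultimately have evV: "eventually (\<lambda>k. \<sigma>1\<^sup>2 < (\<Sum>j<N. v k j) / real N - v k 0 / real K) sequentially"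
    by (rule order_tendstoD)
  have evn: "eventually (\<lambda>k. 9 \<le> dy_index (n k) \<and> 2 ^ (dy_index (n k) - 1) \<le> n k \<and> n k < 2 ^ dy_index (n k)) sequentially"
    using nlim eventually_dy_index[of "\<lambda>_. True"] by (auto simp: filterlim_iff)
  have lnlim: "filterlim (\<lambda>k. ln (ln (real (n k)))) at_top sequentially"
    by (intro filterlim_compose[OF ln_at_top] filterlim_compose[OF filterlim_real_sequentially nlim])
  have evl: "eventually (\<lambda>k. 4 / ((1 - e)\<^sup>2 * e\<^sup>2) \<le> ln (ln (real (n k)))) sequentially"
    using lnlim by (simp add: filterlim_at_top)
  have ev3: "eventually (\<lambda>k. 3 \<le> n k) sequentially" using nlim by (simp add: filterlim_at_top)
  have "eventually (\<lambda>k. \<sigma>1\<^sup>2 < (\<Sum>j<N. v k j) / real N - v k 0 / real K \<and> 3 \<le> n k \<and> 4 / ((1 - e)\<^sup>2 * e\<^sup>2) \<le> ln (ln (real (n k))) \<and>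
     9 \<le> dy_index (n k) \<and> 2 ^ (dy_index (n k) - 1) \<le> n k \<and> n k < 2 ^ dy_index (n k)) sequentially"
    using evV evn evl ev3 by eventually_elim blast
  then obtain k0 where k0: "\<And>k. k \<ge> k0 \<Longrightarrow> \<sigma>1\<^sup>2 < (\<Sum>j<N. v k j) / real N - v k 0 / real K \<and> 3 \<le> n k \<and> 4 / ((1 - e)\<^sup>2 * e\<^sup>2) \<le> ln (ln (real (n k))) \<and>
     9 \<le> dy_index (n k) \<and> 2 ^ (dy_index (n k) - 1) \<le> n k \<and> n k < 2 ^ dy_index (n k)"
    unfolding eventually_sequentially by blast
  \<comment> \<open>ln (n k) is at most (k + 1) (ln N + ln K), so 1 / (2 ln (n k)) is at least A /
    (k + 1), and the harmonic series diverges.\<close>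
  define A where "A = 1 / (2 * (ln (real N) + ln (real K)))"
  have lnK: "0 < ln (real K)" "0 \<le> ln (real N)" using K N by auto
  have A0: "0 < A" unfolding A_def using lnK by simp
  have AE1: "AE \<omega> in M. frequently (\<lambda>k. (1 - e)\<^sup>2 * \<sigma>1 * lil_scale (n k) \<le> R k \<omega>) sequentially"
  proof (rule borel_cantelli_second[where p = "\<lambda>k. A * inverse (real (Suc k))"])
    have "disjoint_family_on I UNIV"
    proof -
      have "I k \<inter> I l = {}" if "k < l" for k l
      proof -
        have "n k \<le> a l" unfolding n_def q_def a_def using that K by (intro mult_left_mono power_increasing) auto
        then show ?thesis unfolding I_def by auto
      qed
      then show ?thesis unfolding disjoint_family_on_def by (metis Int_commute linorder_neqE_nat)
    qed
    \<comment> \<open>The truncation level changes with k, so independence is inherited from the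
      untruncated steps on the disjoint intervals.\<close>
    then have "indep_vars (\<lambda>k. PiM (I k) (\<lambda>_. borel)) (\<lambda>k \<omega>. restrict (\<lambda>i. Y i \<omega>) (I k)) UNIV"
      by (intro indep_vars_restrict[OF indepY]) auto
    then have "indep_vars (\<lambda>_. borel) (\<lambda>k \<omega>. \<Sum>i\<in>I k. th (i div q k) \<bullet> (trunc (c k) (restrict (\<lambda>i. Y i \<omega>) (I k) i) - tmean (c k))) UNIV"
    proof (rule indep_vars_compose2[where Y = "\<lambda>k f. \<Sum>i\<in>I k. th (i div q k) \<bullet> (trunc (c k) (f i) - tmean (c k))"])
      fix k
      have [measurable]: "(\<lambda>f. f i) \<in> PiM (I k) (\<lambda>_. borel) \<rightarrow>\<^sub>M (borel :: 'b measure)" if "i \<in> I k" for i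
        using that by (rule measurable_component_singleton)
      show "(\<lambda>f. \<Sum>i\<in>I k. th (i div q k) \<bullet> (trunc (c k) (f i) - tmean (c k))) \<in> borel_measurable (PiM (I k) (\<lambda>_. borel))"
        by (rule borel_measurable_sum) measurable
    qed
    then show "indep_vars (\<lambda>_. borel) R UNIV"
      unfolding R_def[abs_def] tvar_def by simp
    show "0 \<le> A * inverse (real (Suc k))" for k using A0 by simp
    show "\<not> summable (\<lambda>k. A * inverse (real (Suc k)))"
    proof
      assume "summable (\<lambda>k. A * inverse (real (Suc k)))"
      then have "summable (\<lambda>k. inverse (real (Suc k)))" using A0 by (simp add: summable_cmult_iff)
      then have "summable (\<lambda>k. inverse (real k))" by (subst (asm) summable_Suc_iff)
      then show False using not_summable_harmonic[where 'a = real] by (simp add: inverse_eq_divide)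
    qed
    fix k assume k: "k \<ge> k0"
    note kk = k0[OF k]
    have ne: "0 < (1 - e)\<^sup>2 * e\<^sup>2" using e by simp
    have "A * inverse (real (Suc k)) \<le> 1 / (2 * ln (real (n k)))"
    proof -
      have "ln (real (n k)) = ln (real N) + real (k + 1) * ln (real K)"
        unfolding n_def q_def using N K by (simp add: ln_mult ln_realpow algebra_simps)
      also have "\<dots> \<le> real (k + 1) * (ln (real N) + ln (real K))" using lnK by (simp add: algebra_simps)
      finally have le: "ln (real (n k)) \<le> real (k + 1) * (ln (real N) + ln (real K))" .
      have "0 < ln (real (n k))" using kk by simp
      then have "1 / (2 * (real (k + 1) * (ln (real N) + ln (real K)))) \<le> 1 / (2 * ln (real (n k)))"
        using le by (intro frac_le) auto
      then show ?thesis unfolding A_def by (simp add: field_simps)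
    qed
    also have "\<dots> \<le> prob {\<omega> \<in> space M. (1 - e)\<^sup>2 * \<sigma>1 * lil_scale (n k) \<le> R k \<omega>}"
      unfolding R_def c_def
    proof (rule block_tail_lower[where \<Theta> = \<Theta>])
      show "finite (I k)" unfolding I_def by simp
      show "norm (th (i div q k)) \<le> \<Theta>" if "i \<in> I k" for i
        using that q0[of k] by (intro \<Theta>1) (auto simp: I_def n_def div_less_iff_less_mult)
      show "\<sigma>1\<^sup>2 * real (n k) \<le> (\<Sum>i\<in>I k. expectation (\<lambda>\<omega>. (th (i div q k) \<bullet> tvar (\<tau> * dy_level (dy_index (n k))) i \<omega>)\<^sup>2))"
        unfolding c_def[symmetric] v Vsum using kk by (subst mult.commute) (intro mult_left_mono, auto)
      have "4 / ((1 - e)\<^sup>2 * e\<^sup>2) \<le> ln (ln (real (n k)))" using kk by blast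
      then have "4 \<le> ln (ln (real (n k))) * ((1 - e)\<^sup>2 * e\<^sup>2)" using ne by (simp add: pos_divide_le_eq)
      then show "4 \<le> (1 - e)\<^sup>2 * ln (ln (real (n k))) * e\<^sup>2" by (simp add: mult_ac)
    qed (use kk \<Theta>0 \<sigma>1 e \<tau> in auto)
    finally show "A * inverse (real (Suc k)) \<le> prob {\<omega> \<in> space M. (1 - e)\<^sup>2 * \<sigma>1 * lil_scale (n k) \<le> R k \<omega>}" .
  qed
  \<comment> \<open>Truncation costs 2 \<Theta> \<delta> through the early steps and 4 \<Theta>
    \<delta> through the blocks; with 48 = 6 times 8 the total is
    \<open>\<epsilon>0 / 8\<close>.\<close>
  define \<delta> where "\<delta> = \<epsilon>0 / (48 * \<Theta>)"
  have \<delta>: "0 < \<delta>" unfolding \<delta>_def using \<epsilon>0 \<Theta>0 by simp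
  show ?thesis
    using AE1 bsum_remainder[OF \<tau>(1) \<delta> N, of th] walk_modulus[OF K(3)]
  proof eventually_elim
    fix \<omega>
    assume fr: "frequently (\<lambda>k. (1 - e)\<^sup>2 * \<sigma>1 * lil_scale (n k) \<le> R k \<omega>) sequentially"
      and r: "eventually (\<lambda>n. \<forall>q. n = N * q \<longrightarrow>
     \<bar>bsum N th q \<omega> - tbsum (\<tau> * dy_level (dy_index n)) N th q \<omega>\<bar> \<le> 4 * (\<Sum>j<N. norm (th j)) * \<delta> * lil_scale n \<and>
     (\<forall>l\<le>n. norm (walk l \<omega> - twalk (\<tau> * dy_level (dy_index n)) l \<omega>) \<le> 2 * \<delta> * lil_scale n)) sequentially"
      and m: "eventually (\<lambda>n. \<forall>l l'. l \<le> l' \<longrightarrow> l' \<le> n \<longrightarrow> K * (l' - l) \<le> n \<longrightarrow>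
     norm (walk l' \<omega> - walk l \<omega>) \<le> mod_const * lil_scale n / sqrt (real K)) sequentially"
    have "eventually (\<lambda>k. \<forall>q. n k = N * q \<longrightarrow>
     \<bar>bsum N th q \<omega> - tbsum (\<tau> * dy_level (dy_index (n k))) N th q \<omega>\<bar> \<le> 4 * (\<Sum>j<N. norm (th j)) * \<delta> * lil_scale (n k) \<and>
     (\<forall>l\<le>n k. norm (walk l \<omega> - twalk (\<tau> * dy_level (dy_index (n k))) l \<omega>) \<le> 2 * \<delta> * lil_scale (n k))) sequentially"
      using r nlim unfolding filterlim_iff by blast
    moreover have "eventually (\<lambda>k. \<forall>l l'. l \<le> l' \<longrightarrow> l' \<le> n k \<longrightarrow> K * (l' - l) \<le> n k \<longrightarrow>
     norm (walk l' \<omega> - walk l \<omega>) \<le> mod_const * lil_scale (n k) / sqrt (real K)) sequentially"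
      using m nlim unfolding filterlim_iff by blast
    ultimately have imp: "eventually (\<lambda>k. (1 - e)\<^sup>2 * \<sigma>1 * lil_scale (n k) \<le> R k \<omega> \<longrightarrow> (\<sigma> - \<epsilon>) * lil_scale (N * q k) \<le> bsum N th (q k) \<omega>) sequentially"
      using eventually_ge_at_top[of k0]
    proof (eventually_elim, intro impI)
      fix k
      let ?L = "lil_scale (n k)"
      assume r: "\<forall>q. n k = N * q \<longrightarrow>
     \<bar>bsum N th q \<omega> - tbsum (\<tau> * dy_level (dy_index (n k))) N th q \<omega>\<bar> \<le> 4 * (\<Sum>j<N. norm (th j)) * \<delta> * lil_scale (n k) \<and>
     (\<forall>l\<le>n k. norm (walk l \<omega> - twalk (\<tau> * dy_level (dy_index (n k))) l \<omega>) \<le> 2 * \<delta> * lil_scale (n k))"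
      and m: "\<forall>l l'. l \<le> l' \<longrightarrow> l' \<le> n k \<longrightarrow> K * (l' - l) \<le> n k \<longrightarrow>
     norm (walk l' \<omega> - walk l \<omega>) \<le> mod_const * lil_scale (n k) / sqrt (real K)"
      and k: "k0 \<le> k" and big: "(1 - e)\<^sup>2 * \<sigma>1 * lil_scale (n k) \<le> R k \<omega>"
      have L: "0 < ?L" using k0[OF k] by (intro lil_scale_pos) blast
      have r1: "\<bar>bsum N th (q k) \<omega> - tbsum (c k) N th (q k) \<omega>\<bar> \<le> 4 * (\<Sum>j<N. norm (th j)) * \<delta> * ?L"
        and r2: "norm (walk (a k) \<omega> - twalk (c k) (a k) \<omega>) \<le> 2 * \<delta> * ?L"
        using r an[of k] unfolding c_def n_def by blast+
      have m1: "norm (walk (a k) \<omega>) \<le> mod_const / sqrt (real K) * ?L"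
        using m[rule_format, of 0 "a k"] an[of k] by (simp add: walk_def)
      have "norm (twalk (c k) (a k) \<omega>) \<le> norm (walk (a k) \<omega>) + norm (walk (a k) \<omega> - twalk (c k) (a k) \<omega>)"
        using norm_triangle_ineq4[of "walk (a k) \<omega>" "walk (a k) \<omega> - twalk (c k) (a k) \<omega>"] by simp
      then have tw: "norm (twalk (c k) (a k) \<omega>) \<le> (mod_const / sqrt (real K) + 2 * \<delta>) * ?L"
        using r2 m1 by (simp add: algebra_simps)
      have "tbsum (c k) N th (q k) \<omega> = (\<Sum>i<a k. th (i div q k) \<bullet> tvar (c k) i \<omega>) + R k \<omega>"
        unfolding tbsum_eq[OF q0] R_def I_def n_def[symmetric] lessThan_atLeast0 using an by (simp add: sum.atLeastLessThan_concat)
      also have "(\<Sum>i<a k. th (i div q k) \<bullet> tvar (c k) i \<omega>) = (\<Sum>i<a k. th 0 \<bullet> tvar (c k) i \<omega>)"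
        using aq[of k] by (intro sum.cong refl) auto
      also have "\<dots> = th 0 \<bullet> twalk (c k) (a k) \<omega>" unfolding twalk_def by (simp add: inner_sum_right)
      finally have tb: "tbsum (c k) N th (q k) \<omega> = th 0 \<bullet> twalk (c k) (a k) \<omega> + R k \<omega>" .
      have "\<bar>th 0 \<bullet> twalk (c k) (a k) \<omega>\<bar> \<le> \<Theta> * ((mod_const / sqrt (real K) + 2 * \<delta>) * ?L)"
        using \<Theta>1[of 0] N \<Theta>0 tw by (intro order_trans[OF Cauchy_Schwarz_ineq2] mult_mono) auto
      also have "\<dots> = (\<Theta> * (mod_const / sqrt (real K)) + 2 * \<Theta> * \<delta>) * ?L" by (simp add: algebra_simps)
      also have "\<dots> \<le> (\<epsilon>0 / 8 + 2 * \<Theta> * \<delta>) * ?L" using K1' L by (intro mult_right_mono) auto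
      finally have b1: "\<bar>th 0 \<bullet> twalk (c k) (a k) \<omega>\<bar> \<le> (\<epsilon>0 / 8 + 2 * \<Theta> * \<delta>) * ?L" .
      have b2: "4 * (\<Sum>j<N. norm (th j)) * \<delta> * ?L \<le> 4 * \<Theta> * \<delta> * ?L"
        using \<delta> L unfolding \<Theta>_def by (intro mult_right_mono) auto
      have "bsum N th (q k) \<omega> \<ge> (1 - e)\<^sup>2 * \<sigma>1 * ?L - (\<epsilon>0 / 8 + 2 * \<Theta> * \<delta>) * ?L - 4 * \<Theta> * \<delta> * ?L"
        using r1 b1 b2 tb big by linarith
      moreover have "(\<sigma> - \<epsilon>0 / 2) * ?L \<le> (1 - e)\<^sup>2 * \<sigma>1 * ?L" using target L by (intro mult_right_mono) auto
      ultimately have "bsum N th (q k) \<omega> \<ge> (\<sigma> - \<epsilon>0 / 2) * ?L - (\<epsilon>0 / 8 + 2 * \<Theta> * \<delta>) * ?L - 4 * \<Theta> * \<delta> * ?L" by linarith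
      also have "(\<sigma> - \<epsilon>0 / 2) * ?L - (\<epsilon>0 / 8 + 2 * \<Theta> * \<delta>) * ?L - 4 * \<Theta> * \<delta> * ?L = (\<sigma> - \<epsilon>0 / 2 - \<epsilon>0 / 8 - 6 * (\<Theta> * \<delta>)) * ?L"
        by (simp add: algebra_simps)
      also have "\<Theta> * \<delta> = \<epsilon>0 / 48" unfolding \<delta>_def using \<Theta>0 by simp
      finally have "bsum N th (q k) \<omega> \<ge> (\<sigma> - \<epsilon>0 / 2 - \<epsilon>0 / 8 - 6 * (\<epsilon>0 / 48)) * ?L" .
      moreover have "(\<sigma> - \<epsilon>) * ?L \<le> (\<sigma> - \<epsilon>0 / 2 - \<epsilon>0 / 8 - 6 * (\<epsilon>0 / 48)) * ?L"
        using L \<epsilon>0 by (intro mult_right_mono) auto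
      ultimately show "(\<sigma> - \<epsilon>) * lil_scale (N * q k) \<le> bsum N th (q k) \<omega>" unfolding n_def by linarith
    qed
    have "frequently (\<lambda>k. (\<sigma> - \<epsilon>) * lil_scale (N * q k) \<le> bsum N th (q k) \<omega>) sequentially"
      by (rule frequently_mp[OF imp fr])
    then show "frequently (\<lambda>q. (\<sigma> - \<epsilon>) * lil_scale (N * q) \<le> bsum N th q \<omega>) sequentially"
      using qlim unfolding frequently_def filterlim_iff by blast
  qed
qed

end

section \<open>Paths of finite energy\<close>

text \<open>The fundamental theorem for absolutely continuous functions, in gauge form. Tags outside
  the exceptional null set are handled by the straddle estimate for derivatives. For tags inside it
  the gauge is an open set T of small measure, and absolute continuity bounds the increments over
  the intervals contained in T.\<close>

lemma has_integral_of_abs_cont: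
  fixes f h :: "real \<Rightarrow> real"
  assumes ac: "abs_cont_on {0..1} f"
    and N: "N \<in> null_sets lborel" and der: "\<And>s. s \<in> {0<..<1} - N \<Longrightarrow> (f has_real_derivative h s) (at s)"
    and ab: "0 \<le> a" "a \<le> b" "b \<le> 1"
  shows "(h has_integral (f b - f a)) {a..b}"
proof -
  \<comment> \<open>The end points are added because derivatives are assumed only in the open
    interval.\<close>
  define Z where "Z = N \<union> {0, 1}"
  have Z: "Z \<in> null_sets lborel" unfolding Z_def using N finite_imp_null_set_lborel[of "{0, 1::real}"] by (intro null_sets.Un) auto
  define g where "g x = (if x \<in> Z then 0 else h x)" for x
  have "(g has_integral (f b - f a)) (cbox a b)"
    unfolding has_integral
  proof (intro allI impI)
    fix e :: real assume e: "0 < e"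
    then have "0 < e / 2" by simp
    from ac[unfolded abs_cont_on_def, rule_format, OF this]
    obtain \<delta> where \<delta>: "0 < \<delta>" and acd0: "\<forall>(n::nat) (a::nat \<Rightarrow> real) (b::nat \<Rightarrow> real).
        (\<forall>k<n. a k \<le> b k \<and> {a k..b k} \<subseteq> {0..1}) \<and>
        (\<forall>k<n. \<forall>l<n. k \<noteq> l \<longrightarrow> {a k<..<b k} \<inter> {a l<..<b l} = {}) \<and>
        (\<Sum>k<n. b k - a k) < \<delta> \<longrightarrow> (\<Sum>k<n. \<bar>f (b k) - f (a k)\<bar>) < e / 2"
      by (elim exE conjE)
    note acd = acd0[rule_format, OF conjI, OF _ conjI]
    obtain T where T: "open T" "Z \<subseteq> T" "emeasure lebesgue (T - Z) < ennreal \<delta>"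
    proof -
      have "Z \<in> sets lebesgue" using Z by auto
      from sets_lebesgue_outer_open[OF this \<delta>] show ?thesis using that by metis
    qed
    have mT: "emeasure lborel T < ennreal \<delta>"
    proof -
      have "emeasure lborel T = emeasure lebesgue T" using T(1) by simp
      also have "\<dots> \<le> emeasure lebesgue ((T - Z) \<union> Z)" using T(1) Z by (intro emeasure_mono) auto
      also have "\<dots> \<le> emeasure lebesgue (T - Z) + emeasure lebesgue Z" using T(1) Z by (intro emeasure_subadditive) auto
      also have "emeasure lebesgue Z = 0" by (rule null_setsD1[OF null_sets_completionI[OF Z]])
      finally show ?thesis using T(3) by (simp add: le_less_trans)
    qed
    \<comment> \<open>The \<open>+ 2\<close> keeps the denominator positive when a = b and makes the
      inequality with e / 2 strict.\<close>
    define e' where "e' = e / (2 * (b - a) + 2)"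
    have e': "0 < e'" "e' * (b - a) < e / 2"
    proof -
      show e0: "0 < e'" unfolding e'_def using e ab by simp
      have "e' * (2 * (b - a) + 2) = e" unfolding e'_def using ab by simp
      then show "e' * (b - a) < e / 2" using e0 by (simp add: algebra_simps)
    qed
    have "\<exists>d>0. \<forall>y. \<bar>y - x\<bar> < d \<longrightarrow> \<bar>f y - f x - h x * (y - x)\<bar> \<le> e' * \<bar>y - x\<bar>" if "x \<in> {0..1} - Z" for x
    proof -
      have "(f has_derivative (\<lambda>y. h x * y)) (at x)"
        using der[of x] that unfolding Z_def has_field_derivative_def by auto
      then show ?thesis unfolding has_derivative_at_alt using e'(1) by (auto simp: mult.commute)
    qed
    then obtain d where d: "\<And>x. x \<in> {0..1} - Z \<Longrightarrow> 0 < d x"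
      "\<And>x y. x \<in> {0..1} - Z \<Longrightarrow> \<bar>y - x\<bar> < d x \<Longrightarrow> \<bar>f y - f x - h x * (y - x)\<bar> \<le> e' * \<bar>y - x\<bar>"
      by metis
    define \<gamma> where "\<gamma> x = (if x \<in> Z then T else if x \<in> {0..1} then ball x (d x) else UNIV)" for x
    have g: "gauge \<gamma>" unfolding gauge_def \<gamma>_def using T d by auto
    show "\<exists>\<gamma>. gauge \<gamma> \<and> (\<forall>D. D tagged_division_of cbox a b \<and> \<gamma> fine D \<longrightarrow> norm ((\<Sum>(x, k)\<in>D. measure lborel k *\<^sub>R g x) - (f b - f a)) < e)"
    proof (intro exI[of _ \<gamma>] conjI g allI impI, elim conjE)
      fix p assume p: "p tagged_division_of cbox a b" and fine: "\<gamma> fine p"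
      have fin: "finite p" using p by (rule tagged_division_of_finite)
      have K: "\<exists>u v. K = {u..v} \<and> u \<le> v \<and> x \<in> K \<and> K \<subseteq> {a..b} \<and> K \<subseteq> \<gamma> x" if "(x, K) \<in> p" for x K
        using tagged_division_ofD(2,3,4)[OF p that] fine that unfolding fine_def by fastforce
      have Kp: "K = {Inf K..Sup K}" "Inf K \<le> Sup K" "x \<in> K" "K \<subseteq> {a..b}" "K \<subseteq> \<gamma> x" if "(x, K) \<in> p" for x K
        using K[OF that] by auto
      have cK: "measure lborel K = Sup K - Inf K" if "(x, K) \<in> p" for x K
        using Kp[OF that] by (metis content_real)
      have tot: "(\<Sum>(x,k)\<in>p. f (Sup k) - f (Inf k)) = f b - f a"
        using additive_tagged_division_1[OF ab(2), of p f] p by simp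
      have ctot: "(\<Sum>(x,k)\<in>p. measure lborel k) = b - a"
        using additive_content_tagged_division[OF p] ab by simp
      define B where "B = {q \<in> p. fst q \<in> Z}"
      have Bp: "B \<subseteq> p" "finite B" unfolding B_def using fin by auto
      have bad: "(\<Sum>(x,k)\<in>B. \<bar>f (Sup k) - f (Inf k)\<bar>) < e / 2"
      proof -
        obtain \<phi> where \<phi>: "bij_betw \<phi> {..<card B} B" using ex_bij_betw_nat_finite[OF Bp(2)] by (auto simp: atLeast0LessThan)
        define \<alpha> where "\<alpha> k = Inf (snd (\<phi> k))" for k
        define \<beta> where "\<beta> k = Sup (snd (\<phi> k))" for k
        have \<phi>B: "\<phi> k \<in> B" if "k < card B" for k using \<phi> that unfolding bij_betw_def by auto
        have pk: "(fst (\<phi> k), snd (\<phi> k)) \<in> p" "fst (\<phi> k) \<in> Z" if "k < card B" for k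
          using \<phi>B[OF that] unfolding B_def by auto
        have sn: "snd (\<phi> k) = {\<alpha> k..\<beta> k}" "\<alpha> k \<le> \<beta> k" "{\<alpha> k..\<beta> k} \<subseteq> T" "{\<alpha> k..\<beta> k} \<subseteq> {a..b}" if "k < card B" for k
          using Kp[OF pk(1)[OF that]] pk(2)[OF that] unfolding \<alpha>_def \<beta>_def \<gamma>_def by auto
        have dis: "{\<alpha> k<..<\<beta> k} \<inter> {\<alpha> l<..<\<beta> l} = {}" if "k < card B" "l < card B" "k \<noteq> l" for k l
        proof -
          have "\<phi> k \<noteq> \<phi> l" using \<phi> that unfolding bij_betw_def inj_on_def by auto
          then have "interior (snd (\<phi> k)) \<inter> interior (snd (\<phi> l)) = {}"
            using tagged_division_ofD(5)[OF p pk(1)[OF that(1)] pk(1)[OF that(2)]] by (metis prod.collapse)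
          then show ?thesis unfolding sn(1)[OF that(1)] sn(1)[OF that(2)] by (simp add: interior_atLeastAtMost_real)
        qed
        have "(\<Sum>k<card B. ennreal (\<beta> k - \<alpha> k)) = (\<Sum>k<card B. emeasure lborel {\<alpha> k<..<\<beta> k})"
          using sn(2) by (intro sum.cong) auto
        also have "\<dots> = emeasure lborel (\<Union>k<card B. {\<alpha> k<..<\<beta> k})"
          using dis by (intro sum_emeasure) (auto simp: disjoint_family_on_def)
        also have "\<dots> \<le> emeasure lborel T"
        proof (intro emeasure_mono UN_least)
          show "{\<alpha> k<..<\<beta> k} \<subseteq> T" if "k \<in> {..<card B}" for k using sn(3)[of k] that by (meson greaterThanLessThan_subseteq_atLeastAtMost_iff less_eq_real_def lessThan_iff subset_trans order_refl)
        qed (use T in auto)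
        also have "\<dots> < ennreal \<delta>" by (rule mT)
        finally have "ennreal (\<Sum>k<card B. \<beta> k - \<alpha> k) < ennreal \<delta>" using sn(2) by (subst sum_ennreal[symmetric]) auto
        moreover have "0 \<le> (\<Sum>k<card B. \<beta> k - \<alpha> k)" using sn(2) by (intro sum_nonneg) auto
        ultimately have "(\<Sum>k<card B. \<beta> k - \<alpha> k) < \<delta>" using ennreal_less_iff by blast
        moreover have "{\<alpha> k..\<beta> k} \<subseteq> {0..1}" if "k < card B" for k
          using subset_trans[OF sn(4)[OF that], of "{0..1}"] ab by auto
        ultimately have "(\<Sum>k<card B. \<bar>f (\<beta> k) - f (\<alpha> k)\<bar>) < e / 2"
          using sn(2) dis by (intro acd) blast+
        also have "(\<Sum>k<card B. \<bar>f (\<beta> k) - f (\<alpha> k)\<bar>) = (\<Sum>(x,k)\<in>B. \<bar>f (Sup k) - f (Inf k)\<bar>)"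
          using sum.reindex_bij_betw[OF \<phi>, of "\<lambda>(x,k). \<bar>f (Sup k) - f (Inf k)\<bar>"] by (simp add: \<alpha>_def \<beta>_def case_prod_beta)
        finally show ?thesis .
      qed
      have good: "\<bar>measure lborel k *\<^sub>R g x - (f (Sup k) - f (Inf k))\<bar> \<le> e' * measure lborel k" if "(x, k) \<in> p - B" for x k
      proof -
        have xk: "(x, k) \<in> p" "x \<notin> Z" using that unfolding B_def by auto
        note k = Kp[OF xk(1)]
        have x01: "x \<in> {0..1} - Z" using k xk ab by auto
        have "Inf k \<in> k" "Sup k \<in> k" using k(1,2) by (metis atLeastAtMost_iff order_refl)+
        then have "\<bar>Inf k - x\<bar> < d x" "\<bar>Sup k - x\<bar> < d x"
          using k(5) xk(2) x01 unfolding \<gamma>_def by (auto simp: dist_real_def abs_minus_commute)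
        note dd = d(2)[OF x01 this(1)] d(2)[OF x01 this(2)]
        have ord: "Inf k \<le> x" "x \<le> Sup k" using k(1,3) by (metis atLeastAtMost_iff)+
        have "measure lborel k *\<^sub>R g x - (f (Sup k) - f (Inf k)) = (f (Inf k) - f x - h x * (Inf k - x)) - (f (Sup k) - f x - h x * (Sup k - x))"
          using xk(2) unfolding cK[OF xk(1)] g_def by (simp add: algebra_simps)
        then have "\<bar>measure lborel k *\<^sub>R g x - (f (Sup k) - f (Inf k))\<bar> \<le> e' * \<bar>Inf k - x\<bar> + e' * \<bar>Sup k - x\<bar>"
          using dd by linarith
        also have "\<dots> = e' * measure lborel k" unfolding cK[OF xk(1)] using ord by (simp add: algebra_simps)
        finally show ?thesis .
      qed
      have bad2: "\<bar>measure lborel k *\<^sub>R g x - (f (Sup k) - f (Inf k))\<bar> = \<bar>f (Sup k) - f (Inf k)\<bar>" if "(x, k) \<in> B" for x k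
        using that unfolding B_def g_def by auto
      have "(\<Sum>(x, k)\<in>p. measure lborel k *\<^sub>R g x) - (f b - f a) = (\<Sum>(x,k)\<in>p. measure lborel k *\<^sub>R g x - (f (Sup k) - f (Inf k)))"
        unfolding tot[symmetric] by (simp add: sum_subtractf case_prod_beta)
      also have "\<bar>\<dots>\<bar> \<le> (\<Sum>(x,k)\<in>p. \<bar>measure lborel k *\<^sub>R g x - (f (Sup k) - f (Inf k))\<bar>)"
        by (rule order_trans[OF sum_abs]) (simp add: case_prod_beta)
      also have "\<dots> = (\<Sum>(x,k)\<in>p - B. \<bar>measure lborel k *\<^sub>R g x - (f (Sup k) - f (Inf k))\<bar>) + (\<Sum>(x,k)\<in>B. \<bar>measure lborel k *\<^sub>R g x - (f (Sup k) - f (Inf k))\<bar>)"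
        by (rule sum.subset_diff[OF Bp(1) fin])
      also have "\<dots> \<le> (\<Sum>(x,k)\<in>p - B. e' * measure lborel k) + (\<Sum>(x,k)\<in>B. \<bar>f (Sup k) - f (Inf k)\<bar>)"
        using good bad2 by (intro add_mono sum_mono) auto
      also have "(\<Sum>(x,k)\<in>p - B. e' * measure lborel k) \<le> (\<Sum>(x,k)\<in>p. e' * measure lborel k)"
        using e' fin by (intro sum_mono2) auto
      also have "\<dots> = e' * (b - a)" unfolding ctot[symmetric] by (simp add: sum_distrib_left case_prod_beta)
      finally show "norm ((\<Sum>(x, k)\<in>p. measure lborel k *\<^sub>R g x) - (f b - f a)) < e" using bad e'(2) by simp
    qed
  qed
  moreover have "negligible Z" using Z by (simp add: negligible_iff_null_sets null_sets_completionI)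
  ultimately have "(h has_integral (f b - f a)) (cbox a b)"
    by (rule has_integral_spike[rotated 2]) (auto simp: g_def)
  then show ?thesis by simp
qed

text \<open>The density h in \<open>U_set\<close> is not assumed measurable. Gauge integrability of
  its scalar products yields measurability with respect to \<open>lebesgue\<close>, so the energy is
  moved there; the scalar form reduces the later arguments to real integrands.\<close>

lemma U_set_derivative:
  fixes f :: "real \<Rightarrow> real ^ 'm"
  assumes f: "f \<in> U_set"
  obtains h where "\<And>c a b. 0 \<le> a \<Longrightarrow> a \<le> b \<Longrightarrow> b \<le> 1 \<Longrightarrow> ((\<lambda>s. c \<bullet> h s) has_integral (c \<bullet> (f b - f a))) {a..b}"
    "(\<integral>\<^sup>+ s. ennreal (indicator {0..1} s * (norm (h s))\<^sup>2) \<partial>lebesgue) \<le> 1"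
proof -
  obtain h where h: "AE s in lborel. s \<in> {0<..<1} \<longrightarrow> (f has_vector_derivative h s) (at s)"
    "(\<integral>\<^sup>+ s. ennreal (indicator {0..1} s * (norm (h s))\<^sup>2) \<partial>lborel) \<le> 1" and ac: "\<And>j. abs_cont_on {0..1} (\<lambda>s. f s $ j)"
    using f unfolding U_set_def by blast
  obtain N where N: "N \<in> null_sets lborel" "\<And>s. s \<notin> N \<Longrightarrow> s \<in> {0<..<1} \<longrightarrow> (f has_vector_derivative h s) (at s)"
    using h(1) unfolding eventually_ae_filter by auto
  have comp: "((\<lambda>s. h s $ j) has_integral (f b $ j - f a $ j)) {a..b}" if "0 \<le> a" "a \<le> b" "b \<le> 1" for a b j
  proof (rule has_integral_of_abs_cont[OF ac N(1) _ that])
    fix s assume "s \<in> {0<..<1} - N"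
    then have "(f has_vector_derivative h s) (at s)" using N(2) by auto
    then have "((\<lambda>s. f s $ j) has_vector_derivative h s $ j) (at s)"
      by (rule bounded_linear.has_vector_derivative[OF bounded_linear_vec_nth])
    then show "((\<lambda>s. f s $ j) has_real_derivative h s $ j) (at s)"
      by (simp add: has_real_derivative_iff_has_vector_derivative)
  qed
  show ?thesis
  proof (rule that)
    fix c :: "real ^ 'm" and a b :: real assume ab: "0 \<le> a" "a \<le> b" "b \<le> 1"
    have "((\<lambda>s. \<Sum>j\<in>UNIV. c $ j * h s $ j) has_integral (\<Sum>j\<in>UNIV. c $ j * (f b $ j - f a $ j))) {a..b}"
      by (intro has_integral_sum has_integral_mult_right comp ab) auto
    then show "((\<lambda>s. c \<bullet> h s) has_integral (c \<bullet> (f b - f a))) {a..b}" by (simp add: inner_vec_def)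
  next
    show "(\<integral>\<^sup>+ s. ennreal (indicator {0..1} s * (norm (h s))\<^sup>2) \<partial>lebesgue) \<le> 1"
      using h(2) by (simp add: nn_integral_completion)
  qed
qed

text \<open>Takes the place of Cauchy-Schwarz, which would presuppose square integrability of h:
  with c the mean slope, the pointwise inequality 2 (c \<bullet> h) - |c|^2 \<le> |h|^2 is
  integrated over the interval.\<close>

lemma interval_energy:
  fixes h :: "real \<Rightarrow> real ^ 'm" and f :: "real \<Rightarrow> real ^ 'm"
  assumes h: "((\<lambda>s. (f b - f a) \<bullet> h s) has_integral ((f b - f a) \<bullet> (f b - f a))) {a..b}" and ab: "a < b"
  shows "ennreal ((norm (f b - f a))\<^sup>2 / (b - a)) \<le> (\<integral>\<^sup>+ s. ennreal (indicator {a<..<b} s * (norm (h s))\<^sup>2) \<partial>lebesgue)"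
proof -
  define c where "c = (1 / (b - a)) *\<^sub>R (f b - f a)"
  define \<phi> where "\<phi> s = 2 * (c \<bullet> h s) - (norm c)\<^sup>2" for s
  have "((\<lambda>s. (2 / (b - a)) * ((f b - f a) \<bullet> h s) - (norm c)\<^sup>2) has_integral
     (2 / (b - a)) * ((f b - f a) \<bullet> (f b - f a)) - (b - a) * (norm c)\<^sup>2) {a..b}"
    using ab has_integral_const_real[of "(norm c)\<^sup>2" a b] by (intro has_integral_diff has_integral_mult_right h) auto
  moreover have "(2 / (b - a)) * ((f b - f a) \<bullet> (f b - f a)) - (b - a) * (norm c)\<^sup>2 = (norm (f b - f a))\<^sup>2 / (b - a)"
  proof -
    have "(norm c)\<^sup>2 = (norm (f b - f a))\<^sup>2 / (b - a)\<^sup>2" unfolding c_def using ab by (simp add: power_divide)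
    moreover have "D\<^sup>2 / (b - a)\<^sup>2 * (b - a) = D\<^sup>2 / (b - a)" for D using ab by (simp add: power2_eq_square)
    ultimately have "(b - a) * (norm c)\<^sup>2 = (norm (f b - f a))\<^sup>2 / (b - a)" by (simp only: mult.commute)
    then show ?thesis by (simp add: dot_square_norm)
  qed
  ultimately have "(\<phi> has_integral (norm (f b - f a))\<^sup>2 / (b - a)) (cbox a b)"
    unfolding \<phi>_def c_def by simp
  then have "(\<phi> has_integral (norm (f b - f a))\<^sup>2 / (b - a)) (box a b)" by (rule has_integral_open_interval[THEN iffD2])
  then have I: "((\<lambda>s. if s \<in> {a<..<b} then \<phi> s else 0) has_integral (norm (f b - f a))\<^sup>2 / (b - a)) UNIV"
    by (subst has_integral_restrict_UNIV) simp
  let ?\<phi> = "\<lambda>s. if s \<in> {a<..<b} then \<phi> s else 0"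
  have meas: "?\<phi> \<in> borel_measurable lebesgue"
    using integrable_imp_measurable[of ?\<phi> UNIV] I by (auto simp: lebesgue_on_UNIV_eq integrable_on_def)
  \<comment> \<open>A nonnegative integral is to be bounded below, so the positive part is taken; if
    its integral is infinite there is nothing to show.\<close>
  define \<psi> where "\<psi> s = max 0 (?\<phi> s)" for s
  have \<psi>m: "\<psi> \<in> borel_measurable lebesgue" unfolding \<psi>_def using meas by (intro borel_measurable_max) auto
  have pw: "\<psi> s \<le> indicator {a<..<b} s * (norm (h s))\<^sup>2" for s
  proof -
    have "0 \<le> (norm (h s - c))\<^sup>2" by simp
    then have "\<phi> s \<le> (norm (h s))\<^sup>2" unfolding \<phi>_def
      by (simp add: dot_square_norm[symmetric] inner_diff_left inner_diff_right inner_commute)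
    then show ?thesis unfolding \<psi>_def by (auto simp: indicator_def)
  qed
  have le: "(\<integral>\<^sup>+ s. ennreal (\<psi> s) \<partial>lebesgue) \<le> (\<integral>\<^sup>+ s. ennreal (indicator {a<..<b} s * (norm (h s))\<^sup>2) \<partial>lebesgue)"
    by (intro nn_integral_mono ennreal_leI pw)
  show ?thesis
  proof (cases "(\<integral>\<^sup>+ s. ennreal (\<psi> s) \<partial>lebesgue) = \<infinity>")
    case True
    then show ?thesis using le by (simp add: top_unique)
  next
    case False
    then have int: "integrable lebesgue \<psi>"
      using \<psi>m by (intro integrableI_nonneg) (auto simp: \<psi>_def less_top)
    have "(\<psi> has_integral integral\<^sup>L lebesgue \<psi>) UNIV" by (rule has_integral_integral_lebesgue[OF int])
    then have "(norm (f b - f a))\<^sup>2 / (b - a) \<le> integral\<^sup>L lebesgue \<psi>"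
      by (rule has_integral_le[OF I]) (auto simp: \<psi>_def)
    then have "ennreal ((norm (f b - f a))\<^sup>2 / (b - a)) \<le> ennreal (integral\<^sup>L lebesgue \<psi>)" by (rule ennreal_leI)
    also have "\<dots> = (\<integral>\<^sup>+ s. ennreal (\<psi> s) \<partial>lebesgue)" using int by (intro nn_integral_eq_integral[symmetric]) (auto simp: \<psi>_def)
    finally show ?thesis using le by simp
  qed
qed

text \<open>The energy of a single interval. This modulus of continuity, common to all of
  \<open>U_set\<close>, is what lets grid values control whole paths.\<close>

lemma U_set_holder:
  fixes f :: "real \<Rightarrow> real ^ 'm"
  assumes f: "f \<in> U_set" and ab: "0 \<le> a" "a \<le> b" "b \<le> 1"
  shows "norm (f b - f a) \<le> sqrt (b - a)"
proof (cases "a = b")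
  case False
  then have lt: "a < b" using ab by simp
  obtain h where h: "\<And>c a b. 0 \<le> a \<Longrightarrow> a \<le> b \<Longrightarrow> b \<le> 1 \<Longrightarrow> ((\<lambda>s. c \<bullet> h s) has_integral (c \<bullet> (f b - f a))) {a..b}"
    "(\<integral>\<^sup>+ s. ennreal (indicator {0..1} s * (norm (h s))\<^sup>2) \<partial>lebesgue) \<le> 1"
    using U_set_derivative[OF f] by blast
  have "ennreal ((norm (f b - f a))\<^sup>2 / (b - a)) \<le> (\<integral>\<^sup>+ s. ennreal (indicator {a<..<b} s * (norm (h s))\<^sup>2) \<partial>lebesgue)"
    by (rule interval_energy[OF h(1)[OF ab] lt])
  also have "\<dots> \<le> (\<integral>\<^sup>+ s. ennreal (indicator {0..1} s * (norm (h s))\<^sup>2) \<partial>lebesgue)"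
    using ab by (intro nn_integral_mono ennreal_leI mult_right_mono) (auto simp: indicator_def)
  also have "\<dots> \<le> 1" by (rule h(2))
  finally have "(norm (f b - f a))\<^sup>2 / (b - a) \<le> 1" by simp
  then have "(norm (f b - f a))\<^sup>2 \<le> b - a" using lt by (simp add: field_simps)
  then show ?thesis by (rule real_le_rsqrt)
qed simp

text \<open>Adding the interval estimates uses additivity of the integral of |h|^2, hence its
  measurability on each cell, which is recovered from the coordinates of h. Open cells are disjoint
  and fit inside the unit interval.\<close>

lemma U_set_energy:
  fixes f :: "real \<Rightarrow> real ^ 'm"
  assumes f: "f \<in> U_set" and N: "1 \<le> N"
  shows "real N * (\<Sum>j<N. (norm (f (real (j + 1) / real N) - f (real j / real N)))\<^sup>2) \<le> 1"
proof -
  obtain h where h: "\<And>c a b. 0 \<le> a \<Longrightarrow> a \<le> b \<Longrightarrow> b \<le> 1 \<Longrightarrow> ((\<lambda>s. c \<bullet> h s) has_integral (c \<bullet> (f b - f a))) {a..b}"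
    "(\<integral>\<^sup>+ s. ennreal (indicator {0..1} s * (norm (h s))\<^sup>2) \<partial>lebesgue) \<le> 1"
    using U_set_derivative[OF f] by blast
  define t where "t j = real j / real N" for j
  have N0: "0 < real N" using N by simp
  have t: "0 \<le> t j" "t j < t (j + 1)" "t (j + 1) - t j = 1 / real N" for j
    unfolding t_def using N0 by (auto simp: field_simps)
  have tm: "t i \<le> t j" if "i \<le> j" for i j unfolding t_def using that N0 by (simp add: divide_right_mono)
  have t1: "t j \<le> 1" if "j \<le> N" for j unfolding t_def using that N0 by simp
  have hm: "(\<lambda>s. indicator {0..1} s * (h s $ i)) \<in> borel_measurable lebesgue" for i
  proof -
    have "((\<lambda>s. axis i 1 \<bullet> h s) has_integral (axis i 1 \<bullet> (f 1 - f 0))) {0..1}" by (rule h) auto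
    then have "(\<lambda>s. h s $ i) integrable_on {0..1}" by (auto simp: inner_axis' integrable_on_def)
    then have "(\<lambda>s. if s \<in> {0..1} then h s $ i else 0) integrable_on UNIV" by (rule integrable_restrict_UNIV[THEN iffD2])
    then have "(\<lambda>s. if s \<in> {0..1} then h s $ i else 0) \<in> borel_measurable lebesgue"
      using integrable_imp_measurable[of _ UNIV] by (auto simp: lebesgue_on_UNIV_eq)
    moreover have "(\<lambda>s. if s \<in> {0..1} then h s $ i else 0) = (\<lambda>s. indicator {0..1} s * (h s $ i))" by (auto simp: indicator_def)
    ultimately show ?thesis by simp
  qed
  have em: "(\<lambda>s. ennreal (indicator {t j<..<t (j + 1)} s * (norm (h s))\<^sup>2)) \<in> borel_measurable lebesgue" if "j < N" for j
  proof -
    have sub: "{t j<..<t (j + 1)} \<subseteq> {0..1}" using t(1)[of j] t1[of "j + 1"] that by auto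
    have "(\<lambda>s. indicator {t j<..<t (j + 1)} s * (norm (h s))\<^sup>2) = (\<lambda>s. indicator {t j<..<t (j + 1)} s * (\<Sum>i\<in>UNIV. (indicator {0..1} s * (h s $ i))\<^sup>2))"
      using sub by (auto simp: indicator_def norm_vec_def L2_set_def sum_nonneg fun_eq_iff)
    moreover have "(\<lambda>s. indicator {t j<..<t (j + 1)} s :: real) \<in> borel_measurable lebesgue" by (intro borel_measurable_indicator) auto
    moreover have "(\<lambda>s. indicator {t j<..<t (j + 1)} s * (\<Sum>i\<in>UNIV. (indicator {0..1} s * (h s $ i))\<^sup>2)) \<in> borel_measurable lebesgue"
      by (intro borel_measurable_times borel_measurable_sum borel_measurable_power hm calculation(2))
    ultimately have "(\<lambda>s. indicator {t j<..<t (j + 1)} s * (norm (h s))\<^sup>2) \<in> borel_measurable lebesgue" by simp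
    then show ?thesis by (rule measurable_compose[OF _ measurable_ennreal])
  qed
  have "(\<Sum>j<N. ennreal ((norm (f (t (j + 1)) - f (t j)))\<^sup>2 / (1 / real N))) \<le> (\<Sum>j<N. \<integral>\<^sup>+ s. ennreal (indicator {t j<..<t (j + 1)} s * (norm (h s))\<^sup>2) \<partial>lebesgue)"
  proof (rule sum_mono)
    fix j assume j: "j \<in> {..<N}"
    show "ennreal ((norm (f (t (j + 1)) - f (t j)))\<^sup>2 / (1 / real N)) \<le> (\<integral>\<^sup>+ s. ennreal (indicator {t j<..<t (j + 1)} s * (norm (h s))\<^sup>2) \<partial>lebesgue)"
      unfolding t(3)[of j, symmetric]
      by (rule interval_energy[OF h(1)]) (use t(1,2)[of j] t1[of "j + 1"] j in auto)
  qed
  also have "\<dots> = (\<integral>\<^sup>+ s. (\<Sum>j<N. ennreal (indicator {t j<..<t (j + 1)} s * (norm (h s))\<^sup>2)) \<partial>lebesgue)"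
    using em by (intro nn_integral_sum[symmetric]) auto
  also have "\<dots> \<le> (\<integral>\<^sup>+ s. ennreal (indicator {0..1} s * (norm (h s))\<^sup>2) \<partial>lebesgue)"
  proof (rule nn_integral_mono)
    fix s
    have dj: "disjoint_family_on (\<lambda>j. {t j<..<t (j + 1)}) {..<N}"
    proof -
      have "{t i<..<t (i + 1)} \<inter> {t j<..<t (j + 1)} = {}" if "i < j" for i j
        using tm[of "i + 1" j] that by auto
      then show ?thesis unfolding disjoint_family_on_def by (metis Int_commute linorder_neqE_nat)
    qed
    have "(\<Sum>j<N. indicator {t j<..<t (j + 1)} s :: real) = indicator (\<Union>j<N. {t j<..<t (j + 1)}) s"
      by (rule indicator_UN_disjoint[symmetric]) (use dj in auto)
    also have "\<dots> \<le> indicator {0..1} s"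
    proof -
      have "(\<Union>j<N. {t j<..<t (j + 1)}) \<subseteq> {0..1}"
      proof (rule UN_least)
        fix j assume "j \<in> {..<N}"
        then show "{t j<..<t (j + 1)} \<subseteq> {0..1}" using t(1)[of j] t1[of "j + 1"] by auto
      qed
      moreover have "indicator S s \<le> (indicator T s :: real)" if "S \<subseteq> T" for S T
        using that by (auto simp: indicator_def)
      ultimately show ?thesis by blast
    qed
    finally have "(\<Sum>j<N. indicator {t j<..<t (j + 1)} s) * (norm (h s))\<^sup>2 \<le> indicator {0..1} s * (norm (h s))\<^sup>2"
      by (intro mult_right_mono) auto
    then show "(\<Sum>j<N. ennreal (indicator {t j<..<t (j + 1)} s * (norm (h s))\<^sup>2)) \<le> ennreal (indicator {0..1} s * (norm (h s))\<^sup>2)"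
      by (subst sum_ennreal) (auto simp: sum_distrib_right intro: ennreal_leI)
  qed
  also have "\<dots> \<le> 1" by (rule h(2))
  finally have "ennreal (\<Sum>j<N. (norm (f (t (j + 1)) - f (t j)))\<^sup>2 / (1 / real N)) \<le> 1" by (subst sum_ennreal[symmetric]) auto
  then have "(\<Sum>j<N. (norm (f (t (j + 1)) - f (t j)))\<^sup>2 / (1 / real N)) \<le> 1" by simp
  then show ?thesis unfolding t_def by (simp add: sum_distrib_left mult.commute)
qed

section \<open>Piecewise linear paths\<close>

definition clamp01 :: "real \<Rightarrow> real" where "clamp01 x = max 0 (min 1 x)"

text \<open>Each summand rises linearly from 0 to \<open>d j\<close> on the j-th cell and stays
  there, so the path interpolates the partial sums of d. As a sum of ramps it is visibly Lipschitz
  on the whole line.\<close>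

definition pl_path :: "nat \<Rightarrow> (nat \<Rightarrow> real ^ 'm) \<Rightarrow> real \<Rightarrow> real ^ 'm" where
  "pl_path N d t = (\<Sum>j<N. clamp01 (real N * t - real j) *\<^sub>R d j)"

lemma clamp01_lipschitz: "\<bar>clamp01 x - clamp01 y\<bar> \<le> \<bar>x - y\<bar>"
  unfolding clamp01_def by (auto simp: max_def min_def)

lemma pl_path_0: "pl_path N d 0 = 0"
  unfolding pl_path_def by (intro sum.neutral) (simp add: clamp01_def)

lemma pl_path_piece:
  assumes "i < N" "real i \<le> real N * t" "real N * t \<le> real i + 1"
  shows "pl_path N d t = (\<Sum>j<i. d j) + (real N * t - real i) *\<^sub>R d i"
proof -
  have s: "{..<N} = {..<i} \<union> ({i} \<union> {i<..<N})" using assms(1) by auto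
  have "pl_path N d t = (\<Sum>j<i. clamp01 (real N * t - real j) *\<^sub>R d j) + (clamp01 (real N * t - real i) *\<^sub>R d i + (\<Sum>j\<in>{i<..<N}. clamp01 (real N * t - real j) *\<^sub>R d j))"
    unfolding pl_path_def s by (subst sum.union_disjoint, simp, simp, force, subst sum.union_disjoint) auto
  also have "(\<Sum>j<i. clamp01 (real N * t - real j) *\<^sub>R d j) = (\<Sum>j<i. d j)"
  proof (rule sum.cong[OF refl])
    fix j assume "j \<in> {..<i}"
    then have "real j + 1 \<le> real i" by (simp add: Suc_leI nat_less_real_le)
    then have "clamp01 (real N * t - real j) = 1" using assms(2) unfolding clamp01_def by (simp add: max_def min_def)
    then show "clamp01 (real N * t - real j) *\<^sub>R d j = d j" by simp
  qed
  also have "(\<Sum>j\<in>{i<..<N}. clamp01 (real N * t - real j) *\<^sub>R d j) = 0"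
  proof (rule sum.neutral, rule ballI)
    fix j assume "j \<in> {i<..<N}"
    then have "real i + 1 \<le> real j" by (simp add: Suc_leI nat_less_real_le)
    then have "clamp01 (real N * t - real j) = 0" using assms(3) unfolding clamp01_def by (simp add: max_def min_def)
    then show "clamp01 (real N * t - real j) *\<^sub>R d j = 0" by simp
  qed
  also have "clamp01 (real N * t - real i) = real N * t - real i" using assms(2,3) unfolding clamp01_def by (simp add: max_def min_def)
  finally show ?thesis by simp
qed

lemma pl_path_grid:
  assumes "k \<le> N" "1 \<le> N"
  shows "pl_path N d (real k / real N) = (\<Sum>j<k. d j)"
proof (cases "k < N")
  case True
  show ?thesis using pl_path_piece[OF True, of "real k / real N" d] assms by simp
next
  case False
  then have k: "k = N" "N - 1 < N" using assms by auto
  have "pl_path N d (real k / real N) = (\<Sum>j<N - 1. d j) + (real N * 1 - real (N - 1)) *\<^sub>R d (N - 1)"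
    using pl_path_piece[OF k(2), of 1 d] assms unfolding k(1) by (simp add: of_nat_diff)
  also have "\<dots> = (\<Sum>j<Suc (N - 1). d j)" unfolding sum.lessThan_Suc using assms by (simp add: of_nat_diff)
  finally show ?thesis using assms unfolding k(1) by simp
qed

lemma abs_cont_on_lipschitz:
  assumes L: "\<And>x y. \<bar>f x - f y\<bar> \<le> L * \<bar>x - y\<bar>"
  shows "abs_cont_on S f"
  unfolding abs_cont_on_def
proof (intro allI impI)
  fix e :: real assume e: "0 < e"
  have L0: "0 \<le> L" using L[of 0 1] by simp
  show "\<exists>d>0. \<forall>(n::nat) a b. (\<forall>k<n. a k \<le> b k \<and> {a k..b k} \<subseteq> S) \<and> (\<forall>k<n. \<forall>l<n. k \<noteq> l \<longrightarrow> {a k<..<b k} \<inter> {a l<..<b l} = {}) \<and> (\<Sum>k<n. b k - a k) < d \<longrightarrow> (\<Sum>k<n. \<bar>f (b k) - f (a k)\<bar>) < e"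
  proof (intro exI[of _ "e / (L + 1)"] conjI allI impI, goal_cases)
    case 1
    then show ?case using e L0 by simp
  next
    case (2 n a b)
    have "(\<Sum>k<n. \<bar>f (b k) - f (a k)\<bar>) \<le> (\<Sum>k<n. (L + 1) * (b k - a k))"
    proof (rule sum_mono)
      fix k assume "k \<in> {..<n}"
      then have "a k \<le> b k" using 2 by auto
      then show "\<bar>f (b k) - f (a k)\<bar> \<le> (L + 1) * (b k - a k)"
        using L[of "b k" "a k"] by (simp add: distrib_right)
    qed
    also have "\<dots> = (L + 1) * (\<Sum>k<n. b k - a k)" by (simp add: sum_distrib_left)
    also have "\<dots> < (L + 1) * (e / (L + 1))" using 2 L0 by (intro mult_strict_left_mono) auto
    also have "\<dots> = e" using L0 by simp
    finally show ?case .
  qed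
qed

text \<open>Counterpart of \<open>U_set_energy\<close>: for a piecewise linear path the discrete
  energy is the full energy, the derivative on cell j being N times \<open>d j\<close>.\<close>

lemma pl_path_in_U_set:
  fixes d :: "nat \<Rightarrow> real ^ 'm"
  assumes N: "1 \<le> N" and energy: "real N * (\<Sum>j<N. (norm (d j))\<^sup>2) \<le> 1"
  shows "pl_path N d \<in> U_set"
proof -
  have N0: "0 < real N" using N by simp
  have ac: "abs_cont_on {0..1} (\<lambda>s. pl_path N d s $ i)" for i
  proof (rule abs_cont_on_lipschitz[where L = "\<Sum>j<N. real N * norm (d j)"])
    fix x y
    have "pl_path N d x - pl_path N d y = (\<Sum>j<N. (clamp01 (real N * x - real j) - clamp01 (real N * y - real j)) *\<^sub>R d j)"
      unfolding pl_path_def by (simp add: sum_subtractf scaleR_left_diff_distrib)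
    also have "norm \<dots> \<le> (\<Sum>j<N. (real N * \<bar>x - y\<bar>) * norm (d j))"
    proof (rule sum_norm_le)
      fix j
      have "\<bar>clamp01 (real N * x - real j) - clamp01 (real N * y - real j)\<bar> \<le> \<bar>(real N * x - real j) - (real N * y - real j)\<bar>"
        by (rule clamp01_lipschitz)
      also have "\<dots> = real N * \<bar>x - y\<bar>" using N0 by (simp add: abs_mult right_diff_distrib[symmetric])
      finally show "norm ((clamp01 (real N * x - real j) - clamp01 (real N * y - real j)) *\<^sub>R d j) \<le> (real N * \<bar>x - y\<bar>) * norm (d j)"
        by (simp add: mult_right_mono)
    qed
    also have "\<dots> = (\<Sum>j<N. real N * norm (d j)) * \<bar>x - y\<bar>" by (subst sum_distrib_right) (simp add: mult_ac)
    finally show "\<bar>pl_path N d x $ i - pl_path N d y $ i\<bar> \<le> (\<Sum>j<N. real N * norm (d j)) * \<bar>x - y\<bar>"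
      using component_le_norm_cart[of "pl_path N d x - pl_path N d y" i] by simp
  qed
  define h where "h s = real N *\<^sub>R d (nat \<lfloor>real N * s\<rfloor>)" for s
  have der: "AE s in lborel. s \<in> {0<..<1} \<longrightarrow> (pl_path N d has_vector_derivative h s) (at s)"
  proof (rule AE_I')
    show "(\<lambda>i. real i / real N) ` {..N} \<in> null_sets lborel" by (intro finite_imp_null_set_lborel) auto
    show "{s \<in> space lborel. \<not> (s \<in> {0<..<1} \<longrightarrow> (pl_path N d has_vector_derivative h s) (at s))} \<subseteq> (\<lambda>i. real i / real N) ` {..N}"
    proof
      fix s assume "s \<in> {s \<in> space lborel. \<not> (s \<in> {0<..<1} \<longrightarrow> (pl_path N d has_vector_derivative h s) (at s))}"
      then have s: "0 < s" "s < 1" and nd: "\<not> (pl_path N d has_vector_derivative h s) (at s)" by auto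
      define i where "i = nat \<lfloor>real N * s\<rfloor>"
      have i: "real i \<le> real N * s" "real N * s < real i + 1" unfolding i_def using N0 s by (auto simp: of_nat_nat floor_le_iff)
      have "real N * s < real N * 1" using N0 s by (intro mult_strict_left_mono) auto
      then have iN: "i < N" using i by linarith
      have "s = real i / real N"
      proof (rule ccontr)
        assume "s \<noteq> real i / real N"
        then have lt: "real i < real N * s" using i(1) N0 by (simp add: field_simps)
        have "(pl_path N d has_vector_derivative h s) (at s)"
        proof (rule has_vector_derivative_transform_within_open[where S = "{real i / real N<..<(real i + 1) / real N}"])
          show "((\<lambda>t. (\<Sum>j<i. d j) + (real N * t - real i) *\<^sub>R d i) has_vector_derivative h s) (at s)"
            unfolding h_def i_def[symmetric] by (auto intro!: derivative_eq_intros)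
          show "s \<in> {real i / real N<..<(real i + 1) / real N}" using lt i N0 by (simp add: field_simps)
          show "(\<Sum>j<i. d j) + (real N * t - real i) *\<^sub>R d i = pl_path N d t" if "t \<in> {real i / real N<..<(real i + 1) / real N}" for t
            using that N0 by (intro pl_path_piece[OF iN, symmetric]) (auto simp: field_simps)
        qed simp
        then show False using nd by simp
      qed
      then show "s \<in> (\<lambda>i. real i / real N) ` {..N}" using iN by auto
    qed
  qed
  let ?J = "\<lambda>i. {real i / real N..<(real i + 1) / real N}"
  have "(\<integral>\<^sup>+ s. ennreal (indicator {0..1} s * (norm (h s))\<^sup>2) \<partial>lborel) \<le> (\<integral>\<^sup>+ s. (\<Sum>i<N. ennreal ((real N)\<^sup>2 * (norm (d i))\<^sup>2) * indicator (?J i) s) \<partial>lborel)"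
  proof (rule nn_integral_mono_AE)
    \<comment> \<open>At s = 1 the floor in h is N, outside the range of d controlled by the energy;
      this point is discarded as a null set.\<close>
    have "AE s in lborel. s \<noteq> (1::real)" by (rule AE_lborel_singleton)
    then show "AE s in lborel. ennreal (indicator {0..1} s * (norm (h s))\<^sup>2) \<le> (\<Sum>i<N. ennreal ((real N)\<^sup>2 * (norm (d i))\<^sup>2) * indicator (?J i) s)"
    proof eventually_elim
      fix s :: real assume s1: "s \<noteq> 1"
      show "ennreal (indicator {0..1} s * (norm (h s))\<^sup>2) \<le> (\<Sum>i<N. ennreal ((real N)\<^sup>2 * (norm (d i))\<^sup>2) * indicator (?J i) s)"
      proof (cases "s \<in> {0..1}")
        case True
        then have s: "0 \<le> s" "s < 1" using s1 by auto
        define i where "i = nat \<lfloor>real N * s\<rfloor>"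
        have i: "real i \<le> real N * s" "real N * s < real i + 1" unfolding i_def using N0 s by (auto simp: of_nat_nat floor_le_iff)
        have "real N * s < real N * 1" using N0 s by (intro mult_strict_left_mono) auto
        then have iN: "i < N" using i by linarith
        have "s \<in> ?J i" using i N0 by (simp add: field_simps)
        then have "ennreal (indicator {0..1} s * (norm (h s))\<^sup>2) = ennreal ((real N)\<^sup>2 * (norm (d i))\<^sup>2) * indicator (?J i) s"
          using True by (simp add: h_def i_def power_mult_distrib)
        also have "\<dots> \<le> (\<Sum>i<N. ennreal ((real N)\<^sup>2 * (norm (d i))\<^sup>2) * indicator (?J i) s)"
          using iN by (intro member_le_sum) auto
        finally show ?thesis .
      next
        case False
        then have "indicator {0..1} s = (0::real)" by (rule indicator_simps(2))
        then show ?thesis by simp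
      qed
    qed
  qed
  also have "\<dots> = (\<Sum>i<N. ennreal ((real N)\<^sup>2 * (norm (d i))\<^sup>2) * emeasure lborel (?J i))"
    by (subst nn_integral_sum) (auto simp: nn_integral_cmult)
  also have "\<dots> = (\<Sum>i<N. ennreal (real N * (norm (d i))\<^sup>2))"
  proof (rule sum.cong[OF refl])
    fix i
    have "emeasure lborel (?J i) = ennreal (1 / real N)" using N0 by (simp add: divide_right_mono diff_divide_distrib[symmetric])
    then show "ennreal ((real N)\<^sup>2 * (norm (d i))\<^sup>2) * emeasure lborel (?J i) = ennreal (real N * (norm (d i))\<^sup>2)"
      using N0 by (simp add: ennreal_mult'[symmetric] power2_eq_square)
  qed
  also have "\<dots> = ennreal (real N * (\<Sum>j<N. (norm (d j))\<^sup>2))" by (subst sum_ennreal) (auto simp: sum_distrib_left)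
  also have "\<dots> \<le> 1" using energy by simp
  finally have "(\<integral>\<^sup>+ s. ennreal (indicator {0..1} s * (norm (h s))\<^sup>2) \<partial>lborel) \<le> 1" .
  then show ?thesis unfolding U_set_def using ac der pl_path_0[of N d] by blast
qed

section \<open>Continuity and running means of paths in \<open>U_set\<close>\<close>

lemma U_set_continuous: "f \<in> U_set \<Longrightarrow> continuous_on {0..1} f"
proof (rule uniformly_continuous_imp_continuous, unfold uniformly_continuous_on_def, intro allI impI)
  fix e :: real assume f: "f \<in> U_set" and e: "0 < e"
  have h: "norm (f y - f x) \<le> sqrt \<bar>y - x\<bar>" if "x \<in> {0..1}" "y \<in> {0..1}" for x y
    using U_set_holder[OF f, of x y] U_set_holder[OF f, of y x] that
    by (cases "x \<le> y") (auto simp: norm_minus_commute abs_if)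
  show "\<exists>d>0. \<forall>x\<in>{0..1}. \<forall>x'\<in>{0..1}. dist x' x < d \<longrightarrow> dist (f x') (f x) < e"
  proof (intro exI[of _ "e\<^sup>2"] conjI ballI impI)
    fix x x' :: real assume x: "x \<in> {0..1}" "x' \<in> {0..1}" "dist x' x < e\<^sup>2"
    have "norm (f x' - f x) \<le> sqrt \<bar>x' - x\<bar>" using h x by blast
    also have "\<dots> < sqrt (e\<^sup>2)" using x(3) by (simp only: real_sqrt_less_iff dist_real_def)
    finally show "dist (f x') (f x) < e" using e by (simp add: dist_norm)
  qed (use e in simp)
qed

lemma U_set_0: "f \<in> U_set \<Longrightarrow> f 0 = 0" by (simp add: U_set_def)

lemma U_set_norm_le: "f \<in> U_set \<Longrightarrow> 0 \<le> t \<Longrightarrow> t \<le> 1 \<Longrightarrow> norm (f t) \<le> sqrt t"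
  using U_set_holder[of f 0 t] by (simp add: U_set_0)

lemma gmean_norm_le:
  assumes f: "f \<in> U_set" and t: "0 \<le> t" "t \<le> 1"
  shows "norm (gmean f t) \<le> sqrt t"
proof (cases "t = 0")
  case False
  then have t0: "0 < t" using t by simp
  have "norm (integral (cbox 0 t) f) \<le> sqrt t * measure lborel (cbox 0 t)"
  proof (rule integrable_bound)
    show "f integrable_on cbox 0 t" using U_set_continuous[OF f] t by (intro integrable_continuous) (auto intro: continuous_on_subset)
    show "norm (f x) \<le> sqrt t" if "x \<in> cbox 0 t" for x
    proof -
      have "norm (f x) \<le> sqrt x" using that t by (intro U_set_norm_le[OF f]) auto
      also have "\<dots> \<le> sqrt t" using that by simp
      finally show ?thesis .
    qed
  qed (use t in simp)
  then have "norm (integral {0..t} f) \<le> sqrt t * t" using t by simp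
  then show ?thesis unfolding gmean_def using t0 by (simp add: field_simps)
qed (simp add: gmean_def)

text \<open>Only t = 0 is delicate: there the default value 0 of \<open>gmean\<close> agrees with
  the limit, by the bound sqrt t.\<close>

lemma gmean_continuous:
  assumes f: "f \<in> U_set"
  shows "continuous_on {0..1} (gmean f)"
  unfolding continuous_on_eq_continuous_within
proof
  fix t :: real assume t: "t \<in> {0..1}"
  show "continuous (at t within {0..1}) (gmean f)"
  proof (cases "t = 0")
    case True
    have "((\<lambda>s. gmean f s) \<longlongrightarrow> 0) (at 0 within {0..1})"
    proof (rule Lim_null_comparison)
      show "eventually (\<lambda>s. norm (gmean f s) \<le> sqrt s) (at 0 within {0..1})"
        unfolding eventually_at by (intro exI[of _ 1]) (auto intro: gmean_norm_le[OF f])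
      show "((\<lambda>s. sqrt s) \<longlongrightarrow> 0) (at 0 within {0..1})"
        by (rule tendsto_eq_intros refl tendsto_ident_at)+ simp
    qed
    moreover have "gmean f 0 = 0" by (simp add: gmean_def)
    ultimately show ?thesis unfolding True continuous_within by simp
  next
    case False
    then have t0: "0 < t" using t by simp
    have i: "f integrable_on {0..1}" using U_set_continuous[OF f] by (rule integrable_continuous_real)
    have "continuous (at t within {0..1}) (\<lambda>s. (1 / s) *\<^sub>R integral {0..s} f)"
      using indefinite_integral_continuous_1[OF i] t t0 by (intro continuous_intros) (auto simp: continuous_on_eq_continuous_within)
    moreover have "eventually (\<lambda>s. gmean f s = (1 / s) *\<^sub>R integral {0..s} f) (at t within {0..1})"
      unfolding eventually_at by (intro exI[of _ t]) (use t0 in \<open>auto simp: gmean_def dist_real_def\<close>)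
    ultimately show ?thesis
      unfolding continuous_within using t0 by (subst filterlim_cong[OF refl refl]) (auto simp: gmean_def)
  qed
qed

text \<open>Right end points are used because the discrete means start at index 1. The error keeps
  the factor k / n, which \<open>gmean_discrete\<close> relies on.\<close>

lemma integral_riemann_U_set:
  assumes f: "f \<in> U_set" and n: "1 \<le> n" and k: "k \<le> n"
  shows "norm (integral {0..real k / real n} f - (\<Sum>i<k. (1 / real n) *\<^sub>R f (real (i + 1) / real n))) \<le> real k / real n * sqrt (1 / real n)"
  using k
proof (induction k)
  case (Suc k)
  have n0: "0 < real n" using n by simp
  let ?a = "real k / real n" and ?b = "real (k + 1) / real n"
  have ab: "0 \<le> ?a" "?a \<le> ?b" "?b \<le> 1" "?b - ?a = 1 / real n" using n0 Suc.prems by (auto simp: field_simps)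
  have i: "f integrable_on {s..t}" if "0 \<le> s" "t \<le> 1" for s t
    using that by (intro integrable_continuous_real continuous_on_subset[OF U_set_continuous[OF f]]) auto
  have c: "integral {0..?b} f = integral {0..?a} f + integral {?a..?b} f"
    using ab by (intro Henstock_Kurzweil_Integration.integral_combine[symmetric] i) auto
  have "integral {?a..?b} f - (1 / real n) *\<^sub>R f ?b = integral (cbox ?a ?b) (\<lambda>x. f x - f ?b)"
    using i[of ?a ?b] ab by (subst integral_diff) auto
  also have "norm \<dots> \<le> sqrt (1 / real n) * measure lborel (cbox ?a ?b)"
  proof (rule integrable_bound)
    show "(\<lambda>x. f x - f ?b) integrable_on cbox ?a ?b" using i[of ?a ?b] ab by (intro integrable_diff) auto
    show "norm (f x - f ?b) \<le> sqrt (1 / real n)" if "x \<in> cbox ?a ?b" for x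
    proof -
      have "norm (f ?b - f x) \<le> sqrt (?b - x)" using that by (intro U_set_holder[OF f order_trans[OF ab(1)] _ ab(3)]) auto
      also have "\<dots> \<le> sqrt (1 / real n)" using that ab(4) by (intro real_sqrt_le_mono) auto
      finally show ?thesis by (simp add: norm_minus_commute)
    qed
  qed simp
  also have "\<dots> = 1 / real n * sqrt (1 / real n)" using ab by simp
  finally have st: "norm (integral {?a..?b} f - (1 / real n) *\<^sub>R f ?b) \<le> 1 / real n * sqrt (1 / real n)" .
  have "integral {0..real (Suc k) / real n} f - (\<Sum>i<Suc k. (1 / real n) *\<^sub>R f (real (i + 1) / real n))
    = (integral {0..?a} f - (\<Sum>i<k. (1 / real n) *\<^sub>R f (real (i + 1) / real n))) + (integral {?a..?b} f - (1 / real n) *\<^sub>R f ?b)"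
    using c by simp
  also have "norm \<dots> \<le> real k / real n * sqrt (1 / real n) + 1 / real n * sqrt (1 / real n)"
    using Suc by (intro norm_triangle_mono st) auto
  also have "\<dots> = real (Suc k) / real n * sqrt (1 / real n)" by (simp add: add_divide_distrib algebra_simps)
  finally show ?case .
qed simp

text \<open>Dividing by k / n could magnify errors for small k; since the Riemann error is itself
  proportional to k / n, the bound is uniform in k.\<close>

lemma gmean_discrete:
  assumes f: "f \<in> U_set" and n: "1 \<le> n" and k: "1 \<le> k" "k \<le> n"
    and x: "\<And>i. 1 \<le> i \<Longrightarrow> i \<le> n \<Longrightarrow> norm (x i - r *\<^sub>R f (real i / real n)) \<le> \<delta>" and r: "0 \<le> r"
  shows "norm ((1 / real k) *\<^sub>R (\<Sum>i\<in>{1..k}. x i) - r *\<^sub>R gmean f (real k / real n)) \<le> \<delta> + r * sqrt (1 / real n)"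
proof -
  have n0: "0 < real n" "0 < real k" using n k by auto
  have sx: "(\<Sum>i\<in>{1..k}. x i) = (\<Sum>i<k. x (i + 1))"
    by (rule sum.reindex_bij_witness[where i = "\<lambda>i. i + 1" and j = "\<lambda>i. i - 1"]) auto
  let ?R = "\<Sum>i<k. (1 / real n) *\<^sub>R f (real (i + 1) / real n)"
  let ?I = "integral {0..real k / real n} f"
  have "gmean f (real k / real n) = (real n / real k) *\<^sub>R ?I" unfolding gmean_def using n0 by simp
  then have "(1 / real k) *\<^sub>R (\<Sum>i\<in>{1..k}. x i) - r *\<^sub>R gmean f (real k / real n)
    = (1 / real k) *\<^sub>R (\<Sum>i<k. x (i + 1) - r *\<^sub>R f (real (i + 1) / real n)) + (- (r * real n / real k)) *\<^sub>R (?I - ?R)"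
    unfolding sx using n0 by (simp add: sum_subtractf scaleR_right_diff_distrib scaleR_sum_right[symmetric])
  also have "norm \<dots> \<le> 1 / real k * (real k * \<delta>) + r * real n / real k * (real k / real n * sqrt (1 / real n))"
  proof (rule norm_triangle_mono)
    have "norm (\<Sum>i<k. x (i + 1) - r *\<^sub>R f (real (i + 1) / real n)) \<le> (\<Sum>i<k. \<delta>)"
      using k by (intro sum_norm_le x) auto
    then show "norm ((1 / real k) *\<^sub>R (\<Sum>i<k. x (i + 1) - r *\<^sub>R f (real (i + 1) / real n))) \<le> 1 / real k * (real k * \<delta>)"
      using n0 by (simp add: field_simps)
    have "norm ((- (r * real n / real k)) *\<^sub>R (?I - ?R)) = r * real n / real k * norm (?I - ?R)" using r n0 by simp
    also have "\<dots> \<le> r * real n / real k * (real k / real n * sqrt (1 / real n))"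
      using r n0 by (intro mult_left_mono integral_riemann_U_set[OF f n k(2)]) auto
    finally show "norm ((- (r * real n / real k)) *\<^sub>R (?I - ?R)) \<le> r * real n / real k * (real k / real n * sqrt (1 / real n))" .
  qed
  also have "\<dots> = \<delta> + r * sqrt (1 / real n)" using n0 by simp
  finally show ?thesis .
qed

section \<open>Volumes of linear images and of convex hulls\<close>

lemma nn_integral_lborel_shift:
  fixes g :: "'a::euclidean_space \<Rightarrow> ennreal"
  assumes [measurable]: "g \<in> borel_measurable borel"
  shows "(\<integral>\<^sup>+x. g (x + a) \<partial>lborel) = (\<integral>\<^sup>+x. g x \<partial>lborel)"
proof -
  have "(\<integral>\<^sup>+x. g x \<partial>lborel) = (\<integral>\<^sup>+x. g x \<partial>distr lborel borel ((+) a))" by (simp add: lborel_distr_plus)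
  also have "\<dots> = (\<integral>\<^sup>+x. g (a + x) \<partial>lborel)" by (rule nn_integral_distr) auto
  finally show ?thesis by (simp add: add.commute)
qed

lemma nn_integral_lborel_uminus:
  fixes g :: "'a::euclidean_space \<Rightarrow> ennreal"
  assumes [measurable]: "g \<in> borel_measurable borel"
  shows "(\<integral>\<^sup>+x. g (- x) \<partial>lborel) = (\<integral>\<^sup>+x. g x \<partial>lborel)"
proof -
  have "lborel = density (distr lborel borel (\<lambda>x::'a. 0 + (-1) *\<^sub>R x)) (\<lambda>_. ennreal (\<bar>-1\<bar> ^ DIM('a)))"
    by (rule lborel_affine) simp
  also have "\<dots> = distr lborel borel uminus" by (simp add: density_1)
  finally have "(\<integral>\<^sup>+x. g x \<partial>lborel) = (\<integral>\<^sup>+x. g x \<partial>distr lborel borel uminus)" by (rule arg_cong)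
  also have "\<dots> = (\<integral>\<^sup>+x. g (- x) \<partial>lborel)" by (rule nn_integral_distr) auto
  finally show ?thesis ..
qed

text \<open>Uniqueness of Haar measure for the pull-back of Lebesgue measure under a linear isomorphism,
  via Tonelli; the two Euclidean spaces may be different types.\<close>

lemma lborel_vimage_ratio:
  fixes L :: "'a::euclidean_space \<Rightarrow> 'b::euclidean_space" and L' :: "'b \<Rightarrow> 'a"
  assumes lin: "linear L'" and LL: "\<And>x. L' (L x) = x"
    and S[measurable]: "S \<in> sets borel" and T[measurable]: "T \<in> sets borel"
  shows "emeasure lborel (L' -` S) * emeasure lborel T = emeasure lborel (L' -` T) * emeasure lborel S"
proof -
  have [measurable]: "L' \<in> borel_measurable borel"
    using lin by (intro borel_measurable_continuous_onI linear_continuous_on linear_conv_bounded_linear[THEN iffD1])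
  have pre: "(\<integral>\<^sup>+w. indicator U (L' w) \<partial>lborel) = emeasure lborel (L' -` U)" if [measurable]: "U \<in> sets borel" for U
  proof -
    have "(\<integral>\<^sup>+w. indicator U (L' w) \<partial>lborel) = (\<integral>\<^sup>+w. indicator (L' -` U) w \<partial>lborel)"
      by (intro nn_integral_cong) (auto simp: indicator_def)
    moreover have "L' -` U \<in> sets borel" using measurable_sets[of L' borel borel U] by simp
    ultimately show ?thesis by simp
  qed
  have ind: "(\<integral>\<^sup>+x. indicator U (x + a) \<partial>lborel) = emeasure lborel U" if [measurable]: "U \<in> sets borel" for U :: "'a set" and a
    by (subst nn_integral_lborel_shift) auto
  have "emeasure lborel (L' -` S) * emeasure lborel T = (\<integral>\<^sup>+w. indicator S (L' w) * emeasure lborel T \<partial>lborel)"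
    by (subst nn_integral_multc) (auto simp: pre)
  also have "\<dots> = (\<integral>\<^sup>+w. (\<integral>\<^sup>+x. indicator S (L' w) * indicator T (x + L' w) \<partial>lborel) \<partial>lborel)"
    by (intro nn_integral_cong) (simp add: nn_integral_cmult ind)
  also have "\<dots> = (\<integral>\<^sup>+x. (\<integral>\<^sup>+w. indicator S (L' w) * indicator T (x + L' w) \<partial>lborel) \<partial>lborel)"
    by (rule lborel_pair.Fubini') measurable
  also have "\<dots> = (\<integral>\<^sup>+x. (\<integral>\<^sup>+w. indicator S (- L' w - x) * indicator T (- L' w) \<partial>lborel) \<partial>lborel)"
  proof (rule nn_integral_cong)
    fix x
    let ?h = "\<lambda>w. indicator S (L' w) * indicator T (x + L' w) :: ennreal"
    have "(\<integral>\<^sup>+w. ?h w \<partial>lborel) = (\<integral>\<^sup>+w. ?h (- w) \<partial>lborel)"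
      by (rule nn_integral_lborel_uminus[symmetric, where g = ?h]) measurable
    \<comment> \<open>Replacing w by - (w + L x) moves x from the argument of T into that of S, so
      that a second exchange of integrals separates the two indicators.\<close>
    also have "\<dots> = (\<integral>\<^sup>+w. ?h (- (w + L x)) \<partial>lborel)" by (rule nn_integral_lborel_shift[symmetric, where g = "\<lambda>w. ?h (- w)"]) measurable
    also have "\<dots> = (\<integral>\<^sup>+w. indicator S (- L' w - x) * indicator T (- L' w) \<partial>lborel)"
      by (simp add: linear_diff[OF lin] linear_neg[OF lin] linear_add[OF lin] LL algebra_simps)
    finally show "(\<integral>\<^sup>+w. ?h w \<partial>lborel) = (\<integral>\<^sup>+w. indicator S (- L' w - x) * indicator T (- L' w) \<partial>lborel)" by simp
  qed
  also have "\<dots> = (\<integral>\<^sup>+w. (\<integral>\<^sup>+x. indicator S (- L' w - x) * indicator T (- L' w) \<partial>lborel) \<partial>lborel)"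
    by (rule lborel_pair.Fubini'[symmetric]) measurable
  also have "\<dots> = (\<integral>\<^sup>+w. emeasure lborel S * indicator T (- L' w) \<partial>lborel)"
  proof (rule nn_integral_cong)
    fix w
    have "(\<integral>\<^sup>+x. indicator S (- L' w - x) \<partial>lborel) = (\<integral>\<^sup>+x. indicator S (- (x + L' w)) \<partial>lborel)"
      by (intro nn_integral_cong arg_cong[where f = "indicator S"]) simp
    also have "\<dots> = (\<integral>\<^sup>+x. indicator S (- x) \<partial>lborel)" by (rule nn_integral_lborel_shift[where g = "\<lambda>x. indicator S (- x)"]) measurable
    also have "\<dots> = emeasure lborel S" by (subst nn_integral_lborel_uminus) auto
    finally show "(\<integral>\<^sup>+x. indicator S (- L' w - x) * indicator T (- L' w) \<partial>lborel) = emeasure lborel S * indicator T (- L' w)"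
      by (subst nn_integral_multc) auto
  qed
  also have "\<dots> = emeasure lborel S * (\<integral>\<^sup>+w. indicator T (L' (- w)) \<partial>lborel)"
    by (subst nn_integral_cmult) (auto simp: linear_neg[OF lin])
  also have "(\<integral>\<^sup>+w. indicator T (L' (- w)) \<partial>lborel) = (\<integral>\<^sup>+w. indicator T (L' w) \<partial>lborel)"
    by (rule nn_integral_lborel_uminus[where g = "\<lambda>w. indicator T (L' w)"]) measurable
  finally show ?thesis by (simp add: pre mult.commute)
qed

text \<open>Division-free way to say that L multiplies all volumes by one factor; evaluating a
  convenient test body T identifies the factor.\<close>

lemma measure_linear_image_ratio:
  fixes L :: "'a::euclidean_space \<Rightarrow> 'b::euclidean_space" and L' :: "'b \<Rightarrow> 'a"
  assumes lin: "linear L" "linear L'" and LL: "\<And>x. L' (L x) = x" "\<And>y. L (L' y) = y"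
    and S: "compact S" and T: "compact T"
  shows "measure lborel (L ` S) * measure lborel T = measure lborel (L ` T) * measure lborel S"
proof -
  have im: "L ` U = L' -` U" for U using LL by (auto simp: image_def) metis
  have cL: "compact (L ` U)" if "compact U" for U
    using that lin(1) by (intro compact_continuous_image linear_continuous_on linear_conv_bounded_linear[THEN iffD1])
  have e: "emeasure lborel U = ennreal (measure lborel U)" if "compact U" for U :: "'c::euclidean_space set"
    using emeasure_compact_finite[OF that] by (simp add: emeasure_eq_ennreal_measure)
  have "emeasure lborel (L ` S) * emeasure lborel T = emeasure lborel (L ` T) * emeasure lborel S"
    unfolding im using S T by (intro lborel_vimage_ratio[OF lin(2) LL(1)]) (auto simp: borel_compact)
  then show ?thesis using S T cL by (simp add: e ennreal_mult'[symmetric])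
qed

text \<open>The unit ball serves as test body: L maps ball onto ball, and the volume of the ball
  depends only on the dimension.\<close>

lemma measure_isometry_image:
  fixes L :: "'a::euclidean_space \<Rightarrow> 'b::euclidean_space" and L' :: "'b \<Rightarrow> 'a"
  assumes lin: "linear L" "linear L'" and LL: "\<And>x. L' (L x) = x" "\<And>y. L (L' y) = y"
    and iso: "\<And>x. norm (L x) = norm x" and dim: "DIM('a) = DIM('b)" and S: "compact S"
  shows "measure lborel (L ` S) = measure lborel S"
proof -
  have b: "L ` cball 0 1 = cball 0 1"
  proof
    show "L ` cball 0 1 \<subseteq> cball 0 1" using iso by auto
    show "cball 0 1 \<subseteq> L ` cball 0 1"
    proof
      fix y :: 'b assume "y \<in> cball 0 1"
      then have "L' y \<in> cball 0 1" using iso[of "L' y"] LL by simp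
      then show "y \<in> L ` cball 0 1" using LL(2)[of y] by (metis imageI)
    qed
  qed
  have v: "measure lborel (cball 0 1 :: 'b set) = measure lborel (cball 0 1 :: 'a set)"
    using content_cball[of 1 "0 :: 'a"] content_cball[of 1 "0 :: 'b"] dim by simp
  have p: "0 < measure lborel (cball 0 1 :: 'a set)"
    using content_cball_pos[of 1 "0::'a"] by simp
  have "measure lborel (L ` S) * measure lborel (cball 0 1 :: 'a set) = measure lborel (L ` cball 0 1) * measure lborel S"
    by (rule measure_linear_image_ratio[OF lin LL S]) auto
  then show ?thesis unfolding b v using p by simp
qed

text \<open>\<open>measure_linear_image\<close> of the library is restricted to well-ordered index types.\<close>

lemma measure_linear_image_det:
  fixes f :: "real ^ 'm \<Rightarrow> real ^ 'm"
  assumes "linear f" and "compact S"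
  shows "measure lborel (f ` S) = \<bar>det (matrix f)\<bar> * measure lborel S"
proof -
  let ?P = "\<lambda>f :: real ^ 'm \<Rightarrow> real ^ 'm. linear f \<and> (\<forall>S. compact S \<longrightarrow> measure lborel (f ` S) = \<bar>det (matrix f)\<bar> * measure lborel S)"
  have cpt: "compact (f ` S)" if "linear f" "compact S" for f :: "real ^ 'm \<Rightarrow> real ^ 'm" and S
    using that by (intro compact_continuous_image linear_continuous_on linear_conv_bounded_linear[THEN iffD1])
  have zero: "?P f" if lin: "linear f" and z: "\<And>x. f x $ i = 0" for f :: "real ^ 'm \<Rightarrow> real ^ 'm" and i
  proof (intro conjI allI impI lin)
    fix S :: "(real ^ 'm) set" assume S: "compact S"
    have "f ` S \<subseteq> {x. axis i 1 \<bullet> x = 0}" using z by (auto simp: inner_axis')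
    moreover have "negligible {x :: real ^ 'm. axis i 1 \<bullet> x = 0}" by (rule negligible_hyperplane) (simp add: axis_eq_0_iff)
    ultimately have "negligible (f ` S)" by (rule negligible_subset[rotated])
    then have "measure lebesgue (f ` S) = 0" by (rule negligible_imp_measure0)
    then have m: "measure lborel (f ` S) = 0" using cpt[OF lin S] by (simp add: borel_compact measure_completion)
    have "row i (matrix f) = 0" using z by (simp add: vec_eq_iff row_def matrix_def)
    then have "det (matrix f) = 0" by (rule det_zero_row)
    then show "measure lborel (f ` S) = \<bar>det (matrix f)\<bar> * measure lborel S" using m by simp
  qed
  have "?P f"
  proof (rule induct_linear_elementary[where P = ?P, OF assms(1)])
    fix f g :: "real ^ 'm \<Rightarrow> real ^ 'm" assume fg: "linear f" "linear g" "?P f" "?P g"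
    have "measure lborel ((f \<circ> g) ` S) = \<bar>det (matrix (f \<circ> g))\<bar> * measure lborel S" if S: "compact S" for S
    proof -
      have "measure lborel (f ` (g ` S)) = \<bar>det (matrix f)\<bar> * measure lborel (g ` S)" using fg(3) cpt[OF fg(2) S] by blast
      moreover have "measure lborel (g ` S) = \<bar>det (matrix g)\<bar> * measure lborel S" using fg(4) S by blast
      ultimately show ?thesis using fg(1,2) by (simp add: image_comp matrix_compose det_mul abs_mult)
    qed
    then show "?P (f \<circ> g)" using fg linear_compose by blast
  next
    fix f :: "real ^ 'm \<Rightarrow> real ^ 'm" and i assume "linear f" "\<And>x. f x $ i = 0"
    then show "?P f" by (rule zero)
  next
    fix c :: "'m \<Rightarrow> real"
    let ?f = "\<lambda>x :: real ^ 'm. \<chi> i. c i * x $ i"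
    have lin: "linear ?f" by (auto simp: linear_iff vec_eq_iff algebra_simps)
    show "?P ?f"
    proof (cases "\<forall>i. c i \<noteq> 0")
      case False
      then obtain i where "c i = 0" by blast
      then show ?thesis by (intro zero[OF lin, of i]) simp
    next
      case True
      have m: "matrix ?f $ i $ j = (if i = j then c i else 0)" for i j by (simp add: matrix_def axis_def)
      have d: "det (matrix ?f) = (\<Prod>i\<in>UNIV. c i)" by (subst det_diagonal) (auto simp: m)
      have "measure lborel (?f ` S) = \<bar>det (matrix ?f)\<bar> * measure lborel S" if S: "compact S" for S
      proof -
        define C where "C b = c (THE i. b = axis i 1)" for b :: "real ^ 'm"
        have C: "C (axis i 1) = c i" for i unfolding C_def by (rule arg_cong[where f=c], rule the_equality) (auto simp: axis_eq_axis)
        have B: "(\<Prod>b\<in>Basis. \<bar>C b\<bar>) = (\<Prod>i\<in>UNIV. \<bar>c i\<bar>)"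
          unfolding Basis_vec_def by (simp add: prod.reindex inj_on_def axis_eq_axis C image_image[symmetric] UNION_singleton_eq_range)
        have T: "(\<lambda>x. 0 + (\<Sum>b\<in>Basis. (C b * (x \<bullet> b)) *\<^sub>R b)) = ?f"
        proof
          fix x :: "real ^ 'm"
          have "(\<Sum>b\<in>Basis. (C b * (x \<bullet> b)) *\<^sub>R b) = (\<Sum>i\<in>UNIV. (c i * x $ i) *\<^sub>R axis i 1)"
            unfolding Basis_vec_def by (simp add: sum.reindex inj_on_def axis_eq_axis C UNION_singleton_eq_range inner_axis)
          also have "\<dots> = ?f x" by (simp add: vec_eq_iff axis_def if_distrib cong: if_cong)
          finally show "0 + (\<Sum>b\<in>Basis. (C b * (x \<bullet> b)) *\<^sub>R b) = ?f x" by simp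
        qed
        have nz: "\<And>b. b \<in> Basis \<Longrightarrow> C b \<noteq> 0" unfolding Basis_vec_def using True by (auto simp: C)
        have inj: "inj ?f" using True by (auto simp: inj_def vec_eq_iff)
        have fm: "?f \<in> borel \<rightarrow>\<^sub>M borel" using lin by (intro borel_measurable_continuous_onI linear_continuous_on linear_conv_bounded_linear[THEN iffD1])
        have fS: "?f ` S \<in> sets borel" using cpt[OF lin S] by (rule borel_compact)
        have "emeasure lborel (?f ` S) = emeasure (density (distr lborel borel ?f) (\<lambda>_. (\<Prod>b\<in>Basis. \<bar>C b\<bar>))) (?f ` S)"
          using lborel_affine_euclidean[where c = C and t = 0, OF nz] unfolding T by simp
        also have "\<dots> = ennreal (\<Prod>b\<in>Basis. \<bar>C b\<bar>) * emeasure (distr lborel borel ?f) (?f ` S)"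
          using fS by (subst emeasure_density_const) auto
        also have "emeasure (distr lborel borel ?f) (?f ` S) = emeasure lborel (?f -` (?f ` S))"
          using fm fS by (subst emeasure_distr) auto
        also have "?f -` (?f ` S) = S" using inj by (rule inj_vimage_image_eq)
        finally have "emeasure lborel (?f ` S) = ennreal \<bar>det (matrix ?f)\<bar> * emeasure lborel S"
          unfolding B d by (simp add: abs_prod)
        then show ?thesis unfolding measure_def by (simp add: enn2real_mult)
      qed
      then show ?thesis using lin by blast
    qed
  next
    fix m n :: 'm assume mn: "m \<noteq> n"
    let ?f = "\<lambda>x :: real ^ 'm. \<chi> i. x $ Transposition.transpose m n i"
    have lin: "linear ?f" by (auto simp: linear_iff vec_eq_iff)
    have inv: "?f (?f x) = x" for x by (simp add: vec_eq_iff)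
    have nrm: "norm (?f x) = norm x" for x
    proof -
      have "(\<Sum>i\<in>UNIV. (x $ Transposition.transpose m n i)\<^sup>2) = (\<Sum>i\<in>UNIV. (x $ i)\<^sup>2)"
        by (rule sum.reindex_bij_betw[OF bij_transpose[unfolded bij_betw_def[symmetric]]])
      then show ?thesis by (simp add: norm_vec_def L2_set_def)
    qed
    have "orthogonal_transformation ?f" unfolding orthogonal_transformation using lin nrm by blast
    then have "\<bar>det (matrix ?f)\<bar> = 1" by (rule orthogonal_transformation_det)
    moreover have "measure lborel (?f ` S) = measure lborel S" if "compact S" for S
      by (rule measure_isometry_image[OF lin lin inv inv nrm refl that])
    ultimately show "?P ?f" using lin by simp
  next
    fix m n :: 'm assume mn: "m \<noteq> n"
    let ?f = "\<lambda>x :: real ^ 'm. \<chi> i. if i = m then x $ m + x $ n else x $ i"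
    let ?g = "\<lambda>x :: real ^ 'm. \<chi> i. if i = m then x $ m - x $ n else x $ i"
    let ?D = "\<lambda>x :: real ^ 'm. \<chi> i. if i = m then - x $ m else x $ i"
    have lin: "linear ?f" "linear ?g" "linear ?D" by (auto simp: linear_iff vec_eq_iff algebra_simps)
    \<comment> \<open>The last identity carries the shear case: conjugating the shear by a
      reflection gives its inverse. Hence both scale the ball by the same factor, and since their
      composition is the identity, this factor is 1.\<close>
    have fg: "?f (?g x) = x" "?g (?f x) = x" "?D (?D x) = x" "?D (?f (?D x)) = ?g x" for x using mn by (auto simp: vec_eq_iff)
    have nD: "norm (?D x) = norm x" for x
      unfolding norm_vec_def L2_set_def by (intro arg_cong[where f = sqrt] sum.cong) auto
    have D: "measure lborel (?D ` S) = measure lborel S" if "compact S" for S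
      by (rule measure_isometry_image[OF lin(3) lin(3) fg(3) fg(3) nD refl that])
    let ?B = "cball 0 1 :: (real ^ 'm) set"
    have p: "0 < measure lborel ?B" using content_cball_pos[of 1 "0::real^'m"] by simp
    have DB: "?D ` ?B = ?B"
    proof
      show "?D ` ?B \<subseteq> ?B" by (rule image_subsetI) (simp only: mem_cball_0 nD)
      show "?B \<subseteq> ?D ` ?B"
      proof
        fix y assume "y \<in> ?B"
        then have "?D y \<in> ?B" using nD[of y] by simp
        from imageI[OF this, of ?D] show "y \<in> ?D ` ?B" unfolding fg(3) .
      qed
    qed
    have gB: "?g ` ?B = ?D ` (?f ` ?B)"
    proof -
      have "?D ` (?f ` ?B) = ?D ` (?f ` (?D ` ?B))" unfolding DB ..
      also have "\<dots> = ?g ` ?B" unfolding image_image fg(4) ..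
      finally show ?thesis ..
    qed
    have "measure lborel (?f ` (?g ` ?B)) * measure lborel ?B = measure lborel (?f ` ?B) * measure lborel (?g ` ?B)"
      by (rule measure_linear_image_ratio[OF lin(1,2) fg(2,1) cpt[OF lin(2)]]) auto
    moreover have "?f ` (?g ` ?B) = ?B" unfolding image_image fg(1) by simp
    moreover have "measure lborel (?g ` ?B) = measure lborel (?f ` ?B)" unfolding gB by (intro D cpt lin) auto
    ultimately have "(measure lborel (?f ` ?B))\<^sup>2 = (measure lborel ?B)\<^sup>2" by (simp add: power2_eq_square)
    then have fB: "measure lborel (?f ` ?B) = measure lborel ?B" by (simp add: power2_eq_iff_nonneg)
    have mf: "measure lborel (?f ` S) = measure lborel S" if "compact S" for S
    proof -
      have "measure lborel (?f ` S) * measure lborel ?B = measure lborel (?f ` ?B) * measure lborel S"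
        by (rule measure_linear_image_ratio[OF lin(1,2) fg(2,1) that]) auto
      then show ?thesis using p unfolding fB by simp
    qed
    have "matrix ?f = (\<chi> k. if k = m then row m (mat 1) + 1 *s row n (mat 1) else row k (mat 1 :: real ^ 'm ^ 'm))"
      by (auto simp: matrix_def vec_eq_iff axis_def row_def mat_def)
    then have "det (matrix ?f) = 1" using det_row_operation[OF mn, of "mat 1 :: real ^ 'm ^ 'm" 1] by simp
    then show "?P ?f" using mf lin by simp
  qed
  then show ?thesis using assms(2) by blast
qed

section \<open>Volume of enlarged convex sets\<close>

lemma emeasure_lborel_translate:
  fixes E :: "'a::euclidean_space set"
  assumes E: "E \<in> sets borel"
  shows "emeasure lborel ((+) a ` E) = emeasure lborel E" "(+) a ` E \<in> sets borel"
proof -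
  have im: "(+) a ` E = (+) (- a) -` E"
  proof (intro equalityI subsetI)
    fix x assume "x \<in> (+) (- a) -` E"
    then have "a + (- a + x) \<in> (+) a ` E" by (intro imageI) simp
    then show "x \<in> (+) a ` E" by simp
  qed auto
  show "(+) a ` E \<in> sets borel" unfolding im using measurable_sets[of "(+) (- a)" borel borel E] E by auto
  have "emeasure lborel E = emeasure (distr lborel borel ((+) (- a))) E" by (simp only: lborel_distr_plus)
  also have "\<dots> = emeasure lborel ((+) (- a) -` E)" using E by (subst emeasure_distr) auto
  finally show "emeasure lborel ((+) a ` E) = emeasure lborel E" unfolding im ..
qed

lemma emeasure_lborel_bounded:
  fixes S :: "'a::euclidean_space set"
  assumes "S \<subseteq> cball 0 r"
  shows "emeasure lborel S = ennreal (measure lborel S)"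
proof -
  have "emeasure lborel S \<le> emeasure lborel (cball (0::'a) r)" using assms by (intro emeasure_mono) auto
  also have "\<dots> < \<infinity>" by (rule emeasure_compact_finite) simp
  finally show ?thesis by (intro emeasure_eq_ennreal_measure) auto
qed

text \<open>If \<open>E\<close> is the part of \<open>C + [0, \<delta>] e\<close> outside the convex set \<open>C\<close>, then convexity makes the
  translates of \<open>E\<close> by multiples of \<open>\<delta> e\<close> disjoint; about \<open>R / \<delta>\<close> of them fit into a
  bounded set, so \<open>E\<close> has volume of order \<open>\<delta>\<close>.\<close>

lemma measure_add_segment:
  fixes C :: "'a::euclidean_space set"
  assumes C: "convex C" "compact C" "C \<subseteq> cball 0 R" and \<delta>: "0 < \<delta>" "\<delta> \<le> R" and e: "norm e = 1"
  defines "D \<equiv> (\<lambda>(p, s). p + s *\<^sub>R e) ` (C \<times> {0..\<delta>})"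
  shows "convex D" "compact D" "D \<subseteq> cball 0 (R + \<delta>)"
    "measure lborel D \<le> measure lborel C + measure lborel (cball (0::'a) (4 * R)) / R * \<delta>"
proof -
  have lin: "linear (\<lambda>(p, s). p + s *\<^sub>R e)" by (auto simp: linear_iff algebra_simps)
  show "convex D" unfolding D_def using C by (intro convex_linear_image[OF lin] convex_Times) auto
  show cD: "compact D" unfolding D_def using C lin
    by (intro compact_continuous_image linear_continuous_on compact_Times) (auto simp: linear_conv_bounded_linear)
  show DR: "D \<subseteq> cball 0 (R + \<delta>)"
  proof
    fix x assume "x \<in> D"
    then obtain p s where x: "x = p + s *\<^sub>R e" "p \<in> C" "s \<in> {0..\<delta>}" unfolding D_def by auto
    have "norm x \<le> norm p + norm (s *\<^sub>R e)" unfolding x by (rule norm_triangle_ineq)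
    also have "\<dots> \<le> R + \<delta>" using x C(3) e by (intro add_mono) auto
    finally show "x \<in> cball 0 (R + \<delta>)" by simp
  qed
  define E where "E = D - C"
  have bE: "E \<in> sets borel" unfolding E_def using cD C(2) by (intro sets.Diff borel_compact)
  define n where "n = nat \<lceil>R / \<delta>\<rceil>"
  have n: "R \<le> real n * \<delta>" "real n * \<delta> \<le> R + \<delta>"
  proof -
    have "0 \<le> R / \<delta>" using \<delta> by simp
    then have "R / \<delta> \<le> real n" "real n \<le> R / \<delta> + 1" unfolding n_def by linarith+
    then show "R \<le> real n * \<delta>" "real n * \<delta> \<le> R + \<delta>" using \<delta>
      by (auto simp: field_simps)
  qed
  define T where "T k = (+) ((real k * \<delta>) *\<^sub>R e) ` E" for k
  have disj1: "T j \<inter> T k = {}" if jk: "j < k" for j k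
  proof (rule ccontr)
    assume "T j \<inter> T k \<noteq> {}"
    then obtain p q where pq: "p \<in> E" "q \<in> E" "(real j * \<delta>) *\<^sub>R e + p = (real k * \<delta>) *\<^sub>R e + q" unfolding T_def by auto
    obtain c1 s1 where 1: "p = c1 + s1 *\<^sub>R e" "c1 \<in> C" "0 \<le> s1" "s1 \<le> \<delta>" using pq(1) unfolding E_def D_def by auto
    obtain c0 s0 where 0: "q = c0 + s0 *\<^sub>R e" "c0 \<in> C" "0 \<le> s0" using pq(2) unfolding E_def D_def by auto
    \<comment> \<open>q lies on the segment from \<open>c0 = q - s0 *\<^sub>R e\<close> to
      \<open>c1 = q + \<alpha> *\<^sub>R e\<close>, whose ends are in C. Convexity puts q into C,
      against q in E.\<close>
    define \<alpha> where "\<alpha> = (real k - real j) * \<delta> - s1"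
    have \<alpha>: "0 \<le> \<alpha>"
    proof -
      have "1 * \<delta> \<le> (real k - real j) * \<delta>" using jk \<delta> by (intro mult_right_mono) auto
      then show ?thesis unfolding \<alpha>_def using 1 by simp
    qed
    have c1: "c1 = q + \<alpha> *\<^sub>R e" using pq(3) 1(1) unfolding \<alpha>_def by (simp add: algebra_simps)
    have "q \<in> C"
    proof (cases "\<alpha> + s0 = 0")
      case True
      then have "s0 = 0" using \<alpha> 0 by linarith
      then show ?thesis using 0 by simp
    next
      case False
      then have pos: "0 < \<alpha> + s0" using \<alpha> 0 by linarith
      have "(s0 / (\<alpha> + s0)) *\<^sub>R c1 + (\<alpha> / (\<alpha> + s0)) *\<^sub>R c0 \<in> C"
        using C(1) 1 0 \<alpha> pos by (intro convexD) (auto simp: add_divide_distrib[symmetric])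
      moreover have "(s0 / (\<alpha> + s0)) *\<^sub>R c1 + (\<alpha> / (\<alpha> + s0)) *\<^sub>R c0 = q"
      proof -
        have c0: "c0 = q - s0 *\<^sub>R e" using 0 by simp
        define u where "u = s0 / (\<alpha> + s0)"
        define v where "v = \<alpha> / (\<alpha> + s0)"
        have "u + v = 1" unfolding u_def v_def using pos by (simp add: add_divide_distrib[symmetric] add.commute)
        moreover have "u * \<alpha> = v * s0" unfolding u_def v_def by simp
        moreover have "u *\<^sub>R c1 + v *\<^sub>R c0 = (u + v) *\<^sub>R q + (u * \<alpha> - v * s0) *\<^sub>R e"
          unfolding c1 c0 by (simp add: algebra_simps)
        ultimately show ?thesis unfolding u_def[symmetric] v_def[symmetric] by simp
      qed
      ultimately show ?thesis by simp
    qed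
    then show False using pq(2) unfolding E_def by simp
  qed
  have disj: "disjoint_family_on T {..<n}"
    unfolding disjoint_family_on_def using disj1 by (metis Int_commute linorder_neqE_nat)
  have mT: "T k \<in> sets borel" "emeasure lborel (T k) = emeasure lborel E" for k
    unfolding T_def using emeasure_lborel_translate[OF bE] by auto
  \<comment> \<open>The shift is at most (n - 1) \<delta> \<le> R and points of E have norm at most
    R + \<delta> \<le> 2 R.\<close>
  have TR: "T k \<subseteq> cball 0 (4 * R)" if "k < n" for k
  proof
    fix x assume "x \<in> T k"
    then obtain p where p: "x = (real k * \<delta>) *\<^sub>R e + p" "p \<in> E" unfolding T_def by auto
    have "norm x \<le> norm ((real k * \<delta>) *\<^sub>R e) + norm p" unfolding p by (rule norm_triangle_ineq)
    also have "norm ((real k * \<delta>) *\<^sub>R e) = real k * \<delta>" using e \<delta> by simp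
    also have "real k * \<delta> \<le> (real n - 1) * \<delta>" using that \<delta> by (intro mult_right_mono) auto
    also have "norm p \<le> R + \<delta>" using p DR unfolding E_def by auto
    finally show "x \<in> cball 0 (4 * R)" using n(2) \<delta> by (simp add: algebra_simps)
  qed
  have Efin: "emeasure lborel E = ennreal (measure lborel E)"
    using DR unfolding E_def by (intro emeasure_lborel_bounded) auto
  have "ennreal (real n * measure lborel E) = (\<Sum>k<n. emeasure lborel (T k))"
    unfolding mT(2) by (simp add: Efin ennreal_mult' ennreal_of_nat_eq_real_of_nat)
  also have "\<dots> = emeasure lborel (\<Union>k<n. T k)" using mT disj by (intro sum_emeasure) auto
  also have "\<dots> \<le> emeasure lborel (cball (0::'a) (4 * R))" using TR by (intro emeasure_mono) auto
  also have "\<dots> = ennreal (measure lborel (cball (0::'a) (4 * R)))" by (rule emeasure_lborel_bounded[OF order_refl])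
  finally have nE: "real n * measure lborel E \<le> measure lborel (cball (0::'a) (4 * R))" by simp
  have "R / \<delta> * measure lborel E \<le> real n * measure lborel E" using n(1) \<delta> by (intro mult_right_mono) (auto simp: field_simps)
  with nE have "R / \<delta> * measure lborel E \<le> measure lborel (cball (0::'a) (4 * R))" by linarith
  then have mE: "measure lborel E \<le> measure lborel (cball (0::'a) (4 * R)) / R * \<delta>" using \<delta> by (simp add: field_simps)
  have fm: "C \<in> fmeasurable lborel" "E \<in> fmeasurable lborel"
    using C bE emeasure_compact_finite[OF C(2)] Efin by (auto intro!: fmeasurableI borel_compact)
  have "measure lborel D \<le> measure lborel (C \<union> E)"
    using fm cD by (intro measure_mono_fmeasurable fmeasurable.Un) (auto simp: E_def borel_compact)
  also have "\<dots> \<le> measure lborel C + measure lborel E" using fm by (intro measure_Un_le) auto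
  finally show "measure lborel D \<le> measure lborel C + measure lborel (cball (0::'a) (4 * R)) / R * \<delta>" using mE by linarith
qed

text \<open>Two segments per basis vector, in the directions b and - b, add up to a cube of
  half-width \<delta>. The fixed radius R bounds all intermediate sets, so that every step costs the
  same multiple of \<delta>.\<close>

lemma measure_add_box:
  fixes C :: "'a::euclidean_space set"
  assumes "finite B" "B \<subseteq> Basis" and C: "convex C" "compact C" "C \<subseteq> cball 0 R0" and \<delta>: "0 < \<delta>" "\<delta> \<le> R" and R: "R0 + 2 * real (card B) * \<delta> \<le> R"
  shows "\<exists>D. convex D \<and> compact D \<and> D \<subseteq> cball 0 (R0 + 2 * real (card B) * \<delta>) \<and>
    (\<forall>p\<in>C. \<forall>s. (\<forall>b\<in>B. \<bar>s b\<bar> \<le> \<delta>) \<longrightarrow> p + (\<Sum>b\<in>B. s b *\<^sub>R b) \<in> D) \<and>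
    measure lborel D \<le> measure lborel C + 2 * real (card B) * (measure lborel (cball (0::'a) (4 * R)) / R * \<delta>)"
  using assms(1,2) R
proof (induction B rule: finite_induct)
  case empty
  then show ?case using C by (intro exI[of _ C]) auto
next
  case (insert b B)
  have cb: "real (card (insert b B)) = real (card B) + 1" using insert.hyps by simp
  let ?K = "measure lborel (cball (0::'a) (4 * R)) / R * \<delta>"
  have le: "R0 + 2 * real (card B) * \<delta> \<le> R" using insert.prems(2) \<delta> unfolding cb by (simp add: algebra_simps)
  obtain D where D: "convex D" "compact D" "D \<subseteq> cball 0 (R0 + 2 * real (card B) * \<delta>)"
    "\<And>p s. p \<in> C \<Longrightarrow> (\<forall>b\<in>B. \<bar>s b\<bar> \<le> \<delta>) \<Longrightarrow> p + (\<Sum>b\<in>B. s b *\<^sub>R b) \<in> D"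
    "measure lborel D \<le> measure lborel C + 2 * real (card B) * ?K"
    using insert.IH insert.prems(1) le by blast
  have nb: "norm b = 1" "norm (- b) = 1" using insert.prems(1) by auto
  define D1 where "D1 = (\<lambda>(p, s). p + s *\<^sub>R b) ` (D \<times> {0..\<delta>})"
  define D2 where "D2 = (\<lambda>(p, s). p + s *\<^sub>R (- b)) ` (D1 \<times> {0..\<delta>})"
  have DR: "D \<subseteq> cball 0 R" using D(3) le by (meson order_trans subset_cball)
  note 1 = measure_add_segment[OF D(1,2) DR \<delta> nb(1), folded D1_def]
  have D1R': "D1 \<subseteq> cball 0 (R0 + 2 * real (card B) * \<delta> + \<delta>)"
  proof
    fix x assume "x \<in> D1"
    then obtain p s where x: "x = p + s *\<^sub>R b" "p \<in> D" "s \<in> {0..\<delta>}" unfolding D1_def by auto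
    have "norm x \<le> norm p + norm (s *\<^sub>R b)" unfolding x by (rule norm_triangle_ineq)
    also have "\<dots> \<le> (R0 + 2 * real (card B) * \<delta>) + \<delta>" using x D(3) nb by (intro add_mono) auto
    finally show "x \<in> cball 0 (R0 + 2 * real (card B) * \<delta> + \<delta>)" by simp
  qed
  have D1R: "D1 \<subseteq> cball 0 R"
  proof -
    have "R0 + 2 * real (card B) * \<delta> + \<delta> \<le> R" using insert.prems(2) \<delta> unfolding cb by (simp add: algebra_simps)
    then show ?thesis using D1R' by (meson order_trans subset_cball)
  qed
  note 2 = measure_add_segment[OF 1(1,2) D1R \<delta> nb(2), folded D2_def]
  show ?case
  proof (intro exI[of _ D2] conjI ballI allI impI)
    show "convex D2" "compact D2" by (fact 2)+
    show "D2 \<subseteq> cball 0 (R0 + 2 * real (card (insert b B)) * \<delta>)"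
    proof
      fix x assume "x \<in> D2"
      then obtain p s where x: "x = p + s *\<^sub>R (- b)" "p \<in> D1" "s \<in> {0..\<delta>}" unfolding D2_def by auto
      have "norm x \<le> norm p + norm (s *\<^sub>R (- b))" unfolding x by (rule norm_triangle_ineq)
      also have "\<dots> \<le> (R0 + 2 * real (card B) * \<delta> + \<delta>) + \<delta>" using x D1R' nb by (intro add_mono) auto
      finally show "x \<in> cball 0 (R0 + 2 * real (card (insert b B)) * \<delta>)" unfolding cb by (simp add: algebra_simps)
    qed
    show "measure lborel D2 \<le> measure lborel C + 2 * real (card (insert b B)) * ?K"
    proof -
      obtain \<kappa> where \<kappa>: "\<kappa> = ?K" by blast
      have "2 * real (card (insert b B)) * \<kappa> = 2 * real (card B) * \<kappa> + 2 * \<kappa>" unfolding cb by (simp add: algebra_simps)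
      then show ?thesis using 1(4) 2(4) D(5) unfolding \<kappa>[symmetric] by linarith
    qed
  next
    fix p s assume p: "p \<in> C" and s: "\<forall>c\<in>insert b B. \<bar>s c\<bar> \<le> \<delta>"
    define q where "q = p + (\<Sum>c\<in>B. s c *\<^sub>R c)"
    have q: "q \<in> D" unfolding q_def using D(4)[OF p, of s] s by auto
    have sb: "\<bar>s b\<bar> \<le> \<delta>" using s by simp
    \<comment> \<open>The positive part of the b-coordinate is supplied by D1, the negative part by
      D2.\<close>
    have q1: "q + max 0 (s b) *\<^sub>R b \<in> D1" unfolding D1_def by (rule image_eqI[of _ _ "(q, max 0 (s b))"]) (use q sb \<delta> in auto)
    have "(q + max 0 (s b) *\<^sub>R b) + max 0 (- s b) *\<^sub>R (- b) \<in> D2" unfolding D2_def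
      by (rule image_eqI[of _ _ "(q + max 0 (s b) *\<^sub>R b, max 0 (- s b))"]) (use q1 sb \<delta> in auto)
    moreover have "(q + max 0 (s b) *\<^sub>R b) + max 0 (- s b) *\<^sub>R (- b) = p + (\<Sum>c\<in>insert b B. s c *\<^sub>R c)"
      using insert.hyps by (auto simp: q_def max_def algebra_simps)
    ultimately show "p + (\<Sum>c\<in>insert b B. s c *\<^sub>R c) \<in> D2" by simp
  qed
qed

text \<open>K depends only on R and the dimension. The estimate is one-sided; it is used once with
  the hull of a limit path as C and once with the hull of the rescaled walk as C.\<close>

lemma measure_hull_near_convex:
  fixes R :: real
  assumes R: "0 < R"
  obtains K where "0 \<le> K" and "\<And>(C::'a::euclidean_space set) P \<delta>. convex C \<Longrightarrow> compact C \<Longrightarrow> C \<subseteq> cball 0 R \<Longrightarrow> 0 < \<delta> \<Longrightarrow> \<delta> \<le> R \<Longrightarrow>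
    (\<And>x. x \<in> P \<Longrightarrow> \<exists>y\<in>C. norm (x - y) \<le> \<delta>) \<Longrightarrow> measure lborel (convex hull P) \<le> measure lborel C + K * \<delta>"
proof -
  define R1 where "R1 = R + 2 * real DIM('a) * R"
  define K where "K = 2 * real DIM('a) * (measure lborel (cball (0::'a) (4 * R1)) / R1)"
  have R1: "R \<le> R1" unfolding R1_def using R by simp
  show ?thesis
  proof (rule that[of K])
    show "0 \<le> K" unfolding K_def using R R1 by auto
  next
    fix C P :: "'a set" and \<delta> :: real
    assume C: "convex C" "compact C" "C \<subseteq> cball 0 R" and \<delta>: "0 < \<delta>" "\<delta> \<le> R" and P: "\<And>x. x \<in> P \<Longrightarrow> \<exists>y\<in>C. norm (x - y) \<le> \<delta>"
    have le: "R + 2 * real (card (Basis::'a set)) * \<delta> \<le> R1" unfolding R1_def using \<delta> by (intro add_mono mult_left_mono) auto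
    have "\<exists>D. convex D \<and> compact D \<and> D \<subseteq> cball 0 (R + 2 * real (card (Basis::'a set)) * \<delta>) \<and>
      (\<forall>p\<in>C. \<forall>s. (\<forall>b\<in>Basis. \<bar>s b\<bar> \<le> \<delta>) \<longrightarrow> p + (\<Sum>b\<in>Basis. s b *\<^sub>R b) \<in> D) \<and>
      measure lborel D \<le> measure lborel C + 2 * real (card (Basis::'a set)) * (measure lborel (cball (0::'a) (4 * R1)) / R1 * \<delta>)"
      by (rule measure_add_box[OF finite_Basis order_refl C \<delta>(1) order_trans[OF \<delta>(2) R1] le])
    then obtain D where D: "convex D" "compact D"
      "\<And>p s. p \<in> C \<Longrightarrow> (\<forall>b\<in>Basis. \<bar>s b\<bar> \<le> \<delta>) \<Longrightarrow> p + (\<Sum>b\<in>Basis. s b *\<^sub>R b) \<in> D"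
      "measure lborel D \<le> measure lborel C + 2 * real DIM('a) * (measure lborel (cball (0::'a) (4 * R1)) / R1 * \<delta>)"
      by blast
    have "P \<subseteq> D"
    proof
      fix x assume "x \<in> P"
      then obtain y where y: "y \<in> C" "norm (x - y) \<le> \<delta>" using P by blast
      have "y + (\<Sum>b\<in>Basis. ((x - y) \<bullet> b) *\<^sub>R b) \<in> D"
        using y by (intro D(3)) (auto intro: order_trans[OF Basis_le_norm])
      then show "x \<in> D" by (simp only: euclidean_representation) simp
    qed
    then have "convex hull P \<subseteq> D" using D(1) by (simp add: hull_minimal)
    show "measure lborel (convex hull P) \<le> measure lborel C + K * \<delta>"
    proof (cases "convex hull P \<in> sets lborel")
      case True
      have "measure lborel (convex hull P) \<le> measure lborel D"
        using \<open>convex hull P \<subseteq> D\<close> True emeasure_compact_finite[OF D(2)] D(2) by (intro measure_mono_fmeasurable) (auto intro!: fmeasurableI borel_compact)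
      then show ?thesis using D(4) unfolding K_def by simp
    next
      case False
      \<comment> \<open>A non-measurable hull has \<open>measure\<close> 0 by convention.\<close>
      then show ?thesis unfolding K_def using R R1 \<delta> by (simp add: measure_notin_sets)
    qed
  qed
qed

section \<open>Product maps and orthonormal frames\<close>

lemma measure_lborel_Times:
  fixes A :: "'a::euclidean_space set" and B :: "'b::euclidean_space set"
  assumes "A \<in> sets borel" "B \<in> sets borel"
  shows "measure lborel (A \<times> B) = measure lborel A * measure lborel B"
  unfolding measure_def lborel_prod[symmetric] using assms
  by (subst lborel.emeasure_pair_measure_Times) (auto simp: enn2real_mult)

text \<open>Calibrated on the product of \<open>{0..1}\<close> with the unit ball, where the product
  measure and \<open>measure_linear_image_det\<close> give both volumes.\<close>

lemma measure_product_linear_image: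
  fixes f :: "real ^ 'm \<Rightarrow> real ^ 'm"
  assumes s: "0 < s" and f: "linear f" "linear g" "\<And>x. g (f x) = x" "\<And>x. f (g x) = x" and C: "compact C"
  shows "measure lborel ((\<lambda>(t, x). (s * t, f x)) ` C) = s * \<bar>det (matrix f)\<bar> * measure lborel (C :: (real \<times> (real ^ 'm)) set)"
proof -
  let ?F = "\<lambda>(t, x). (s * t, f x)" and ?G = "\<lambda>(t, x). (t / s, g x)"
  have lin: "linear ?F" "linear ?G"
    using linear_add[OF f(1)] linear_scale[OF f(1)] linear_add[OF f(2)] linear_scale[OF f(2)]
    by (auto simp: linear_iff algebra_simps add_divide_distrib)
  have inv: "?G (?F z) = z" "?F (?G z) = z" for z using s f by (auto simp: case_prod_beta)
  let ?b = "cball 0 1 :: (real ^ 'm) set"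
  let ?T = "{0..1::real} \<times> ?b"
  have bpos: "0 < measure lborel ?b" using content_cball_pos[of 1 "0::real^'m"] by simp
  have T: "measure lborel ?T = measure lborel ?b" by (subst measure_lborel_Times) auto
  have "?F ` ?T = {0..s} \<times> f ` ?b"
  proof
    show "?F ` ?T \<subseteq> {0..s} \<times> f ` ?b" using s by (auto simp: mult_left_le)
    show "{0..s} \<times> f ` ?b \<subseteq> ?F ` ?T"
    proof
      fix z assume "z \<in> {0..s} \<times> f ` ?b"
      then obtain t x where z: "z = (t, f x)" "0 \<le> t" "t \<le> s" "x \<in> ?b" by auto
      then have "z = ?F (t / s, x)" "(t / s, x) \<in> ?T" using s by auto
      then show "z \<in> ?F ` ?T" by blast
    qed
  qed
  moreover have "compact (f ` ?b)" using f(1) by (intro compact_continuous_image linear_continuous_on) (auto simp: linear_conv_bounded_linear)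
  ultimately have FT: "measure lborel (?F ` ?T) = s * (\<bar>det (matrix f)\<bar> * measure lborel ?b)"
    using s measure_linear_image_det[OF f(1), of ?b] by (simp add: measure_lborel_Times borel_compact)
  have "measure lborel (?F ` C) * measure lborel ?T = measure lborel (?F ` ?T) * measure lborel C"
    by (rule measure_linear_image_ratio[OF lin inv C]) (auto intro!: compact_Times)
  then show ?thesis unfolding FT T using bpos by simp
qed

text \<open>Passage from coordinates in the orthonormal system e, B j back to the ambient space. The
  e-coordinate is a separate real factor, to match the ambient space of
  \<open>Hhull\<close>.\<close>

definition frame_map :: "real ^ 'n \<Rightarrow> ('m::finite \<Rightarrow> real ^ 'n) \<Rightarrow> real \<times> (real ^ 'm) \<Rightarrow> real ^ 'n" where
  "frame_map e B z = fst z *\<^sub>R e + (\<Sum>j\<in>UNIV. (snd z $ j) *\<^sub>R B j)"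

text \<open>Orthonormality provides a left inverse, equality of dimensions makes the map onto, and
  it preserves norms; so volumes agree although the two spaces are different types.\<close>

lemma frame_map:
  fixes e :: "real ^ 'n" and B :: "'m::finite \<Rightarrow> real ^ 'n"
  assumes dim: "CARD('n) = CARD('m) + 1" and e: "e \<bullet> e = 1" and B: "\<And>i j. B i \<bullet> B j = (if i = j then 1 else 0)" and Be: "\<And>i. B i \<bullet> e = 0"
  shows linear_frame_map: "linear (frame_map e B)"
    and frame_map_surj: "frame_map e B (e \<bullet> y, \<chi> j. B j \<bullet> y) = y"
    and measure_frame_map: "compact C \<Longrightarrow> measure lborel (frame_map e B ` C) = measure lborel C"
proof -
  show lin: "linear (frame_map e B)"
    unfolding frame_map_def by (auto simp: linear_iff algebra_simps sum.distrib scaleR_sum_right)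
  have eB: "e \<bullet> B i = 0" for i using Be[of i] by (simp add: inner_commute)
  have c1: "e \<bullet> frame_map e B z = fst z" for z
    unfolding frame_map_def by (simp add: inner_add_right inner_sum_right e eB)
  have c2: "B j \<bullet> frame_map e B z = snd z $ j" for z j
    unfolding frame_map_def by (simp add: inner_add_right inner_sum_right B Be if_distrib cong: if_cong)
  have co: "(e \<bullet> frame_map e B z, \<chi> j. B j \<bullet> frame_map e B z) = z" for z
    unfolding c1 c2 by (simp add: prod_eq_iff)
  have inj: "inj (frame_map e B)" by (metis co injI)
  have d: "DIM(real \<times> (real ^ 'm)) = DIM(real ^ 'n)" using dim by simp
  have "dim (range (frame_map e B)) = dim (UNIV :: (real \<times> (real ^ 'm)) set)"
    using lin inj by (intro dim_image_eq) (auto simp: inj_on_def)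
  then have "dim (range (frame_map e B)) = DIM(real ^ 'n)" using d by simp
  then have "span (range (frame_map e B)) = UNIV" by (rule dim_eq_full[THEN iffD1])
  moreover have "subspace (range (frame_map e B))" using lin by (intro linear_subspace_image) auto
  then have "span (range (frame_map e B)) = range (frame_map e B)" by (rule span_eq_iff[THEN iffD2])
  ultimately have "range (frame_map e B) = UNIV" by (simp only:)
  then show su: "frame_map e B (e \<bullet> y, \<chi> j. B j \<bullet> y) = y" for y
    using co by (metis rangeE UNIV_I)
  have nrm: "norm (frame_map e B z) = norm z" for z
  proof -
    have "frame_map e B z \<bullet> frame_map e B z = fst z * (e \<bullet> frame_map e B z) + (\<Sum>j\<in>UNIV. snd z $ j * (B j \<bullet> frame_map e B z))"
      by (subst (1) frame_map_def) (simp add: inner_add_left inner_sum_left)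
    also have "\<dots> = z \<bullet> z" unfolding c1 c2 by (simp add: inner_prod_def inner_vec_def)
    finally show ?thesis by (simp add: norm_eq_sqrt_inner)
  qed
  have lin': "linear (\<lambda>y. (e \<bullet> y, \<chi> j. B j \<bullet> y))" by (auto simp: linear_iff inner_add_right vec_eq_iff)
  show "measure lborel (frame_map e B ` C) = measure lborel C" if "compact C"
    by (rule measure_isometry_image[OF lin lin' co su nrm d that])
qed

section \<open>Strassen's law\<close>

lemma le_one_plus_of_square_le:
  fixes s \<kappa> :: real
  assumes "s\<^sup>2 \<le> s + \<kappa>" "0 \<le> \<kappa>"
  shows "s \<le> 1 + \<kappa>"
proof (rule ccontr)
  assume "\<not> s \<le> 1 + \<kappa>"
  then have s: "1 + \<kappa> < s" by simp
  then have "(1 + \<kappa>) * s < s * s" using assms by (intro mult_strict_right_mono) auto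
  moreover have "s + \<kappa> \<le> (1 + \<kappa>) * s"
  proof -
    have "\<kappa> * 1 \<le> \<kappa> * s" using assms s by (intro mult_left_mono) auto
    then show ?thesis by (simp add: algebra_simps)
  qed
  ultimately show False using assms by (simp add: power2_eq_square)
qed

lemma finite_net_cball:
  fixes r \<eta> :: real
  assumes "0 < \<eta>"
  obtains F :: "'a::euclidean_space set" where "finite F" "\<And>x. norm x \<le> r \<Longrightarrow> \<exists>y\<in>F. norm (x - y) < \<eta>"
proof -
  have "seq_compact (cball (0::'a) r)" by (simp add: compact_imp_seq_compact)
  from seq_compact_imp_totally_bounded[OF this] assms
  obtain F :: "'a set" where F: "finite F" "cball 0 r \<subseteq> (\<Union>x\<in>F. ball x \<eta>)" by blast
  have "\<exists>y\<in>F. norm (x - y) < \<eta>" if x: "norm x \<le> r" for x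
  proof -
    have "x \<in> cball 0 r" using x by (simp only: mem_cball_0)
    then have "x \<in> (\<Union>y\<in>F. ball y \<eta>)" by (rule subsetD[OF F(2)])
    then show ?thesis unfolding UN_iff mem_ball dist_norm by (simp only: norm_minus_commute)
  qed
  with F(1) show ?thesis by (rule that)
qed

lemma sum_norm_sq_le:
  fixes x :: "nat \<Rightarrow> 'a::real_normed_vector"
  shows "(\<Sum>j<N. norm (x j)) \<le> sqrt (real N * (\<Sum>j<N. (norm (x j))\<^sup>2))"
proof -
  have "(\<Sum>j<N. norm (x j) * 1)\<^sup>2 \<le> (\<Sum>j<N. (norm (x j))\<^sup>2) * (\<Sum>j<N. 1\<^sup>2)"
    by (rule Cauchy_Schwarz_ineq_sum)
  then have "(\<Sum>j<N. norm (x j))\<^sup>2 \<le> real N * (\<Sum>j<N. (norm (x j))\<^sup>2)" by (simp add: mult.commute)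
  then show ?thesis by (rule real_le_rsqrt)
qed

text \<open>Testing x against a nearby \<theta> gives almost |x|^2 on the left and, up to errors,
  the dual norm of x on the right. With s the square root of the energy this reads s^2 \<le> s +
  O(\<eta>), hence s \<le> 1 + O(\<eta>).\<close>

lemma energy_le_of_net:
  fixes x \<theta> :: "nat \<Rightarrow> 'a::real_inner"
  assumes N: "1 \<le> N" and x: "\<And>j. j < N \<Longrightarrow> norm (x j) \<le> C" and \<theta>: "\<And>j. j < N \<Longrightarrow> norm (x j - \<theta> j) \<le> \<eta>" and \<eta>: "0 \<le> \<eta>"
    and b: "(\<Sum>j<N. \<theta> j \<bullet> x j) \<le> sqrt ((\<Sum>j<N. (norm (\<theta> j))\<^sup>2) / real N) + \<eta>"
  shows "sqrt (real N * (\<Sum>j<N. (norm (x j))\<^sup>2)) \<le> 1 + \<eta> * (real N * (real N * C + real N + 1))"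
proof -
  define X where "X = sqrt (\<Sum>j<N. (norm (x j))\<^sup>2)"
  have N0: "0 < real N" and N1: "1 \<le> real N" using N by auto
  have C0: "0 \<le> C" using x[of 0] N norm_ge_zero[of "x 0"] by linarith
  have X0: "0 \<le> X" and X2: "X\<^sup>2 = (\<Sum>j<N. (norm (x j))\<^sup>2)" unfolding X_def by (simp_all add: sum_nonneg)
  have "sqrt (\<Sum>j<N. (norm (\<theta> j))\<^sup>2) \<le> L2_set (\<lambda>j. norm (x j) + \<eta>) {..<N}"
    unfolding L2_set_def
  proof (intro real_sqrt_le_mono sum_mono power_mono)
    fix j assume "j \<in> {..<N}"
    then have "norm (x j - \<theta> j) \<le> \<eta>" using \<theta> by simp
    then show "norm (\<theta> j) \<le> norm (x j) + \<eta>" using norm_triangle_ineq2[of "\<theta> j" "x j"] by (simp add: norm_minus_commute)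
  qed auto
  also have "\<dots> \<le> L2_set (\<lambda>j. norm (x j)) {..<N} + L2_set (\<lambda>j. \<eta>) {..<N}" by (rule L2_set_triangle_ineq)
  also have "L2_set (\<lambda>j. \<eta>) {..<N} \<le> (\<Sum>j<N. \<eta>)" using \<eta> by (intro L2_set_le_sum) auto
  also have "L2_set (\<lambda>j. norm (x j)) {..<N} = X" unfolding X_def L2_set_def ..
  finally have th: "sqrt (\<Sum>j<N. (norm (\<theta> j))\<^sup>2) \<le> X + real N * \<eta>" by simp
  have "X\<^sup>2 - \<eta> * (real N * C) \<le> (\<Sum>j<N. \<theta> j \<bullet> x j)"
  proof -
    have "(\<Sum>j<N. (norm (x j))\<^sup>2 - \<eta> * C) \<le> (\<Sum>j<N. \<theta> j \<bullet> x j)"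
    proof (rule sum_mono)
      fix j assume j: "j \<in> {..<N}"
      have "(x j - \<theta> j) \<bullet> x j \<le> norm (x j - \<theta> j) * norm (x j)" by (rule norm_cauchy_schwarz)
      also have "\<dots> \<le> \<eta> * C" using \<theta> x j C0 \<eta> by (intro mult_mono) auto
      finally show "(norm (x j))\<^sup>2 - \<eta> * C \<le> \<theta> j \<bullet> x j" by (simp add: inner_diff_left power2_norm_eq_inner)
    qed
    then show ?thesis by (simp add: sum_subtractf X2 mult_ac)
  qed
  also note b
  also have "sqrt ((\<Sum>j<N. (norm (\<theta> j))\<^sup>2) / real N) \<le> (X + real N * \<eta>) / sqrt (real N)"
    unfolding real_sqrt_divide using th by (intro divide_right_mono) auto
  finally have 1: "X\<^sup>2 - \<eta> * (real N * C) \<le> (X + real N * \<eta>) / sqrt (real N) + \<eta>" by simp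
  define s where "s = sqrt (real N) * X"
  have s2: "s\<^sup>2 = real N * X\<^sup>2" unfolding s_def by (simp add: power_mult_distrib)
  have sN: "1 \<le> sqrt (real N)" using N1 by simp
  have "real N * (X\<^sup>2 - \<eta> * (real N * C)) \<le> real N * ((X + real N * \<eta>) / sqrt (real N) + \<eta>)" using 1 by (intro mult_left_mono) auto
  also have "\<dots> = sqrt (real N) * (X + real N * \<eta>) + real N * \<eta>"
  proof -
    have "real N / sqrt (real N) = sqrt (real N)" using N0 by (rule real_div_sqrt[OF less_imp_le])
    then have "real N * ((X + real N * \<eta>) / sqrt (real N)) = sqrt (real N) * (X + real N * \<eta>)" by (metis times_divide_eq_left times_divide_eq_right)
    then show ?thesis by (simp add: distrib_left)
  qed
  also have "sqrt (real N) * (X + real N * \<eta>) \<le> s + real N * (real N * \<eta>)"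
  proof -
    have "sqrt (real N) \<le> real N" using N1 by (intro real_le_lsqrt) (auto simp: power2_eq_square)
    then have "sqrt (real N) * (real N * \<eta>) \<le> real N * (real N * \<eta>)" using \<eta> by (intro mult_right_mono) auto
    then show ?thesis unfolding s_def by (simp add: distrib_left)
  qed
  finally have "s\<^sup>2 \<le> s + \<eta> * (real N * (real N * C + real N + 1))" unfolding s2 by (simp add: algebra_simps)
  then have "s \<le> 1 + \<eta> * (real N * (real N * C + real N + 1))"
    using \<eta> C0 by (intro le_one_plus_of_square_le) auto
  then show ?thesis unfolding s_def X_def by (simp add: real_sqrt_mult)
qed

context white_seq
begin

definition incr :: "nat \<Rightarrow> nat \<Rightarrow> 'a \<Rightarrow> 'b" where "incr q j \<omega> = walk ((j + 1) * q) \<omega> - walk (j * q) \<omega>"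

lemma walk_eq_sum_incr: "walk (j * q) \<omega> = (\<Sum>i<j. incr q i \<omega>)"
  unfolding incr_def by (induction j) (simp_all add: walk_def)

text \<open>A finite net suffices because \<open>walk_modulus\<close> with N = 1 confines each
  increment, divided by the scale, to the ball of radius \<open>mod_const\<close>; only finitely
  many functionals and null sets are involved.\<close>

lemma energy_upper:
  assumes N: "1 \<le> N" and \<epsilon>: "0 < \<epsilon>"
  shows "AE \<omega> in M. eventually (\<lambda>q. sqrt (real N * (\<Sum>j<N. (norm (incr q j \<omega>))\<^sup>2)) \<le> (1 + \<epsilon>) * lil_scale (N * q)) sequentially"
proof -
  \<comment> \<open>Chosen so that the error term of \<open>energy_le_of_net\<close> with C =
    \<open>mod_const\<close> becomes \<epsilon>.\<close>
  define \<eta> where "\<eta> = \<epsilon> / (real N * (real N * mod_const + real N + 1))"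
  have "0 \<le> real N * mod_const" using mod_const_pos by simp
  then have c0: "0 < real N * mod_const + real N + 1" by linarith
  have pos: "0 < real N * (real N * mod_const + real N + 1)" using N c0 by simp
  have \<eta>: "0 < \<eta>" "\<eta> * (real N * (real N * mod_const + real N + 1)) = \<epsilon>"
  proof -
    show "0 < \<eta>" unfolding \<eta>_def using \<epsilon> pos by (rule divide_pos_pos)
    have "\<epsilon> / D * D = \<epsilon>" if "0 < D" for D :: real using that by simp
    then show "\<eta> * (real N * (real N * mod_const + real N + 1)) = \<epsilon>" unfolding \<eta>_def using pos by blast
  qed
  obtain F :: "'b set" where F: "finite F" "\<And>x. norm x \<le> mod_const \<Longrightarrow> \<exists>y\<in>F. norm (x - y) < \<eta>" using finite_net_cball[OF \<eta>(1)] by blast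
  define \<Theta> where "\<Theta> = PiE {..<N} (\<lambda>_. F)"
  have f\<Theta>: "finite \<Theta>" unfolding \<Theta>_def using F by (intro finite_PiE) auto
  have "AE \<omega> in M. \<forall>th\<in>\<Theta>. eventually (\<lambda>q. bsum N th q \<omega> \<le> (sqrt ((\<Sum>j<N. (norm (th j))\<^sup>2) / real N) + \<eta>) * lil_scale (N * q)) sequentially"
    using f\<Theta> by (intro AE_finite_allI bsum_upper[OF N \<eta>(1)])
  then show ?thesis using walk_modulus[OF order_refl]
  proof eventually_elim
    fix \<omega>
    assume "\<forall>th\<in>\<Theta>. eventually (\<lambda>q. bsum N th q \<omega> \<le> (sqrt ((\<Sum>j<N. (norm (th j))\<^sup>2) / real N) + \<eta>) * lil_scale (N * q)) sequentially"
    then have 1: "eventually (\<lambda>q. \<forall>th\<in>\<Theta>. bsum N th q \<omega> \<le> (sqrt ((\<Sum>j<N. (norm (th j))\<^sup>2) / real N) + \<eta>) * lil_scale (N * q)) sequentially"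
      using f\<Theta> by (simp add: eventually_ball_finite)
    assume "eventually (\<lambda>n. \<forall>l l'. l \<le> l' \<longrightarrow> l' \<le> n \<longrightarrow> 1 * (l' - l) \<le> n \<longrightarrow>
     norm (walk l' \<omega> - walk l \<omega>) \<le> mod_const * lil_scale n / sqrt (real 1)) sequentially"
    moreover have "filterlim (\<lambda>q. N * q) at_top sequentially" using filterlim_mult_nat[OF N filterlim_ident] by simp
    ultimately have 2: "eventually (\<lambda>q. \<forall>l l'. l \<le> l' \<longrightarrow> l' \<le> N * q \<longrightarrow> 1 * (l' - l) \<le> N * q \<longrightarrow>
     norm (walk l' \<omega> - walk l \<omega>) \<le> mod_const * lil_scale (N * q) / sqrt (real 1)) sequentially"
      unfolding filterlim_iff by blast
    show "eventually (\<lambda>q. sqrt (real N * (\<Sum>j<N. (norm (incr q j \<omega>))\<^sup>2)) \<le> (1 + \<epsilon>) * lil_scale (N * q)) sequentially"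
      using 1 2 eventually_ge_at_top[of 3]
    proof eventually_elim
      fix q :: nat
      let ?L = "lil_scale (N * q)"
      assume 1: "\<forall>th\<in>\<Theta>. bsum N th q \<omega> \<le> (sqrt ((\<Sum>j<N. (norm (th j))\<^sup>2) / real N) + \<eta>) * ?L"
        and 2: "\<forall>l l'. l \<le> l' \<longrightarrow> l' \<le> N * q \<longrightarrow> 1 * (l' - l) \<le> N * q \<longrightarrow> norm (walk l' \<omega> - walk l \<omega>) \<le> mod_const * ?L / sqrt (real 1)" and q: "3 \<le> q"
      have "3 \<le> N * q" using q N by (metis le_trans mult_le_mono1 nat_mult_1)
      then have L: "0 < ?L" by (rule lil_scale_pos)
      define x where "x j = (1 / ?L) *\<^sub>R incr q j \<omega>" for j
      have x: "norm (x j) \<le> mod_const" if "j < N" for j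
      proof -
        have le: "(j + 1) * q \<le> N * q" by (rule mult_le_mono1) (use that in auto)
        have "1 * ((j + 1) * q - j * q) \<le> N * q" unfolding mult_1 by (rule order_trans[OF diff_le_self le])
        from 2[rule_format, OF _ le this] have "norm (incr q j \<omega>) \<le> mod_const * ?L" unfolding incr_def by simp
        then show ?thesis unfolding x_def using L by (simp add: field_simps)
      qed
      have "\<exists>y. j < N \<longrightarrow> y \<in> F \<and> norm (x j - y) < \<eta>" for j using F(2)[OF x] by blast
      then obtain y where y: "\<And>j. j < N \<Longrightarrow> y j \<in> F \<and> norm (x j - y j) < \<eta>" by metis
      define th where "th = restrict y {..<N}"
      have th: "th \<in> \<Theta>" unfolding th_def \<Theta>_def using y by auto
      have thx: "norm (x j - th j) \<le> \<eta>" if "j < N" for j unfolding th_def using y[OF that] that by simp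
      have "bsum N th q \<omega> = ?L * (\<Sum>j<N. th j \<bullet> x j)"
        unfolding bsum_def x_def incr_def using L by (simp add: sum_distrib_left)
      then have "?L * (\<Sum>j<N. th j \<bullet> x j) \<le> ?L * (sqrt ((\<Sum>j<N. (norm (th j))\<^sup>2) / real N) + \<eta>)" using 1 th by (metis mult.commute)
      then have "(\<Sum>j<N. th j \<bullet> x j) \<le> sqrt ((\<Sum>j<N. (norm (th j))\<^sup>2) / real N) + \<eta>" using L by (simp only: mult_le_cancel_left_pos)
      then have "sqrt (real N * (\<Sum>j<N. (norm (x j))\<^sup>2)) \<le> 1 + \<eta> * (real N * (real N * mod_const + real N + 1))"
        using \<eta>(1) by (intro energy_le_of_net[OF N x thx]) auto
      then have "?L * sqrt (real N * (\<Sum>j<N. (norm (x j))\<^sup>2)) \<le> ?L * (1 + \<epsilon>)" unfolding \<eta>(2) using L by (intro mult_left_mono) auto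
      moreover have "?L * sqrt (real N * (\<Sum>j<N. (norm (x j))\<^sup>2)) = sqrt (real N * (\<Sum>j<N. (norm (incr q j \<omega>))\<^sup>2))"
      proof -
        have "incr q j \<omega> = ?L *\<^sub>R x j" for j unfolding x_def using L by simp
        then have "real N * (\<Sum>j<N. (norm (incr q j \<omega>))\<^sup>2) = ?L\<^sup>2 * (real N * (\<Sum>j<N. (norm (x j))\<^sup>2))"
          by (simp add: power_mult_distrib sum_distrib_left mult_ac)
        then show ?thesis using L by (simp only: real_sqrt_mult) simp
      qed
      ultimately show "sqrt (real N * (\<Sum>j<N. (norm (incr q j \<omega>))\<^sup>2)) \<le> (1 + \<epsilon>) * ?L" by (simp add: mult.commute)
    qed
  qed
qed

text \<open>Expand the energy of x - d, for x the increments divided by the scale: the energy of x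
  is at most (1 + \<eta>)^2, that of d is 1, and the cross term is infinitely often at least 2 (1 -
  N \<eta>), because d has dual norm 1 / N. The remainder is at most \<eta> (3 + 2 N), which
  explains the choice of \<eta>.\<close>

lemma incr_near_frequently:
  assumes N: "1 \<le> N" and d: "real N * (\<Sum>j<N. (norm (d j))\<^sup>2) = 1" and \<epsilon>: "0 < \<epsilon>"
  shows "AE \<omega> in M. frequently (\<lambda>q. (\<Sum>j<N. norm (incr q j \<omega> - lil_scale (N * q) *\<^sub>R d j)) \<le> \<epsilon> * lil_scale (N * q)) sequentially"
proof -
  have N0: "0 < real N" and N1: "1 \<le> real N" using N by auto
  define \<eta> where "\<eta> = min 1 (\<epsilon>\<^sup>2 / (3 + 2 * real N))"
  have \<eta>: "0 < \<eta>" "\<eta> \<le> 1" "\<eta> * (3 + 2 * real N) \<le> \<epsilon>\<^sup>2"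
  proof -
    show "0 < \<eta>" "\<eta> \<le> 1" unfolding \<eta>_def using \<epsilon> by auto
    have "\<eta> * (3 + 2 * real N) \<le> \<epsilon>\<^sup>2 / (3 + 2 * real N) * (3 + 2 * real N)" unfolding \<eta>_def by (intro mult_right_mono) auto
    then show "\<eta> * (3 + 2 * real N) \<le> \<epsilon>\<^sup>2" by simp
  qed
  have sd: "(\<Sum>j<N. (norm (d j))\<^sup>2) = 1 / real N" using d N0 by (simp add: field_simps)
  have sig: "sqrt ((\<Sum>j<N. (norm (d j))\<^sup>2) / real N) = 1 / real N" unfolding sd by (simp add: real_sqrt_divide)
  have sig0: "0 < sqrt ((\<Sum>j<N. (norm (d j))\<^sup>2) / real N)" unfolding sig using N0 by simp
  show ?thesis
    using bsum_lower[OF N \<eta>(1) sig0] energy_upper[OF N \<eta>(1)]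
  proof eventually_elim
    fix \<omega>
    assume 1: "frequently (\<lambda>q. (sqrt ((\<Sum>j<N. (norm (d j))\<^sup>2) / real N) - \<eta>) * lil_scale (N * q) \<le> bsum N d q \<omega>) sequentially"
      and 2: "eventually (\<lambda>q. sqrt (real N * (\<Sum>j<N. (norm (incr q j \<omega>))\<^sup>2)) \<le> (1 + \<eta>) * lil_scale (N * q)) sequentially"
    have "eventually (\<lambda>q. (sqrt ((\<Sum>j<N. (norm (d j))\<^sup>2) / real N) - \<eta>) * lil_scale (N * q) \<le> bsum N d q \<omega> \<longrightarrow> (\<Sum>j<N. norm (incr q j \<omega> - lil_scale (N * q) *\<^sub>R d j)) \<le> \<epsilon> * lil_scale (N * q)) sequentially"
      using 2 eventually_ge_at_top[of 3]
    proof (eventually_elim, intro impI)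
      fix q :: nat
      let ?L = "lil_scale (N * q)"
      assume e: "sqrt (real N * (\<Sum>j<N. (norm (incr q j \<omega>))\<^sup>2)) \<le> (1 + \<eta>) * ?L" and q: "3 \<le> q"
        and b: "(sqrt ((\<Sum>j<N. (norm (d j))\<^sup>2) / real N) - \<eta>) * ?L \<le> bsum N d q \<omega>"
      have "3 \<le> N * q" using q N by (metis le_trans mult_le_mono1 nat_mult_1)
      then have L: "0 < ?L" by (rule lil_scale_pos)
      have e2: "real N * (\<Sum>j<N. (norm (incr q j \<omega>))\<^sup>2) \<le> ((1 + \<eta>) * ?L)\<^sup>2" using e by (rule sqrt_le_D)
      have "(norm (incr q j \<omega> - ?L *\<^sub>R d j))\<^sup>2 = (norm (incr q j \<omega>))\<^sup>2 + ?L\<^sup>2 * (norm (d j))\<^sup>2 - 2 * ?L * (d j \<bullet> incr q j \<omega>)" for j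
        unfolding power2_norm_eq_inner by (simp add: inner_diff_left inner_diff_right inner_commute power2_eq_square algebra_simps)
      then have "(\<Sum>j<N. (norm (incr q j \<omega> - ?L *\<^sub>R d j))\<^sup>2) = (\<Sum>j<N. (norm (incr q j \<omega>))\<^sup>2) + ?L\<^sup>2 * (\<Sum>j<N. (norm (d j))\<^sup>2) - 2 * ?L * bsum N d q \<omega>"
        unfolding bsum_def incr_def[symmetric] sum_distrib_left by (simp only: sum.distrib sum_subtractf)
      then have "real N * (\<Sum>j<N. (norm (incr q j \<omega> - ?L *\<^sub>R d j))\<^sup>2) = real N * (\<Sum>j<N. (norm (incr q j \<omega>))\<^sup>2) + ?L\<^sup>2 * (real N * (\<Sum>j<N. (norm (d j))\<^sup>2)) - 2 * ?L * (real N * bsum N d q \<omega>)"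
        by (simp only: right_diff_distrib distrib_left mult.left_commute[of "real N"])
      also have "\<dots> \<le> ((1 + \<eta>) * ?L)\<^sup>2 + ?L\<^sup>2 - 2 * ?L * (real N * ((1 / real N - \<eta>) * ?L))"
        unfolding d using e2 b[unfolded sig] L N0 by (intro diff_mono add_mono mult_left_mono) auto
      also have "\<dots> = (2 * \<eta> + \<eta>\<^sup>2 + 2 * real N * \<eta>) * ?L\<^sup>2" using N0 by (simp add: power2_eq_square field_simps)
      also have "\<dots> \<le> (\<eta> * (3 + 2 * real N)) * ?L\<^sup>2"
      proof (rule mult_right_mono)
        have "\<eta>\<^sup>2 \<le> \<eta>" using \<eta> by (simp add: power2_eq_square mult_left_le)
        then show "2 * \<eta> + \<eta>\<^sup>2 + 2 * real N * \<eta> \<le> \<eta> * (3 + 2 * real N)" by (simp add: algebra_simps)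
      qed simp
      also have "\<dots> \<le> \<epsilon>\<^sup>2 * ?L\<^sup>2" using \<eta>(3) by (rule mult_right_mono) simp
      finally have "real N * (\<Sum>j<N. (norm (incr q j \<omega> - ?L *\<^sub>R d j))\<^sup>2) \<le> (\<epsilon> * ?L)\<^sup>2" by (simp add: power_mult_distrib)
      then have "sqrt (real N * (\<Sum>j<N. (norm (incr q j \<omega> - ?L *\<^sub>R d j))\<^sup>2)) \<le> \<epsilon> * ?L" using \<epsilon> L by (intro real_le_lsqrt) (auto intro: sum_nonneg)
      then show "(\<Sum>j<N. norm (incr q j \<omega> - ?L *\<^sub>R d j)) \<le> \<epsilon> * ?L" by (rule order_trans[OF sum_norm_sq_le])
    qed
    from frequently_mp[OF this 1]
    show "frequently (\<lambda>q. (\<Sum>j<N. norm (incr q j \<omega> - lil_scale (N * q) *\<^sub>R d j)) \<le> \<epsilon> * lil_scale (N * q)) sequentially" .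
  qed
qed

end

section \<open>From block increments to whole paths\<close>

lemma exists_large_nat_sqrt:
  fixes A \<delta> :: real
  assumes "0 < \<delta>"
  obtains N :: nat where "N0 \<le> N" "1 \<le> N" "A / sqrt (real N) \<le> \<delta>"
proof -
  obtain m :: nat where m: "\<bar>A\<bar> / \<delta> < real m" using reals_Archimedean2 by blast
  define N where "N = m\<^sup>2 + N0 + 1"
  have "real m = sqrt ((real m)\<^sup>2)" by simp
  also have "\<dots> \<le> sqrt (real N)" unfolding N_def by (intro real_sqrt_le_mono) simp
  finally have "\<bar>A\<bar> / \<delta> \<le> sqrt (real N)" using m by linarith
  then have "\<bar>A\<bar> \<le> \<delta> * sqrt (real N)" using assms by (simp add: field_simps)
  moreover have "0 < N" unfolding N_def by simp
  ultimately have "A / sqrt (real N) \<le> \<delta>" by (simp add: field_simps)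
  then show ?thesis using that[of N] unfolding N_def by auto
qed

text \<open>The approximating path interpolates the block increments for q = n div N, divided by 1 +
  \<delta> / 2 times the scale so that its energy is at most 1. Half of \<delta> pays for this
  factor, the other half for the oscillation of walk and path within a block.\<close>

lemma strassen_upper:
  fixes Y :: "nat \<Rightarrow> 'a \<Rightarrow> real ^ 'm"
  assumes "white_seq M Y" and \<delta>: "0 < \<delta>"
  shows "AE \<omega> in M. eventually (\<lambda>n. \<exists>f\<in>U_set. \<forall>k\<le>n. norm ((\<Sum>i<k. Y i \<omega>) - lil_scale n *\<^sub>R f (real k / real n)) \<le> \<delta> * lil_scale n) sequentially"
proof -
  interpret white_seq M Y by fact
  have d2: "0 < \<delta> / 2" using \<delta> by simp
  obtain N where N: "1 \<le> N" "(mod_const + 1) / sqrt (real N) \<le> \<delta> / 2" using exists_large_nat_sqrt[OF d2, of 1] by blast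
  have N0: "0 < real N" using N by simp
  show ?thesis
    using energy_upper[OF N(1) d2] walk_modulus[OF N(1)]
  proof eventually_elim
    fix \<omega>
    assume 1: "eventually (\<lambda>q. sqrt (real N * (\<Sum>j<N. (norm (incr q j \<omega>))\<^sup>2)) \<le> (1 + \<delta> / 2) * lil_scale (N * q)) sequentially"
      and 2: "eventually (\<lambda>n. \<forall>l l'. l \<le> l' \<longrightarrow> l' \<le> n \<longrightarrow> N * (l' - l) \<le> n \<longrightarrow>
     norm (walk l' \<omega> - walk l \<omega>) \<le> mod_const * lil_scale n / sqrt (real N)) sequentially"
    have "filterlim (\<lambda>n. n div N) at_top sequentially" using N by (intro filterlim_at_top_div_const_nat) auto
    then have 3: "eventually (\<lambda>n. sqrt (real N * (\<Sum>j<N. (norm (incr (n div N) j \<omega>))\<^sup>2)) \<le> (1 + \<delta> / 2) * lil_scale (N * (n div N)) \<and> N + 3 \<le> n div N) sequentially"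
      using eventually_conj[OF 1 eventually_ge_at_top[of "N + 3"]] unfolding filterlim_iff by blast
    show "eventually (\<lambda>n. \<exists>f\<in>U_set. \<forall>k\<le>n. norm ((\<Sum>i<k. Y i \<omega>) - lil_scale n *\<^sub>R f (real k / real n)) \<le> \<delta> * lil_scale n) sequentially"
      using 3 2
    proof eventually_elim
      fix n
      define q where "q = n div N"
      let ?L = "lil_scale n"
      assume "sqrt (real N * (\<Sum>j<N. (norm (incr (n div N) j \<omega>))\<^sup>2)) \<le> (1 + \<delta> / 2) * lil_scale (N * (n div N)) \<and> N + 3 \<le> n div N"
      then have e: "sqrt (real N * (\<Sum>j<N. (norm (incr q j \<omega>))\<^sup>2)) \<le> (1 + \<delta> / 2) * lil_scale (N * q)" and q: "N + 3 \<le> q" unfolding q_def by auto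
      assume m: "\<forall>l l'. l \<le> l' \<longrightarrow> l' \<le> n \<longrightarrow> N * (l' - l) \<le> n \<longrightarrow> norm (walk l' \<omega> - walk l \<omega>) \<le> mod_const * ?L / sqrt (real N)"
      have q0: "0 < q" using q by simp
      have Nq: "N * q \<le> n" "n < N * q + N" unfolding q_def using N(1) dividend_less_times_div[of N n] by auto
      have qNq: "q \<le> N * q" using N by simp
      have nq3: "3 \<le> N * q" using q qNq by linarith
      then have n3: "3 \<le> n" using Nq by linarith
      have n0: "0 < real n" using n3 by simp
      have L: "0 < ?L" using n3 by (rule lil_scale_pos)
      have LL: "lil_scale (N * q) \<le> ?L" using nq3 Nq by (intro lil_scale_mono)
      define c where "c = (1 + \<delta> / 2) * ?L"
      have c: "0 < c" unfolding c_def using L \<delta> by simp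
      define d where "d j = (1 / c) *\<^sub>R incr q j \<omega>" for j
      define f where "f = pl_path N d"
      have f: "f \<in> U_set" unfolding f_def
      proof (rule pl_path_in_U_set[OF N(1)])
        have "sqrt (real N * (\<Sum>j<N. (norm (incr q j \<omega>))\<^sup>2)) \<le> c" unfolding c_def by (rule order_trans[OF e mult_left_mono[OF LL]]) (use \<delta> in simp)
        then have "real N * (\<Sum>j<N. (norm (incr q j \<omega>))\<^sup>2) \<le> c\<^sup>2" by (rule sqrt_le_D)
        moreover have "real N * (\<Sum>j<N. (norm (d j))\<^sup>2) = (real N * (\<Sum>j<N. (norm (incr q j \<omega>))\<^sup>2)) / c\<^sup>2"
          unfolding d_def using c by (simp add: power_divide sum_divide_distrib[symmetric])
        ultimately show "real N * (\<Sum>j<N. (norm (d j))\<^sup>2) \<le> 1" using c by simp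
      qed
      show "\<exists>f\<in>U_set. \<forall>k\<le>n. norm ((\<Sum>i<k. Y i \<omega>) - ?L *\<^sub>R f (real k / real n)) \<le> \<delta> * ?L"
      proof (intro bexI[OF _ f] allI impI)
        fix k assume k: "k \<le> n"
        define j where "j = k div q"
        have jk: "j * q \<le> k" "k < j * q + q" unfolding j_def using q0 dividend_less_times_div[of q k] by (auto simp: mult.commute)
        have j: "j \<le> N"
        proof -
          have "j * q < (N + 1) * q" using jk k Nq q by (simp add: algebra_simps)
          then have "j < N + 1" using mult_less_cancel2 by blast
          then show ?thesis by simp
        qed
        have w: "norm (walk k \<omega> - walk (j * q) \<omega>) \<le> mod_const * ?L / sqrt (real N)"
        proof (rule m[rule_format])
          have "N * (k - j * q) \<le> N * q" using jk by (intro mult_le_mono2) linarith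
          then show "N * (k - j * q) \<le> n" using Nq by linarith
        qed (use jk k in auto)
        have "c *\<^sub>R f (real j / real N) = (\<Sum>i<j. incr q i \<omega>)"
          unfolding f_def pl_path_grid[OF j N(1)] d_def using c by (simp add: scaleR_sum_right)
        then have wj: "walk (j * q) \<omega> = c *\<^sub>R f (real j / real N)" unfolding walk_eq_sum_incr by simp
        have jN: "0 \<le> real j / real N" "real j / real N \<le> 1" using j N0 by auto
        have kn: "0 \<le> real k / real n" "real k / real n \<le> 1" using k n0 by auto
        \<comment> \<open>Since n need not be a multiple of N, the grids j / N and k / n do not
          match; \<open>N + 3 \<le> q\<close> gives N^2 \<le> n, which limits the mismatch to 1 /
          N.\<close>
        have near: "\<bar>real j / real N - real k / real n\<bar> \<le> 1 / real N"
        proof -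
          have "real (N * q) \<le> real n" "real n \<le> real (N * q + N)" using Nq unfolding of_nat_le_iff by auto
          then have NqR: "real N * real q \<le> real n" "real n \<le> real N * real q + real N" by auto
          have "real k \<le> (real j + 1) * real q" using jk(2) by (metis add.commute mult.commute mult_Suc less_imp_le of_nat_Suc of_nat_le_iff of_nat_mult)
          then have "real k * real N \<le> (real j + 1) * real q * real N" using N0 by (intro mult_right_mono) auto
          also have "\<dots> = (real j + 1) * (real N * real q)" by simp
          also have "\<dots> \<le> (real j + 1) * real n" using NqR by (intro mult_left_mono) auto
          finally have a: "real k / real n \<le> (real j + 1) / real N" using n0 N0 by (simp add: field_simps)
          have "real j * real n \<le> real j * (real N * real q + real N)" using NqR by (intro mult_left_mono) auto
          also have "\<dots> = real N * real (j * q) + real N * real j" by (simp add: algebra_simps)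
          also have "\<dots> \<le> real N * real k + real N * real N" using jk(1) j by (intro add_mono mult_left_mono) (auto simp del: of_nat_mult)
          also have "real N * real N \<le> real n"
          proof -
            have "N * N \<le> N * q" using q by (intro mult_le_mono2) linarith
            then show ?thesis using Nq by (metis of_nat_le_iff of_nat_mult order_trans)
          qed
          finally have "real j * real n \<le> real N * real k + real n" by simp
          then have b: "real j / real N \<le> real k / real n + 1 / real N" using n0 N0 by (simp add: field_simps)
          show ?thesis using a b by (simp add: add_divide_distrib abs_le_iff)
        qed
        have fd: "norm (f (real j / real N) - f (real k / real n)) \<le> 1 / sqrt (real N)"
        proof -
          have "norm (f (real j / real N) - f (real k / real n)) \<le> sqrt \<bar>real j / real N - real k / real n\<bar>"
            using U_set_holder[OF f jN(1) _ kn(2)] U_set_holder[OF f kn(1) _ jN(2)]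
            by (cases "real j / real N \<le> real k / real n") (auto simp: norm_minus_commute abs_if)
          also have "\<dots> \<le> sqrt (1 / real N)" using near by (rule real_sqrt_le_mono)
          finally show ?thesis by (simp add: real_sqrt_divide)
        qed
        have fj: "norm (f (real j / real N)) \<le> 1"
          using U_set_norm_le[OF f jN] jN(2) by (smt (verit) real_sqrt_le_1_iff)
        have "walk k \<omega> - ?L *\<^sub>R f (real k / real n) = (walk k \<omega> - walk (j * q) \<omega>) + ((\<delta> / 2 * ?L) *\<^sub>R f (real j / real N) + ?L *\<^sub>R (f (real j / real N) - f (real k / real n)))"
          unfolding wj c_def by (simp add: algebra_simps)
        also have "norm \<dots> \<le> mod_const * ?L / sqrt (real N) + (\<delta> / 2 * ?L * 1 + ?L * (1 / sqrt (real N)))"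
        proof (intro norm_triangle_mono w)
          have "\<delta> / 2 * ?L * norm (f (real j / real N)) \<le> \<delta> / 2 * ?L * 1" using fj L \<delta> by (intro mult_left_mono) auto
          then show "norm ((\<delta> / 2 * ?L) *\<^sub>R f (real j / real N)) \<le> \<delta> / 2 * ?L * 1" using L \<delta> by simp
          have "?L * norm (f (real j / real N) - f (real k / real n)) \<le> ?L * (1 / sqrt (real N))" using fd L by (intro mult_left_mono) auto
          then show "norm (?L *\<^sub>R (f (real j / real N) - f (real k / real n))) \<le> ?L * (1 / sqrt (real N))" using L by simp
        qed
        also have "\<dots> = ((mod_const + 1) / sqrt (real N) + \<delta> / 2) * ?L" by (simp add: add_divide_distrib algebra_simps)
        also have "\<dots> \<le> (\<delta> / 2 + \<delta> / 2) * ?L" using N(2) L by (intro mult_right_mono add_mono) auto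
        finally show "norm ((\<Sum>i<k. Y i \<omega>) - ?L *\<^sub>R f (real k / real n)) \<le> \<delta> * ?L" unfolding walk_def by simp
      qed
    qed
  qed
qed

text \<open>Only directions of unit energy are approached through \<open>incr_near_frequently\<close>; the factor \<open>r\<close> normalises
  the grid increments of \<open>f\<close>. It only enlarges hulls, by \<open>measure_scaled_Hhull\<close>.\<close>

lemma strassen_lower:
  fixes Y :: "nat \<Rightarrow> 'a \<Rightarrow> real ^ 'm"
  assumes "white_seq M Y" and f: "f \<in> U_set" and t0: "0 \<le> t0" "t0 \<le> 1" "f t0 \<noteq> 0" and \<delta>: "0 < \<delta>"
  shows "AE \<omega> in M. frequently (\<lambda>n. \<exists>r. 1 \<le> r \<and> r \<le> 2 / norm (f t0) \<and>
    (\<forall>k\<le>n. norm ((\<Sum>i<k. Y i \<omega>) - (lil_scale n * r) *\<^sub>R f (real k / real n)) \<le> \<delta> * lil_scale n)) sequentially"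
proof -
  interpret white_seq M Y by fact
  define \<rho> where "\<rho> = 2 / norm (f t0)"
  have ft: "0 < norm (f t0)" using t0 by simp
  have \<rho>: "0 < \<rho>" unfolding \<rho>_def using ft by simp
  have d2: "0 < \<delta> / 2" using \<delta> by simp
  \<comment> \<open>A grid this fine still sees that f is nonzero at t0, so the discrete energy is
    bounded below. Hence r is at most 2 / |f t0| whatever larger N a small \<delta>
    requires.\<close>
  obtain N1 :: nat where N1: "1 / sqrt (real N) \<le> norm (f t0) / 2" if "N1 \<le> N" for N
  proof -
    obtain m where m: "(0::nat) \<le> m" "1 \<le> m" "1 / sqrt (real m) \<le> norm (f t0) / 2"
      using exists_large_nat_sqrt[of "norm (f t0) / 2" 0 1] ft by auto
    have "1 / sqrt (real N) \<le> norm (f t0) / 2" if "m \<le> N" for N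
    proof -
      have "1 / sqrt (real N) \<le> 1 / sqrt (real m)" using that m by (intro divide_left_mono) auto
      then show ?thesis using m by linarith
    qed
    then show ?thesis using that by blast
  qed
  obtain N where N: "N1 \<le> N" "1 \<le> N" "(mod_const + \<rho>) / sqrt (real N) \<le> \<delta> / 2" using exists_large_nat_sqrt[OF d2] by blast
  have N0: "0 < real N" using N by simp
  define x where "x j = f (real (j + 1) / real N) - f (real j / real N)" for j
  define E where "E = real N * (\<Sum>j<N. (norm (x j))\<^sup>2)"
  have E1: "E \<le> 1" unfolding E_def x_def by (rule U_set_energy[OF f N(2)])
  have fx: "f (real j / real N) = (\<Sum>i<j. x i)" for j
    unfolding x_def by (induction j) (simp_all add: U_set_0[OF f])
  have sE: "norm (f t0) / 2 \<le> sqrt E"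
  proof -
    define j where "j = nat \<lfloor>t0 * real N\<rfloor>"
    have t0N: "0 \<le> t0 * real N" using t0 by simp
    have j: "real j \<le> t0 * real N" "t0 * real N < real j + 1" unfolding j_def using t0N by linarith+
    have "t0 * real N \<le> 1 * real N" using t0 by (intro mult_right_mono) auto
    then have jN: "j \<le> N" using j by linarith
    have "norm (f t0 - f (real j / real N)) \<le> sqrt (t0 - real j / real N)"
      using j t0 N0 by (intro U_set_holder[OF f]) (auto simp: field_simps)
    also have "t0 - real j / real N = (t0 * real N - real j) / real N" using N0 by (simp add: diff_divide_distrib)
    also have "sqrt \<dots> \<le> sqrt (1 / real N)" using j N0 by (intro real_sqrt_le_mono divide_right_mono) auto
    also have "\<dots> \<le> norm (f t0) / 2" using N1[OF N(1)] by (simp add: real_sqrt_divide)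
    finally have "norm (f t0) / 2 \<le> norm (f (real j / real N))" using norm_triangle_ineq2[of "f t0" "f (real j / real N)"] by linarith
    also have "\<dots> \<le> (\<Sum>i<j. norm (x i))" unfolding fx by (rule norm_sum)
    also have "\<dots> \<le> (\<Sum>i<N. norm (x i))" using jN by (intro sum_mono2) auto
    also have "\<dots> \<le> sqrt E" unfolding E_def by (rule sum_norm_sq_le)
    finally show ?thesis .
  qed
  then have sE0: "0 < sqrt E" using ft by linarith
  then have E0: "0 < E" by simp
  define r where "r = 1 / sqrt E"
  have r: "1 \<le> r" "r \<le> \<rho>"
  proof -
    have "sqrt E \<le> 1" using E1 by simp
    then show "1 \<le> r" unfolding r_def using sE0 by simp
    have "1 / sqrt E \<le> 1 / (norm (f t0) / 2)" using sE ft by (intro frac_le) auto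
    then show "r \<le> \<rho>" unfolding r_def \<rho>_def by simp
  qed
  define d where "d j = r *\<^sub>R x j" for j
  have dN: "real N * (\<Sum>j<N. (norm (d j))\<^sup>2) = 1"
  proof -
    have "real N * (\<Sum>j<N. (norm (d j))\<^sup>2) = r\<^sup>2 * E" unfolding d_def E_def by (simp add: power_mult_distrib sum_distrib_left mult_ac)
    also have "\<dots> = 1" unfolding r_def using E0 by (simp add: power_divide)
    finally show ?thesis .
  qed
  show ?thesis
    using incr_near_frequently[OF N(2) dN d2] walk_modulus[OF N(2)]
  proof eventually_elim
    fix \<omega>
    assume 1: "frequently (\<lambda>q. (\<Sum>j<N. norm (incr q j \<omega> - lil_scale (N * q) *\<^sub>R d j)) \<le> \<delta> / 2 * lil_scale (N * q)) sequentially"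
      and 2: "eventually (\<lambda>n. \<forall>l l'. l \<le> l' \<longrightarrow> l' \<le> n \<longrightarrow> N * (l' - l) \<le> n \<longrightarrow>
     norm (walk l' \<omega> - walk l \<omega>) \<le> mod_const * lil_scale n / sqrt (real N)) sequentially"
    have lim: "filterlim (\<lambda>q. N * q) at_top sequentially" using filterlim_mult_nat[OF N(2) filterlim_ident] by simp
    let ?P = "\<lambda>n. \<exists>r. 1 \<le> r \<and> r \<le> 2 / norm (f t0) \<and> (\<forall>k\<le>n. norm ((\<Sum>i<k. Y i \<omega>) - (lil_scale n * r) *\<^sub>R f (real k / real n)) \<le> \<delta> * lil_scale n)"
    have "eventually (\<lambda>q. \<forall>l l'. l \<le> l' \<longrightarrow> l' \<le> N * q \<longrightarrow> N * (l' - l) \<le> N * q \<longrightarrow>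
     norm (walk l' \<omega> - walk l \<omega>) \<le> mod_const * lil_scale (N * q) / sqrt (real N)) sequentially"
      using 2 lim unfolding filterlim_iff by blast
    then have "eventually (\<lambda>q. (\<Sum>j<N. norm (incr q j \<omega> - lil_scale (N * q) *\<^sub>R d j)) \<le> \<delta> / 2 * lil_scale (N * q) \<longrightarrow> ?P (N * q)) sequentially"
      using eventually_ge_at_top[of 3]
    proof (eventually_elim, intro impI)
      fix q :: nat
      define n where "n = N * q"
      let ?L = "lil_scale n"
      assume "\<forall>l l'. l \<le> l' \<longrightarrow> l' \<le> N * q \<longrightarrow> N * (l' - l) \<le> N * q \<longrightarrow> norm (walk l' \<omega> - walk l \<omega>) \<le> mod_const * lil_scale (N * q) / sqrt (real N)"
        and q: "3 \<le> q" and "(\<Sum>j<N. norm (incr q j \<omega> - lil_scale (N * q) *\<^sub>R d j)) \<le> \<delta> / 2 * lil_scale (N * q)"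
      then have m: "\<forall>l l'. l \<le> l' \<longrightarrow> l' \<le> n \<longrightarrow> N * (l' - l) \<le> n \<longrightarrow> norm (walk l' \<omega> - walk l \<omega>) \<le> mod_const * ?L / sqrt (real N)"
        and i: "(\<Sum>j<N. norm (incr q j \<omega> - ?L *\<^sub>R d j)) \<le> \<delta> / 2 * ?L" unfolding n_def by blast+
      have q0: "0 < q" using q by simp
      have "3 \<le> n" unfolding n_def using q N by (metis le_trans mult_le_mono1 nat_mult_1)
      then have L: "0 < ?L" and n0: "0 < real n" by (auto intro: lil_scale_pos)
      have "?P n"
      proof (intro exI[of _ r] conjI allI impI)
        show "1 \<le> r" "r \<le> 2 / norm (f t0)" using r unfolding \<rho>_def by auto
        fix k assume k: "k \<le> n"
        define j where "j = k div q"
        have jk: "j * q \<le> k" "k < j * q + q" unfolding j_def using q0 dividend_less_times_div[of q k] by (auto simp: mult.commute)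
        have j: "j \<le> N"
        proof -
          have "j * q \<le> N * q" using jk k unfolding n_def by linarith
          then show ?thesis using q0 by simp
        qed
        have w: "norm (walk k \<omega> - walk (j * q) \<omega>) \<le> mod_const * ?L / sqrt (real N)"
        proof (rule m[rule_format])
          show "N * (k - j * q) \<le> n" unfolding n_def using jk by (intro mult_le_mono2) linarith
        qed (use jk k in auto)
        have "walk (j * q) \<omega> - (?L * r) *\<^sub>R f (real j / real N) = (\<Sum>i<j. incr q i \<omega> - ?L *\<^sub>R d i)"
          unfolding walk_eq_sum_incr fx d_def by (simp add: sum_subtractf scaleR_sum_right)
        also have "norm \<dots> \<le> (\<Sum>i<j. norm (incr q i \<omega> - ?L *\<^sub>R d i))" by (rule norm_sum)
        also have "\<dots> \<le> (\<Sum>i<N. norm (incr q i \<omega> - ?L *\<^sub>R d i))" using j by (intro sum_mono2) auto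
        also note i
        finally have wj: "norm (walk (j * q) \<omega> - (?L * r) *\<^sub>R f (real j / real N)) \<le> \<delta> / 2 * ?L" .
        have q0r: "0 < real q" using q0 by simp
        have rn: "real n = real N * real q" unfolding n_def by simp
        have a: "real j / real N \<le> real k / real n"
        proof -
          have "real j * real q \<le> real k" using jk(1) by (metis of_nat_le_iff of_nat_mult)
          then show ?thesis unfolding rn using N0 q0r by (simp add: field_simps)
        qed
        have b: "real k / real n - real j / real N \<le> 1 / real N"
        proof -
          have "real k \<le> (real j + 1) * real q" using jk(2) by (metis add.commute mult.commute mult_Suc less_imp_le of_nat_Suc of_nat_le_iff of_nat_mult)
          then have "real k / real n \<le> (real j + 1) * real q / real n" by (intro divide_right_mono) auto
          also have "\<dots> = real j / real N + 1 / real N" unfolding rn using N0 q0r by (simp add: add_divide_distrib)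
          finally show ?thesis by linarith
        qed
        have "norm (f (real k / real n) - f (real j / real N)) \<le> sqrt (real k / real n - real j / real N)"
          using k n0 a by (intro U_set_holder[OF f]) auto
        also have "\<dots> \<le> sqrt (1 / real N)" using b by (rule real_sqrt_le_mono)
        finally have fd: "norm (f (real j / real N) - f (real k / real n)) \<le> 1 / sqrt (real N)" by (simp add: real_sqrt_divide norm_minus_commute)
        have "walk k \<omega> - (?L * r) *\<^sub>R f (real k / real n) = (walk k \<omega> - walk (j * q) \<omega>) + ((walk (j * q) \<omega> - (?L * r) *\<^sub>R f (real j / real N)) + (?L * r) *\<^sub>R (f (real j / real N) - f (real k / real n)))"
          by (simp add: algebra_simps)
        also have "norm \<dots> \<le> mod_const * ?L / sqrt (real N) + (\<delta> / 2 * ?L + ?L * \<rho> * (1 / sqrt (real N)))"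
        proof (intro norm_triangle_mono w wj)
          have "?L * r * norm (f (real j / real N) - f (real k / real n)) \<le> ?L * \<rho> * (1 / sqrt (real N))"
            using fd L r \<rho> by (intro mult_mono) auto
          then show "norm ((?L * r) *\<^sub>R (f (real j / real N) - f (real k / real n))) \<le> ?L * \<rho> * (1 / sqrt (real N))"
            using L r by simp
        qed
        also have "\<dots> = ((mod_const + \<rho>) / sqrt (real N) + \<delta> / 2) * ?L" by (simp add: add_divide_distrib algebra_simps)
        also have "\<dots> \<le> (\<delta> / 2 + \<delta> / 2) * ?L" using N(3) L by (intro mult_right_mono add_mono) auto
        finally show "norm ((\<Sum>i<k. Y i \<omega>) - (?L * r) *\<^sub>R f (real k / real n)) \<le> \<delta> * ?L" unfolding walk_def by simp
      qed
      then show "?P (N * q)" unfolding n_def .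
    qed
    then have "frequently (\<lambda>q. ?P (N * q)) sequentially" using 1 by (rule frequently_mp)
    then show "frequently ?P sequentially" using lim unfolding frequently_def filterlim_iff by blast
  qed
qed

section \<open>Limsup of hull volumes of an isotropic walk\<close>

lemma Hhull_eq: "Hhull g = convex hull ((\<lambda>t. (t, g t)) ` {0..1})"
  unfolding Hhull_def by (rule arg_cong[where f = "\<lambda>S. convex hull S"]) auto

lemma graph_in_Hhull: "t \<in> {0..1} \<Longrightarrow> (t, g t) \<in> Hhull g"
  unfolding Hhull_eq by (intro hull_inc imageI)

lemma Hhull_gmean:
  assumes f: "f \<in> U_set"
  shows "convex (Hhull (gmean f))" "compact (Hhull (gmean f))" "Hhull (gmean f) \<subseteq> cball 0 2"
proof -
  show "convex (Hhull (gmean f))" unfolding Hhull_eq by simp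
  show "compact (Hhull (gmean f))" unfolding Hhull_eq
    by (intro compact_convex_hull compact_continuous_image continuous_intros gmean_continuous[OF f]) simp
  show "Hhull (gmean f) \<subseteq> cball 0 2" unfolding Hhull_eq
  proof (rule hull_minimal)
    show "(\<lambda>t. (t, gmean f t)) ` {0..1} \<subseteq> cball 0 2"
    proof clarify
      fix t :: real assume t: "t \<in> {0..1}"
      have "norm (t, gmean f t) \<le> norm t + norm (gmean f t)" by (rule norm_Pair_le)
      also have "\<dots> \<le> 1 + sqrt t" using t gmean_norm_le[OF f, of t] by (intro add_mono) auto
      also have "\<dots> \<le> 1 + 1" using t by simp
      finally show "(t, gmean f t) \<in> cball 0 2" by simp
    qed
  qed simp
qed

text \<open>Stretching the m space coordinates by r multiplies the volume by r^m, which is at least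
  1.\<close>

lemma measure_scaled_Hhull:
  fixes f :: "real \<Rightarrow> real ^ 'm"
  assumes f: "f \<in> U_set" and r: "1 \<le> r"
  shows "measure lborel (Hhull (gmean f)) \<le> measure lborel (convex hull ((\<lambda>t. (t, r *\<^sub>R gmean f t)) ` {0..1}))"
proof -
  let ?F = "\<lambda>(t::real, x :: real ^ 'm). (1 * t, r *\<^sub>R x)"
  have lin: "linear ?F" by (auto simp: linear_iff algebra_simps)
  have "(\<lambda>t. (t, r *\<^sub>R gmean f t)) ` {0..1} = ?F ` ((\<lambda>t. (t, gmean f t)) ` {0..1})" by (simp add: image_image)
  then have e: "convex hull ((\<lambda>t. (t, r *\<^sub>R gmean f t)) ` {0..1}) = ?F ` Hhull (gmean f)"
    unfolding Hhull_eq by (simp only: convex_hull_linear_image[OF lin])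
  have "measure lborel (?F ` Hhull (gmean f)) = 1 * \<bar>det (matrix ((*\<^sub>R) r :: real ^ 'm \<Rightarrow> real ^ 'm))\<bar> * measure lborel (Hhull (gmean f))"
    using r Hhull_gmean(2)[OF f]
    by (intro measure_product_linear_image[where g = "\<lambda>x. (1 / r) *\<^sub>R x"]) auto
  also have "\<dots> = r ^ CARD('m) * measure lborel (Hhull (gmean f))" using r by simp
  finally have "measure lborel (?F ` Hhull (gmean f)) = r ^ CARD('m) * measure lborel (Hhull (gmean f))" .
  moreover have "1 * measure lborel (Hhull (gmean f)) \<le> r ^ CARD('m) * measure lborel (Hhull (gmean f))"
    using r by (intro mult_right_mono one_le_power) auto
  ultimately show ?thesis unfolding e by simp
qed

text \<open>For large k the relative error is small; the finitely many small k contribute a bounded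
  amount, which vanishes after division by n.\<close>

lemma ratio_uniform:
  fixes h :: "nat \<Rightarrow> real"
  assumes h: "(\<lambda>k. h k / real k) \<longlonglongrightarrow> 1" and \<delta>: "0 < \<delta>"
  shows "eventually (\<lambda>n. \<forall>k\<le>n. \<bar>h k / real n - real k / real n\<bar> \<le> \<delta>) sequentially"
proof -
  have "eventually (\<lambda>k. dist (h k / real k) 1 < \<delta>) sequentially" using h \<delta> by (rule tendstoD)
  then obtain k0 where k0: "\<And>k. k \<ge> k0 \<Longrightarrow> \<bar>h k / real k - 1\<bar> < \<delta>" unfolding eventually_sequentially dist_real_def by blast
  define B where "B = (\<Sum>k\<le>k0. \<bar>h k - real k\<bar>)"
  obtain n0 :: nat where n0: "B / \<delta> < real n0" using reals_Archimedean2 by blast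
  show ?thesis
  proof (rule eventually_sequentiallyI[of "n0 + 1"], intro allI impI)
    fix n k assume n: "n0 + 1 \<le> n" and k: "k \<le> n"
    have n': "0 < real n" using n by simp
    have "\<bar>h k - real k\<bar> \<le> \<delta> * real n"
    proof (cases "k \<ge> k0 \<and> k > 0")
      case True
      then have "\<bar>h k - real k\<bar> = \<bar>h k / real k - 1\<bar> * real k"
      proof -
        have "h k - real k = (h k / real k - 1) * real k" using True by (simp add: left_diff_distrib)
        then show ?thesis by (simp add: abs_mult)
      qed
      also have "\<dots> \<le> \<delta> * real n" using k0[of k] True k \<delta> by (intro mult_mono) auto
      finally show ?thesis .
    next
      case False
      then have "k \<in> {..k0}" by auto
      then have "\<bar>h k - real k\<bar> \<le> B" unfolding B_def by (intro member_le_sum) auto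
      also have "B \<le> \<delta> * real n0" using n0 \<delta> by (simp add: field_simps)
      also have "\<dots> \<le> \<delta> * real n" using n \<delta> by (intro mult_left_mono) auto
      finally show ?thesis .
    qed
    moreover have "h k / real n - real k / real n = (h k - real k) / real n" by (simp add: diff_divide_distrib)
    ultimately show "\<bar>h k / real n - real k / real n\<bar> \<le> \<delta>" using n' by (simp add: field_simps)
  qed
qed

text \<open>At k = 0 the convention 1 / 0 = 0 yields 0, in agreement with the values of
  \<open>G\<close> and \<open>gmean\<close> there.\<close>

definition path_mean :: "(nat \<Rightarrow> 'v::real_vector) \<Rightarrow> nat \<Rightarrow> 'v" where
  "path_mean P k = (1 / real k) *\<^sub>R (\<Sum>i\<in>{1..k}. P i)"

text \<open>The k-th mean in coordinates in which the hull stabilises: \<open>h k\<close>,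
  asymptotic to k, is up to a constant the component along \<open>mu\<close>, and P is the whitened
  walk.\<close>

definition scaled_point :: "(nat \<Rightarrow> real) \<Rightarrow> (nat \<Rightarrow> real ^ 'm) \<Rightarrow> nat \<Rightarrow> nat \<Rightarrow> real \<times> (real ^ 'm)" where
  "scaled_point h P n k = (h k / real n, (1 / lil_scale n) *\<^sub>R path_mean P k)"

lemma scaled_point_near:
  assumes f: "f \<in> U_set" and n: "3 \<le> n" and k: "k \<le> n" and h0: "h 0 = 0" and h: "\<bar>h k / real n - real k / real n\<bar> \<le> \<delta>"
    and P: "\<And>k. k \<le> n \<Longrightarrow> norm (P k - (lil_scale n * r) *\<^sub>R f (real k / real n)) \<le> \<delta> * lil_scale n" and r: "0 \<le> r" and \<delta>: "0 \<le> \<delta>"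
  shows "norm (scaled_point h P n k - (real k / real n, r *\<^sub>R gmean f (real k / real n))) \<le> 2 * \<delta> + r * sqrt (1 / real n)"
proof (cases "k = 0")
  case True
  then show ?thesis using \<delta> r by (simp add: scaled_point_def path_mean_def h0 gmean_def)
next
  case False
  let ?L = "lil_scale n"
  have L: "0 < ?L" using n by (rule lil_scale_pos)
  have "norm ((1 / real k) *\<^sub>R (\<Sum>i\<in>{1..k}. (1 / ?L) *\<^sub>R P i) - r *\<^sub>R gmean f (real k / real n)) \<le> \<delta> + r * sqrt (1 / real n)"
  proof (rule gmean_discrete[OF f _ _ k _ r])
    fix i assume "1 \<le> i" "i \<le> n"
    have "norm ((1 / ?L) *\<^sub>R P i - r *\<^sub>R f (real i / real n)) = norm ((1 / ?L) *\<^sub>R (P i - (?L * r) *\<^sub>R f (real i / real n)))"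
      using L by (simp add: scaleR_right_diff_distrib)
    also have "\<dots> = (1 / ?L) * norm (P i - (?L * r) *\<^sub>R f (real i / real n))" using L by simp
    also have "\<dots> \<le> (1 / ?L) * (\<delta> * ?L)" using L P[OF \<open>i \<le> n\<close>] by (intro mult_left_mono) auto
    finally show "norm ((1 / ?L) *\<^sub>R P i - r *\<^sub>R f (real i / real n)) \<le> \<delta>" using L by simp
  qed (use n False in auto)
  moreover have "(1 / real k) *\<^sub>R (\<Sum>i\<in>{1..k}. (1 / ?L) *\<^sub>R P i) = (1 / ?L) *\<^sub>R path_mean P k"
    unfolding path_mean_def by (simp add: scaleR_sum_right mult.commute)
  ultimately have 2: "norm ((1 / ?L) *\<^sub>R path_mean P k - r *\<^sub>R gmean f (real k / real n)) \<le> \<delta> + r * sqrt (1 / real n)" by simp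
  have "scaled_point h P n k - (real k / real n, r *\<^sub>R gmean f (real k / real n))
     = (h k / real n - real k / real n, (1 / ?L) *\<^sub>R path_mean P k - r *\<^sub>R gmean f (real k / real n))"
    unfolding scaled_point_def by simp
  also have "norm \<dots> \<le> norm (h k / real n - real k / real n) + norm ((1 / ?L) *\<^sub>R path_mean P k - r *\<^sub>R gmean f (real k / real n))"
    by (rule norm_Pair_le)
  finally show ?thesis using 2 h by simp
qed

lemma eventually_sqrt_inverse_le:
  assumes "0 < (\<delta>::real)"
  shows "eventually (\<lambda>n. sqrt (1 / real n) \<le> \<delta>) sequentially"
proof -
  have "(\<lambda>n. sqrt (1 / real n)) \<longlonglongrightarrow> sqrt 0" by (intro tendsto_real_sqrt lim_1_over_n)
  then have "eventually (\<lambda>n. sqrt (1 / real n) < \<delta>) sequentially" using assms by (intro order_tendstoD) auto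
  then show ?thesis by eventually_elim simp
qed

lemma exists_small_step:
  fixes K c e m :: real
  assumes "0 \<le> K" "0 < c" "0 < e" "0 < m"
  obtains \<delta> where "0 < \<delta>" "\<delta> \<le> m" "K * (c * \<delta>) \<le> e"
proof -
  define \<delta> where "\<delta> = min m (e / (c * (K + 1)))"
  have pos: "0 < c * (K + 1)" using assms by simp
  have d: "0 < \<delta>" unfolding \<delta>_def using assms pos by simp
  have "\<delta> \<le> e / (c * (K + 1))" unfolding \<delta>_def by (rule min.cobounded2)
  then have "\<delta> * (c * (K + 1)) \<le> e" using pos by (simp only: pos_le_divide_eq)
  moreover have "0 < c * \<delta>" using assms d by simp
  ultimately have "K * (c * \<delta>) \<le> e" by (simp add: algebra_simps)
  moreover have "\<delta> \<le> m" unfolding \<delta>_def by (rule min.cobounded1)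
  ultimately show ?thesis using that d by blast
qed

text \<open>Deterministic: the approximating path may change with n, because the hull estimate with
  C = \<open>Hhull (gmean f)\<close> is uniform over \<open>U_set\<close>.\<close>

lemma limsup_hull_upper:
  fixes P :: "nat \<Rightarrow> real ^ 'm"
  assumes h: "(\<lambda>k. h k / real k) \<longlonglongrightarrow> 1" "h 0 = 0"
    and U: "\<And>\<delta>. 0 < \<delta> \<Longrightarrow> eventually (\<lambda>n. \<exists>f\<in>U_set. \<forall>k\<le>n. norm (P k - lil_scale n *\<^sub>R f (real k / real n)) \<le> \<delta> * lil_scale n) sequentially"
  shows "limsup (\<lambda>n. ereal (measure lborel (convex hull (scaled_point h P n ` {..n})))) \<le> lambda_tilde TYPE('m)"
proof (rule ereal_le_epsilon2)
  fix e :: real assume e: "0 < e"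
  obtain K where K: "0 \<le> K" "\<And>(C::(real \<times> (real ^ 'm)) set) P \<delta>. convex C \<Longrightarrow> compact C \<Longrightarrow> C \<subseteq> cball 0 2 \<Longrightarrow> 0 < \<delta> \<Longrightarrow> \<delta> \<le> 2 \<Longrightarrow>
    (\<And>x. x \<in> P \<Longrightarrow> \<exists>y\<in>C. norm (x - y) \<le> \<delta>) \<Longrightarrow> measure lborel (convex hull P) \<le> measure lborel C + K * \<delta>"
    using measure_hull_near_convex[of 2] by (metis zero_less_numeral)
  obtain \<delta> where \<delta>: "0 < \<delta>" "\<delta> \<le> 1/2" and Kd: "K * (3 * \<delta>) \<le> e"
    using exists_small_step[OF K(1) _ e, of 3 "1/2"] by auto
  have "eventually (\<lambda>n. ereal (measure lborel (convex hull (scaled_point h P n ` {..n}))) \<le> lambda_tilde TYPE('m) + ereal e) sequentially"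
    using U[OF \<delta>(1)] ratio_uniform[OF h(1) \<delta>(1)] eventually_sqrt_inverse_le[OF \<delta>(1)] eventually_ge_at_top[of 3]
  proof eventually_elim
    fix n
    assume "\<exists>f\<in>U_set. \<forall>k\<le>n. norm (P k - lil_scale n *\<^sub>R f (real k / real n)) \<le> \<delta> * lil_scale n"
      and hk: "\<forall>k\<le>n. \<bar>h k / real n - real k / real n\<bar> \<le> \<delta>" and sn: "sqrt (1 / real n) \<le> \<delta>" and n: "3 \<le> n"
    then obtain f where f: "f \<in> U_set" "\<And>k. k \<le> n \<Longrightarrow> norm (P k - (lil_scale n * 1) *\<^sub>R f (real k / real n)) \<le> \<delta> * lil_scale n" by auto
    have "measure lborel (convex hull (scaled_point h P n ` {..n})) \<le> measure lborel (Hhull (gmean f)) + K * (3 * \<delta>)"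
    proof (rule K(2)[OF Hhull_gmean[OF f(1)]])
      fix x assume "x \<in> scaled_point h P n ` {..n}"
      then obtain k where k: "k \<le> n" "x = scaled_point h P n k" by auto
      have "norm (x - (real k / real n, 1 *\<^sub>R gmean f (real k / real n))) \<le> 2 * \<delta> + 1 * sqrt (1 / real n)"
        unfolding k(2) using hk k(1) \<delta>(1) by (intro scaled_point_near[where h = h and P = P, OF f(1) n k(1) h(2)] f(2)) auto
      also have "\<dots> \<le> 3 * \<delta>" using sn by simp
      finally have "norm (x - (real k / real n, gmean f (real k / real n))) \<le> 3 * \<delta>" by simp
      moreover have "(real k / real n, gmean f (real k / real n)) \<in> Hhull (gmean f)" using k n by (intro graph_in_Hhull) auto
      ultimately show "\<exists>y\<in>Hhull (gmean f). norm (x - y) \<le> 3 * \<delta>" by blast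
    qed (use \<delta> in auto)
    then have "measure lborel (convex hull (scaled_point h P n ` {..n})) \<le> measure lborel (Hhull (gmean f)) + e" using Kd by linarith
    then have "ereal (measure lborel (convex hull (scaled_point h P n ` {..n}))) \<le> ereal (measure lborel (Hhull (gmean f))) + ereal e" by simp
    also have "\<dots> \<le> lambda_tilde TYPE('m) + ereal e" unfolding lambda_tilde_def using f(1) by (intro add_right_mono SUP_upper)
    finally show "ereal (measure lborel (convex hull (scaled_point h P n ` {..n}))) \<le> lambda_tilde TYPE('m) + ereal e" .
  qed
  then show "limsup (\<lambda>n. ereal (measure lborel (convex hull (scaled_point h P n ` {..n})))) \<le> lambda_tilde TYPE('m) + ereal e"
    by (rule Limsup_bounded)
qed

lemma frequently_le_Limsup:
  fixes X :: "'a \<Rightarrow> ereal"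
  assumes "frequently (\<lambda>n. c \<le> X n) F"
  shows "c \<le> Limsup F X"
proof (rule ccontr)
  assume "\<not> c \<le> Limsup F X"
  then have "eventually (\<lambda>n. X n < c) F" by (intro Limsup_lessD) simp
  then show False using assms unfolding frequently_def by (simp add: not_le)
qed

text \<open>Roles are reversed: the graph stretched by r is close to the finite hull. A graph point
  is within 2 \<delta> of the graph over the preceding grid time, and that point within 3 \<delta>
  of a scaled mean. Undoing the stretching only decreases the volume.\<close>

lemma limsup_hull_lower:
  fixes P :: "nat \<Rightarrow> real ^ 'm"
  assumes h: "(\<lambda>k. h k / real k) \<longlonglongrightarrow> 1" "h 0 = 0" and f: "f \<in> U_set" and \<rho>: "1 \<le> \<rho>"
    and L: "\<And>\<delta>. 0 < \<delta> \<Longrightarrow> frequently (\<lambda>n. \<exists>r. 1 \<le> r \<and> r \<le> \<rho> \<and> (\<forall>k\<le>n. norm (P k - (lil_scale n * r) *\<^sub>R f (real k / real n)) \<le> \<delta> * lil_scale n)) sequentially"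
  shows "ereal (measure lborel (Hhull (gmean f))) \<le> limsup (\<lambda>n. ereal (measure lborel (convex hull (scaled_point h P n ` {..n}))))"
proof (rule ereal_le_epsilon2)
  fix e :: real assume e: "0 < e"
  \<comment> \<open>Scaled points have norm at most (1 + \<rho>) + 3 \<delta>, and 5 \<delta> must
    not exceed the radius; with \<delta> \<le> 1 this R serves both.\<close>
  define R where "R = \<rho> + 6"
  have R: "0 < R" unfolding R_def using \<rho> by simp
  obtain K where K: "0 \<le> K" "\<And>(C::(real \<times> (real ^ 'm)) set) P \<delta>. convex C \<Longrightarrow> compact C \<Longrightarrow> C \<subseteq> cball 0 R \<Longrightarrow> 0 < \<delta> \<Longrightarrow> \<delta> \<le> R \<Longrightarrow>
    (\<And>x. x \<in> P \<Longrightarrow> \<exists>y\<in>C. norm (x - y) \<le> \<delta>) \<Longrightarrow> measure lborel (convex hull P) \<le> measure lborel C + K * \<delta>"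
    using measure_hull_near_convex[OF R] by metis
  obtain \<delta> where \<delta>: "0 < \<delta>" "\<delta> \<le> 1" and Kd: "K * (5 * \<delta>) \<le> e"
    using exists_small_step[OF K(1) _ e, of 5 1] by auto
  \<comment> \<open>The factor r, at most \<rho>, multiplies the space coordinates, so the curve is
    resolved to \<delta> / \<rho>.\<close>
  have d\<rho>: "0 < \<delta> / \<rho>" using \<delta> \<rho> by simp
  have "uniformly_continuous_on {0..1} (gmean f)" by (rule compact_uniformly_continuous[OF gmean_continuous[OF f]]) simp
  then obtain w where w: "0 < w" "\<And>s t. s \<in> {0..1} \<Longrightarrow> t \<in> {0..1} \<Longrightarrow> dist s t < w \<Longrightarrow> dist (gmean f s) (gmean f t) < \<delta> / \<rho>"
    unfolding uniformly_continuous_on_def using d\<rho> by (metis (no_types))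
  define \<kappa> where "\<kappa> = min (w / 2) \<delta>"
  have \<kappa>: "0 < \<kappa>" "\<kappa> \<le> \<delta>" "\<kappa> < w" unfolding \<kappa>_def using w \<delta> by auto
  have "(\<lambda>n. 1 / real n) \<longlonglongrightarrow> 0" by (rule lim_1_over_n)
  then have ev1: "eventually (\<lambda>n. 1 / real n < \<kappa>) sequentially" using \<kappa>(1) by (rule order_tendstoD)
  have "frequently (\<lambda>n. ereal (measure lborel (Hhull (gmean f)) - e) \<le> ereal (measure lborel (convex hull (scaled_point h P n ` {..n})))) sequentially"
  proof (rule frequently_mp[OF _ L[OF \<delta>(1)]])
    show "eventually (\<lambda>n. (\<exists>r. 1 \<le> r \<and> r \<le> \<rho> \<and> (\<forall>k\<le>n. norm (P k - (lil_scale n * r) *\<^sub>R f (real k / real n)) \<le> \<delta> * lil_scale n)) \<longrightarrow>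
      ereal (measure lborel (Hhull (gmean f)) - e) \<le> ereal (measure lborel (convex hull (scaled_point h P n ` {..n})))) sequentially"
      using ratio_uniform[OF h(1) \<delta>(1)] eventually_sqrt_inverse_le[OF d\<rho>] ev1 eventually_ge_at_top[of 3]
    proof (eventually_elim, intro impI, elim exE conjE)
      fix n r
      assume hk: "\<forall>k\<le>n. \<bar>h k / real n - real k / real n\<bar> \<le> \<delta>" and sn: "sqrt (1 / real n) \<le> \<delta> / \<rho>" and n1: "1 / real n < \<kappa>" and n: "3 \<le> n"
        and r: "1 \<le> r" "r \<le> \<rho>" and Pk: "\<forall>k\<le>n. norm (P k - (lil_scale n * r) *\<^sub>R f (real k / real n)) \<le> \<delta> * lil_scale n"
      have n0: "0 < real n" using n by simp
      let ?g = "\<lambda>t. (t, r *\<^sub>R gmean f t)"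
      have rs: "r * sqrt (1 / real n) \<le> \<delta>"
      proof -
        have "r * sqrt (1 / real n) \<le> \<rho> * (\<delta> / \<rho>)" using r sn \<rho> by (intro mult_mono) auto
        then show ?thesis using \<rho> by simp
      qed
      have near: "norm (scaled_point h P n k - ?g (real k / real n)) \<le> 3 * \<delta>" if k: "k \<le> n" for k
      proof -
        have "norm (scaled_point h P n k - ?g (real k / real n)) \<le> 2 * \<delta> + r * sqrt (1 / real n)"
          using hk Pk k r \<delta>(1) by (intro scaled_point_near[where h = h and P = P, OF f n k h(2)]) auto
        then show ?thesis using rs by simp
      qed
      have gn: "norm (?g t) \<le> 1 + \<rho>" if t: "t \<in> {0..1}" for t
      proof -
        have "norm (?g t) \<le> norm t + norm (r *\<^sub>R gmean f t)" by (rule norm_Pair_le)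
        also have "\<dots> \<le> 1 + \<rho> * 1"
        proof (intro add_mono)
          have "norm (gmean f t) \<le> sqrt t" using t by (intro gmean_norm_le[OF f]) auto
          also have "\<dots> \<le> 1" using t by simp
          finally have "\<bar>r\<bar> * norm (gmean f t) \<le> \<rho> * 1" using r by (intro mult_mono) auto
          then show "norm (r *\<^sub>R gmean f t) \<le> \<rho> * 1" by simp
        qed (use t in auto)
        finally show ?thesis by simp
      qed
      have "measure lborel (convex hull (?g ` {0..1})) \<le> measure lborel (convex hull (scaled_point h P n ` {..n})) + K * (5 * \<delta>)"
      proof (rule K(2))
        show "convex (convex hull (scaled_point h P n ` {..n}))" by simp
        show "compact (convex hull (scaled_point h P n ` {..n}))" by (intro compact_convex_hull finite_imp_compact) simp
        show "convex hull (scaled_point h P n ` {..n}) \<subseteq> cball 0 R"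
        proof (rule hull_minimal)
          show "scaled_point h P n ` {..n} \<subseteq> cball 0 R"
          proof (rule image_subsetI)
            fix k assume "k \<in> {..n}"
            then have k: "k \<le> n" by simp
            have "norm (scaled_point h P n k) \<le> norm (?g (real k / real n)) + norm (scaled_point h P n k - ?g (real k / real n))"
              using norm_triangle_ineq[of "?g (real k / real n)" "scaled_point h P n k - ?g (real k / real n)"] by simp
            also have "\<dots> \<le> (1 + \<rho>) + 3 * \<delta>" using k n0 by (intro add_mono gn near) auto
            finally show "scaled_point h P n k \<in> cball 0 R" using \<delta> unfolding R_def by simp
          qed
        qed simp
        show "0 < 5 * \<delta>" "5 * \<delta> \<le> R" using \<delta> \<rho> unfolding R_def by auto
        fix x assume "x \<in> ?g ` {0..1}"
        then obtain t where t: "t \<in> {0..1}" "x = ?g t" by auto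
        define k where "k = nat \<lfloor>t * real n\<rfloor>"
        have tn: "0 \<le> t * real n" using t by simp
        have k: "real k \<le> t * real n" "t * real n < real k + 1" unfolding k_def using tn by linarith+
        have "t * real n \<le> 1 * real n" using t by (intro mult_right_mono) auto
        then have kn: "k \<le> n" using k by linarith
        have tk: "\<bar>t - real k / real n\<bar> \<le> 1 / real n"
        proof -
          have "t - real k / real n = (t * real n - real k) / real n" using n0 by (simp add: diff_divide_distrib)
          moreover have "\<bar>(t * real n - real k) / real n\<bar> \<le> 1 / real n" using k n0 by (simp add: divide_right_mono)
          ultimately show ?thesis by simp
        qed
        have "dist (gmean f t) (gmean f (real k / real n)) < \<delta> / \<rho>"
          using t kn n0 tk n1 \<kappa> by (intro w(2)) (auto simp: dist_real_def)
        then have "r * norm (gmean f t - gmean f (real k / real n)) \<le> \<rho> * (\<delta> / \<rho>)" using r \<rho> by (intro mult_mono) (auto simp: dist_norm)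
        then have g2: "norm (r *\<^sub>R (gmean f t - gmean f (real k / real n))) \<le> \<delta>" using r \<rho> by simp
        have "?g t - ?g (real k / real n) = (t - real k / real n, r *\<^sub>R (gmean f t - gmean f (real k / real n)))"
          by (simp add: scaleR_right_diff_distrib)
        also have "norm \<dots> \<le> norm (t - real k / real n) + norm (r *\<^sub>R (gmean f t - gmean f (real k / real n)))" by (rule norm_Pair_le)
        also have "\<dots> \<le> \<delta> + \<delta>" using tk n1 \<kappa> g2 by (intro add_mono) auto
        finally have g3: "norm (?g t - ?g (real k / real n)) \<le> 2 * \<delta>" by simp
        have "x - scaled_point h P n k = (?g t - ?g (real k / real n)) - (scaled_point h P n k - ?g (real k / real n))" unfolding t(2) by simp
        also have "norm \<dots> \<le> 2 * \<delta> + 3 * \<delta>" by (rule norm_triangle_le_diff[OF add_mono[OF g3 near[OF kn]]])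
        finally have "norm (x - scaled_point h P n k) \<le> 5 * \<delta>" by simp
        moreover have "scaled_point h P n k \<in> convex hull (scaled_point h P n ` {..n})" using kn by (intro hull_inc imageI) auto
        ultimately show "\<exists>y\<in>convex hull (scaled_point h P n ` {..n}). norm (x - y) \<le> 5 * \<delta>" by blast
      qed
      then show "ereal (measure lborel (Hhull (gmean f)) - e) \<le> ereal (measure lborel (convex hull (scaled_point h P n ` {..n})))"
        using measure_scaled_Hhull[OF f r(1)] Kd by simp
    qed
  qed
  then have "ereal (measure lborel (Hhull (gmean f)) - e) \<le> limsup (\<lambda>n. ereal (measure lborel (convex hull (scaled_point h P n ` {..n}))))"
    by (rule frequently_le_Limsup)
  then have "ereal (measure lborel (Hhull (gmean f)) - e) + ereal e \<le> limsup (\<lambda>n. ereal (measure lborel (convex hull (scaled_point h P n ` {..n})))) + ereal e"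
    by (rule add_right_mono)
  then show "ereal (measure lborel (Hhull (gmean f))) \<le> limsup (\<lambda>n. ereal (measure lborel (convex hull (scaled_point h P n ` {..n})))) + ereal e" by simp
qed

lemma measure_Hhull_zero:
  fixes g :: "real \<Rightarrow> real ^ 'm"
  assumes g: "\<And>t. t \<in> {0..1} \<Longrightarrow> g t = 0"
  shows "measure lborel (Hhull g) = 0"
proof -
  \<comment> \<open>The normal of a hyperplane containing the graph; any space coordinate would
    do.\<close>
  let ?a = "(0, axis undefined 1) :: real \<times> (real ^ 'm)"
  have "Hhull g \<subseteq> {z. ?a \<bullet> z = 0}" unfolding Hhull_eq using g by (intro hull_minimal convex_hyperplane) auto
  moreover have "negligible {z. ?a \<bullet> z = 0}" by (rule negligible_hyperplane) (simp add: zero_prod_def axis_eq_0_iff)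
  ultimately have n: "negligible (Hhull g)" by (rule negligible_subset[rotated])
  have "(\<lambda>t. (t, g t)) ` {0..1} = (\<lambda>t. (t, 0)) ` {0..1}" using g by (intro image_cong) auto
  then have "compact (Hhull g)" unfolding Hhull_eq
    by (simp only:) (intro compact_convex_hull compact_continuous_image continuous_intros, simp)
  then have "measure lborel (Hhull g) = measure lebesgue (Hhull g)" by (simp add: borel_compact measure_completion)
  then show ?thesis using negligible_imp_measure0[OF n] by simp
qed

text \<open>The exceptional null sets depend on the path and the tolerance. A sequence of volumes
  with supremum \<open>lambda_tilde\<close> and the tolerances 1 / (j + 1) keep their number
  countable.\<close>

lemma white_limsup_hull:
  fixes Y :: "nat \<Rightarrow> 'a \<Rightarrow> real ^ 'm" and h :: "'a \<Rightarrow> nat \<Rightarrow> real"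
  assumes w: "white_seq M Y" and h: "AE \<omega> in M. (\<lambda>k. h \<omega> k / real k) \<longlonglongrightarrow> 1 \<and> h \<omega> 0 = 0"
  shows "AE \<omega> in M. limsup (\<lambda>n. ereal (measure lborel (convex hull (scaled_point (h \<omega>) (\<lambda>k. \<Sum>i<k. Y i \<omega>) n ` {..n})))) = lambda_tilde TYPE('m)"
proof -
  let ?V = "\<lambda>\<omega>. limsup (\<lambda>n. ereal (measure lborel (convex hull (scaled_point (h \<omega>) (\<lambda>k. \<Sum>i<k. Y i \<omega>) n ` {..n}))))"
  have lower: "AE \<omega> in M. ereal (measure lborel (Hhull (gmean f))) \<le> ?V \<omega>" if f: "f \<in> U_set" for f :: "real \<Rightarrow> real ^ 'm"
  proof (cases "\<exists>t0\<in>{0..1}. f t0 \<noteq> 0")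
    case True
    then obtain t0 where t0: "0 \<le> t0" "t0 \<le> 1" "f t0 \<noteq> 0" by auto
    have "norm (f t0) \<le> sqrt t0" by (rule U_set_norm_le[OF f t0(1,2)])
    also have "\<dots> \<le> 1" using t0 by simp
    finally have \<rho>: "1 \<le> 2 / norm (f t0)" using t0 by simp
    have "AE \<omega> in M. \<forall>j. frequently (\<lambda>n. \<exists>r. 1 \<le> r \<and> r \<le> 2 / norm (f t0) \<and>
      (\<forall>k\<le>n. norm ((\<Sum>i<k. Y i \<omega>) - (lil_scale n * r) *\<^sub>R f (real k / real n)) \<le> (1 / real (Suc j)) * lil_scale n)) sequentially"
      by (intro AE_all_countable[THEN iffD2] allI strassen_lower[OF w f t0]) simp
    then show ?thesis using h
    proof eventually_elim
      fix \<omega>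
      assume L: "\<forall>j. frequently (\<lambda>n. \<exists>r. 1 \<le> r \<and> r \<le> 2 / norm (f t0) \<and>
        (\<forall>k\<le>n. norm ((\<Sum>i<k. Y i \<omega>) - (lil_scale n * r) *\<^sub>R f (real k / real n)) \<le> (1 / real (Suc j)) * lil_scale n)) sequentially"
        and h: "(\<lambda>k. h \<omega> k / real k) \<longlonglongrightarrow> 1 \<and> h \<omega> 0 = 0"
      show "ereal (measure lborel (Hhull (gmean f))) \<le> ?V \<omega>"
      proof (rule limsup_hull_lower[OF _ _ f \<rho>])
        fix \<delta> :: real assume "0 < \<delta>"
        then obtain j where j: "inverse (real (Suc j)) < \<delta>" using reals_Archimedean by blast
        have ev: "eventually (\<lambda>n. (\<exists>r. 1 \<le> r \<and> r \<le> 2 / norm (f t0) \<and>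
          (\<forall>k\<le>n. norm ((\<Sum>i<k. Y i \<omega>) - (lil_scale n * r) *\<^sub>R f (real k / real n)) \<le> (1 / real (Suc j)) * lil_scale n)) \<longrightarrow>
          (\<exists>r. 1 \<le> r \<and> r \<le> 2 / norm (f t0) \<and>
          (\<forall>k\<le>n. norm ((\<Sum>i<k. Y i \<omega>) - (lil_scale n * r) *\<^sub>R f (real k / real n)) \<le> \<delta> * lil_scale n))) sequentially"
          using eventually_ge_at_top[of 3]
        proof eventually_elim
          fix n :: nat assume "3 \<le> n"
          then have "(1 / real (Suc j)) * lil_scale n \<le> \<delta> * lil_scale n"
            using j lil_scale_pos[of n] by (intro mult_right_mono) (auto simp: inverse_eq_divide)
          then show "(\<exists>r. 1 \<le> r \<and> r \<le> 2 / norm (f t0) \<and>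
          (\<forall>k\<le>n. norm ((\<Sum>i<k. Y i \<omega>) - (lil_scale n * r) *\<^sub>R f (real k / real n)) \<le> (1 / real (Suc j)) * lil_scale n)) \<longrightarrow>
          (\<exists>r. 1 \<le> r \<and> r \<le> 2 / norm (f t0) \<and>
          (\<forall>k\<le>n. norm ((\<Sum>i<k. Y i \<omega>) - (lil_scale n * r) *\<^sub>R f (real k / real n)) \<le> \<delta> * lil_scale n))"
            by (meson order_trans)
        qed
        show "frequently (\<lambda>n. \<exists>r. 1 \<le> r \<and> r \<le> 2 / norm (f t0) \<and>
          (\<forall>k\<le>n. norm ((\<Sum>i<k. Y i \<omega>) - (lil_scale n * r) *\<^sub>R f (real k / real n)) \<le> \<delta> * lil_scale n)) sequentially"
          by (rule frequently_mp[OF ev]) (rule L[rule_format])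
      qed (use h in auto)
    qed
  next
    case False
    \<comment> \<open>The zero path is outside the scope of \<open>strassen_lower\<close>; its hull
      has volume 0.\<close>
    have "gmean f t = 0" if "t \<in> {0..1}" for t
    proof -
      have "integral {0..t} f = integral {0..t} (\<lambda>_. 0)" using False that by (intro integral_cong) auto
      then show ?thesis by (simp add: gmean_def)
    qed
    then have "measure lborel (Hhull (gmean f)) = 0" by (rule measure_Hhull_zero)
    moreover have "0 \<le> ?V \<omega>" for \<omega>
    proof -
      have "ereal 0 \<le> ?V \<omega>" by (rule frequently_le_Limsup) (simp add: eventually_frequently)
      then show ?thesis by (simp add: zero_ereal_def)
    qed
    ultimately show ?thesis by (simp add: zero_ereal_def[symmetric])
  qed
  have "(\<lambda>f. ereal (measure lborel (Hhull (gmean f)))) ` (U_set :: (real \<Rightarrow> real ^ 'm) set) \<noteq> {}"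
    using pl_path_in_U_set[of 1 "\<lambda>_. 0 :: real ^ 'm"] by auto
  from Sup_countable_SUP[OF this] obtain s :: "nat \<Rightarrow> ereal"
    where s: "range s \<subseteq> (\<lambda>f. ereal (measure lborel (Hhull (gmean f)))) ` (U_set :: (real \<Rightarrow> real ^ 'm) set)" "lambda_tilde TYPE('m) = (SUP i. s i)"
    unfolding lambda_tilde_def by blast
  have "AE \<omega> in M. s i \<le> ?V \<omega>" for i
  proof -
    obtain f :: "real \<Rightarrow> real ^ 'm" where "f \<in> U_set" "s i = ereal (measure lborel (Hhull (gmean f)))" using s(1) by blast
    then show ?thesis using lower by simp
  qed
  then have "AE \<omega> in M. \<forall>i. s i \<le> ?V \<omega>" by (simp add: AE_all_countable)
  then have lo: "AE \<omega> in M. lambda_tilde TYPE('m) \<le> ?V \<omega>" unfolding s(2) by eventually_elim (auto intro: SUP_least)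
  have "AE \<omega> in M. \<forall>j. eventually (\<lambda>n. \<exists>f\<in>U_set. \<forall>k\<le>n. norm ((\<Sum>i<k. Y i \<omega>) - lil_scale n *\<^sub>R f (real k / real n)) \<le> (1 / real (Suc j)) * lil_scale n) sequentially"
    by (intro AE_all_countable[THEN iffD2] allI strassen_upper[OF w]) simp
  then have up: "AE \<omega> in M. ?V \<omega> \<le> lambda_tilde TYPE('m)" using h
  proof eventually_elim
    fix \<omega>
    assume U: "\<forall>j. eventually (\<lambda>n. \<exists>f\<in>U_set. \<forall>k\<le>n. norm ((\<Sum>i<k. Y i \<omega>) - lil_scale n *\<^sub>R f (real k / real n)) \<le> (1 / real (Suc j)) * lil_scale n) sequentially"
      and h: "(\<lambda>k. h \<omega> k / real k) \<longlonglongrightarrow> 1 \<and> h \<omega> 0 = 0"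
    show "?V \<omega> \<le> lambda_tilde TYPE('m)"
    proof (rule limsup_hull_upper)
      fix \<delta> :: real assume "0 < \<delta>"
      then obtain j where j: "inverse (real (Suc j)) < \<delta>" using reals_Archimedean by blast
      show "eventually (\<lambda>n. \<exists>f\<in>U_set. \<forall>k\<le>n. norm ((\<Sum>i<k. Y i \<omega>) - lil_scale n *\<^sub>R f (real k / real n)) \<le> \<delta> * lil_scale n) sequentially"
        using U[rule_format, of j] eventually_ge_at_top[of 3]
      proof eventually_elim
        fix n :: nat assume U: "\<exists>f\<in>U_set. \<forall>k\<le>n. norm ((\<Sum>i<k. Y i \<omega>) - lil_scale n *\<^sub>R f (real k / real n)) \<le> (1 / real (Suc j)) * lil_scale n" and "3 \<le> n"
        then have "(1 / real (Suc j)) * lil_scale n \<le> \<delta> * lil_scale n"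
          using j lil_scale_pos[of n] by (intro mult_right_mono) (auto simp: inverse_eq_divide)
        then show "\<exists>f\<in>U_set. \<forall>k\<le>n. norm ((\<Sum>i<k. Y i \<omega>) - lil_scale n *\<^sub>R f (real k / real n)) \<le> \<delta> * lil_scale n"
          using U by (meson order_trans)
      qed
    qed (use h in auto)
  qed
  show ?thesis using lo up by eventually_elim (rule antisym)
qed

section \<open>Reduction to an isotropic walk\<close>

text \<open>Gram-Schmidt by induction on the index set: \<open>mu\<close> and the vectors chosen so
  far span less than the whole space, which leaves a unit vector orthogonal to all of them. This
  makes the choice in \<open>perp_cov\<close> meaningful.\<close>

lemma exists_perp_basis:
  fixes mu :: "real ^ 'n"
  assumes dim: "CARD('n) = CARD('m) + 1"
  shows "\<exists>B :: 'm::finite \<Rightarrow> real ^ 'n. (\<forall>i j. B i \<bullet> B j = (if i = j then 1 else 0)) \<and> (\<forall>i. B i \<bullet> mu = 0)"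
proof -
  have "\<exists>B :: 'm \<Rightarrow> real ^ 'n. (\<forall>i\<in>I. \<forall>j\<in>I. B i \<bullet> B j = (if i = j then 1 else 0)) \<and> (\<forall>i\<in>I. B i \<bullet> mu = 0)" for I :: "'m set"
    using finite[of I]
  proof (induction I rule: finite_induct)
    case (insert a I)
    then obtain B :: "'m \<Rightarrow> real ^ 'n" where B: "\<forall>i\<in>I. \<forall>j\<in>I. B i \<bullet> B j = (if i = j then 1 else 0)" "\<forall>i\<in>I. B i \<bullet> mu = 0" by blast
    have "card (insert a I) \<le> CARD('m)" by (rule card_mono) auto
    then have cI: "card I < CARD('m)" using insert by simp
    have "dim (insert mu (B ` I)) \<le> card (insert mu (B ` I))" by (rule dim_le_card') (use insert in simp)
    also have "\<dots> \<le> Suc (card (B ` I))" by (rule card_insert_le_m1) auto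
    also have "\<dots> \<le> Suc (card I)" using card_image_le[OF insert(1), of B] by simp
    also have "\<dots> < DIM(real ^ 'n)" using cI dim by simp
    finally obtain v where v: "v \<noteq> 0" "\<And>y. y \<in> span (insert mu (B ` I)) \<Longrightarrow> orthogonal v y"
      using orthogonal_to_subspace_exists by blast
    have v0: "v \<bullet> mu = 0" "\<And>i. i \<in> I \<Longrightarrow> v \<bullet> B i = 0"
      using v(2)[OF span_base, unfolded orthogonal_def] by auto
    then have v1: "\<And>i. i \<in> I \<Longrightarrow> B i \<bullet> v = 0" by (simp add: inner_commute)
    have "sgn v \<bullet> sgn v = 1" using v(1) by (simp add: dot_square_norm norm_sgn)
    then have "\<forall>i\<in>insert a I. \<forall>j\<in>insert a I. (B(a := sgn v)) i \<bullet> (B(a := sgn v)) j = (if i = j then 1 else 0)"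
      using B(1) v0 v1 insert(2) by (auto simp: sgn_div_norm)
    moreover have "\<forall>i\<in>insert a I. (B(a := sgn v)) i \<bullet> mu = 0"
      using B(2) v0 by (auto simp: sgn_div_norm)
    ultimately show ?case by blast
  qed simp
  from this[of UNIV] show ?thesis by simp
qed

text \<open>Gram-Schmidt for the inner product \<open>u \<bullet> (\<Gamma> *v v)\<close>: its
  orthonormal vectors form the rows of W, which takes the place of an inverse square root of
  \<Gamma>.\<close>

lemma positive_definite_whitening:
  fixes \<Gamma> :: "real ^ 'm ^ 'm"
  assumes sym: "\<And>u v. u \<bullet> (\<Gamma> *v v) = v \<bullet> (\<Gamma> *v u)" and pos: "\<And>v. v \<noteq> 0 \<Longrightarrow> 0 < v \<bullet> (\<Gamma> *v v)"
  shows "\<exists>W :: real ^ 'm ^ 'm. W ** \<Gamma> ** transpose W = mat 1"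
proof -
  have "\<exists>w :: 'm \<Rightarrow> real ^ 'm. \<forall>i\<in>I. \<forall>j\<in>I. w i \<bullet> (\<Gamma> *v w j) = (if i = j then 1 else 0)" for I :: "'m set"
    using finite[of I]
  proof (induction I rule: finite_induct)
    case (insert a I)
    then obtain w :: "'m \<Rightarrow> real ^ 'm" where w: "\<forall>i\<in>I. \<forall>j\<in>I. w i \<bullet> (\<Gamma> *v w j) = (if i = j then 1 else 0)" by blast
    have "card (insert a I) \<le> CARD('m)" by (rule card_mono) auto
    then have cI: "card I < CARD('m)" using insert by simp
    have "dim ((\<lambda>i. \<Gamma> *v w i) ` I) \<le> card ((\<lambda>i. \<Gamma> *v w i) ` I)" by (rule dim_le_card') (use insert in simp)
    also have "\<dots> \<le> card I" by (rule card_image_le[OF insert(1)])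
    also have "\<dots> < DIM(real ^ 'm)" using cI by simp
    finally obtain v where v: "v \<noteq> 0" "\<And>y. y \<in> span ((\<lambda>i. \<Gamma> *v w i) ` I) \<Longrightarrow> orthogonal v y"
      using orthogonal_to_subspace_exists by blast
    have v0: "\<And>i. i \<in> I \<Longrightarrow> v \<bullet> (\<Gamma> *v w i) = 0"
      using v(2)[OF span_base, unfolded orthogonal_def] by auto
    then have v1: "\<And>i. i \<in> I \<Longrightarrow> w i \<bullet> (\<Gamma> *v v) = 0" using sym by metis
    define c where "c = 1 / sqrt (v \<bullet> (\<Gamma> *v v))"
    have c: "c * (c * (v \<bullet> (\<Gamma> *v v))) = 1" unfolding c_def using pos[OF v(1)] by (simp add: field_simps)
    have "\<forall>i\<in>insert a I. \<forall>j\<in>insert a I. (w(a := c *\<^sub>R v)) i \<bullet> (\<Gamma> *v (w(a := c *\<^sub>R v)) j) = (if i = j then 1 else 0)"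
      using w v0 v1 c insert(2) by (auto simp: matrix_vector_mult_scaleR)
    then show ?case by blast
  qed simp
  from this[of UNIV] obtain w :: "'m \<Rightarrow> real ^ 'm" where w: "\<And>i j. w i \<bullet> (\<Gamma> *v w j) = (if i = j then 1 else 0)" by auto
  have "((\<chi> i. w i) ** \<Gamma> ** transpose (\<chi> i. w i)) $ i $ j = w i \<bullet> (\<Gamma> *v w j)" for i j
  proof -
    have "((\<chi> i. w i) ** (\<Gamma> ** transpose (\<chi> i. w i))) $ i $ j = w i \<bullet> (\<Gamma> *v w j)"
      by (simp add: matrix_matrix_mult_def matrix_vector_mult_def inner_vec_def transpose_def)
    then show ?thesis by (simp add: matrix_mul_assoc)
  qed
  then have "(\<chi> i. w i) ** \<Gamma> ** transpose (\<chi> i. w i) = mat 1" by (simp add: vec_eq_iff w mat_def)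
  then show ?thesis by blast
qed

lemma measure_hyperplane_hull:
  fixes w :: "'v::euclidean_space"
  assumes "w \<noteq> 0" "\<And>x. x \<in> P \<Longrightarrow> w \<bullet> x = 0"
  shows "measure lborel (convex hull P) = 0"
proof -
  have "convex hull P \<subseteq> {x. w \<bullet> x = 0}" using assms(2) by (intro hull_minimal convex_hyperplane) auto
  moreover have "negligible {x. w \<bullet> x = 0}" using assms(1) by (intro negligible_hyperplane) auto
  ultimately have "negligible (convex hull P)" by (rule negligible_subset[rotated])
  then have n: "convex hull P \<in> null_sets lebesgue" by (simp only: negligible_iff_null_sets)
  show ?thesis
  proof (cases "convex hull P \<in> sets lborel")
    case True
    then have "measure lborel (convex hull P) = measure lebesgue (convex hull P)" by (simp add: measure_completion)
    then show ?thesis using n by (simp add: measure_def null_sets_def)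
  qed (simp add: measure_notin_sets)
qed

section \<open>Linear images, shifts and covariances of the step sequence\<close>

lemma (in iid_seq) iid_seq_linear:
  fixes L :: "'v \<Rightarrow> 'w::euclidean_space"
  assumes L: "linear L"
  shows "iid_seq M (\<lambda>i \<omega>. L (Y i \<omega>))"
proof -
  have bl: "bounded_linear L" using L by (simp add: linear_conv_bounded_linear)
  have Lm[measurable]: "L \<in> borel_measurable borel"
    by (rule borel_measurable_continuous_onI[OF bounded_linear.continuous_on[OF bl continuous_on_id]])
  show ?thesis
  proof unfold_locales
    show "(\<lambda>\<omega>. L (Y i \<omega>)) \<in> borel_measurable M" for i by measurable
    show "indep_vars (\<lambda>_. borel) (\<lambda>i \<omega>. L (Y i \<omega>)) UNIV"
      by (rule indep_vars_compose2[OF indepY]) measurable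
    show "distr M borel (\<lambda>\<omega>. L (Y i \<omega>)) = distr M borel (\<lambda>\<omega>. L (Y 0 \<omega>))" for i
    proof -
      have "distr (distr M borel (Y i)) borel L = distr (distr M borel (Y 0)) borel L" by (simp only: identY[of i])
      then show ?thesis by (simp add: distr_distr comp_def)
    qed
    obtain K where K: "\<And>x. norm (L x) \<le> norm x * K" "0 < K" using bounded_linear.pos_bounded[OF bl] by blast
    show "integrable M (\<lambda>\<omega>. (norm (L (Y 0 \<omega>)))\<^sup>2)"
    proof (rule Bochner_Integration.integrable_bound[OF integrable_mult_right[OF sqY, of "K\<^sup>2"]])
      show "AE \<omega> in M. norm ((norm (L (Y 0 \<omega>)))\<^sup>2) \<le> norm (K\<^sup>2 * (norm (Y 0 \<omega>))\<^sup>2)"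
      proof (rule AE_I2)
        fix \<omega>
        have "(norm (L (Y 0 \<omega>)))\<^sup>2 \<le> (norm (Y 0 \<omega>) * K)\<^sup>2" using K by (intro power_mono) auto
        then show "norm ((norm (L (Y 0 \<omega>)))\<^sup>2) \<le> norm (K\<^sup>2 * (norm (Y 0 \<omega>))\<^sup>2)" by (simp add: power_mult_distrib mult.commute)
      qed
    qed measurable
    show "expectation (\<lambda>\<omega>. L (Y 0 \<omega>)) = 0"
      using integral_bounded_linear[OF bl integrable_Y] meanY linear_0[OF L] by simp
  qed
qed

text \<open>\<open>S\<close> sums the steps from index 1 on, while \<open>walk\<close> starts at
  index 0; the shift reconciles the two.\<close>

lemma (in iid_seq) iid_seq_Suc: "iid_seq M (\<lambda>i. Y (Suc i))"
proof unfold_locales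
  show "indep_vars (\<lambda>_. borel) (\<lambda>i. Y (Suc i)) UNIV" using indep_vars_shift[OF indepY, of 1 UNIV] by simp
  show "distr M borel (Y (Suc i)) = distr M borel (Y (Suc 0))" for i using identY[of "Suc i"] identY[of "Suc 0"] by simp
  show "integrable M (\<lambda>\<omega>. (norm (Y (Suc 0) \<omega>))\<^sup>2)" by (rule integrable_ident[where f = "\<lambda>y. (norm y)\<^sup>2", OF _ sqY]) measurable
  show "expectation (Y (Suc 0)) = 0" using expectation_ident[where f = "\<lambda>y. y" and i = "Suc 0"] meanY by simp
qed measurable

lemma (in prob_space) iid_seq_centered:
  fixes Z :: "nat \<Rightarrow> 'a \<Rightarrow> 'v::euclidean_space"
  assumes [measurable]: "\<And>i. Z i \<in> borel_measurable M" and indep: "indep_vars (\<lambda>_. borel) Z UNIV"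
    and ident: "\<And>i. distr M borel (Z i) = distr M borel (Z 0)" and sq: "integrable M (\<lambda>\<omega>. (norm (Z 0 \<omega>))\<^sup>2)"
  shows "iid_seq M (\<lambda>i \<omega>. Z i \<omega> - expectation (Z 0))"
proof -
  have nZ: "integrable M (\<lambda>\<omega>. norm (Z 0 \<omega>))"
    by (rule square_integrable_imp_integrable) (use sq in auto)
  then have iZ: "integrable M (Z 0)" by (subst (asm) integrable_norm_iff) measurable
  show ?thesis
  proof unfold_locales
    show "indep_vars (\<lambda>_. borel) (\<lambda>i \<omega>. Z i \<omega> - expectation (Z 0)) UNIV"
      by (rule indep_vars_compose2[OF indep]) measurable
    show "distr M borel (\<lambda>\<omega>. Z i \<omega> - expectation (Z 0)) = distr M borel (\<lambda>\<omega>. Z 0 \<omega> - expectation (Z 0))" for i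
    proof -
      have "distr (distr M borel (Z i)) borel (\<lambda>z. z - expectation (Z 0)) = distr (distr M borel (Z 0)) borel (\<lambda>z. z - expectation (Z 0))"
        by (simp only: ident[of i])
      then show ?thesis by (simp add: distr_distr comp_def)
    qed
    show "integrable M (\<lambda>\<omega>. (norm (Z 0 \<omega> - expectation (Z 0)))\<^sup>2)"
    proof -
      have "(norm (Z 0 \<omega> - expectation (Z 0)))\<^sup>2 = (norm (Z 0 \<omega>))\<^sup>2 - 2 * (Z 0 \<omega> \<bullet> expectation (Z 0)) + (norm (expectation (Z 0)))\<^sup>2" for \<omega>
        by (simp add: power2_norm_eq_inner inner_diff_left inner_diff_right inner_commute)
      moreover have "integrable M (\<lambda>\<omega>. (norm (Z 0 \<omega>))\<^sup>2 - 2 * (Z 0 \<omega> \<bullet> expectation (Z 0)) + (norm (expectation (Z 0)))\<^sup>2)"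
        using sq iZ by (intro Bochner_Integration.integrable_add Bochner_Integration.integrable_diff integrable_mult_right integrable_inner_left) auto
      ultimately show ?thesis by simp
    qed
    show "expectation (\<lambda>\<omega>. Z 0 \<omega> - expectation (Z 0)) = 0"
      using iZ by (simp add: prob_space)
  qed measurable
qed

text \<open>Polarization reduces mixed products to squares.\<close>

lemma (in iid_seq) integrable_inner_prod: "integrable M (\<lambda>\<omega>. (u \<bullet> Y 0 \<omega>) * (v \<bullet> Y 0 \<omega>))"
proof -
  have "(u \<bullet> Y 0 \<omega>) * (v \<bullet> Y 0 \<omega>) = (((u + v) \<bullet> Y 0 \<omega>)\<^sup>2 - (u \<bullet> Y 0 \<omega>)\<^sup>2 - (v \<bullet> Y 0 \<omega>)\<^sup>2) / 2" for \<omega>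
    by (simp add: inner_add_left power2_sum)
  then show ?thesis by (simp only:) (intro integrable_divide Bochner_Integration.integrable_diff integrable_inner_sq)
qed

lemma iid_seq_covariance:
  fixes X :: "nat \<Rightarrow> 'a \<Rightarrow> real ^ 'n"
  assumes X: "iid_seq M X"
  shows "(\<integral>\<omega>. (u \<bullet> X 0 \<omega>) * (v \<bullet> X 0 \<omega>) \<partial>M) = u \<bullet> ((\<chi> i j. \<integral>\<omega>. X 0 \<omega> $ i * X 0 \<omega> $ j \<partial>M) *v v)"
proof -
  interpret iid_seq M X by (rule X)
  have int: "integrable M (\<lambda>\<omega>. X 0 \<omega> $ i * X 0 \<omega> $ j)" for i j
    using integrable_inner_prod[of "axis i 1" "axis j 1"] by (simp add: inner_axis')
  have "(u \<bullet> X 0 \<omega>) * (v \<bullet> X 0 \<omega>) = (\<Sum>i\<in>UNIV. \<Sum>j\<in>UNIV. (u $ i * v $ j) * (X 0 \<omega> $ i * X 0 \<omega> $ j))" for \<omega>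
    by (simp add: inner_vec_def sum_product mult_ac)
  then have "expectation (\<lambda>\<omega>. (u \<bullet> X 0 \<omega>) * (v \<bullet> X 0 \<omega>)) = (\<Sum>i\<in>UNIV. \<Sum>j\<in>UNIV. (u $ i * v $ j) * expectation (\<lambda>\<omega>. X 0 \<omega> $ i * X 0 \<omega> $ j))"
    by (simp only:) (simp add: Bochner_Integration.integral_sum int)
  also have "\<dots> = u \<bullet> ((\<chi> i j. \<integral>\<omega>. X 0 \<omega> $ i * X 0 \<omega> $ j \<partial>M) *v v)"
    by (simp add: inner_vec_def matrix_vector_mult_def sum_distrib_left mult_ac)
  finally show ?thesis .
qed

lemma lil_scale_over_n: "(\<lambda>n. lil_scale n / real n) \<longlonglongrightarrow> 0"
proof -
  have "(\<lambda>n. sqrt (2 * (ln (real n) / real n))) \<longlonglongrightarrow> sqrt (2 * 0)"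
    by (intro tendsto_real_sqrt tendsto_mult tendsto_const lim_ln_over_n)
  then have l: "(\<lambda>n. sqrt (2 * (ln (real n) / real n))) \<longlonglongrightarrow> 0" by simp
  show ?thesis
  proof (rule tendsto_sandwich[OF _ _ tendsto_const l])
    show "eventually (\<lambda>n. 0 \<le> lil_scale n / real n) sequentially"
      using eventually_ge_at_top[of 3] by eventually_elim (auto intro!: divide_nonneg_nonneg less_imp_le[OF lil_scale_pos])
    show "eventually (\<lambda>n. lil_scale n / real n \<le> sqrt (2 * (ln (real n) / real n))) sequentially"
      using eventually_ge_at_top[of 3]
    proof eventually_elim
      fix n :: nat assume n: "3 \<le> n"
      have n0: "0 < real n" using n by simp
      have "ln (real n) > 0" using n by simp
      then have "ln (ln (real n)) \<le> ln (real n)" using ln_le_minus_one[of "ln (real n)"] by simp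
      then have le: "2 * real n * ln (ln (real n)) / (real n)\<^sup>2 \<le> 2 * (ln (real n) / real n)"
        using n0 by (simp add: power2_eq_square field_simps)
      have "lil_scale n / real n = sqrt (2 * real n * ln (ln (real n)) / (real n)\<^sup>2)"
        unfolding lil_scale_def using n0 by (simp add: real_sqrt_divide)
      then show "lil_scale n / real n \<le> sqrt (2 * (ln (real n) / real n))" using le by simp
    qed
  qed
qed

text \<open>The strong law in the form required for the drift direction, read off from
  \<open>walk_modulus\<close> with N = 1 because the scale is o(n).\<close>

lemma (in iid_seq) path_mean_walk_sublinear:
  "AE \<omega> in M. (\<lambda>k. norm (path_mean (\<lambda>i. walk i \<omega>) k) / real k) \<longlonglongrightarrow> 0"
  using walk_modulus[of 1, OF order_refl]
proof eventually_elim
  fix \<omega>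
  assume W: "eventually (\<lambda>n. \<forall>l l'. l \<le> l' \<longrightarrow> l' \<le> n \<longrightarrow> 1 * (l' - l) \<le> n \<longrightarrow>
     norm (walk l' \<omega> - walk l \<omega>) \<le> mod_const * lil_scale n / sqrt (real 1)) sequentially"
  have l: "(\<lambda>n. mod_const * (lil_scale n / real n)) \<longlonglongrightarrow> 0" by (rule tendsto_mult_right_zero[OF lil_scale_over_n])
  show "(\<lambda>k. norm (path_mean (\<lambda>i. walk i \<omega>) k) / real k) \<longlonglongrightarrow> 0"
  proof (rule tendsto_sandwich[OF _ _ tendsto_const l])
    show "eventually (\<lambda>k. norm (path_mean (\<lambda>i. walk i \<omega>) k) / real k \<le> mod_const * (lil_scale k / real k)) sequentially"
      using W eventually_ge_at_top[of 3]
    proof eventually_elim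
      fix k
      assume W: "\<forall>l l'. l \<le> l' \<longrightarrow> l' \<le> k \<longrightarrow> 1 * (l' - l) \<le> k \<longrightarrow>
        norm (walk l' \<omega> - walk l \<omega>) \<le> mod_const * lil_scale k / sqrt (real 1)" and k: "3 \<le> k"
      have "norm (walk i \<omega>) \<le> mod_const * lil_scale k" if "i \<in> {1..k}" for i
        using W[rule_format, of 0 i] that by (simp add: walk_def)
      then have "norm (\<Sum>i\<in>{1..k}. walk i \<omega>) \<le> (\<Sum>i\<in>{1..k}. mod_const * lil_scale k)" by (rule sum_norm_le)
      then have "norm (path_mean (\<lambda>i. walk i \<omega>) k) \<le> mod_const * lil_scale k"
        unfolding path_mean_def using k by (simp add: field_simps)
      then have "norm (path_mean (\<lambda>i. walk i \<omega>) k) / real k \<le> (mod_const * lil_scale k) / real k" by (rule divide_right_mono) simp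
      then show "norm (path_mean (\<lambda>i. walk i \<omega>) k) / real k \<le> mod_const * (lil_scale k / real k)" by simp
    qed
  qed simp
qed

text \<open>The points \<open>x k\<close> are images of the scaled points under a scaling composed
  with A, followed by the orthonormal frame. Hulls commute with linear maps, so the volumes differ
  by the product of the determinants.\<close>

lemma measure_hull_rescaled:
  fixes x :: "nat \<Rightarrow> real ^ 'n" and B :: "'m::finite \<Rightarrow> real ^ 'n" and A W :: "real ^ 'm ^ 'm"
  assumes dim: "CARD('n) = CARD('m) + 1" and e: "e \<bullet> e = 1" and B: "\<And>i j. B i \<bullet> B j = (if i = j then 1 else 0)" and Be: "\<And>i. B i \<bullet> e = 0"
    and AW: "A ** W = mat 1" and c: "0 < c" and n: "3 \<le> n"
    and xe: "\<And>k. e \<bullet> x k = c * h k" and xB: "\<And>k. (\<chi> j. B j \<bullet> x k) = A *v path_mean P k"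
  shows "measure lborel (convex hull (x ` {..n})) =
    (c * real n) * (lil_scale n ^ CARD('m) * \<bar>det A\<bar>) * measure lborel (convex hull (scaled_point h P n ` {..n}))"
proof -
  have n0: "0 < real n" using n by simp
  have L: "0 < lil_scale n" using n by (rule lil_scale_pos)
  have WA: "W ** A = mat 1" using AW by (simp only: matrix_left_right_inverse)
  define f where "f v = lil_scale n *\<^sub>R (A *v v)" for v
  define g where "g v = W *v ((1 / lil_scale n) *\<^sub>R v)" for v
  have linA: "linear ((*v) A)" by (rule matrix_vector_mul_linear)
  have linf: "linear f" unfolding f_def by (intro linear_compose_scale_right linA)
  have ling: "linear g"
    unfolding g_def using linear_compose[OF linear_scaleR matrix_vector_mul_linear[of W]] by (simp add: comp_def)
  have gf: "g (f v) = v" for v using L by (simp add: f_def g_def matrix_vector_mul_assoc WA)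
  have fg: "f (g v) = v" for v using L by (simp add: f_def g_def matrix_vector_mul_assoc AW)
  have detf: "\<bar>det (matrix f)\<bar> = lil_scale n ^ CARD('m) * \<bar>det A\<bar>"
  proof -
    have "f = (\<lambda>v. lil_scale n *\<^sub>R v) \<circ> ((*v) A)" unfolding f_def by auto
    then have "matrix f = matrix (\<lambda>v :: real ^ 'm. lil_scale n *\<^sub>R v) ** A"
      using matrix_compose[OF linA linear_scaleR[of "lil_scale n"]] by simp
    then show ?thesis using L by (simp add: det_mul abs_mult)
  qed
  let ?F = "\<lambda>(t, v). ((c * real n) * t, f v)"
  have linF: "linear ?F"
    using linear_add[OF linf] linear_scale[OF linf] by (auto simp: linear_iff algebra_simps)
  have lin_frame: "linear (frame_map e B)" by (rule linear_frame_map[OF dim e B Be])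
  have "x k = frame_map e B (?F (scaled_point h P n k))" for k
  proof -
    have "?F (scaled_point h P n k) = (e \<bullet> x k, \<chi> j. B j \<bullet> x k)"
      unfolding xe xB scaled_point_def f_def using L n0 by (simp add: matrix_vector_mult_scaleR)
    then show ?thesis using frame_map_surj[OF dim e B Be, of "x k"] by simp
  qed
  then have "x ` {..n} = frame_map e B ` ?F ` scaled_point h P n ` {..n}" by (auto simp: image_image)
  then have hull: "convex hull (x ` {..n}) = frame_map e B ` ?F ` (convex hull (scaled_point h P n ` {..n}))"
    by (simp only: convex_hull_linear_image[OF linF] convex_hull_linear_image[OF lin_frame])
  have cpt: "compact (convex hull (scaled_point h P n ` {..n}))"
    by (intro compact_convex_hull finite_imp_compact) simp
  then have "compact (?F ` (convex hull (scaled_point h P n ` {..n})))"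
    by (intro compact_continuous_image linear_continuous_on linF[unfolded linear_conv_bounded_linear])
  then have "measure lborel (convex hull (x ` {..n})) = measure lborel (?F ` (convex hull (scaled_point h P n ` {..n})))"
    unfolding hull by (rule measure_frame_map[OF dim e B Be])
  also have "\<dots> = (c * real n) * \<bar>det (matrix f)\<bar> * measure lborel (convex hull (scaled_point h P n ` {..n}))"
    using c n0 by (intro measure_product_linear_image[OF _ linf ling gf fg cpt]) simp
  finally show ?thesis unfolding detf .
qed

text \<open>Here m = d - 1: one factor n belongs to the direction of \<open>mu\<close>, and each of
  the m other directions contributes one scale.\<close>

lemma sqrt_lil_normalization:
  assumes n: "3 \<le> n"
  shows "sqrt (2 ^ m * real n ^ (m + 2) * (ln (ln (real n))) ^ m) = real n * lil_scale n ^ m"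
proof (rule real_sqrt_unique)
  have "(real n * lil_scale n ^ m)\<^sup>2 = (real n)\<^sup>2 * ((lil_scale n)\<^sup>2) ^ m"
    by (simp add: power_mult_distrib power_mult[symmetric] mult.commute)
  also have "\<dots> = (real n)\<^sup>2 * (2 * real n * ln (ln (real n))) ^ m" using n by (simp add: lil_scale_sq)
  also have "\<dots> = 2 ^ m * real n ^ (m + 2) * (ln (ln (real n))) ^ m"
    by (simp only: power_mult_distrib power_add) (simp add: mult_ac)
  finally show "(real n * lil_scale n ^ m)\<^sup>2 = 2 ^ m * real n ^ (m + 2) * (ln (ln (real n))) ^ m" .
  show "0 \<le> real n * lil_scale n ^ m" using n lil_scale_pos[of n] by simp
qed

lemma path_mean_linear: "linear f \<Longrightarrow> f (path_mean P k) = path_mean (\<lambda>i. f (P i)) k"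
  unfolding path_mean_def by (simp add: linear_scale linear_sum)

lemma linear_coords: "linear (\<lambda>x. \<chi> j. B j \<bullet> x :: real ^ 'm)"
  by (rule linearI) (auto simp: vec_eq_iff inner_add_right)

lemma (in white_seq) white_seq_Suc: "white_seq M (\<lambda>i. Y (Suc i))"
proof -
  have "expectation (\<lambda>\<omega>. (v \<bullet> Y (Suc 0) \<omega>)\<^sup>2) = (norm v)\<^sup>2" for v
    using expectation_ident[where f = "\<lambda>y. (v \<bullet> y)\<^sup>2" and i = "Suc 0"] white[of v] by simp
  then show ?thesis by (intro white_seq.intro iid_seq_Suc white_seq_axioms.intro)
qed

lemma (in iid_seq) AE_inner_eq_0:
  assumes "expectation (\<lambda>\<omega>. (v \<bullet> Y 0 \<omega>)\<^sup>2) = 0"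
  shows "AE \<omega> in M. v \<bullet> Y i \<omega> = 0"
proof -
  have [measurable]: "(\<lambda>y. (v \<bullet> y)\<^sup>2) \<in> borel_measurable borel" by measurable
  have "integrable M (\<lambda>\<omega>. (v \<bullet> Y i \<omega>)\<^sup>2)" by (rule integrable_ident[where f = "\<lambda>y. (v \<bullet> y)\<^sup>2", OF _ integrable_inner_sq]) measurable
  moreover have "expectation (\<lambda>\<omega>. (v \<bullet> Y i \<omega>)\<^sup>2) = 0"
    using assms expectation_ident[where f = "\<lambda>y. (v \<bullet> y)\<^sup>2" and i = i] by simp
  ultimately have "AE \<omega> in M. (v \<bullet> Y i \<omega>)\<^sup>2 = 0" by (subst (asm) integral_nonneg_eq_0_iff_AE) auto
  then show ?thesis by eventually_elim simp
qed

theorem theorem3p4: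
  fixes M :: "'a measure" and Z :: "nat \<Rightarrow> 'a \<Rightarrow> real ^ 'n"
    and mu :: "real ^ 'n" and Sig :: "real ^ 'n ^ 'n"
    and S G :: "nat \<Rightarrow> 'a \<Rightarrow> real ^ 'n"
  assumes "prob_space M"
    and dim: "CARD('n) = CARD('m) + 1" "CARD('n) \<ge> 2"
    and rv: "\<And>i. Z i \<in> borel_measurable M"
    and indep: "prob_space.indep_vars M (\<lambda>_. borel) Z UNIV"
    and ident: "\<And>i. distr M borel (Z i) = distr M borel (Z 0)"
    and sq: "integrable M (\<lambda>\<omega>. (norm (Z 0 \<omega>))\<^sup>2)"
    and mu_def: "mu = (\<integral>\<omega>. Z 0 \<omega> \<partial>M)"
    and mu_nz: "mu \<noteq> 0"
    and Sig_def: "Sig = (\<chi> i j. \<integral>\<omega>. (Z 0 \<omega> $ i - mu $ i) * (Z 0 \<omega> $ j - mu $ j) \<partial>M)"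
    and S_def: "\<And>n \<omega>. S n \<omega> = (\<Sum>i\<in>{1..n}. Z i \<omega>)"
    and G_def: "\<And>n \<omega>. G n \<omega> = (if n = 0 then 0 else (1 / real n) *\<^sub>R (\<Sum>i\<in>{1..n}. S i \<omega>))"
  shows "AE \<omega> in M.
    limsup (\<lambda>n. ereal (measure lborel (convex hull {G k \<omega> | k. k \<le> n}) /
        sqrt (2 ^ (CARD('n) - 1) * real n ^ (CARD('n) + 1) * (ln (ln (real n))) ^ (CARD('n) - 1))))
    = lambda_tilde TYPE('m) * ereal (norm mu / 2 * sqrt (det (perp_cov Sig mu :: real ^ 'm ^ 'm)))"
proof -
  interpret prob_space M by (rule assms(1))
  define X where "X i \<omega> = Z i \<omega> - mu" for i \<omega>
  have X: "iid_seq M X"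
    unfolding X_def mu_def by (rule iid_seq_centered[OF rv indep ident sq])
  define B where "B = (SOME B :: 'm \<Rightarrow> real ^ 'n.
               (\<forall>i j. B i \<bullet> B j = (if i = j then 1 else 0)) \<and> (\<forall>i. B i \<bullet> mu = 0))"
  have "(\<forall>i j. B i \<bullet> B j = (if i = j then 1 else 0)) \<and> (\<forall>i. B i \<bullet> mu = 0)"
    unfolding B_def by (rule someI_ex[OF exists_perp_basis[OF dim(1)]])
  then have BB: "\<And>i j. B i \<bullet> B j = (if i = j then 1 else 0)" and Bmu: "\<And>i. B i \<bullet> mu = 0" by blast+
  define \<Gamma> where "\<Gamma> = (perp_cov Sig mu :: real ^ 'm ^ 'm)"
  have \<Gamma>: "\<Gamma> = (\<chi> i j. B i \<bullet> (Sig *v B j))" unfolding \<Gamma>_def perp_cov_def Let_def B_def ..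
  define L where "L x = (\<chi> j. B j \<bullet> x)" for x
  have linL: "linear L" unfolding L_def by (rule linear_coords)
  define X' where "X' i \<omega> = L (X i \<omega>)" for i \<omega>
  have X': "iid_seq M X'" unfolding X'_def by (rule iid_seq.iid_seq_linear[OF X linL])
  have cov: "expectation (\<lambda>\<omega>. (u \<bullet> X' 0 \<omega>) * (v \<bullet> X' 0 \<omega>)) = u \<bullet> (\<Gamma> *v v)" for u v
  proof -
    have "(\<chi> i j. expectation (\<lambda>\<omega>. X' 0 \<omega> $ i * X' 0 \<omega> $ j)) = \<Gamma>"
      unfolding \<Gamma> X'_def L_def Sig_def
      using iid_seq_covariance[OF X] by (simp add: X_def)
    then show ?thesis using iid_seq_covariance[OF X', of u v] by simp
  qed
  have X'0: "AE \<omega> in M. v \<bullet> X' i \<omega> = 0" if "v \<bullet> (\<Gamma> *v v) = 0" for v i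
    by (rule iid_seq.AE_inner_eq_0[OF X']) (use cov[of v v] that in \<open>simp add: power2_eq_square\<close>)
  have S_X: "S k \<omega> = real k *\<^sub>R mu + (\<Sum>i<k. X (Suc i) \<omega>)" for k \<omega>
  proof -
    have "S k \<omega> = (\<Sum>i<k. Z (Suc i) \<omega>)" unfolding S_def by (induction k) auto
    also have "\<dots> = (\<Sum>i<k. mu + X (Suc i) \<omega>)" by (simp add: X_def)
    finally show ?thesis by (simp add: sum.distrib sum_constant_scaleR del: sum_constant)
  qed
  have LS: "L (S k \<omega>) = (\<Sum>i<k. X' (Suc i) \<omega>)" for k \<omega>
  proof -
    have "L mu = 0" by (simp add: L_def Bmu vec_eq_iff)
    then show ?thesis unfolding S_X X'_def by (simp add: linear_add[OF linL] linear_scale[OF linL] linear_sum[OF linL])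
  qed
  have G_mean: "G k \<omega> = path_mean (\<lambda>i. S i \<omega>) k" for k \<omega> by (simp add: G_def path_mean_def)
  have hullset: "{G k \<omega> | k. k \<le> n} = (\<lambda>k. G k \<omega>) ` {..n}" for n \<omega> by auto
  have pows: "CARD('n) - 1 = CARD('m)" "CARD('n) + 1 = CARD('m) + 2" using dim by auto
  show ?thesis
  proof (cases "det \<Gamma> = 0")
    case True
    \<comment> \<open>A kernel vector of \<Gamma> is a direction in which the walk almost surely
      never moves, so all hulls are flat. The right-hand side is 0 too, as 0 times any extended real
      is 0.\<close>
    then obtain v where v: "v \<noteq> 0" "\<Gamma> *v v = 0"
      using matrix_left_invertible_ker[of \<Gamma>] invertible_det_nz[of \<Gamma>] invertible_left_inverse[of \<Gamma>] by blast
    define w where "w = (\<Sum>j\<in>UNIV. v $ j *\<^sub>R B j)"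
    have wL: "w \<bullet> x = v \<bullet> L x" for x
      unfolding w_def L_def inner_vec_def[of v] by (simp add: inner_sum_left)
    have Bw: "B i \<bullet> w = v $ i" for i
      unfolding w_def by (simp add: inner_sum_right BB if_distrib cong: if_cong)
    have w: "w \<noteq> 0"
    proof
      assume "w = 0"
      then have "v $ i = 0" for i using Bw[of i] by simp
      then have "v = 0" by (simp add: vec_eq_iff)
      then show False using v(1) by simp
    qed
    have "AE \<omega> in M. \<forall>i. v \<bullet> X' i \<omega> = 0"
      by (intro AE_all_countable[THEN iffD2] allI X'0) (simp add: v)
    then show ?thesis
    proof eventually_elim
      fix \<omega> assume 0: "\<forall>i. v \<bullet> X' i \<omega> = 0"
      have "w \<bullet> S i \<omega> = 0" for i unfolding wL LS by (simp add: inner_sum_right 0)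
      then have "w \<bullet> G k \<omega> = 0" for k unfolding G_mean path_mean_def by (simp add: inner_sum_right)
      then have "measure lborel (convex hull {G k \<omega> | k. k \<le> n}) = 0" for n
        by (intro measure_hyperplane_hull[OF w]) auto
      then show "limsup (\<lambda>n. ereal (measure lborel (convex hull {G k \<omega> | k. k \<le> n}) /
        sqrt (2 ^ (CARD('n) - 1) * real n ^ (CARD('n) + 1) * (ln (ln (real n))) ^ (CARD('n) - 1))))
        = lambda_tilde TYPE('m) * ereal (norm mu / 2 * sqrt (det (perp_cov Sig mu :: real ^ 'm ^ 'm)))"
        using True unfolding \<Gamma>_def by (simp add: Limsup_const zero_ereal_def[symmetric])
    qed
  next
    case False
    have sym: "u \<bullet> (\<Gamma> *v v) = v \<bullet> (\<Gamma> *v u)" for u v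
      unfolding cov[symmetric] by (simp add: mult.commute)
    \<comment> \<open>If the quadratic form vanishes at v, then v \<bullet> X' vanishes almost
      surely. Pairing with every u gives \<open>\<Gamma> *v v = 0\<close>, against det \<Gamma>
      \<noteq> 0.\<close>
    have pos: "0 < v \<bullet> (\<Gamma> *v v)" if v: "v \<noteq> 0" for v
    proof (rule ccontr)
      assume "\<not> 0 < v \<bullet> (\<Gamma> *v v)"
      moreover have "0 \<le> v \<bullet> (\<Gamma> *v v)" unfolding cov[symmetric] by (rule integral_nonneg_AE) simp
      ultimately have "v \<bullet> (\<Gamma> *v v) = 0" by simp
      from X'0[OF this, of 0] have ae: "AE \<omega> in M. v \<bullet> X' 0 \<omega> = 0" .
      have "u \<bullet> (\<Gamma> *v v) = 0" for u
      proof -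
        have "AE \<omega> in M. (u \<bullet> X' 0 \<omega>) * (v \<bullet> X' 0 \<omega>) = 0" using ae by eventually_elim simp
        then show ?thesis unfolding cov[symmetric] by (rule integral_eq_zero_AE)
      qed
      then have "\<Gamma> *v v = 0" using inner_eq_zero_iff by blast
      then show False
        using v False matrix_left_invertible_ker[of \<Gamma>] invertible_det_nz[of \<Gamma>] invertible_left_inverse[of \<Gamma>] by blast
    qed
    obtain W :: "real ^ 'm ^ 'm" where W: "W ** \<Gamma> ** transpose W = mat 1"
      using positive_definite_whitening[OF sym pos] by blast
    \<comment> \<open>The inverse of W, which turns the whitened walk back into the original one;
      |det A| = sqrt (det \<Gamma>) is the source of the determinant in the result.\<close>
    define A where "A = \<Gamma> ** transpose W"
    have WA: "W ** A = mat 1" using W unfolding A_def by (simp only: matrix_mul_assoc)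
    then have AW: "A ** W = mat 1" by (simp only: matrix_left_right_inverse)
    have detA: "sqrt (det \<Gamma>) = \<bar>det A\<bar>"
    proof -
      have "det W * det A = 1" using arg_cong[OF WA, of det] by (simp add: det_mul)
      moreover have "det A = det \<Gamma> * det W" unfolding A_def by (simp add: det_mul)
      ultimately have "det \<Gamma> = (det A)\<^sup>2" by (simp add: power2_eq_square mult_ac)
      then show ?thesis by simp
    qed
    have whiteY: "white_seq M (\<lambda>i \<omega>. W *v X' (Suc i) \<omega>)"
    proof -
      have "white_seq M (\<lambda>i \<omega>. W *v X' i \<omega>)"
      proof (intro white_seq.intro white_seq_axioms.intro)
        show "iid_seq M (\<lambda>i \<omega>. W *v X' i \<omega>)" by (rule iid_seq.iid_seq_linear[OF X' matrix_vector_mul_linear])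
        fix v :: "real ^ 'm"
        have "v \<bullet> (W *v x) = (transpose W *v v) \<bullet> x" for x by (simp add: dot_lmul_matrix)
        then have "expectation (\<lambda>\<omega>. (v \<bullet> (W *v X' 0 \<omega>))\<^sup>2) = (transpose W *v v) \<bullet> (\<Gamma> *v (transpose W *v v))"
          by (simp only: cov[symmetric] power2_eq_square)
        also have "\<dots> = v \<bullet> (W *v (\<Gamma> *v (transpose W *v v)))" by (simp add: dot_lmul_matrix)
        also have "\<dots> = v \<bullet> ((W ** \<Gamma> ** transpose W) *v v)" by (simp only: matrix_vector_mul_assoc matrix_mul_assoc)
        finally show "expectation (\<lambda>\<omega>. (v \<bullet> (W *v X' 0 \<omega>))\<^sup>2) = (norm v)\<^sup>2" unfolding W by (simp add: power2_norm_eq_inner)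
      qed
      then show ?thesis by (rule white_seq.white_seq_Suc)
    qed
    define e where "e = (1 / norm mu) *\<^sub>R mu"
    have e: "e \<bullet> e = 1" unfolding e_def using mu_nz by (simp add: dot_square_norm power2_eq_square)
    have Be: "B i \<bullet> e = 0" for i unfolding e_def by (simp add: Bmu)
    \<comment> \<open>Normalised to be asymptotic to k: the drift of
      \<open>mu \<bullet> G k \<omega>\<close> is (k + 1) / 2 times |mu|^2, by averaging 1, ...,
      k.\<close>
    define h where "h \<omega> k = 2 / (norm mu)\<^sup>2 * (mu \<bullet> G k \<omega>)" for \<omega> k
    have eG: "e \<bullet> G k \<omega> = (norm mu / 2) * h \<omega> k" for k \<omega>
      unfolding e_def h_def using mu_nz by (simp add: power2_eq_square)
    have BG: "(\<chi> j. B j \<bullet> G k \<omega>) = A *v path_mean (\<lambda>i. \<Sum>l<i. W *v X' (Suc l) \<omega>) k" for k \<omega>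
    proof -
      have "A *v (\<Sum>l<i. W *v X' (Suc l) \<omega>) = L (S i \<omega>)" for i
        unfolding LS by (simp add: linear_sum[OF matrix_vector_mul_linear] matrix_vector_mul_assoc AW)
      then have "A *v path_mean (\<lambda>i. \<Sum>l<i. W *v X' (Suc l) \<omega>) k = L (path_mean (\<lambda>i. S i \<omega>) k)"
        by (simp add: path_mean_linear[OF matrix_vector_mul_linear] path_mean_linear[OF linL])
      then show ?thesis by (simp add: G_mean L_def)
    qed
    have "AE \<omega> in M. (\<lambda>k. h \<omega> k / real k) \<longlonglongrightarrow> 1 \<and> h \<omega> 0 = 0"
    proof -
      define \<zeta> where "\<zeta> i \<omega> = mu \<bullet> X (Suc i) \<omega>" for i \<omega>
      have \<zeta>: "iid_seq M \<zeta>"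
        unfolding \<zeta>_def
        by (rule iid_seq.iid_seq_linear[OF iid_seq.iid_seq_Suc[OF X]])
          (simp add: linear_conv_bounded_linear bounded_linear_inner_right)
      have h_mean: "h \<omega> k / real k = real (k + 1) / real k + 2 / (norm mu)\<^sup>2 * (path_mean (\<lambda>i. iid_seq.walk \<zeta> i \<omega>) k / real k)"
        if k: "0 < k" for k \<omega>
      proof -
        have sums: "(\<Sum>i\<in>{1..k}. real i) = real k * real (k + 1) / 2"
          by (induction k) (auto simp: field_simps)
        have "mu \<bullet> S i \<omega> = real i * (norm mu)\<^sup>2 + iid_seq.walk \<zeta> i \<omega>" for i
          unfolding S_X iid_seq.walk_def[OF \<zeta>] \<zeta>_def by (simp add: inner_add_right inner_sum_right power2_norm_eq_inner)
        then have "mu \<bullet> G k \<omega> = (1 / real k) * (\<Sum>i\<in>{1..k}. real i * (norm mu)\<^sup>2 + iid_seq.walk \<zeta> i \<omega>)"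
          unfolding G_mean path_mean_def by (simp add: inner_sum_right)
        also have "\<dots> = (1 / real k) * (\<Sum>i\<in>{1..k}. real i) * (norm mu)\<^sup>2 + path_mean (\<lambda>i. iid_seq.walk \<zeta> i \<omega>) k"
          unfolding path_mean_def by (simp add: sum.distrib sum_distrib_right[symmetric] distrib_left)
        also have "\<dots> = real (k + 1) / 2 * (norm mu)\<^sup>2 + path_mean (\<lambda>i. iid_seq.walk \<zeta> i \<omega>) k"
          unfolding sums using k by simp
        finally show ?thesis unfolding h_def using mu_nz k by (simp add: field_simps)
      qed
      have "AE \<omega> in M. (\<lambda>k. norm (path_mean (\<lambda>i. iid_seq.walk \<zeta> i \<omega>) k) / real k) \<longlonglongrightarrow> 0"
        by (rule iid_seq.path_mean_walk_sublinear[OF \<zeta>])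
      then show ?thesis
      proof eventually_elim
        fix \<omega>
        assume "(\<lambda>k. norm (path_mean (\<lambda>i. iid_seq.walk \<zeta> i \<omega>) k) / real k) \<longlonglongrightarrow> 0"
        then have "(\<lambda>k. norm (path_mean (\<lambda>i. iid_seq.walk \<zeta> i \<omega>) k / real k)) \<longlonglongrightarrow> 0" by simp
        then have "(\<lambda>k. path_mean (\<lambda>i. iid_seq.walk \<zeta> i \<omega>) k / real k) \<longlonglongrightarrow> 0" by (simp only: tendsto_norm_zero_iff)
        then have "(\<lambda>k. 2 / (norm mu)\<^sup>2 * (path_mean (\<lambda>i. iid_seq.walk \<zeta> i \<omega>) k / real k)) \<longlonglongrightarrow> 0"
          by (rule tendsto_mult_right_zero)
        moreover have "(\<lambda>k. real (k + 1) / real k) \<longlonglongrightarrow> 1"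
          using LIMSEQ_Suc_n_over_n[where 'a = real] by (simp add: add.commute)
        ultimately have "(\<lambda>k. real (k + 1) / real k + 2 / (norm mu)\<^sup>2 * (path_mean (\<lambda>i. iid_seq.walk \<zeta> i \<omega>) k / real k)) \<longlonglongrightarrow> 1 + 0"
          by (intro tendsto_add)
        moreover have "eventually (\<lambda>k. real (k + 1) / real k + 2 / (norm mu)\<^sup>2 * (path_mean (\<lambda>i. iid_seq.walk \<zeta> i \<omega>) k / real k) = h \<omega> k / real k) sequentially"
          using eventually_gt_at_top[of 0] by eventually_elim (simp only: h_mean)
        ultimately have "(\<lambda>k. h \<omega> k / real k) \<longlonglongrightarrow> 1 + 0" by (rule Lim_transform_eventually)
        then show "(\<lambda>k. h \<omega> k / real k) \<longlonglongrightarrow> 1 \<and> h \<omega> 0 = 0" by (simp add: h_def G_def)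
      qed
    qed
    from white_limsup_hull[OF whiteY this] show ?thesis
    proof eventually_elim
      fix \<omega>
      let ?V = "\<lambda>n. measure lborel (convex hull (scaled_point (h \<omega>) (\<lambda>k. \<Sum>i<k. W *v X' (Suc i) \<omega>) n ` {..n}))"
      define c where "c = norm mu / 2 * \<bar>det A\<bar>"
      assume V: "limsup (\<lambda>n. ereal (?V n)) = lambda_tilde TYPE('m)"
      have "eventually (\<lambda>n. ereal (measure lborel (convex hull {G k \<omega> | k. k \<le> n}) /
        sqrt (2 ^ (CARD('n) - 1) * real n ^ (CARD('n) + 1) * (ln (ln (real n))) ^ (CARD('n) - 1))) = ereal c * ereal (?V n)) sequentially"
        using eventually_ge_at_top[of 3]
      proof eventually_elim
        fix n :: nat assume n: "3 \<le> n"
        have nz: "real n * lil_scale n ^ CARD('m) \<noteq> 0" using n lil_scale_pos[OF n] by simp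
        have "measure lborel (convex hull {G k \<omega> | k. k \<le> n}) =
          (norm mu / 2 * real n) * (lil_scale n ^ CARD('m) * \<bar>det A\<bar>) * ?V n"
          unfolding hullset using mu_nz by (intro measure_hull_rescaled[OF dim(1) e BB Be AW _ n eG BG]) simp
        also have "\<dots> = (real n * lil_scale n ^ CARD('m)) * (c * ?V n)" unfolding c_def by (simp add: mult_ac)
        finally show "ereal (measure lborel (convex hull {G k \<omega> | k. k \<le> n}) /
          sqrt (2 ^ (CARD('n) - 1) * real n ^ (CARD('n) + 1) * (ln (ln (real n))) ^ (CARD('n) - 1))) = ereal c * ereal (?V n)"
          unfolding pows sqrt_lil_normalization[OF n] using nz by simp
      qed
      then have "limsup (\<lambda>n. ereal (measure lborel (convex hull {G k \<omega> | k. k \<le> n}) /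
        sqrt (2 ^ (CARD('n) - 1) * real n ^ (CARD('n) + 1) * (ln (ln (real n))) ^ (CARD('n) - 1)))) = limsup (\<lambda>n. ereal c * ereal (?V n))"
        by (rule Limsup_eq)
      \<comment> \<open>The factor is finite and nonnegative, so it may be taken out of the limsup
        in the extended reals.\<close>
      also have "\<dots> = ereal c * limsup (\<lambda>n. ereal (?V n))" by (rule Limsup_ereal_mult_left) (auto simp: c_def)
      also have "\<dots> = lambda_tilde TYPE('m) * ereal (norm mu / 2 * sqrt (det \<Gamma>))" unfolding V detA c_def by (rule mult.commute)
      finally show "limsup (\<lambda>n. ereal (measure lborel (convex hull {G k \<omega> | k. k \<le> n}) /
        sqrt (2 ^ (CARD('n) - 1) * real n ^ (CARD('n) + 1) * (ln (ln (real n))) ^ (CARD('n) - 1))))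
        = lambda_tilde TYPE('m) * ereal (norm mu / 2 * sqrt (det (perp_cov Sig mu :: real ^ 'm ^ 'm)))"
        unfolding \<Gamma>_def .
    qed
  qed
qed

end
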